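(* Let $\mathfrak g$ be of type $B_n$, $n\ge2$, and let $\lambda\in P^+$ be such that $\lambda(h_i)=0$ for all $i>2$. Then, as $\mathfrak g$-modules, $M(\lambda)[k]\cong V(\lambda-k\theta_{1,1})$ if $0\le k\le[d_2'\lambda(h_2)]$, and $M(\lambda)[k]=0$ otherwise. Moreover, $M(\lambda)\cong T(\lambda)$ as $\mathfrak g[t]$-modules.
   Context: $\mathfrak g$ is a finite-dimensional complex simple Lie algebra with Cartan subalgebra $\mathfrak h$, Dynkin nodes $I=\{1,\dots,n\}$ labelled as in Humphreys/Bourbaki (in type $B_n$, $\alpha_n$ is the short simple root), positive roots $R^+$, simple roots $\alpha_i$, coroots $h_i$, fundamental weights $\omega_i$, dominant weights $P^+$, $\mathfrak n^\pm=\bigoplus_{\alpha\in R^+}\mathfrak g_{\pm\alpha}$, $x_\alpha^\pm$ a generator of $\mathfrak g_{\pm\alpha}$. For a subalgebra $\mathfrak a$, $\mathfrak a[t]=\mathfrak a\otimes\mathbb C[t]$; $x_{\alpha,r}^\pm=x_\alpha^\pm\otimes t^r$. $V(\mu)$ is the irreducible $\mathfrak g$-module of highest weight $\mu\in P^+$. For $i\in I$, $m\ge0$, $M(m\omega_i)$ is the quotient of $U(\mathfrak g[t])$ by the left ideal generated by $\mathfrak n^+[t]$, $\mathfrak h\otimes t\mathbb C[t]$, $h_i-m$, $(x_{\alpha_i}^-)^{m+1}$, $x_{\alpha_i,1}^-$, and $h_j$, $x_{\alpha_j}^-$ for all $j\ne i$; $v_{i,m}$ is the image of $1$. Put $R^+(i,m,r)=\{\alpha\in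 R^+:x_{\alpha,r}^-v_{i,m}=0\}$ and, for $\lambda\in P^+$, $R^+(\lambda,r)=\bigcap_{i\in I}R^+(i,\lambda(h_i),r)$. $M(\lambda)$ is the quotient of $U(\mathfrak g[t])$ by the left ideal generated by $\mathfrak n^+[t]$, $\mathfrak h\otimes t\mathbb C[t]$, $h_i-\lambda(h_i)$, $(x_{\alpha_i}^-)^{\lambda(h_i)+1}$ ($i\in I$), and $x_{\alpha,r}^-$ for all $r\in\mathbb Z_{\ge0}$, $\alpha\in R^+(\lambda,r)$. It is $\mathbb Z_{\ge0}$-graded by the degree in $t$, with the image of $1$ in degree $0$; $M(\lambda)[k]$ is the $k$-th graded piece, a $\mathfrak g$-module. $T(\lambda)$ is the $\mathfrak g[t]$-submodule of $\bigotimes_{i\in I}M(\lambda(h_i)\omega_i)$ generated by the top (i.e. $\lambda$-) weight space. $\theta_{1,1}=\sum_{k=1}^n\alpha_k+\sum_{k=2}^n\alpha_k$. $d_i'=1$ for $i<n$ and $d_n'=\frac12$; $[x]$ is the integer part of $x$. *)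

theory Defs
  imports
    Complex_Main
    "HOL-Library.FuncSet"
    "HOL-Library.Poly_Mapping"
    "HOL-Computational_Algebra.Polynomial"
begin

section \<open>Complex vector spaces and Lie algebras\<close>

class complex_vector = ab_group_add +
  fixes scaleC :: "complex \<Rightarrow> 'a \<Rightarrow> 'a"  (infixr "*\<^sub>C" 75)
  assumes scaleC_add_right: "c *\<^sub>C (x + y) = c *\<^sub>C x + c *\<^sub>C y"
    and scaleC_add_left: "(c + d) *\<^sub>C x = c *\<^sub>C x + d *\<^sub>C x"
    and scaleC_scaleC: "c *\<^sub>C d *\<^sub>C x = (c * d) *\<^sub>C x"
    and scaleC_one: "1 *\<^sub>C x = x"

global_interpretation complex_vector: vector_space "scaleC :: complex \<Rightarrow> 'a \<Rightarrow> 'a::complex_vector"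
  defines cspan = complex_vector.span
    and csubspace = complex_vector.subspace
  by unfold_locales (simp_all add: scaleC_add_right scaleC_add_left scaleC_scaleC scaleC_one)

class complex_lie_algebra = complex_vector +
  fixes bracket :: "'a \<Rightarrow> 'a \<Rightarrow> 'a"
  assumes bracket_add_left: "bracket (x + y) z = bracket x z + bracket y z"
    and bracket_add_right: "bracket x (y + z) = bracket x y + bracket x z"
    and bracket_scaleC_left: "bracket (c *\<^sub>C x) y = c *\<^sub>C bracket x y"
    and bracket_scaleC_right: "bracket x (c *\<^sub>C y) = c *\<^sub>C bracket x y"
    and bracket_self: "bracket x x = 0"
    and jacobi: "bracket x (bracket y z) + bracket y (bracket z x) + bracket z (bracket x y) = 0"

lemma bracket_zero_left [simp]: "bracket 0 (x::'a::complex_lie_algebra) = 0"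
  using bracket_add_left[of 0 0 x] by simp

lemma bracket_zero_right [simp]: "bracket (x::'a::complex_lie_algebra) 0 = 0"
  using bracket_add_right[of x 0 0] by simp

lemma bracket_antisym: "bracket (x::'a::complex_lie_algebra) y = - bracket y x"
proof -
  have "bracket (x + y) (x + y) = bracket x y + bracket y x"
    by (simp only: bracket_add_left bracket_add_right) (simp add: bracket_self)
  then show ?thesis by (simp add: bracket_self eq_neg_iff_add_eq_0)
qed

lemma lie_eq_neg_self: "(x::'a::complex_vector) = - x \<Longrightarrow> x = 0"
proof -
  assume "x = - x"
  then have "x + x = 0" using eq_neg_iff_add_eq_0 by blast
  then have "(1 + 1) *\<^sub>C x = 0" by (simp only: scaleC_add_left scaleC_one)
  then show "x = 0" by simp
qed

definition lie_ideal :: "'g::complex_lie_algebra set \<Rightarrow> bool" where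
  "lie_ideal J \<longleftrightarrow> csubspace J \<and> (\<forall>x. \<forall>y\<in>J. bracket x y \<in> J)"

definition finite_dimensional :: "'g::complex_vector itself \<Rightarrow> bool" where
  "finite_dimensional _ \<longleftrightarrow> (\<exists>B::'g set. finite B \<and> cspan B = UNIV)"

definition simple_lie_algebra :: "'g::complex_lie_algebra itself \<Rightarrow> bool" where
  "simple_lie_algebra _ \<longleftrightarrow>
     (\<exists>x y::'g. bracket x y \<noteq> 0) \<and> (\<forall>J::'g set. lie_ideal J \<longrightarrow> J = {0} \<or> J = UNIV)"

text \<open>The usual notion for semisimple algebras: a maximal commutative subalgebra all of whose
  elements are ad-diagonalizable. (This is the textbook definition used e.g. by B. Hall; for
  semisimple algebras it is the same as a maximal toral subalgebra, or as a nilpotent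
  self-normalizing one.)\<close>

definition cartan_subalgebra :: "'g::complex_lie_algebra set \<Rightarrow> bool" where
  "cartan_subalgebra H \<longleftrightarrow>
     csubspace H \<and>
     (\<forall>x\<in>H. \<forall>y\<in>H. bracket x y = 0) \<and>
     (\<forall>x. (\<forall>y\<in>H. bracket y x = 0) \<longrightarrow> x \<in> H) \<and>
     (\<forall>y\<in>H. cspan {x. \<exists>c. bracket y x = c *\<^sub>C x} = UNIV)"

text \<open>A linear form on \<open>H\<close> is represented by its extension by \<open>0\<close> outside \<open>H\<close>, so that equality
  of linear forms is equality of functions.\<close>

definition dual :: "'g::complex_vector set \<Rightarrow> ('g \<Rightarrow> complex) set" where
  "dual H = {f. (\<forall>x\<in>H. \<forall>y\<in>H. f (x + y) = f x + f y) \<and>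
                (\<forall>c. \<forall>x\<in>H. f (c *\<^sub>C x) = c * f x) \<and> (\<forall>x. x \<notin> H \<longrightarrow> f x = 0)}"

definition root_space :: "'g::complex_lie_algebra set \<Rightarrow> ('g \<Rightarrow> complex) \<Rightarrow> 'g set" where
  "root_space H \<beta> = {x. \<forall>y\<in>H. bracket y x = \<beta> y *\<^sub>C x}"

definition roots :: "'g::complex_lie_algebra set \<Rightarrow> ('g \<Rightarrow> complex) set" where
  "roots H = {\<beta> \<in> dual H. \<beta> \<noteq> (\<lambda>_. 0) \<and> root_space H \<beta> \<noteq> {0}}"

definition positive_roots ::
    "'g::complex_lie_algebra set \<Rightarrow> nat \<Rightarrow> (nat \<Rightarrow> 'g \<Rightarrow> complex) \<Rightarrow> ('g \<Rightarrow> complex) set" where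
  "positive_roots H n \<alpha> =
     {\<beta> \<in> roots H. \<exists>c::nat \<Rightarrow> nat. \<beta> = (\<lambda>x. \<Sum>i=1..n. of_nat (c i) * \<alpha> i x)}"

text \<open>\<open>\<alpha> 1, \<dots>, \<alpha> n\<close> is a base of the root system: a linearly independent family of roots such that
  every root or its negative is a combination of the \<open>\<alpha> i\<close> with coefficients in \<open>\<nat>\<close>.\<close>

definition root_base :: "'g::complex_lie_algebra set \<Rightarrow> nat \<Rightarrow> (nat \<Rightarrow> 'g \<Rightarrow> complex) \<Rightarrow> bool" where
  "root_base H n \<alpha> \<longleftrightarrow>
     (\<forall>i\<in>{1..n}. \<alpha> i \<in> roots H) \<and>
     (\<forall>c::nat \<Rightarrow> complex. (\<forall>x\<in>H. (\<Sum>i=1..n. c i * \<alpha> i x) = 0) \<longrightarrow> (\<forall>i\<in>{1..n}. c i = 0)) \<and>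
     (\<forall>\<beta>\<in>roots H. \<beta> \<in> positive_roots H n \<alpha> \<or> (\<lambda>x. - \<beta> x) \<in> positive_roots H n \<alpha>)"

definition is_coroot :: "'g::complex_lie_algebra set \<Rightarrow> ('g \<Rightarrow> complex) \<Rightarrow> 'g \<Rightarrow> bool" where
  "is_coroot H \<beta> h \<longleftrightarrow>
     h \<in> cspan {bracket x y | x y. x \<in> root_space H \<beta> \<and> y \<in> root_space H (\<lambda>z. - \<beta> z)} \<and> \<beta> h = 2"

text \<open>\<open>cartan_matrix_B n i j\<close> is the value of the \<open>j\<close>-th simple root on the \<open>i\<close>-th simple coroot;
  the \<open>n\<close>-th simple root is the short one.\<close>

definition cartan_matrix_B :: "nat \<Rightarrow> nat \<Rightarrow> nat \<Rightarrow> int" where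
  "cartan_matrix_B n i j =
     (if i = j then 2
      else if i = n \<and> j + 1 = n then -2
      else if i + 1 = j \<or> j + 1 = i then -1
      else 0)"

section \<open>The current algebra\<close>

text \<open>The space \<open>\<gg>[t] = \<gg> \<otimes> \<complex>[t]\<close> is the type \<open>'g poly\<close> of polynomials with coefficients in \<open>\<gg>\<close>;
  \<open>x \<otimes> t\<^sup>r\<close> is \<open>monom x r\<close>.\<close>

instantiation poly :: (complex_vector) complex_vector
begin

definition scaleC_poly :: "complex \<Rightarrow> 'a poly \<Rightarrow> 'a poly" where
  "scaleC_poly c p = map_poly (scaleC c) p"

lemma coeff_scaleC [simp]: "coeff (c *\<^sub>C p) i = c *\<^sub>C coeff p i" for p :: "'a poly"
  by (simp add: scaleC_poly_def coeff_map_poly)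

instance
  by standard (simp_all add: poly_eq_iff scaleC_add_right scaleC_add_left scaleC_scaleC scaleC_one)

end

lemma scaleC_monom: "c *\<^sub>C monom x r = monom (c *\<^sub>C x) r"
  by (simp add: poly_eq_iff)

lemma poly_additive_induct [case_names monom add]:
  fixes p :: "'a::ab_group_add poly"
  assumes "\<And>a i. P (monom a i)" "\<And>p q. P p \<Longrightarrow> P q \<Longrightarrow> P (p + q)"
  shows "P p"
proof -
  have "P 0" using assms(1)[of 0 0] by simp
  have "P (\<Sum>i\<in>A. monom (coeff p i) i)" if "finite A" for A
    using that by induction (simp_all add: assms \<open>P 0\<close>)
  from this[of "{..degree p}"] show ?thesis by (simp add: poly_as_sum_of_monoms)
qed

instantiation poly :: (complex_lie_algebra) complex_lie_algebra
begin

definition bracket_poly :: "'a poly \<Rightarrow> 'a poly \<Rightarrow> 'a poly" where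
  "bracket_poly p q =
     (\<Sum>i\<le>degree p. \<Sum>j\<le>degree q. monom (bracket (coeff p i) (coeff q j)) (i + j))"

lemma bracket_poly_bound:
  fixes p q :: "'a poly"
  assumes "degree p \<le> N" "degree q \<le> M"
  shows "bracket p q = (\<Sum>i\<le>N. \<Sum>j\<le>M. monom (bracket (coeff p i) (coeff q j)) (i + j))"
proof -
  have "(\<Sum>j\<le>M. monom (bracket (coeff p i) (coeff q j)) (i + j)) =
        (\<Sum>j\<le>degree q. monom (bracket (coeff p i) (coeff q j)) (i + j))" for i
    using assms(2) by (intro sum.mono_neutral_right) (auto simp: coeff_eq_0)
  then show ?thesis unfolding bracket_poly_def
    using assms(1) by (simp, intro sum.mono_neutral_left) (auto simp: coeff_eq_0)
qed

lemma bracket_monom: "bracket (monom a i) (monom b j) = monom (bracket a b) (i + j)" for a b :: 'a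
proof -
  have "bracket (monom a i) (monom b j) =
    (\<Sum>k\<le>i. \<Sum>l\<le>j. if k = i then (if l = j then monom (bracket a b) (i + j) else 0) else 0)"
    unfolding bracket_poly_bound[OF degree_monom_le degree_monom_le]
    by (intro sum.cong) auto
  also have "\<dots> = (\<Sum>k\<le>i. if k = i then (\<Sum>l\<le>j. if l = j then monom (bracket a b) (i + j) else 0) else 0)"
    by (intro sum.cong) auto
  finally show ?thesis by simp
qed

lemma bracket_poly_add_left: "bracket (p + q) r = bracket p r + bracket q r" for p q r :: "'a poly"
  unfolding bracket_poly_bound[OF degree_add_le_max order_refl]
    bracket_poly_bound[OF max.cobounded1[of "degree p" "degree q"] order_refl, of r]
    bracket_poly_bound[OF max.cobounded2[of "degree q" "degree p"] order_refl, of r]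
  by (simp add: bracket_add_left add_monom[symmetric] sum.distrib)

lemma bracket_poly_antisym: "bracket p q = - bracket q p" for p q :: "'a poly"
proof -
  have "bracket p q = (\<Sum>j\<le>degree q. \<Sum>i\<le>degree p. monom (bracket (coeff p i) (coeff q j)) (i + j))"
    unfolding bracket_poly_def by (rule sum.swap)
  also have "\<dots> = - bracket q p"
    unfolding bracket_poly_def sum_negf[symmetric]
    by (intro sum.cong refl) (subst bracket_antisym, simp add: minus_monom add.commute)
  finally show ?thesis .
qed

lemma bracket_poly_add_right: "bracket r (p + q) = bracket r p + bracket r q" for p q r :: "'a poly"
  by (metis bracket_poly_add_left bracket_poly_antisym minus_add_distrib)

lemma bracket_poly_scaleC_left: "bracket (c *\<^sub>C p) q = c *\<^sub>C bracket p q" for p q :: "'a poly"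
proof (induction p rule: poly_additive_induct)
  case (monom a i)
  show ?case
    by (induction q rule: poly_additive_induct)
      (simp_all add: scaleC_monom bracket_monom bracket_scaleC_left bracket_poly_add_right scaleC_add_right)
next
  case (add p p')
  then show ?case by (simp add: scaleC_add_right bracket_poly_add_left)
qed

lemma bracket_poly_jacobi:
  "bracket p (bracket q r) + bracket q (bracket r p) + bracket r (bracket p q) = 0" for p q r :: "'a poly"
proof (induction p rule: poly_additive_induct)
  case (monom a i)
  show ?case
  proof (induction q rule: poly_additive_induct)
    case (monom b j)
    show ?case
    proof (induction r rule: poly_additive_induct)
      case (monom c k)
      have "i + (j + k) = i + j + k" "j + (k + i) = i + j + k" "k + (i + j) = i + j + k" by auto
      then show ?case by (simp only: bracket_monom add_monom jacobi) simp
    next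
      case (add p q)
      have *: "a1 + b1 + c1 = 0 \<Longrightarrow> a2 + b2 + c2 = 0 \<Longrightarrow> (a1 + a2) + (b1 + b2) + (c1 + c2) = 0"
        for a1 b1 c1 a2 b2 c2 :: "'a poly" by (metis add.assoc add.commute add.right_neutral)
      from add show ?case by (simp only: bracket_poly_add_left bracket_poly_add_right *)
    qed
  next
    case (add p q)
    have *: "a1 + b1 + c1 = 0 \<Longrightarrow> a2 + b2 + c2 = 0 \<Longrightarrow> (a1 + a2) + (b1 + b2) + (c1 + c2) = 0"
      for a1 b1 c1 a2 b2 c2 :: "'a poly" by (metis add.assoc add.commute add.right_neutral)
    from add show ?case by (simp only: bracket_poly_add_left bracket_poly_add_right *)
  qed
next
  case (add p q)
  have *: "a1 + b1 + c1 = 0 \<Longrightarrow> a2 + b2 + c2 = 0 \<Longrightarrow> (a1 + a2) + (b1 + b2) + (c1 + c2) = 0"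
    for a1 b1 c1 a2 b2 c2 :: "'a poly" by (metis add.assoc add.commute add.right_neutral)
  from add show ?case by (simp only: bracket_poly_add_left bracket_poly_add_right *)
qed

instance
proof
  fix c :: complex and p q r :: "'a poly"
  show "bracket (p + q) r = bracket p r + bracket q r" by (rule bracket_poly_add_left)
  show "bracket p (q + r) = bracket p q + bracket p r" by (rule bracket_poly_add_right)
  show "bracket (c *\<^sub>C p) q = c *\<^sub>C bracket p q" by (rule bracket_poly_scaleC_left)
  show "bracket p (c *\<^sub>C q) = c *\<^sub>C bracket p q"
    by (metis bracket_poly_scaleC_left bracket_poly_antisym complex_vector.scale_minus_right)
  show "bracket p p = 0" by (rule lie_eq_neg_self) (rule bracket_poly_antisym)
  show "bracket p (bracket q r) + bracket q (bracket r p) + bracket r (bracket p q) = 0"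
    by (rule bracket_poly_jacobi)
qed

end

section \<open>The universal enveloping algebra\<close>

instantiation complex :: complex_vector
begin

definition scaleC_complex :: "complex \<Rightarrow> complex \<Rightarrow> complex" where
  "scaleC_complex c z = c * z"

instance by standard (simp_all add: scaleC_complex_def algebra_simps)

end

instantiation poly_mapping :: (type, complex_vector) complex_vector
begin

lift_definition scaleC_poly_mapping :: "complex \<Rightarrow> ('a \<Rightarrow>\<^sub>0 'b) \<Rightarrow> ('a \<Rightarrow>\<^sub>0 'b)"
  is "\<lambda>c f k. c *\<^sub>C f k"
  by (auto elim: rev_finite_subset)

instance
  by standard
    (transfer; simp add: fun_eq_iff scaleC_add_right scaleC_add_left scaleC_scaleC scaleC_one)+

end

text \<open>Words form the free monoid, written additively because the multiplication of
  \<^typ>\<open>'a \<Rightarrow>\<^sub>0 complex\<close> is convolution with respect to \<open>+\<close>; thus \<open>'a free_algebra\<close> is the free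
  associative unital algebra on the set of all elements of \<open>'a\<close>.\<close>

datatype 'a word = Word (letters: "'a list")

instantiation word :: (type) monoid_add
begin

definition zero_word :: "'a word" where "zero_word = Word []"

definition plus_word :: "'a word \<Rightarrow> 'a word \<Rightarrow> 'a word" where
  "plus_word v w = Word (letters v @ letters w)"

instance by standard (simp_all add: zero_word_def plus_word_def)

end

type_synonym 'a free_algebra = "'a word \<Rightarrow>\<^sub>0 complex"

lemma scaleC_free_algebra: "c *\<^sub>C p = Poly_Mapping.single 0 c * p" for p :: "'a free_algebra"
proof -
  have "c *\<^sub>C p = Poly_Mapping.map ((*) c) p"
    by (transfer; auto simp: scaleC_complex_def fun_eq_iff when_def)
  then show ?thesis by (simp add: mult_map_scale_conv_mult)
qed

definition letter :: "'a \<Rightarrow> 'a free_algebra" where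
  "letter x = Poly_Mapping.single (Word [x]) 1"

text \<open>The two-sided ideal that makes the generators linear in the Lie algebra and turns the bracket
  into the commutator.\<close>

inductive_set uea_ideal :: "'l::complex_lie_algebra free_algebra set" where
  zero: "0 \<in> uea_ideal"
| add: "p \<in> uea_ideal \<Longrightarrow> q \<in> uea_ideal \<Longrightarrow> p + q \<in> uea_ideal"
| mult: "p \<in> uea_ideal \<Longrightarrow> a * p * b \<in> uea_ideal"
| letter_add: "letter (x + y) - letter x - letter y \<in> uea_ideal"
| letter_scaleC: "letter (c *\<^sub>C x) - c *\<^sub>C letter x \<in> uea_ideal"
| letter_bracket: "letter x * letter y - letter y * letter x - letter (bracket x y) \<in> uea_ideal"

lemma uea_ideal_mult_left: "p \<in> uea_ideal \<Longrightarrow> a * p \<in> uea_ideal"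
  using uea_ideal.mult[of p a 1] by simp

lemma uea_ideal_mult_right: "p \<in> uea_ideal \<Longrightarrow> p * a \<in> uea_ideal"
  using uea_ideal.mult[of p 1 a] by simp

lemma uea_ideal_uminus: "p \<in> uea_ideal \<Longrightarrow> - p \<in> uea_ideal"
  using uea_ideal_mult_left[of p "- 1"] by simp

lemma uea_ideal_diff: "p \<in> uea_ideal \<Longrightarrow> q \<in> uea_ideal \<Longrightarrow> p - q \<in> uea_ideal"
  using uea_ideal.add[OF _ uea_ideal_uminus, of p q] by simp

lemma lookup_free_algebra_mult_zero:
  "Poly_Mapping.lookup (p * q) 0 = Poly_Mapping.lookup p 0 * Poly_Mapping.lookup q 0"
  for p q :: "'a free_algebra"
proof -
  have "(0 = v + w) = (w = 0 \<and> v = 0)" for v w :: "'a word"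
    by (cases v; cases w) (auto simp: zero_word_def plus_word_def)
  then show ?thesis
    by (simp add: lookup_mult when_when[symmetric] Sum_any_when_independent mult_when)
qed

lemma lookup_letter_zero: "Poly_Mapping.lookup (letter x) 0 = 0"
  by (simp add: letter_def lookup_single zero_word_def)

lemma uea_ideal_augmentation: "p \<in> uea_ideal \<Longrightarrow> Poly_Mapping.lookup p 0 = 0"
proof (induction rule: uea_ideal.induct)
qed (simp_all add: lookup_add lookup_minus lookup_free_algebra_mult_zero scaleC_free_algebra
      lookup_letter_zero)

quotient_type (overloaded) 'l uea =
  "'l::complex_lie_algebra free_algebra" / "\<lambda>p q. p - q \<in> uea_ideal"
proof (rule equivpI)
  show "reflp (\<lambda>p q::'l free_algebra. p - q \<in> uea_ideal)"
    by (rule reflpI) (simp add: uea_ideal.zero)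
  show "symp (\<lambda>p q::'l free_algebra. p - q \<in> uea_ideal)"
    by (rule sympI) (use uea_ideal_uminus in fastforce)
  show "transp (\<lambda>p q::'l free_algebra. p - q \<in> uea_ideal)"
    by (rule transpI) (use uea_ideal.add in fastforce)
qed

instantiation uea :: (complex_lie_algebra) ring_1
begin

lift_definition zero_uea :: "'a uea" is 0 .
lift_definition one_uea :: "'a uea" is 1 .

lift_definition plus_uea :: "'a uea \<Rightarrow> 'a uea \<Rightarrow> 'a uea" is "(+)"
  using uea_ideal.add by (fastforce simp: algebra_simps)

lift_definition minus_uea :: "'a uea \<Rightarrow> 'a uea \<Rightarrow> 'a uea" is "(-)"
  using uea_ideal_diff by (fastforce simp: algebra_simps)

lift_definition uminus_uea :: "'a uea \<Rightarrow> 'a uea" is uminus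
  using uea_ideal_uminus by fastforce

lift_definition times_uea :: "'a uea \<Rightarrow> 'a uea \<Rightarrow> 'a uea" is "(*)"
proof -
  fix p p' q q' :: "'a free_algebra"
  assume "p - p' \<in> uea_ideal" "q - q' \<in> uea_ideal"
  then have "(p - p') * q + p' * (q - q') \<in> uea_ideal"
    by (intro uea_ideal.add uea_ideal_mult_left uea_ideal_mult_right)
  then show "p * q - p' * q' \<in> uea_ideal" by (simp add: algebra_simps)
qed

instance
proof
  have "(1 :: 'a free_algebra) \<notin> uea_ideal"
    using uea_ideal_augmentation[of "1 :: 'a free_algebra"] by auto
  then have "(0 :: 'a free_algebra) - 1 \<notin> uea_ideal"
    using uea_ideal_uminus[of "- 1 :: 'a free_algebra"] by auto
  then show "(0 :: 'a uea) \<noteq> 1" by transfer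
qed (transfer; simp add: algebra_simps uea_ideal.zero)+

end

instantiation uea :: (complex_lie_algebra) complex_vector
begin

lift_definition scaleC_uea :: "complex \<Rightarrow> 'a uea \<Rightarrow> 'a uea" is scaleC
  by (simp add: scaleC_free_algebra uea_ideal_mult_left flip: right_diff_distrib)

instance
  by standard
    (transfer; simp add: scaleC_add_right scaleC_add_left scaleC_scaleC scaleC_one uea_ideal.zero)+

end

lift_definition uea_embed :: "'l::complex_lie_algebra \<Rightarrow> 'l uea" is letter .

definition left_ideal :: "'r::ring_1 set \<Rightarrow> bool" where
  "left_ideal J \<longleftrightarrow> 0 \<in> J \<and> (\<forall>u\<in>J. \<forall>v\<in>J. u + v \<in> J) \<and> (\<forall>a. \<forall>u\<in>J. a * u \<in> J)"

definition left_ideal_generated :: "'r::ring_1 set \<Rightarrow> 'r set" where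
  "left_ideal_generated S = \<Inter> {J. left_ideal J \<and> S \<subseteq> J}"

section \<open>Modules over Lie algebras\<close>

record ('l, 'v) lie_module =
  carrier :: "'v set"
  zero :: "'v"
  add :: "'v \<Rightarrow> 'v \<Rightarrow> 'v"
  smult :: "complex \<Rightarrow> 'v \<Rightarrow> 'v"
  action :: "'l \<Rightarrow> 'v \<Rightarrow> 'v"

hide_const (open) carrier zero add smult action

definition lie_module_iso :: "('l, 'v) lie_module \<Rightarrow> ('l, 'w) lie_module \<Rightarrow> bool"  (infix "\<cong>\<^sub>L" 50) where
  "M \<cong>\<^sub>L N \<longleftrightarrow> (\<exists>f. bij_betw f (lie_module.carrier M) (lie_module.carrier N) \<and>
     (\<forall>u\<in>lie_module.carrier M. \<forall>v\<in>lie_module.carrier M.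
        f (lie_module.add M u v) = lie_module.add N (f u) (f v)) \<and>
     (\<forall>c. \<forall>u\<in>lie_module.carrier M. f (lie_module.smult M c u) = lie_module.smult N c (f u)) \<and>
     (\<forall>x. \<forall>u\<in>lie_module.carrier M. f (lie_module.action M x u) = lie_module.action N x (f u)))"

definition submodule :: "('l, 'v) lie_module \<Rightarrow> 'v set \<Rightarrow> bool" where
  "submodule M N \<longleftrightarrow>
     N \<subseteq> lie_module.carrier M \<and> lie_module.zero M \<in> N \<and>
     (\<forall>u\<in>N. \<forall>v\<in>N. lie_module.add M u v \<in> N) \<and>
     (\<forall>c. \<forall>u\<in>N. lie_module.smult M c u \<in> N) \<and> (\<forall>x. \<forall>u\<in>N. lie_module.action M x u \<in> N)"

definition generated_submodule :: "('l, 'v) lie_module \<Rightarrow> 'v set \<Rightarrow> ('l, 'v) lie_module" where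
  "generated_submodule M S = M\<lparr>lie_module.carrier := \<Inter> {N. submodule M N \<and> S \<subseteq> N}\<rparr>"

definition coset :: "'v::ab_group_add set \<Rightarrow> 'v \<Rightarrow> 'v set" where
  "coset B v = {v + b | b. b \<in> B}"

text \<open>The quotient \<open>(A + B) / B\<close> for subspaces \<open>A\<close> and \<open>B\<close> of \<open>'v\<close>, where \<open>\<rho> x\<close> is linear and maps
  \<open>B\<close> into \<open>B\<close>. The elements are cosets of \<open>B\<close>, and the operations are those on representatives.\<close>

definition quotient_module ::
    "('l \<Rightarrow> 'v \<Rightarrow> 'v) \<Rightarrow> 'v::complex_vector set \<Rightarrow> 'v set \<Rightarrow> ('l, 'v set) lie_module" where
  "quotient_module \<rho> A B =
     \<lparr>lie_module.carrier = coset B ` A,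
      zero = B,
      add = (\<lambda>X Y. {x + y | x y. x \<in> X \<and> y \<in> Y}),
      smult = (\<lambda>c X. {c *\<^sub>C x + b | x b. x \<in> X \<and> b \<in> B}),
      action = (\<lambda>l X. {\<rho> l x + b | x b. x \<in> X \<and> b \<in> B})\<rparr>"

definition uea_quotient :: "'l::complex_lie_algebra uea set \<Rightarrow> ('l, 'l uea set) lie_module" where
  "uea_quotient J = quotient_module (\<lambda>x u. uea_embed x * u) UNIV J"

text \<open>Tensor product over a finite index set \<open>I\<close>: the vector space freely spanned by the families in
  the product of the carriers, modulo the multilinearity relations. A Lie algebra element \<open>x\<close> sends
  the pure tensor of \<open>f\<close> to the sum over \<open>i \<in> I\<close> of the pure tensors with \<open>f i\<close> replaced by \<open>x f i\<close>.\<close>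

definition tensor_families ::
    "nat set \<Rightarrow> (nat \<Rightarrow> ('l, 'v) lie_module) \<Rightarrow> (nat \<Rightarrow> 'v) set" where
  "tensor_families I Ms = (\<Pi>\<^sub>E i\<in>I. lie_module.carrier (Ms i))"

definition pure :: "(nat \<Rightarrow> 'v) \<Rightarrow> ((nat \<Rightarrow> 'v) \<Rightarrow>\<^sub>0 complex)" where
  "pure f = Poly_Mapping.single f 1"

definition tensor_relations ::
    "nat set \<Rightarrow> (nat \<Rightarrow> ('l, 'v) lie_module) \<Rightarrow> ((nat \<Rightarrow> 'v) \<Rightarrow>\<^sub>0 complex) set" where
  "tensor_relations I Ms = cspan
     ({pure (f(i := lie_module.add (Ms i) a b)) - pure (f(i := a)) - pure (f(i := b)) | f i a b.
         f \<in> tensor_families I Ms \<and> i \<in> I \<and>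
         a \<in> lie_module.carrier (Ms i) \<and> b \<in> lie_module.carrier (Ms i)} \<union>
      {pure (f(i := lie_module.smult (Ms i) c a)) - c *\<^sub>C pure (f(i := a)) | f i c a.
         f \<in> tensor_families I Ms \<and> i \<in> I \<and> a \<in> lie_module.carrier (Ms i)})"

definition tensor_action ::
    "nat set \<Rightarrow> (nat \<Rightarrow> ('l, 'v) lie_module) \<Rightarrow> 'l \<Rightarrow> ((nat \<Rightarrow> 'v) \<Rightarrow>\<^sub>0 complex) \<Rightarrow> ((nat \<Rightarrow> 'v) \<Rightarrow>\<^sub>0 complex)"
  where
  "tensor_action I Ms x p =
     (\<Sum>f\<in>Poly_Mapping.keys p. Poly_Mapping.lookup p f *\<^sub>C
        (\<Sum>i\<in>I. pure (f(i := lie_module.action (Ms i) x (f i)))))"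

definition tensor_product ::
    "nat set \<Rightarrow> (nat \<Rightarrow> ('l, 'v) lie_module) \<Rightarrow> ('l, ((nat \<Rightarrow> 'v) \<Rightarrow>\<^sub>0 complex) set) lie_module" where
  "tensor_product I Ms =
     quotient_module (tensor_action I Ms) (cspan (pure ` tensor_families I Ms)) (tensor_relations I Ms)"

section \<open>Modules over current algebras\<close>

definition current :: "'g::zero set \<Rightarrow> 'g poly set" where
  "current S = {p. \<forall>r. coeff p r \<in> S}"

abbreviation cur :: "'g::complex_lie_algebra \<Rightarrow> nat \<Rightarrow> 'g poly uea" where
  "cur x r \<equiv> uea_embed (monom x r)"

text \<open>The homogeneous component of \<open>U(\<gg>[t])\<close> of degree \<open>k\<close> in \<open>t\<close>.\<close>

definition uea_degree :: "nat \<Rightarrow> 'g::complex_lie_algebra poly uea set" where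
  "uea_degree k =
     cspan {prod_list (map (\<lambda>(x, r). cur x r) ws) | ws. sum_list (map snd ws) = k}"

definition restrict_to_constants :: "('g::zero poly, 'v) lie_module \<Rightarrow> ('g, 'v) lie_module" where
  "restrict_to_constants M =
     \<lparr>lie_module.carrier = lie_module.carrier M, zero = lie_module.zero M, add = lie_module.add M,
      smult = lie_module.smult M, action = (\<lambda>x. lie_module.action M (monom x 0))\<rparr>"

text \<open>\<open>H\<close> is a Cartan subalgebra, \<open>\<alpha> 1, \<dots>, \<alpha> n\<close> are the simple roots, \<open>h 1, \<dots>, h n\<close> the simple
  coroots, and \<open>xm \<beta>\<close> is a generator of the root space of \<open>- \<beta>\<close> for every positive root \<open>\<beta>\<close>.\<close>

locale simple_lie =
  fixes H :: "'g::complex_lie_algebra set"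
    and n :: nat
    and \<alpha> :: "nat \<Rightarrow> 'g \<Rightarrow> complex"
    and h :: "nat \<Rightarrow> 'g"
    and xm :: "('g \<Rightarrow> complex) \<Rightarrow> 'g"
  assumes finite_dimensional: "finite_dimensional TYPE('g)"
    and simple: "simple_lie_algebra TYPE('g)"
    and cartan: "cartan_subalgebra H"
    and base: "root_base H n \<alpha>"
    and coroot: "\<And>i. i \<in> {1..n} \<Longrightarrow> is_coroot H (\<alpha> i) (h i)"
    and negative_root_vector:
      "\<And>\<beta>. \<beta> \<in> positive_roots H n \<alpha> \<Longrightarrow> root_space H (\<lambda>y. - \<beta> y) = cspan {xm \<beta>}"
begin

definition dominant_weights :: "('g \<Rightarrow> complex) set" where
  "dominant_weights = {\<Lambda> \<in> dual H. \<forall>i\<in>{1..n}. \<Lambda> (h i) \<in> \<nat>}"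

text \<open>For dominant \<open>\<Lambda>\<close>, the value \<open>\<Lambda> (h i)\<close> as a natural number.\<close>

definition weight_coeff :: "('g \<Rightarrow> complex) \<Rightarrow> nat \<Rightarrow> nat" where
  "weight_coeff \<Lambda> i = (THE m. \<Lambda> (h i) = of_nat m)"

definition n_plus :: "'g set" where
  "n_plus = cspan (\<Union>\<beta>\<in>positive_roots H n \<alpha>. root_space H \<beta>)"

definition verma_relations :: "('g \<Rightarrow> complex) \<Rightarrow> 'g uea set" where
  "verma_relations \<mu> = uea_embed ` n_plus \<union> {uea_embed y - \<mu> y *\<^sub>C 1 | y. y \<in> H}"

text \<open>The irreducible module of highest weight \<open>\<mu>\<close>, as the quotient of the Verma module by the sum
  of all its proper submodules; the latter are the proper left ideals of \<open>U(\<gg>)\<close> that contain the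
  Verma relations.\<close>

definition V :: "('g \<Rightarrow> complex) \<Rightarrow> ('g, 'g uea set) lie_module" where
  "V \<mu> = uea_quotient (left_ideal_generated
     (verma_relations \<mu> \<union> \<Union> {J. left_ideal J \<and> verma_relations \<mu> \<subseteq> J \<and> J \<noteq> UNIV}))"

text \<open>\<open>\<nn>\<^sup>+[t]\<close> and \<open>\<hh> \<otimes> t\<complex>[t]\<close>, the relations common to all modules below;
  \<open>M_fund i m\<close> is the module \<open>M(m\<omega>\<^sub>i)\<close>, and \<open>R_fund i m r\<close>, \<open>R_weight \<Lambda> r\<close> are the sets
  \<open>R\<^sup>+(i,m,r)\<close>, \<open>R\<^sup>+(\<Lambda>,r)\<close>.\<close>

definition current_relations :: "'g poly uea set" where
  "current_relations =
     uea_embed ` current n_plus \<union> uea_embed ` {p \<in> current H. coeff p 0 = 0}"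

definition M_fund_ideal :: "nat \<Rightarrow> nat \<Rightarrow> 'g poly uea set" where
  "M_fund_ideal i m = left_ideal_generated
     (current_relations \<union>
      {cur (h i) 0 - of_nat m, cur (xm (\<alpha> i)) 0 ^ (m + 1), cur (xm (\<alpha> i)) 1} \<union>
      (\<Union>j\<in>{1..n} - {i}. {cur (h j) 0, cur (xm (\<alpha> j)) 0}))"

definition M_fund :: "nat \<Rightarrow> nat \<Rightarrow> ('g poly, 'g poly uea set) lie_module" where
  "M_fund i m = uea_quotient (M_fund_ideal i m)"

definition M_fund_gen :: "nat \<Rightarrow> nat \<Rightarrow> 'g poly uea set" where
  "M_fund_gen i m = coset (M_fund_ideal i m) 1"

definition R_fund :: "nat \<Rightarrow> nat \<Rightarrow> nat \<Rightarrow> ('g \<Rightarrow> complex) set" where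
  "R_fund i m r =
     {\<beta> \<in> positive_roots H n \<alpha>.
        lie_module.action (M_fund i m) (monom (xm \<beta>) r) (M_fund_gen i m) =
          lie_module.zero (M_fund i m)}"

definition R_weight :: "('g \<Rightarrow> complex) \<Rightarrow> nat \<Rightarrow> ('g \<Rightarrow> complex) set" where
  "R_weight \<Lambda> r = (\<Inter>i\<in>{1..n}. R_fund i (weight_coeff \<Lambda> i) r)"

definition M_ideal :: "('g \<Rightarrow> complex) \<Rightarrow> 'g poly uea set" where
  "M_ideal \<Lambda> = left_ideal_generated
     (current_relations \<union>
      (\<Union>i\<in>{1..n}. {cur (h i) 0 - \<Lambda> (h i) *\<^sub>C 1, cur (xm (\<alpha> i)) 0 ^ (weight_coeff \<Lambda> i + 1)}) \<union>
      (\<Union>r. (\<lambda>\<beta>. cur (xm \<beta>) r) ` R_weight \<Lambda> r))"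

definition M :: "('g \<Rightarrow> complex) \<Rightarrow> ('g poly, 'g poly uea set) lie_module" where
  "M \<Lambda> = uea_quotient (M_ideal \<Lambda>)"

definition M_graded :: "('g \<Rightarrow> complex) \<Rightarrow> nat \<Rightarrow> ('g, 'g poly uea set) lie_module" where
  "M_graded \<Lambda> k =
     restrict_to_constants ((M \<Lambda>)\<lparr>lie_module.carrier := coset (M_ideal \<Lambda>) ` uea_degree k\<rparr>)"

definition weight_space :: "('g poly, 'v) lie_module \<Rightarrow> ('g \<Rightarrow> complex) \<Rightarrow> 'v set" where
  "weight_space N \<mu> = {v \<in> lie_module.carrier N.
     \<forall>y\<in>H. lie_module.action N (monom y 0) v = lie_module.smult N (\<mu> y) v}"

definition T ::
    "('g \<Rightarrow> complex) \<Rightarrow> ('g poly, ((nat \<Rightarrow> 'g poly uea set) \<Rightarrow>\<^sub>0 complex) set) lie_module" where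
  "T \<Lambda> = (let N = tensor_product {1..n} (\<lambda>i. M_fund i (weight_coeff \<Lambda> i))
          in generated_submodule N (weight_space N \<Lambda>))"

definition type_B :: bool where
  "type_B \<longleftrightarrow> (\<forall>i\<in>{1..n}. \<forall>j\<in>{1..n}. \<alpha> j (h i) = of_int (cartan_matrix_B n i j))"

definition theta11 :: "'g \<Rightarrow> complex" where
  "theta11 = (\<lambda>y. (\<Sum>k=1..n. \<alpha> k y) + (\<Sum>k=2..n. \<alpha> k y))"

end

definition d_prime :: "nat \<Rightarrow> nat \<Rightarrow> real" where
  "d_prime n i = (if i < n then 1 else 1/2)"

end

theory Submission
  imports Defs "HOL-Library.Function_Algebras" "HOL-Library.Multiset"
begin

text \<open>Write \<open>\<theta>\<close> for the root \<open>theta11\<close>, which is the highest root, \<open>v\<close> for the generator of \<open>M(\<Lambda>)\<close> and \<open>f\<close>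
  for \<open>x\<^sub>\<theta>\<^sup>- \<otimes> t\<close>. The value of \<open>\<theta>\<close> is \<open>1\<close> (or \<open>2\<close> if \<open>n = 2\<close>) at \<open>h\<^sub>2\<close> and \<open>0\<close> at the other coroots, so
  \<open>[d\<^sub>2' \<lambda>(h\<^sub>2)]\<close> is the largest \<open>p\<close> for which \<open>\<Lambda> - p\<theta>\<close> is dominant.

  All modules in question are quotients of \<open>U(g[t])\<close> by an ideal in which \<open>f\<close> is the only element
  \<open>x\<^sub>\<beta>\<^sup>- \<otimes> t\<^sup>r\<close> with \<open>r \<ge> 1\<close> that may be missing (\<open>current_hw\<close>); this comes from the bounds on the coefficients of
  a positive root at \<open>\<alpha>\<^sub>1\<close> and \<open>\<alpha>\<^sub>2\<close>. Commuting elements shows that the vectors \<open>f\<^sup>k v\<close> are singular of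
  weight \<open>\<Lambda> - k\<theta>\<close> and generate the degree \<open>k\<close> part over \<open>U(g)\<close>. Integrable highest weight modules are irreducible,
  by the Casimir element (\<open>integrable_irreducible\<close>), so the degree \<open>k\<close> part is \<open>V(\<Lambda> - k\<theta>)\<close> or \<open>0\<close>, and it
  is \<open>0\<close> for \<open>k > p\<close> because \<open>\<Lambda> - k\<theta>\<close> is not dominant. The Casimir element also separates the degrees, so a
  module of this kind is determined by the set of those \<open>k\<close> with \<open>f\<^sup>k v = 0\<close> (\<open>larger_ideal_eq\<close>). What has to be
  shown is that \<open>f\<^sup>p v\<close> does not vanish, in \<open>M(\<Lambda>)\<close> and in the tensor product.

  For that, let \<open>g[t]\<close> act on functions of \<open>y \<in> g\<close> with values in functionals on \<open>U(g)\<close>: elements of \<open>g\<close>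
  in the natural way, \<open>x \<otimes> t\<close> as the derivative in direction \<open>x\<close>, and higher degrees by \<open>0\<close>. If \<open>\<phi>\<close> is
  the Harish-Chandra projection at a dominant weight \<open>\<mu>\<close>, then \<open>\<kappa>(e\<^sub>\<theta>, y)\<^sup>p \<phi>\<close> is a highest weight vector of
  weight \<open>\<mu> + p\<theta>\<close>, and \<open>f\<close> lowers the exponent one by one (\<open>nonvanishing_powers\<close>). The choice
  \<open>\<mu> = \<Lambda> - p\<theta>\<close> gives the claim for \<open>M(\<Lambda>)\<close>. The choices \<open>\<mu> = \<lambda>(h\<^sub>1) \<omega>\<^sub>1\<close>, with exponent \<open>0\<close>, and \<open>\<mu> = \<lambda>(h\<^sub>2) \<omega>\<^sub>2 - p\<theta>\<close>
  give \<open>v\<^sub>1 \<noteq> 0\<close> and \<open>f\<^sup>p v\<^sub>2 \<noteq> 0\<close> for the generators of the factors of the tensor product; there \<open>f\<close> kills all generators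
  but \<open>v\<^sub>2\<close>, so \<open>f\<^sup>p\<close> sends the product of the generators to \<open>v\<^sub>1 \<otimes> f\<^sup>p v\<^sub>2 \<otimes> \<dots> \<noteq> 0\<close> (\<open>top_annihilator\<close>). The
  \<open>\<Lambda>\<close>-weight space of the tensor product is spanned by that product, which thus generates \<open>T(\<Lambda>)\<close>.

  The projection at \<open>\<mu>\<close> exists when the Verma module of \<open>\<mu>\<close> does not vanish, and this enters as the
  condition \<open>1 \<notin> verma_ideal \<mu>\<close>. It holds for \<open>\<mu> = 0\<close>, and it is invariant under translations by \<open>\<complex>\<theta>\<close>, by the same
  construction with complex powers of \<open>\<kappa>(e\<^sub>\<theta>, y)\<close> as Taylor series (\<open>proper_shift\<close>). Since \<open>\<theta>\<close> is a multiple of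
  \<open>\<omega>\<^sub>2\<close>, it holds on \<open>\<complex>\<omega>\<^sub>2\<close>, and it holds for all of \<open>\<Lambda> - k\<theta>\<close> and \<open>\<lambda>(h\<^sub>1) \<omega>\<^sub>1\<close> together or for none of them; in
  the latter case both sides of all claimed isomorphisms would be zero.\<close>


section \<open>Linear algebra modulo a subspace\<close>

definition clin :: "('a::complex_vector \<Rightarrow> 'b::complex_vector) \<Rightarrow> bool" where
  "clin f \<longleftrightarrow> (\<forall>x y. f (x + y) = f x + f y) \<and> (\<forall>c x. f (c *\<^sub>C x) = c *\<^sub>C f x)"

lemma clinI: "(\<And>x y. f (x + y) = f x + f y) \<Longrightarrow> (\<And>c x. f (c *\<^sub>C x) = c *\<^sub>C f x) \<Longrightarrow> clin f"
  by (simp add: clin_def)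

lemma clin_add: "clin f \<Longrightarrow> f (x + y) = f x + f y"
  and clin_scale: "clin f \<Longrightarrow> f (c *\<^sub>C x) = c *\<^sub>C f x"
  by (simp_all add: clin_def)

lemma clin_zero: "clin f \<Longrightarrow> f 0 = 0"
  using clin_scale[of f 0 0] by simp

lemma clin_minus: "clin f \<Longrightarrow> f (- x) = - f x"
  using clin_scale[of f "- 1" x] by simp

lemma clin_diff: "clin f \<Longrightarrow> f (x - y) = f x - f y"
  using clin_add[of f x "- y"] clin_minus[of f y] by simp

lemma clin_sum: "clin f \<Longrightarrow> f (sum g S) = (\<Sum>i\<in>S. f (g i))"
  by (induction S rule: infinite_finite_induct) (simp_all add: clin_zero clin_add)

lemma clin_funpow: "clin f \<Longrightarrow> clin (f ^^ k)" for f :: "'a::complex_vector \<Rightarrow> 'a"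
  by (induction k) (simp_all add: clin_def)

lemma subspace_add: "csubspace S \<Longrightarrow> x \<in> S \<Longrightarrow> y \<in> S \<Longrightarrow> x + y \<in> S"
  by (rule complex_vector.subspace_add)

lemma subspace_scale: "csubspace S \<Longrightarrow> x \<in> S \<Longrightarrow> c *\<^sub>C x \<in> S"
  by (rule complex_vector.subspace_scale)

lemma subspace_zero: "csubspace S \<Longrightarrow> 0 \<in> S"
  by (rule complex_vector.subspace_0)

lemma subspace_diff: "csubspace S \<Longrightarrow> x \<in> S \<Longrightarrow> y \<in> S \<Longrightarrow> x - y \<in> S"
  by (rule complex_vector.subspace_diff)

lemma subspace_minus: "csubspace S \<Longrightarrow> x \<in> S \<Longrightarrow> - x \<in> S"
  by (rule complex_vector.subspace_neg)

lemma subspace_sum: "csubspace S \<Longrightarrow> (\<And>i. i \<in> A \<Longrightarrow> g i \<in> S) \<Longrightarrow> sum g A \<in> S"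
  by (rule complex_vector.subspace_sum)

lemma subspace_diff_cancel: "csubspace S \<Longrightarrow> x - y \<in> S \<Longrightarrow> x \<in> S \<longleftrightarrow> y \<in> S"
  using subspace_add[of S "x - y" y] subspace_diff[of S x "x - y"] by auto

lemma subspace_zero_set: "csubspace {0}"
  by (rule complex_vector.subspace_single_0)

lemma subspaceI:
  "0 \<in> S \<Longrightarrow> (\<And>x y. x \<in> S \<Longrightarrow> y \<in> S \<Longrightarrow> x + y \<in> S) \<Longrightarrow> (\<And>c x. x \<in> S \<Longrightarrow> c *\<^sub>C x \<in> S) \<Longrightarrow> csubspace S"
  by (simp add: complex_vector.subspace_def)

lemma subspace_vimage: "clin f \<Longrightarrow> csubspace S \<Longrightarrow> csubspace {x. f x \<in> S}"
  by (intro subspaceI) (simp_all add: clin_zero clin_add clin_scale subspace_zero subspace_add subspace_scale)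

lemma subspace_plus:
  assumes "csubspace A" "csubspace B" shows "csubspace {a + b | a b. a \<in> A \<and> b \<in> B}"
  using complex_vector.subspace_sums[OF assms] .

lemma span_induct_clin:
  assumes "x \<in> cspan S" "clin f" "csubspace T" "\<And>s. s \<in> S \<Longrightarrow> f s \<in> T"
  shows "f x \<in> T"
proof -
  have "S \<subseteq> {x. f x \<in> T}" using assms by auto
  then have "cspan S \<subseteq> {x. f x \<in> T}"
    by (rule complex_vector.span_minimal) (rule subspace_vimage[OF assms(2,3)])
  then show ?thesis using assms(1) by auto
qed

lemma clin_span_eq:
  assumes "clin f" "clin g" "\<And>s. s \<in> S \<Longrightarrow> f s = g s" "x \<in> cspan S"
  shows "f x = g x"
proof -
  have "clin (\<lambda>x. f x - g x)"
    using assms(1,2) by (intro clinI) (simp_all add: clin_def complex_vector.scale_right_diff_distrib)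
  from span_induct_clin[OF assms(4) this subspace_zero_set] assms(3) show ?thesis by simp
qed

text \<open>Vandermonde without determinants: applying \<open>Y i - \<chi> d\<^sub>0 i\<close> for an \<open>i\<close> that distinguishes
  \<open>d\<^sub>0\<close> from \<open>d\<^sub>1\<close> removes the term \<open>d\<^sub>0\<close> and only rescales the others, so the claim for \<open>d\<^sub>1\<close>
  follows from a shorter sum. It is used for joint eigenspaces of a Cartan subalgebra and for
  eigenspaces of the Casimir element, and always modulo a stable subspace.\<close>

lemma eigen_separation:
  fixes Y :: "'i \<Rightarrow> 'v::complex_vector \<Rightarrow> 'v" and x :: "'d \<Rightarrow> 'v"
  assumes B: "csubspace B" and lin: "\<And>i. i \<in> I \<Longrightarrow> clin (Y i)"
    and stable: "\<And>i b. i \<in> I \<Longrightarrow> b \<in> B \<Longrightarrow> Y i b \<in> B"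
    and "finite D"
    and eig: "\<And>d i. d \<in> D \<Longrightarrow> i \<in> I \<Longrightarrow> Y i (x d) - \<chi> d i *\<^sub>C x d \<in> B"
    and dist: "\<And>d d'. d \<in> D \<Longrightarrow> d' \<in> D \<Longrightarrow> d \<noteq> d' \<Longrightarrow> \<exists>i\<in>I. \<chi> d i \<noteq> \<chi> d' i"
    and sum: "(\<Sum>d\<in>D. x d) \<in> B" and "d1 \<in> D"
  shows "x d1 \<in> B"
  using \<open>finite D\<close> eig dist sum \<open>d1 \<in> D\<close>
proof (induction "card D" arbitrary: D x)
  case 0
  then show ?case by simp
next
  case (Suc k)
  show ?case
  proof (cases "D = {d1}")
    case True
    with Suc.prems show ?thesis by simp
  next
    case False
    then obtain d0 where d0: "d0 \<in> D" "d0 \<noteq> d1" using Suc.prems by blast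
    then obtain i where i: "i \<in> I" "\<chi> d0 i \<noteq> \<chi> d1 i" using Suc.prems(3)[of d0 d1] Suc.prems(5) by blast
    define x' where "x' d = (\<chi> d i - \<chi> d0 i) *\<^sub>C x d" for d
    have B': "Y i (x d) - \<chi> d i *\<^sub>C x d \<in> B" if "d \<in> D" for d using Suc.prems(2) that i by blast
    have "(\<Sum>d\<in>D. Y i (x d)) - \<chi> d0 i *\<^sub>C (\<Sum>d\<in>D. x d) \<in> B"
      using stable[OF i(1) Suc.prems(4)] clin_sum[OF lin[OF i(1)], of x D]
      by (intro subspace_diff[OF B] subspace_scale[OF B] Suc.prems(4)) simp
    moreover have "(\<Sum>d\<in>D. Y i (x d) - \<chi> d i *\<^sub>C x d) \<in> B"
      by (intro subspace_sum[OF B] B')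
    ultimately have "((\<Sum>d\<in>D. Y i (x d)) - \<chi> d0 i *\<^sub>C (\<Sum>d\<in>D. x d)) - (\<Sum>d\<in>D. Y i (x d) - \<chi> d i *\<^sub>C x d) \<in> B"
      by (rule subspace_diff[OF B])
    also have "((\<Sum>d\<in>D. Y i (x d)) - \<chi> d0 i *\<^sub>C (\<Sum>d\<in>D. x d)) - (\<Sum>d\<in>D. Y i (x d) - \<chi> d i *\<^sub>C x d)
        = (\<Sum>d\<in>D. x' d)"
      by (simp add: x'_def complex_vector.scale_sum_right sum_subtractf complex_vector.scale_left_diff_distrib)
    also have "\<dots> = x' d0 + (\<Sum>d\<in>D - {d0}. x' d)"
      using Suc.prems(1) d0 by (simp add: sum.remove)
    also have "x' d0 = 0" by (simp add: x'_def)
    finally have s: "(\<Sum>d\<in>D - {d0}. x' d) \<in> B" by simp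
    have "x' d1 \<in> B"
    proof (rule Suc.hyps(1))
      show "k = card (D - {d0})" using Suc.hyps(2) d0 Suc.prems(1) by simp
      show "finite (D - {d0})" using Suc.prems by simp
      show "Y j (x' d) - \<chi> d j *\<^sub>C x' d \<in> B" if "d \<in> D - {d0}" "j \<in> I" for d j
      proof -
        have "(\<chi> d i - \<chi> d0 i) *\<^sub>C (Y j (x d) - \<chi> d j *\<^sub>C x d) \<in> B"
          using that Suc.prems(2) by (intro subspace_scale[OF B]) auto
        then show ?thesis using clin_scale[OF lin[OF that(2)]]
          by (simp add: x'_def complex_vector.scale_right_diff_distrib mult.commute)
      qed
      show "\<exists>i\<in>I. \<chi> d i \<noteq> \<chi> d' i" if "d \<in> D - {d0}" "d' \<in> D - {d0}" "d \<noteq> d'" for d d'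
        using that Suc.prems(3) by blast
      show "d1 \<in> D - {d0}" using d0 Suc.prems by simp
    qed (rule s)
    from subspace_scale[OF B this, of "inverse (\<chi> d1 i - \<chi> d0 i)"] i(2)
    show ?thesis by (simp add: x'_def)
  qed
qed

lemma span_Union_subspaces:
  assumes "x \<in> cspan (\<Union>i\<in>I. E i)" and "\<And>i. i \<in> I \<Longrightarrow> csubspace (E i)"
  obtains D g where "finite D" "D \<subseteq> I" "\<And>d. d \<in> D \<Longrightarrow> g d \<in> E d" "x = (\<Sum>d\<in>D. g d)"
proof -
  define P where "P x \<longleftrightarrow> (\<exists>D g. finite D \<and> D \<subseteq> I \<and> (\<forall>d\<in>D. g d \<in> E d) \<and> x = (\<Sum>d\<in>D. g d))" for x
  have P0: "P 0" unfolding P_def by (rule exI[of _ "{}"]) simp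
  have add: "P (x + y)" if "P x" "P y" for x y
  proof -
    from that obtain D g D' g' where *: "finite D" "D \<subseteq> I" "\<forall>d\<in>D. g d \<in> E d" "x = (\<Sum>d\<in>D. g d)"
      "finite D'" "D' \<subseteq> I" "\<forall>d\<in>D'. g' d \<in> E d" "y = (\<Sum>d\<in>D'. g' d)" unfolding P_def by blast
    define G where "G d = (if d \<in> D then g d else 0)" for d
    define G' where "G' d = (if d \<in> D' then g' d else 0)" for d
    have "x = (\<Sum>d\<in>D \<union> D'. G d)" "y = (\<Sum>d\<in>D \<union> D'. G' d)"
      using * by (auto simp: G_def G'_def intro!: sum.mono_neutral_cong_left)
    then have "x + y = (\<Sum>d\<in>D \<union> D'. G d + G' d)" by (simp add: sum.distrib)
    moreover have "G d + G' d \<in> E d" if "d \<in> D \<union> D'" for d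
      using * that assms(2)[of d] by (auto simp: G_def G'_def intro!: subspace_add subspace_zero)
    ultimately show ?thesis unfolding P_def using *
      by (intro exI[of _ "D \<union> D'"] exI[of _ "\<lambda>d. G d + G' d"]) auto
  qed
  have scale: "P (c *\<^sub>C x)" if "P x" for c x
  proof -
    from that obtain D g where *: "finite D" "D \<subseteq> I" "\<forall>d\<in>D. g d \<in> E d" "x = (\<Sum>d\<in>D. g d)"
      unfolding P_def by blast
    then have "c *\<^sub>C x = (\<Sum>d\<in>D. c *\<^sub>C g d)" by (simp add: complex_vector.scale_sum_right)
    then show ?thesis unfolding P_def using * assms(2)
      by (intro exI[of _ D] exI[of _ "\<lambda>d. c *\<^sub>C g d"]) (auto intro!: subspace_scale)
  qed
  have "csubspace {x. P x}" by (intro subspaceI) (auto intro: P0 add scale)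
  moreover have "(\<Union>i\<in>I. E i) \<subseteq> {x. P x}"
  proof
    fix x assume "x \<in> (\<Union>i\<in>I. E i)"
    then obtain i where "i \<in> I" "x \<in> E i" by blast
    then show "x \<in> {x. P x}" unfolding P_def
      by (auto intro!: exI[of _ "{i}"] exI[of _ "\<lambda>_. x"])
  qed
  ultimately have "P x" using complex_vector.span_minimal assms(1) by blast
  then show thesis unfolding P_def using that by blast
qed

lemma exists_functional:
  fixes u :: "'v::complex_vector"
  assumes J: "csubspace J" and u: "u \<notin> J"
  obtains \<phi> :: "'v \<Rightarrow> complex" where "clin \<phi>" "\<And>j. j \<in> J \<Longrightarrow> \<phi> j = 0" "\<phi> u = 1"
proof -
  obtain B where B: "B \<subseteq> J" "complex_vector.independent B" "J \<subseteq> cspan B"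
    by (rule complex_vector.basis_exists[of J])
  have "cspan B \<subseteq> J" by (rule complex_vector.span_minimal[OF B(1) J])
  then have "u \<notin> cspan B" using u by blast
  from complex_vector.independent_insertI[OF this B(2)]
  have ind: "complex_vector.independent (insert u B)" .
  interpret vp: vector_space_pair "scaleC :: complex \<Rightarrow> 'v \<Rightarrow> 'v" "scaleC :: complex \<Rightarrow> complex \<Rightarrow> complex"
    by (simp add: vector_space_pair_def complex_vector.vector_space_axioms)
  show thesis
  proof (rule exE[OF vp.linear_independent_extend[OF ind, of "\<lambda>x. if x = u then 1 else 0"]])
    fix g :: "'v \<Rightarrow> complex"
    assume *: "Vector_Spaces.linear scaleC scaleC g \<and> (\<forall>x\<in>insert u B. g x = (if x = u then 1 else 0))"
    note g = conjunct1[OF *] conjunct2[OF *]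
    have lin: "clin g"
      by (intro clinI vp.linear_add[OF g(1)] vp.linear_scale[OF g(1)])
    have zero: "g j = 0" if "j \<in> J" for j
    proof (rule clin_span_eq[OF lin, of "\<lambda>_. 0"])
      show "clin (\<lambda>_::'v. 0::complex)" by (simp add: clin_def)
      show "j \<in> cspan B" using that B(3) by (rule subsetD[rotated])
      show "g s = 0" if "s \<in> B" for s using g(2) that u B(1) by auto
    qed
    have "g u = 1" using g(2) by simp
    from that[OF lin zero this] show thesis .
  qed
qed

text \<open>The trace of the compression of \<open>X\<close> to the span of a basis \<open>B\<close> of a subspace.\<close>

definition btrace :: "'v::complex_vector set \<Rightarrow> ('v \<Rightarrow> 'v) \<Rightarrow> complex" where
  "btrace B X = (\<Sum>b\<in>B. complex_vector.representation B (X b) b)"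

lemma btrace_commute:
  assumes B: "finite B" "complex_vector.independent B" and lin: "clin X" "clin Y"
    and X: "\<And>b. b \<in> B \<Longrightarrow> X b \<in> cspan B" and Y: "\<And>b. b \<in> B \<Longrightarrow> Y b \<in> cspan B"
  shows "btrace B (\<lambda>v. X (Y v)) = btrace B (\<lambda>v. Y (X v))"
proof -
  let ?r = "complex_vector.representation B"
  have expand: "?r (X' (Y' b)) b = (\<Sum>b'\<in>B. ?r (Y' b) b' * ?r (X' b') b)"
    if "clin X'" "\<And>b. b \<in> B \<Longrightarrow> X' b \<in> cspan B" "\<And>b. b \<in> B \<Longrightarrow> Y' b \<in> cspan B" "b \<in> B" for X' Y' b
  proof -
    have "Y' b = (\<Sum>b'\<in>B. ?r (Y' b) b' *\<^sub>C b')"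
      using complex_vector.sum_representation_eq[OF B(2) that(3)[OF that(4)] B(1) order_refl] by simp
    then have "X' (Y' b) = X' (\<Sum>b'\<in>B. ?r (Y' b) b' *\<^sub>C b')" by (rule arg_cong)
    also have "\<dots> = (\<Sum>b'\<in>B. ?r (Y' b) b' *\<^sub>C X' b')"
      by (simp add: clin_sum[OF that(1)] clin_scale[OF that(1)])
    finally have "?r (X' (Y' b)) = ?r (\<Sum>b'\<in>B. ?r (Y' b) b' *\<^sub>C X' b')" by simp
    also have "\<dots> = (\<lambda>c. \<Sum>b'\<in>B. ?r (?r (Y' b) b' *\<^sub>C X' b') c)"
      by (rule complex_vector.representation_sum[OF B(2)])
        (auto intro: complex_vector.span_scale that(2))
    finally show ?thesis
      using that(2) by (simp add: complex_vector.representation_scale[OF B(2)])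
  qed
  have "btrace B (\<lambda>v. X (Y v)) = (\<Sum>b\<in>B. \<Sum>b'\<in>B. ?r (Y b) b' * ?r (X b') b)"
    unfolding btrace_def by (intro sum.cong refl expand lin X Y)
  also have "\<dots> = (\<Sum>b'\<in>B. \<Sum>b\<in>B. ?r (X b') b * ?r (Y b) b')"
    by (subst sum.swap) (simp add: mult.commute)
  also have "\<dots> = btrace B (\<lambda>v. Y (X v))"
    unfolding btrace_def by (intro sum.cong refl expand[symmetric] lin X Y)
  finally show ?thesis .
qed

lemma btrace_diff:
  assumes "complex_vector.independent B" "\<And>b. b \<in> B \<Longrightarrow> X b \<in> cspan B" "\<And>b. b \<in> B \<Longrightarrow> Y b \<in> cspan B"
  shows "btrace B (\<lambda>v. X v - Y v) = btrace B X - btrace B Y"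
  using assms unfolding btrace_def
  by (simp add: complex_vector.representation_diff sum_subtractf)

lemma btrace_add:
  assumes "complex_vector.independent B" "\<And>b. b \<in> B \<Longrightarrow> X b \<in> cspan B" "\<And>b. b \<in> B \<Longrightarrow> Y b \<in> cspan B"
  shows "btrace B (\<lambda>v. X v + Y v) = btrace B X + btrace B Y"
  using assms unfolding btrace_def
  by (simp add: complex_vector.representation_add sum.distrib)

lemma btrace_scale:
  assumes "complex_vector.independent B" "\<And>b. b \<in> B \<Longrightarrow> X b \<in> cspan B"
  shows "btrace B (\<lambda>v. c *\<^sub>C X v) = c * btrace B X"
  using assms unfolding btrace_def
  by (simp add: complex_vector.representation_scale sum_distrib_left)

lemma btrace_diagonal:
  assumes "complex_vector.independent B" "\<And>b. b \<in> B \<Longrightarrow> X b = w b *\<^sub>C b"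
  shows "btrace B X = (\<Sum>b\<in>B. w b)"
proof -
  have "complex_vector.representation B (X b) b = w b" if "b \<in> B" for b
    using that assms complex_vector.representation_scale[OF assms(1) complex_vector.span_base[OF that], of "w b"]
      complex_vector.representation_basis[OF assms(1) that] by simp
  then show ?thesis unfolding btrace_def by simp
qed

section \<open>Representations of \<open>sl\<^sub>2\<close> modulo a subspace\<close>

locale sl2_operators =
  fixes e f k :: "'v::complex_vector \<Rightarrow> 'v" and B :: "'v set"
  assumes lin: "clin e" "clin f" "clin k" and B: "csubspace B"
    and stable: "\<And>v. v \<in> B \<Longrightarrow> e v \<in> B" "\<And>v. v \<in> B \<Longrightarrow> f v \<in> B" "\<And>v. v \<in> B \<Longrightarrow> k v \<in> B"
    and ef: "\<And>v. e (f v) - f (e v) = k v"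
    and ke: "\<And>v. k (e v) - e (k v) = 2 *\<^sub>C e v"
    and kf: "\<And>v. k (f v) - f (k v) = (- 2) *\<^sub>C f v"
begin

lemma opposite: "sl2_operators f e (\<lambda>v. - k v) B"
proof
  show "clin (\<lambda>v. - k v)" using lin(3) by (simp add: clin_def)
  show "f (e v) - e (f v) = - k v" for v using ef[of v] by (metis minus_diff_eq)
  show "- k (f v) - f (- k v) = 2 *\<^sub>C f v" for v
    unfolding clin_minus[OF lin(2)] using arg_cong[OF kf[of v], of uminus] by simp
  show "- k (e v) - e (- k v) = (- 2) *\<^sub>C e v" for v
    unfolding clin_minus[OF lin(1)] using arg_cong[OF ke[of v], of uminus] by simp
qed (use lin B stable in \<open>auto intro: subspace_minus\<close>)

lemma f_pow_stable: "v \<in> B \<Longrightarrow> (f ^^ j) v \<in> B"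
  using stable by (induction j) auto

lemma weight_f_pow:
  assumes "k v - c *\<^sub>C v \<in> B"
  shows "k ((f ^^ j) v) - (c - 2 * of_nat j) *\<^sub>C (f ^^ j) v \<in> B"
proof (induction j)
  case (Suc j)
  let ?w = "(f ^^ j) v"
  have "k (f ?w) - (c - 2 * of_nat (Suc j)) *\<^sub>C f ?w
      = (k (f ?w) - f (k ?w) - (- 2) *\<^sub>C f ?w) + f (k ?w - (c - 2 * of_nat j) *\<^sub>C ?w)"
    unfolding clin_diff[OF lin(2)] clin_scale[OF lin(2)]
    by (simp add: algebra_simps complex_vector.scale_left_diff_distrib scaleC_add_left)
  also have "\<dots> \<in> B" using kf[of ?w] Suc stable(2) by simp
  finally show ?case by simp
qed (use assms in simp)

lemma weight_e_pow:
  assumes "k v - c *\<^sub>C v \<in> B"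
  shows "k ((e ^^ j) v) - (c + 2 * of_nat j) *\<^sub>C (e ^^ j) v \<in> B"
proof -
  interpret op: sl2_operators f e "\<lambda>v. - k v" B by (rule opposite)
  have "- k v - (- c) *\<^sub>C v \<in> B" using subspace_minus[OF B assms] by simp
  from subspace_minus[OF B op.weight_f_pow[OF this, of j]] show ?thesis
    by (simp add: algebra_simps complex_vector.scale_left_diff_distrib scaleC_add_left)
qed

lemma e_f_pow:
  assumes wt: "k v - c *\<^sub>C v \<in> B"
  shows "e ((f ^^ Suc j) v) - ((f ^^ Suc j) (e v) + (of_nat (Suc j) * (c - of_nat j)) *\<^sub>C (f ^^ j) v) \<in> B"
proof (induction j)
  case 0
  have "e (f v) - (f (e v) + c *\<^sub>C v) = k v - c *\<^sub>C v" unfolding ef[of v, symmetric] by simp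
  then show ?case using wt by (metis add.right_neutral funpow_0 funpow_simps_right(1) id_apply lambda_zero mult_1 of_nat_0 of_nat_1 One_nat_def diff_zero funpow.simps(2) o_apply)
next
  case (Suc j)
  let ?w = "(f ^^ Suc j) v"
  have "e (f ?w) - ((f ^^ Suc (Suc j)) (e v) + (of_nat (Suc (Suc j)) * (c - of_nat (Suc j))) *\<^sub>C ?w)
      = f (e ?w - ((f ^^ Suc j) (e v) + (of_nat (Suc j) * (c - of_nat j)) *\<^sub>C (f ^^ j) v))
        + (k ?w - (c - 2 * of_nat (Suc j)) *\<^sub>C ?w)
        + ((c - 2 * of_nat (Suc j)) + of_nat (Suc j) * (c - of_nat j)
           - of_nat (Suc (Suc j)) * (c - of_nat (Suc j))) *\<^sub>C ?w"
    unfolding ef[of ?w, symmetric]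
    by (simp only: clin_diff[OF lin(2)] clin_add[OF lin(2)] clin_scale[OF lin(2)]
        complex_vector.scale_left_diff_distrib scaleC_add_left funpow.simps o_apply) (simp add: algebra_simps)
  also have "(c - 2 * of_nat (Suc j)) + of_nat (Suc j) * (c - of_nat j)
           - of_nat (Suc (Suc j)) * (c - of_nat (Suc j)) = (0::complex)"
    by (simp add: algebra_simps)
  finally show ?case
    using subspace_add[OF B stable(2)[OF Suc] weight_f_pow[OF wt, of "Suc j"]] by simp
qed

text \<open>If \<open>N\<close> is the first power with \<open>f\<^sup>N v \<in> B\<close>, then \<open>0 \<equiv> e f\<^sup>N v \<equiv> N (c - N + 1) f\<^sup>N\<^sup>-\<^sup>1 v\<close>
  forces \<open>c = N - 1\<close>. The hypothesis \<open>f (e v) \<in> B\<close> instead of \<open>e v \<in> B\<close> matters for root strings.\<close>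

lemma primitive_string:
  assumes wt: "k v - c *\<^sub>C v \<in> B" and fe: "f (e v) \<in> B" and v: "v \<notin> B" and nil: "(f ^^ N) v \<in> B"
  obtains d where "c = of_nat d" "(f ^^ Suc d) v \<in> B" "\<And>j. j \<le> d \<Longrightarrow> (f ^^ j) v \<notin> B"
proof -
  define M where "M = (LEAST M. (f ^^ M) v \<in> B)"
  have M: "(f ^^ M) v \<in> B" "\<And>j. j < M \<Longrightarrow> (f ^^ j) v \<notin> B"
    unfolding M_def using nil by (auto intro: LeastI dest: not_less_Least)
  have "M \<noteq> 0" using M(1) v by (metis funpow_0)
  then obtain d where d: "M = Suc d" using not0_implies_Suc by blast
  have "(f ^^ d) (f (e v)) \<in> B" by (rule f_pow_stable[OF fe])
  then have "(f ^^ Suc d) (e v) \<in> B" by (simp only: funpow_Suc_right o_apply)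
  moreover have "e ((f ^^ Suc d) v) \<in> B" using M d stable by simp
  ultimately have "e ((f ^^ Suc d) v) - (f ^^ Suc d) (e v)
      - (e ((f ^^ Suc d) v) - ((f ^^ Suc d) (e v) + (of_nat (Suc d) * (c - of_nat d)) *\<^sub>C (f ^^ d) v)) \<in> B"
    by (intro subspace_diff[OF B] e_f_pow[OF wt])
  then have *: "(of_nat (Suc d) * (c - of_nat d)) *\<^sub>C (f ^^ d) v \<in> B" by (simp add: algebra_simps)
  have "c = of_nat d"
  proof (rule ccontr)
    assume "c \<noteq> of_nat d"
    then have nz: "of_nat (Suc d) * (c - of_nat d) \<noteq> 0" by (simp del: of_nat_Suc)
    from subspace_scale[OF B *, of "inverse (of_nat (Suc d) * (c - of_nat d))"]
    have "(f ^^ d) v \<in> B" unfolding scaleC_scaleC left_inverse[OF nz] scaleC_one .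
    with M(2) d show False by blast
  qed
  then show thesis by (rule that) (use M d in auto)
qed

lemma lowest_string:
  assumes "k v - of_nat d *\<^sub>C v \<in> B" "e v \<in> B" "(f ^^ N) v \<in> B"
  shows "(f ^^ Suc d) v \<in> B"
proof (cases "v \<in> B")
  case False
  obtain d' where "(of_nat d :: complex) = of_nat d'" "(f ^^ Suc d') v \<in> B"
    using primitive_string[OF assms(1) stable(2)[OF assms(2)] False assms(3)] by blast
  then show ?thesis by simp
qed (rule f_pow_stable)

lemma reflection_pos:
  assumes wt: "k v - c *\<^sub>C v \<in> B" and v: "v \<notin> B" and e: "\<exists>N. (e ^^ N) v \<in> B"
    and f: "\<And>v. \<exists>N. (f ^^ N) v \<in> B"
  obtains m :: int where "c = of_int m" "m \<ge> 0 \<Longrightarrow> \<exists>j. (f ^^ (j + nat m)) ((e ^^ j) v) \<notin> B"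
proof -
  define M where "M = (LEAST M. (e ^^ M) v \<in> B)"
  have M: "(e ^^ M) v \<in> B" "\<And>j. j < M \<Longrightarrow> (e ^^ j) v \<notin> B"
    unfolding M_def using e by (auto intro: LeastI dest: not_less_Least)
  have "M \<noteq> 0" using M(1) v by (metis funpow_0)
  then obtain j where j: "M = Suc j" using not0_implies_Suc by blast
  let ?u = "(e ^^ j) v"
  have u: "?u \<notin> B" "e ?u \<in> B" using M j by auto
  obtain N where N: "(f ^^ N) ?u \<in> B" using f by blast
  obtain d where d: "c + 2 * of_nat j = of_nat d" "\<And>i. i \<le> d \<Longrightarrow> (f ^^ i) ?u \<notin> B"
    using primitive_string[OF weight_e_pow[OF wt] stable(2)[OF u(2)] u(1) N] by blast
  show thesis
  proof (rule that[of "int d - 2 * int j"])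
    show "c = of_int (int d - 2 * int j)" using d(1) by (simp add: algebra_simps)
    assume "int d - 2 * int j \<ge> 0"
    then show "\<exists>j'. (f ^^ (j' + nat (int d - 2 * int j))) ((e ^^ j') v) \<notin> B"
      using d(2)[of "j + nat (int d - 2 * int j)"] by (intro exI[of _ j]) auto
  qed
qed

text \<open>Raise \<open>v\<close> as far as possible to a primitive vector; its string reaches down symmetrically about
  weight \<open>0\<close>, and so passes through the weight opposite to that of \<open>v\<close>.\<close>

lemma reflection:
  assumes wt: "k v - c *\<^sub>C v \<in> B" and v: "v \<notin> B"
    and e: "\<And>v. \<exists>N. (e ^^ N) v \<in> B" and f: "\<And>v. \<exists>N. (f ^^ N) v \<in> B"
  obtains m :: int where "c = of_int m" "m \<ge> 0 \<Longrightarrow> \<exists>j. (f ^^ (j + nat m)) ((e ^^ j) v) \<notin> B"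
    "m \<le> 0 \<Longrightarrow> \<exists>j. (e ^^ (j + nat (- m))) ((f ^^ j) v) \<notin> B"
proof -
  interpret op: sl2_operators f e "\<lambda>v. - k v" B by (rule opposite)
  have wt': "- k v - (- c) *\<^sub>C v \<in> B" using subspace_minus[OF B wt] by simp
  obtain m where m: "c = of_int m" "m \<ge> 0 \<Longrightarrow> \<exists>j. (f ^^ (j + nat m)) ((e ^^ j) v) \<notin> B"
    using reflection_pos[OF wt v e f] by blast
  obtain m' where m': "- c = of_int m'" "m' \<ge> 0 \<Longrightarrow> \<exists>j. (e ^^ (j + nat m')) ((f ^^ j) v) \<notin> B"
    using op.reflection_pos[OF wt' v f e] by blast
  have "m' = - m" using m(1) m'(1) by (metis of_int_eq_iff of_int_minus)
  with m m' that show thesis by simp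
qed

end

section \<open>Enveloping algebras\<close>

lemma embed_add: "uea_embed (x + y) = uea_embed x + uea_embed y"
proof (transfer)
  fix x y :: 'a
  show "letter (x + y) - (letter x + letter y) \<in> uea_ideal"
    using uea_ideal.letter_add[of x y] by (simp add: algebra_simps)
qed

lemma embed_scaleC: "uea_embed (c *\<^sub>C x) = c *\<^sub>C uea_embed x"
  by transfer (rule uea_ideal.letter_scaleC)

lemma embed_bracket: "uea_embed (bracket x y) = uea_embed x * uea_embed y - uea_embed y * uea_embed x"
proof (transfer)
  fix x y :: 'a
  show "letter (bracket x y) - (letter x * letter y - letter y * letter x) \<in> uea_ideal"
    using uea_ideal_uminus[OF uea_ideal.letter_bracket[of x y]] by (simp add: algebra_simps)
qed

lemma embed_commute: "uea_embed x * uea_embed y = uea_embed y * uea_embed x + uea_embed (bracket x y)"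
  by (simp add: embed_bracket)

lemma clin_embed: "clin uea_embed"
  by (intro clinI embed_add embed_scaleC)

lemmas embed_zero = clin_zero[OF clin_embed]
  and embed_minus = clin_minus[OF clin_embed]
  and embed_sum = clin_sum[OF clin_embed]

lemma free_algebra_scale_left: "(c *\<^sub>C p) * q = c *\<^sub>C (p * q)" for p q :: "'a free_algebra"
  by (simp add: scaleC_free_algebra mult.assoc)

lemma poly_mapping_sum_monomials:
  "(\<Sum>w\<in>Poly_Mapping.keys p. Poly_Mapping.single w (Poly_Mapping.lookup p w)) = p"
  for p :: "'a \<Rightarrow>\<^sub>0 'b::comm_monoid_add"
proof (rule poly_mapping_eqI)
  fix v
  have "Poly_Mapping.lookup (\<Sum>w\<in>Poly_Mapping.keys p. Poly_Mapping.single w (Poly_Mapping.lookup p w)) v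
      = (\<Sum>w\<in>Poly_Mapping.keys p. if w = v then Poly_Mapping.lookup p w else 0)"
    by (simp add: lookup_sum lookup_single when_def)
  also have "\<dots> = Poly_Mapping.lookup p v"
    by (simp add: in_keys_iff)
  finally show "Poly_Mapping.lookup (\<Sum>w\<in>Poly_Mapping.keys p. Poly_Mapping.single w (Poly_Mapping.lookup p w)) v
      = Poly_Mapping.lookup p v" .
qed

lemma single_zero_commute: "p * Poly_Mapping.single 0 c = Poly_Mapping.single 0 c * p" for p :: "'a free_algebra"
proof -
  have "finite A \<Longrightarrow> (\<Sum>w\<in>A. Poly_Mapping.single w (g w)) * Poly_Mapping.single 0 c
     = Poly_Mapping.single 0 c * (\<Sum>w\<in>A. Poly_Mapping.single w (g w))" for A and g :: "'a word \<Rightarrow> complex"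
    by (induction A rule: finite_induct) (simp_all add: mult_single algebra_simps)
  from this[of "Poly_Mapping.keys p" "Poly_Mapping.lookup p"] show ?thesis
    by (simp add: poly_mapping_sum_monomials)
qed

lemma free_algebra_scale_right: "p * (c *\<^sub>C q) = c *\<^sub>C (p * q)" for p q :: "'a free_algebra"
  by (simp add: scaleC_free_algebra single_zero_commute mult.assoc[symmetric])

lemma uea_scale_left: "(c *\<^sub>C u) * v = c *\<^sub>C (u * v)" for u v :: "'l::complex_lie_algebra uea"
  by transfer (simp add: free_algebra_scale_left uea_ideal.zero)

lemma uea_scale_right: "u * (c *\<^sub>C v) = c *\<^sub>C (u * v)" for u v :: "'l::complex_lie_algebra uea"
  by transfer (simp add: free_algebra_scale_right uea_ideal.zero)

lemma clin_mult_left: "clin (\<lambda>v. u * v)" for u :: "'l::complex_lie_algebra uea"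
  by (intro clinI) (simp_all add: algebra_simps uea_scale_right)

lemma clin_mult_right: "clin (\<lambda>v. v * u)" for u :: "'l::complex_lie_algebra uea"
  by (intro clinI) (simp_all add: algebra_simps uea_scale_left)

lemma poly_mapping_induct:
  fixes p :: "'a \<Rightarrow>\<^sub>0 'b::comm_monoid_add"
  assumes "\<And>w c. P (Poly_Mapping.single w c)" "\<And>p q. P p \<Longrightarrow> P q \<Longrightarrow> P (p + q)"
  shows "P p"
proof -
  have P0: "P 0" using assms(1)[of undefined 0] by simp
  have "finite A \<Longrightarrow> P (\<Sum>w\<in>A. Poly_Mapping.single w (g w))" for A g
    by (induction A rule: finite_induct) (simp_all add: assms P0)
  from this[of "Poly_Mapping.keys p" "Poly_Mapping.lookup p"] show ?thesis
    by (simp add: poly_mapping_sum_monomials)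
qed

lemma uea_induct [case_names one mult add scale]:
  fixes u :: "'l::complex_lie_algebra uea"
  assumes one: "P 1" and mult: "\<And>x u. P u \<Longrightarrow> P (uea_embed x * u)"
    and add: "\<And>u v. P u \<Longrightarrow> P v \<Longrightarrow> P (u + v)" and scale: "\<And>c u. P u \<Longrightarrow> P (c *\<^sub>C u)"
  shows "P u"
proof -
  have word: "P (abs_uea (Poly_Mapping.single (Word xs) 1))" for xs :: "'l list"
  proof (induction xs)
    case Nil
    have "Poly_Mapping.single (Word []) 1 = (1 :: 'l free_algebra)"
      by (simp add: zero_word_def[symmetric])
    then show ?case using one by (simp add: one_uea.abs_eq[symmetric])
  next
    case (Cons x xs)
    have "Poly_Mapping.single (Word (x # xs)) 1 = letter x * Poly_Mapping.single (Word xs) (1::complex)"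
      by (simp add: letter_def mult_single plus_word_def)
    then show ?case using mult[OF Cons, of x]
      by (simp add: times_uea.abs_eq[symmetric] uea_embed.abs_eq)
  qed
  have "P (abs_uea q)" for q :: "'l free_algebra"
  proof (induction q rule: poly_mapping_induct)
    fix w :: "'l word" and c :: complex
    have "Poly_Mapping.single w c = c *\<^sub>C Poly_Mapping.single w (1::complex)"
      by (simp add: scaleC_free_algebra mult_single)
    then show "P (abs_uea (Poly_Mapping.single w c))"
      using scale[OF word[of "letters w"], of c] by (simp add: scaleC_uea.abs_eq[symmetric])
  next
    fix p q :: "'l free_algebra"
    assume "P (abs_uea p)" "P (abs_uea q)"
    from add[OF this] show "P (abs_uea (p + q))" by (simp add: plus_uea.abs_eq)
  qed
  from this[of "rep_uea u"] show ?thesis by (simp add: Quotient3_abs_rep[OF Quotient3_uea])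
qed

lemma left_ideal_subspace: "left_ideal J \<Longrightarrow> csubspace J" for J :: "'l::complex_lie_algebra uea set"
proof (rule subspaceI)
  fix c and x :: "'l uea" assume "left_ideal J" "x \<in> J"
  moreover have "c *\<^sub>C x = (c *\<^sub>C 1) * x" by (simp add: uea_scale_left)
  ultimately show "c *\<^sub>C x \<in> J" unfolding left_ideal_def by metis
qed (auto simp: left_ideal_def)

lemma left_ideal_mult: "left_ideal J \<Longrightarrow> u \<in> J \<Longrightarrow> a * u \<in> J"
  by (simp add: left_ideal_def)

lemma left_ideal_UNIV: "left_ideal J \<Longrightarrow> 1 \<in> J \<Longrightarrow> J = UNIV"
  using left_ideal_mult[of J 1] by auto

lemma left_ideal_generated: "left_ideal (left_ideal_generated S)"
  unfolding left_ideal_generated_def left_ideal_def by blast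

lemma left_ideal_generated_base: "S \<subseteq> left_ideal_generated S"
  unfolding left_ideal_generated_def by blast

lemma left_ideal_generated_least: "left_ideal J \<Longrightarrow> S \<subseteq> J \<Longrightarrow> left_ideal_generated S \<subseteq> J"
  unfolding left_ideal_generated_def by blast

lemma left_idealI:
  fixes J :: "'l::complex_lie_algebra uea set"
  assumes "csubspace J" "\<And>x u. u \<in> J \<Longrightarrow> uea_embed x * u \<in> J"
  shows "left_ideal J"
proof -
  have "a * u \<in> J" if "u \<in> J" for a u
    using that
  proof (induction a rule: uea_induct)
    case (mult x a)
    then show ?case using assms(2)[of "a * u" x] by (simp add: mult.assoc)
  next
    case (add a b)
    then show ?case by (simp add: distrib_right subspace_add[OF assms(1)])
  next
    case (scale c a)
    then show ?case by (simp add: uea_scale_left subspace_scale[OF assms(1)])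
  qed simp
  then show ?thesis unfolding left_ideal_def
    using subspace_zero[OF assms(1)] subspace_add[OF assms(1)] by blast
qed

lemma left_ideal_sum:
  fixes I J :: "'l::complex_lie_algebra uea set"
  assumes "left_ideal I" "left_ideal J"
  shows "left_ideal {a + b | a b. a \<in> I \<and> b \<in> J}"
proof (rule left_idealI)
  show "csubspace {a + b | a b. a \<in> I \<and> b \<in> J}"
    by (intro subspace_plus left_ideal_subspace assms)
  show "uea_embed x * u \<in> {a + b | a b. a \<in> I \<and> b \<in> J}" if "u \<in> {a + b | a b. a \<in> I \<and> b \<in> J}" for x u
    using that assms by (auto simp: distrib_left) (blast intro: left_ideal_mult)
qed

lemma left_ideal_bracket:
  assumes "left_ideal J" "uea_embed x * u \<in> J" "uea_embed y * u \<in> J"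
  shows "uea_embed (bracket x y) * u \<in> J"
proof -
  have "uea_embed x * (uea_embed y * u) - uea_embed y * (uea_embed x * u) \<in> J"
    by (intro subspace_diff left_ideal_subspace left_ideal_mult assms)
  then show ?thesis by (simp add: embed_bracket algebra_simps)
qed

text \<open>This holds because \<open>x\<^sup>m y\<close> is a combination of the products \<open>(ad x)\<^sup>j(y) x\<^sup>m\<^sup>-\<^sup>j\<close>, and for \<open>m = N + d\<close> one of the
  two factors vanishes in each of them.\<close>

lemma locally_nilpotent_step:
  assumes J: "left_ideal J" and "((bracket x) ^^ d) y = 0" and "uea_embed x ^ N * u \<in> J"
  shows "uea_embed x ^ (N + d) * (uea_embed y * u) \<in> J"
  using assms(2,3)
proof (induction "N + d" arbitrary: N d y u)
  case 0
  then show ?case using left_ideal_mult[OF J] by simp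
next
  case (Suc k)
  show ?case
  proof (cases "d = 0 \<or> N = 0")
    case True
    then show ?thesis
    proof
      assume "d = 0" then show ?thesis using Suc.prems(1) by (simp add: embed_zero subspace_zero left_ideal_subspace[OF J])
    next
      assume "N = 0" then show ?thesis using Suc.prems(2) by (auto intro!: left_ideal_mult[OF J])
    qed
  next
    case False
    then obtain d' N' where d: "d = Suc d'" "N = Suc N'" by (cases d; cases N) auto
    have 1: "uea_embed x ^ (N' + d) * (uea_embed y * (uea_embed x * u)) \<in> J"
      using Suc.hyps(1)[of N' d y "uea_embed x * u"] Suc.hyps(2) Suc.prems d
      by (simp add: mult.assoc power_commutes[symmetric])
    have 2: "uea_embed x ^ (N + d') * (uea_embed (bracket x y) * u) \<in> J"
      using Suc.hyps(1)[of N d' "bracket x y" u] Suc.hyps(2) Suc.prems d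
      by (simp add: funpow_Suc_right del: funpow.simps)
    have "N' + d = k" "N + d' = k" using d Suc.hyps(2) by auto
    with subspace_add[OF left_ideal_subspace[OF J] 1 2]
    have "uea_embed x ^ k * ((uea_embed y * uea_embed x + uea_embed (bracket x y)) * u) \<in> J"
      by (simp add: algebra_simps)
    then show ?thesis using Suc.hyps(2) unfolding embed_commute[of x y, symmetric]
      by (metis power_Suc2 mult.assoc)
  qed
qed

lemma locally_nilpotent:
  assumes J: "left_ideal J" and ad: "\<And>y. \<exists>d. ((bracket x) ^^ d) y = 0" and "uea_embed x ^ N \<in> J"
  shows "\<exists>N. uea_embed x ^ N * u \<in> J"
proof (induction u rule: uea_induct)
  case one
  then show ?case using assms(3) by (intro exI[of _ N]) simp
next
  case (mult y u)
  then show ?case using locally_nilpotent_step[OF J] ad by blast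
next
  case (add u v)
  then obtain M N where *: "uea_embed x ^ M * u \<in> J" "uea_embed x ^ N * v \<in> J" by blast
  have "uea_embed x ^ (N + M) * u \<in> J" "uea_embed x ^ (M + N) * v \<in> J"
    using left_ideal_mult[OF J *(1), of "uea_embed x ^ N"] left_ideal_mult[OF J *(2), of "uea_embed x ^ M"]
    by (simp_all add: power_add mult.assoc)
  then show ?case
    by (intro exI[of _ "M + N"]) (simp add: distrib_left add.commute subspace_add[OF left_ideal_subspace[OF J]])
next
  case (scale c u)
  then show ?case by (metis uea_scale_right subspace_scale[OF left_ideal_subspace[OF J]])
qed

lemma funpow_mult: "((\<lambda>v. a * v) ^^ k) v = a ^ k * v" for a v :: "'r::monoid_mult"
  by (induction k) (simp_all add: mult.assoc)

section \<open>The action of the enveloping algebra\<close>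

definition word_act :: "('l \<Rightarrow> 'p \<Rightarrow> 'p) \<Rightarrow> 'l word \<Rightarrow> 'p \<Rightarrow> 'p" where
  "word_act \<rho> w p = foldr \<rho> (letters w) p"

definition free_act :: "('l \<Rightarrow> 'p \<Rightarrow> 'p) \<Rightarrow> 'l free_algebra \<Rightarrow> 'p::complex_vector \<Rightarrow> 'p" where
  "free_act \<rho> q p = (\<Sum>w\<in>Poly_Mapping.keys q. Poly_Mapping.lookup q w *\<^sub>C word_act \<rho> w p)"

text \<open>The value depends on a chosen representative; it is well defined modulo \<open>B\<close> for a
  representation modulo \<open>B\<close> as in the following locale.\<close>

definition uea_act :: "('l::complex_lie_algebra \<Rightarrow> 'p \<Rightarrow> 'p) \<Rightarrow> 'l uea \<Rightarrow> 'p::complex_vector \<Rightarrow> 'p" where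
  "uea_act \<rho> u p = free_act \<rho> (rep_uea u) p"

text \<open>A representation on \<open>A / B\<close> is handled by operators on the ambient space, because the
  quotients that occur (tensor products, for instance) do not form types.\<close>

locale representation_mod =
  fixes \<rho> :: "'l::complex_lie_algebra \<Rightarrow> 'p::complex_vector \<Rightarrow> 'p" and A B :: "'p set"
  assumes lin: "\<And>x. clin (\<rho> x)" and A: "csubspace A" and B: "csubspace B" and BA: "B \<subseteq> A"
    and act_A: "\<And>x a. a \<in> A \<Longrightarrow> \<rho> x a \<in> A" and act_B: "\<And>x b. b \<in> B \<Longrightarrow> \<rho> x b \<in> B"
    and act_add: "\<And>x y a. a \<in> A \<Longrightarrow> \<rho> (x + y) a - \<rho> x a - \<rho> y a \<in> B"
    and act_scale: "\<And>c x a. a \<in> A \<Longrightarrow> \<rho> (c *\<^sub>C x) a - c *\<^sub>C \<rho> x a \<in> B"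
    and act_bracket: "\<And>x y a. a \<in> A \<Longrightarrow> \<rho> x (\<rho> y a) - \<rho> y (\<rho> x a) - \<rho> (bracket x y) a \<in> B"
begin

lemma clin_word: "clin (word_act \<rho> w)"
proof -
  have "clin (foldr \<rho> xs)" for xs
    by (induction xs) (simp_all add: clin_def lin[unfolded clin_def])
  then show ?thesis unfolding word_act_def[abs_def] .
qed

lemma word_A: "a \<in> A \<Longrightarrow> word_act \<rho> w a \<in> A" and word_B: "a \<in> B \<Longrightarrow> word_act \<rho> w a \<in> B"
proof -
  have "a \<in> A \<Longrightarrow> foldr \<rho> xs a \<in> A" "a \<in> B \<Longrightarrow> foldr \<rho> xs a \<in> B" for xs
    by (induction xs) (simp_all add: act_A act_B)
  then show "a \<in> A \<Longrightarrow> word_act \<rho> w a \<in> A" "a \<in> B \<Longrightarrow> word_act \<rho> w a \<in> B"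
    unfolding word_act_def by auto
qed

lemma word_plus: "word_act \<rho> (v + w) a = word_act \<rho> v (word_act \<rho> w a)"
  by (simp add: word_act_def plus_word_def)

lemma clin_free: "clin (free_act \<rho> q)"
  using clin_word by (intro clinI)
    (simp_all add: free_act_def clin_def scaleC_add_right sum.distrib complex_vector.scale_sum_right mult.commute)

lemma free_A: "a \<in> A \<Longrightarrow> free_act \<rho> q a \<in> A" and free_B: "a \<in> B \<Longrightarrow> free_act \<rho> q a \<in> B"
  unfolding free_act_def by (auto intro!: subspace_sum[OF A] subspace_sum[OF B] subspace_scale[OF A] subspace_scale[OF B] word_A word_B)

lemma free_act_superset:
  assumes "finite S" "Poly_Mapping.keys q \<subseteq> S"
  shows "free_act \<rho> q a = (\<Sum>w\<in>S. Poly_Mapping.lookup q w *\<^sub>C word_act \<rho> w a)"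
  unfolding free_act_def using assms by (intro sum.mono_neutral_left) (auto simp: in_keys_iff)

lemma free_add: "free_act \<rho> (p + q) a = free_act \<rho> p a + free_act \<rho> q a"
proof -
  let ?S = "Poly_Mapping.keys p \<union> Poly_Mapping.keys q"
  have "Poly_Mapping.keys (p + q) \<subseteq> ?S" by (rule Poly_Mapping.keys_add)
  then show ?thesis
    by (simp add: free_act_superset[of ?S] lookup_add scaleC_add_left sum.distrib)
qed

lemma free_single: "free_act \<rho> (Poly_Mapping.single w c) a = c *\<^sub>C word_act \<rho> w a"
  by (cases "c = 0") (simp_all add: free_act_def)

lemma free_mult: "free_act \<rho> (p * q) a = free_act \<rho> p (free_act \<rho> q a)"
proof (induction p rule: poly_mapping_induct)
  fix v c
  show "free_act \<rho> (Poly_Mapping.single v c * q) a = free_act \<rho> (Poly_Mapping.single v c) (free_act \<rho> q a)"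
  proof (induction q rule: poly_mapping_induct)
    fix w d
    show "free_act \<rho> (Poly_Mapping.single v c * Poly_Mapping.single w d) a
      = free_act \<rho> (Poly_Mapping.single v c) (free_act \<rho> (Poly_Mapping.single w d) a)"
      by (simp add: mult_single free_single word_plus clin_scale[OF clin_word] mult.commute)
  next
    fix p q
    assume "free_act \<rho> (Poly_Mapping.single v c * p) a = free_act \<rho> (Poly_Mapping.single v c) (free_act \<rho> p a)"
      "free_act \<rho> (Poly_Mapping.single v c * q) a = free_act \<rho> (Poly_Mapping.single v c) (free_act \<rho> q a)"
    then show "free_act \<rho> (Poly_Mapping.single v c * (p + q)) a = free_act \<rho> (Poly_Mapping.single v c) (free_act \<rho> (p + q) a)"
      by (simp add: distrib_left free_add clin_add[OF clin_free])
  qed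
qed (simp add: distrib_right free_add)

lemma free_minus: "free_act \<rho> (- p) a = - free_act \<rho> p a"
  using free_add[of p "- p" a] by (simp add: eq_neg_iff_add_eq_0 add.commute free_act_def)

lemma free_diff: "free_act \<rho> (p - q) a = free_act \<rho> p a - free_act \<rho> q a"
  using free_add[of p "- q" a] free_minus[of q a] by simp

lemma free_scale: "free_act \<rho> (c *\<^sub>C p) a = c *\<^sub>C free_act \<rho> p a"
  by (simp add: scaleC_free_algebra free_mult free_single word_act_def zero_word_def)

lemma free_letter: "free_act \<rho> (letter x) a = \<rho> x a"
  by (simp add: letter_def free_single word_act_def)

lemma free_one: "free_act \<rho> 1 a = a"
proof -
  have "word_act \<rho> 0 a = a" by (simp add: word_act_def zero_word_def)
  then show ?thesis using free_single[of 0 1 a] by simp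
qed

lemma free_ideal: "p \<in> uea_ideal \<Longrightarrow> a \<in> A \<Longrightarrow> free_act \<rho> p a \<in> B"
proof (induction arbitrary: a rule: uea_ideal.induct)
  case zero
  then show ?case by (simp add: free_act_def subspace_zero[OF B])
next
  case (add p q)
  then show ?case by (simp add: free_add subspace_add[OF B])
next
  case (mult p b c)
  then show ?case by (simp add: free_mult free_A free_B)
next
  case (letter_add x y)
  then show ?case using act_add by (simp add: free_diff free_letter)
next
  case (letter_scaleC c x)
  then show ?case using act_scale by (simp add: free_diff free_scale free_letter)
next
  case (letter_bracket x y)
  then show ?case using act_bracket by (simp add: free_diff free_mult free_letter)
qed

lemma rep_abs: "rep_uea (abs_uea q) - q \<in> uea_ideal"
  by (rule Quotient3_rep_abs[OF Quotient3_uea]) (simp add: uea_ideal.zero)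

lemma act_abs: "a \<in> A \<Longrightarrow> uea_act \<rho> (abs_uea q) a - free_act \<rho> q a \<in> B"
  unfolding uea_act_def free_diff[symmetric] by (rule free_ideal[OF rep_abs])

lemma abs_rep: "abs_uea (rep_uea u) = u"
  by (rule Quotient3_abs_rep[OF Quotient3_uea])

lemma uea_A: "a \<in> A \<Longrightarrow> uea_act \<rho> u a \<in> A" and uea_B: "a \<in> B \<Longrightarrow> uea_act \<rho> u a \<in> B"
  unfolding uea_act_def by (simp_all add: free_A free_B)

lemma uea_plus: "a \<in> A \<Longrightarrow> uea_act \<rho> (u + v) a - (uea_act \<rho> u a + uea_act \<rho> v a) \<in> B"
  using act_abs[of a "rep_uea u + rep_uea v"]
  by (simp add: plus_uea.abs_eq[symmetric] abs_rep free_add uea_act_def)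

lemma uea_times: "a \<in> A \<Longrightarrow> uea_act \<rho> (u * v) a - uea_act \<rho> u (uea_act \<rho> v a) \<in> B"
  using act_abs[of a "rep_uea u * rep_uea v"]
  by (simp add: times_uea.abs_eq[symmetric] abs_rep free_mult uea_act_def)

lemma uea_scale: "a \<in> A \<Longrightarrow> uea_act \<rho> (c *\<^sub>C u) a - c *\<^sub>C uea_act \<rho> u a \<in> B"
  using act_abs[of a "c *\<^sub>C rep_uea u"]
  by (simp add: scaleC_uea.abs_eq[symmetric] abs_rep free_scale uea_act_def)

lemma uea_letter: "a \<in> A \<Longrightarrow> uea_act \<rho> (uea_embed x) a - \<rho> x a \<in> B"
  using act_abs[of a "letter x"] by (simp add: uea_embed.abs_eq free_letter)

lemma uea_one: "a \<in> A \<Longrightarrow> uea_act \<rho> 1 a - a \<in> B"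
  using act_abs[of a 1] by (simp add: one_uea.abs_eq[symmetric] free_one)

lemma uea_minus: "a \<in> A \<Longrightarrow> uea_act \<rho> (u - v) a - (uea_act \<rho> u a - uea_act \<rho> v a) \<in> B"
  using act_abs[of a "rep_uea u - rep_uea v"]
  by (simp add: minus_uea.abs_eq[symmetric] abs_rep free_diff uea_act_def)

definition annihilator :: "'p \<Rightarrow> 'l uea set" where
  "annihilator v = {u. uea_act \<rho> u v \<in> B}"

lemma letter_mem: "a \<in> A \<Longrightarrow> uea_act \<rho> (uea_embed x * u) a \<in> B \<longleftrightarrow> \<rho> x (uea_act \<rho> u a) \<in> B"
proof -
  assume a: "a \<in> A"
  have "uea_act \<rho> (uea_embed x * u) a - \<rho> x (uea_act \<rho> u a)
     = (uea_act \<rho> (uea_embed x * u) a - uea_act \<rho> (uea_embed x) (uea_act \<rho> u a))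
       + (uea_act \<rho> (uea_embed x) (uea_act \<rho> u a) - \<rho> x (uea_act \<rho> u a))" by simp
  also have "\<dots> \<in> B" by (intro subspace_add[OF B] uea_times uea_letter uea_A a)
  finally show ?thesis by (rule subspace_diff_cancel[OF B])
qed

lemma annihilator_left_ideal: "a \<in> A \<Longrightarrow> left_ideal (annihilator a)"
proof (rule left_idealI)
  assume a: "a \<in> A"
  have "u + v \<in> annihilator a" if "u \<in> annihilator a" "v \<in> annihilator a" for u v
    using subspace_diff_cancel[OF B uea_plus[OF a, of u v]] that
    by (simp add: annihilator_def subspace_add[OF B])
  moreover have "c *\<^sub>C u \<in> annihilator a" if "u \<in> annihilator a" for c u
    using subspace_diff_cancel[OF B uea_scale[OF a, of c u]] that
    by (simp add: annihilator_def subspace_scale[OF B])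
  moreover have "0 \<in> annihilator a"
    using subspace_diff_cancel[OF B uea_scale[OF a, of 0 0]] by (simp add: annihilator_def subspace_zero[OF B])
  ultimately show "csubspace (annihilator a)" by (intro subspaceI) auto
  show "uea_embed x * u \<in> annihilator a" if "u \<in> annihilator a" for x u
    using that letter_mem[OF a] by (simp add: annihilator_def act_B)
qed

lemma annihilator_letter: "a \<in> A \<Longrightarrow> uea_embed x \<in> annihilator a \<longleftrightarrow> \<rho> x a \<in> B"
  using subspace_diff_cancel[OF B uea_letter] by (simp add: annihilator_def)

lemma annihilator_one: "a \<in> A \<Longrightarrow> 1 \<in> annihilator a \<longleftrightarrow> a \<in> B"
  using subspace_diff_cancel[OF B uea_one] by (simp add: annihilator_def)

lemma annihilator_letter_minus:
  assumes a: "a \<in> A"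
  shows "uea_embed x - c *\<^sub>C 1 \<in> annihilator a \<longleftrightarrow> \<rho> x a - c *\<^sub>C a \<in> B"
proof -
  have "uea_act \<rho> (uea_embed x - c *\<^sub>C 1) a - (\<rho> x a - c *\<^sub>C a)
     = (uea_act \<rho> (uea_embed x - c *\<^sub>C 1) a - (uea_act \<rho> (uea_embed x) a - uea_act \<rho> (c *\<^sub>C 1) a))
       + (uea_act \<rho> (uea_embed x) a - \<rho> x a) - (uea_act \<rho> (c *\<^sub>C 1) a - c *\<^sub>C uea_act \<rho> 1 a)
       - c *\<^sub>C (uea_act \<rho> 1 a - a)"
    by (simp add: complex_vector.scale_right_diff_distrib)
  also have "\<dots> \<in> B"
    by (intro subspace_add[OF B] subspace_diff[OF B] subspace_scale[OF B] uea_minus uea_letter uea_scale uea_one a)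
  finally show ?thesis using subspace_diff_cancel[OF B] by (simp add: annihilator_def)
qed

lemma annihilator_power:
  assumes a: "a \<in> A"
  shows "uea_embed x ^ N \<in> annihilator a \<longleftrightarrow> ((\<rho> x) ^^ N) a \<in> B"
proof -
  have "uea_act \<rho> (uea_embed x ^ N) a - ((\<rho> x) ^^ N) a \<in> B"
  proof (induction N)
    case 0
    then show ?case using uea_one[OF a] by simp
  next
    case (Suc N)
    have "uea_act \<rho> (uea_embed x ^ Suc N) a - ((\<rho> x) ^^ Suc N) a
      = (uea_act \<rho> (uea_embed x * uea_embed x ^ N) a - uea_act \<rho> (uea_embed x) (uea_act \<rho> (uea_embed x ^ N) a))
        + (uea_act \<rho> (uea_embed x) (uea_act \<rho> (uea_embed x ^ N) a) - \<rho> x (uea_act \<rho> (uea_embed x ^ N) a))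
        + \<rho> x (uea_act \<rho> (uea_embed x ^ N) a - ((\<rho> x) ^^ N) a)"
      by (simp add: clin_diff[OF lin])
    also have "\<dots> \<in> B"
      by (intro subspace_add[OF B] uea_times uea_letter uea_A a act_B Suc)
    finally show ?case .
  qed
  then show ?thesis using subspace_diff_cancel[OF B] by (simp add: annihilator_def)
qed

end

section \<open>Root spaces and the Killing form\<close>

lemma subspace_image: "clin f \<Longrightarrow> csubspace S \<Longrightarrow> csubspace (f ` S)"
proof (rule subspaceI)
  assume f: "clin f" and S: "csubspace S"
  show "0 \<in> f ` S" using clin_zero[OF f] subspace_zero[OF S] by (auto intro: rev_image_eqI)
  show "x + y \<in> f ` S" if "x \<in> f ` S" "y \<in> f ` S" for x y
    using that clin_add[OF f, symmetric] subspace_add[OF S] by auto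
  show "c *\<^sub>C x \<in> f ` S" if "x \<in> f ` S" for c x
    using that clin_scale[OF f, symmetric] subspace_scale[OF S] by auto
qed

lemma clin_ad: "clin (bracket x)" and clin_ad_left: "clin (\<lambda>x. bracket x y)"
  by (intro clinI bracket_add_right bracket_scaleC_right, intro clinI bracket_add_left bracket_scaleC_left)

lemmas bracket_diff_right = clin_diff[OF clin_ad]
  and bracket_sum_right = clin_sum[OF clin_ad]
  and bracket_minus_right = clin_minus[OF clin_ad]
  and bracket_minus_left = clin_minus[OF clin_ad_left]

lemma ad_bracket: "bracket x (bracket y z) = bracket (bracket x y) z + bracket y (bracket x z)"
proof -
  have "bracket y (bracket z x) = - bracket y (bracket x z)"
    using bracket_antisym[of z x] by (simp add: bracket_minus_right)
  moreover have "bracket z (bracket x y) = - bracket (bracket x y) z" by (rule bracket_antisym)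
  ultimately show ?thesis using jacobi[of x y z] by (simp add: algebra_simps)
qed

lemma ad_bracket_operator: "bracket (bracket x y) z = bracket x (bracket y z) - bracket y (bracket x z)"
  by (simp add: ad_bracket[of x y z])

lemma sl2_left_mult:
  fixes J :: "'l::complex_lie_algebra uea set"
  assumes J: "left_ideal J" and "bracket e f = k" "bracket k e = 2 *\<^sub>C e" "bracket k f = (- 2) *\<^sub>C f"
  shows "sl2_operators (\<lambda>u. uea_embed e * u) (\<lambda>u. uea_embed f * u) (\<lambda>u. uea_embed k * u) J"
proof unfold_locales
  show "csubspace J" by (rule left_ideal_subspace[OF J])
  have A: "uea_embed e * (uea_embed f * u) - uea_embed f * (uea_embed e * u) = uea_embed (bracket e f) * u" for u
    unfolding  embed_bracket by (simp add: left_diff_distrib mult.assoc)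
  show  "uea_embed e * (uea_embed f * u) - uea_embed f * (uea_embed e * u) = uea_embed k * u" for u
    unfolding A assms(2) ..
  have "uea_embed k * (uea_embed e * u) - uea_embed e * (uea_embed k * u) = uea_embed (bracket k e) * u" for u
    unfolding embed_bracket by (simp add: left_diff_distrib mult.assoc)
  then show "uea_embed k * (uea_embed e * u) - uea_embed e * (uea_embed k * u) = 2 *\<^sub>C (uea_embed e * u)" for u
    unfolding assms(3) embed_scaleC uea_scale_left .
  have "uea_embed k * (uea_embed f * u) - uea_embed f * (uea_embed k * u) = uea_embed (bracket k f) * u" for u
    unfolding embed_bracket by (simp add: left_diff_distrib mult.assoc)
  then show "uea_embed k * (uea_embed f * u) - uea_embed f * (uea_embed k * u) = (- 2) *\<^sub>C (uea_embed f * u)" for u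
    unfolding assms(4) embed_scaleC uea_scale_left .
  show "clin (\<lambda>u. uea_embed e * u)" "clin (\<lambda>u. uea_embed f * u)" "clin (\<lambda>u. uea_embed k * u)"
    by (rule clin_mult_left)+
qed (rule left_ideal_mult[OF J], assumption)+

lemma dual_add: "\<beta> \<in> dual H \<Longrightarrow> \<gamma> \<in> dual H \<Longrightarrow> (\<lambda>x. \<beta> x + \<gamma> x) \<in> dual H"
  by (simp add: dual_def algebra_simps)

lemma dual_scale: "\<beta> \<in> dual H \<Longrightarrow> (\<lambda>x. c * \<beta> x) \<in> dual H"
  by (simp add: dual_def algebra_simps)

lemma dual_minus: "\<beta> \<in> dual H \<Longrightarrow> (\<lambda>x. - \<beta> x) \<in> dual H"
  by (simp add: dual_def)

lemma dual_diff: "\<beta> \<in> dual H \<Longrightarrow> \<gamma> \<in> dual H \<Longrightarrow> (\<lambda>x. \<beta> x - \<gamma> x) \<in> dual H"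
  by (simp add: dual_def algebra_simps)

lemma dual_zero: "(\<lambda>_. 0) \<in> dual H"
  by (simp add: dual_def)

lemma dual_sum: "(\<And>i. i \<in> A \<Longrightarrow> g i \<in> dual H) \<Longrightarrow> (\<lambda>x. \<Sum>i\<in>A. c i * g i x) \<in> dual H"
proof (induction A rule: infinite_finite_induct)
  case (insert a A)
  then have "(\<lambda>x. c a * g a x + (\<Sum>i\<in>A. c i * g i x)) \<in> dual H"
    by (intro dual_add dual_scale) auto
  with insert show ?case by simp
qed (simp_all add: dual_zero)

lemma dual_ext: "\<beta> \<in> dual H \<Longrightarrow> \<gamma> \<in> dual H \<Longrightarrow> (\<And>y. y \<in> H \<Longrightarrow> \<beta> y = \<gamma> y) \<Longrightarrow> \<beta> = \<gamma>"
proof (rule ext)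
  fix y assume "\<beta> \<in> dual H" "\<gamma> \<in> dual H" "\<And>y. y \<in> H \<Longrightarrow> \<beta> y = \<gamma> y"
  then show "\<beta> y = \<gamma> y" by (cases "y \<in> H") (simp_all add: dual_def)
qed

lemma dual_distinct: "\<beta> \<in> dual H \<Longrightarrow> \<gamma> \<in> dual H \<Longrightarrow> \<beta> \<noteq> \<gamma> \<Longrightarrow> \<exists>y\<in>H. \<beta> y \<noteq> \<gamma> y"
  using dual_ext by blast

lemma dual_lin:
  assumes "\<beta> \<in> dual H" "csubspace H" "x \<in> H" "y \<in> H"
  shows "\<beta> (x + y) = \<beta> x + \<beta> y" "\<beta> (c *\<^sub>C x) = c * \<beta> x" "\<beta> 0 = 0"
proof -
  show "\<beta> (x + y) = \<beta> x + \<beta> y" "\<beta> (c *\<^sub>C x) = c * \<beta> x" using assms by (auto simp: dual_def)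
  have "\<beta> (0 *\<^sub>C x) = 0 * \<beta> x" using assms by (auto simp: dual_def simp del: complex_vector.scale_zero_left)
  then show "\<beta> 0 = 0" by simp
qed

lemma dual_sum_arg:
  assumes "\<beta> \<in> dual H" "csubspace H" "\<And>i. i \<in> A \<Longrightarrow> y i \<in> H"
  shows "\<beta> (\<Sum>i\<in>A. c i *\<^sub>C y i) = (\<Sum>i\<in>A. c i * \<beta> (y i))"
  using assms(3)
proof (induction A rule: infinite_finite_induct)
  case (insert a A)
  have "\<beta> (c a *\<^sub>C y a + (\<Sum>i\<in>A. c i *\<^sub>C y i)) = \<beta> (c a *\<^sub>C y a) + \<beta> (\<Sum>i\<in>A. c i *\<^sub>C y i)"
    using insert by (intro dual_lin(1)[OF assms(1,2)] subspace_scale subspace_sum assms(2)) auto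
  then show ?case using insert dual_lin(2)[OF assms(1,2), of "y a" "y a"] by simp
qed (simp_all add: dual_lin(3)[OF assms(1,2) subspace_zero subspace_zero] assms(2))

context simple_lie
begin

lemma H_subspace: "csubspace H"
  and H_abelian: "\<And>x y. x \<in> H \<Longrightarrow> y \<in> H \<Longrightarrow> bracket x y = 0"
  and H_centralizer: "\<And>x. (\<And>y. y \<in> H \<Longrightarrow> bracket y x = 0) \<Longrightarrow> x \<in> H"
  and H_diagonalizable: "\<And>y. y \<in> H \<Longrightarrow> cspan {x. \<exists>c. bracket y x = c *\<^sub>C x} = UNIV"
  using cartan unfolding cartan_subalgebra_def by auto

lemma root_space_subspace: "csubspace (root_space H \<beta>)"
  by (intro subspaceI) (auto simp: root_space_def bracket_add_right bracket_scaleC_right scaleC_add_right mult.commute)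

lemma root_spaceD: "x \<in> root_space H \<beta> \<Longrightarrow> y \<in> H \<Longrightarrow> bracket y x = \<beta> y *\<^sub>C x"
  by (simp add: root_space_def)

lemma root_space_zero: "root_space H (\<lambda>_. 0) = H"
  using H_abelian H_centralizer by (auto simp: root_space_def)

lemma bracket_root_space:
  assumes "x \<in> root_space H \<beta>" "z \<in> root_space H \<gamma>"
  shows "bracket x z \<in> root_space H (\<lambda>y. \<beta> y + \<gamma> y)"
  using assms
  by (auto simp: root_space_def ad_bracket[of _ x z] bracket_scaleC_left bracket_scaleC_right scaleC_add_left)

lemma bracket_pow_root_space:
  assumes "x \<in> root_space H \<gamma>" "z \<in> root_space H \<beta>"
  shows "((bracket x) ^^ k) z \<in> root_space H (\<lambda>y. \<beta> y + of_nat k * \<gamma> y)"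
proof (induction k)
  case (Suc k)
  have "(\<lambda>y. \<gamma> y + (\<beta> y + of_nat k * \<gamma> y)) = (\<lambda>y. \<beta> y + of_nat (Suc k) * \<gamma> y)"
    by (simp add: algebra_simps fun_eq_iff)
  with bracket_root_space[OF assms(1) Suc] show ?case by simp
qed (use assms in simp)

text \<open>One element of \<open>H\<close> after the other: the components of a joint eigenvector of \<open>Y\<close> with respect to a
  further element that commutes with \<open>Y\<close> are joint eigenvectors again.\<close>

lemma joint_eigenvectors_span:
  assumes "finite Y" "Y \<subseteq> H"
  shows "cspan {x. \<forall>y\<in>Y. \<exists>c. bracket y x = c *\<^sub>C x} = UNIV"
  using assms
proof (induction Y)
  case empty
  then show ?case by simp
next
  case (insert y Y)
  let ?S = "{x. \<forall>y\<in>insert y Y. \<exists>c. bracket y x = c *\<^sub>C x}"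
  define E where "E c = {x. bracket y x = c *\<^sub>C x}" for c
  have E: "csubspace (E c)" for c
    unfolding E_def by (intro subspaceI) (auto simp: bracket_add_right bracket_scaleC_right scaleC_add_right mult.commute)
  have "{x. \<forall>y\<in>Y. \<exists>c. bracket y x = c *\<^sub>C x} \<subseteq> cspan ?S"
  proof
    fix x assume "x \<in> {x. \<forall>y\<in>Y. \<exists>c. bracket y x = c *\<^sub>C x}"
    then have x: "\<And>y'. y' \<in> Y \<Longrightarrow> \<exists>c. bracket y' x = c *\<^sub>C x" by blast
    have "(\<Union>c\<in>UNIV. E c) = {x. \<exists>c. bracket y x = c *\<^sub>C x}" by (auto simp: E_def)
    then have "x \<in> cspan (\<Union>c\<in>UNIV. E c)" using H_diagonalizable[of y] insert.prems by auto
    then obtain D g where D: "finite D" "\<And>d. d \<in> D \<Longrightarrow> g d \<in> E d" "x = (\<Sum>d\<in>D. g d)"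
      by (rule span_Union_subspaces) (use E in auto)
    have "g d \<in> ?S" if d: "d \<in> D" for d
    proof -
      have "\<exists>c. bracket y' (g d) = c *\<^sub>C g d" if y': "y' \<in> Y" for y'
      proof -
        obtain a where a: "bracket y' x = a *\<^sub>C x" using x y' by blast
        have "bracket y' (g d) - a *\<^sub>C g d \<in> {0}"
        proof (rule eigen_separation[where D = D and I = "{()}" and Y = "\<lambda>_. bracket y" and \<chi> = "\<lambda>c _. c"
              and x = "\<lambda>d. bracket y' (g d) - a *\<^sub>C g d"])
          fix c i assume c: "c \<in> D"
          have "bracket y y' = 0" using H_abelian insert.prems y' by blast
          moreover have "bracket y (g c) = c *\<^sub>C g c" using D(2)[OF c] by (simp add: E_def)
          ultimately show "bracket y (bracket y' (g c) - a *\<^sub>C g c) - c *\<^sub>C (bracket y' (g c) - a *\<^sub>C g c) \<in> {0}"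
            by (simp add: bracket_diff_right ad_bracket[of y y'] bracket_scaleC_right
                complex_vector.scale_right_diff_distrib mult.commute)
        next
          have "(\<Sum>d\<in>D. bracket y' (g d) - a *\<^sub>C g d) = bracket y' x - a *\<^sub>C x"
            by (simp add: D(3) sum_subtractf bracket_sum_right complex_vector.scale_sum_right)
          then show "(\<Sum>d\<in>D. bracket y' (g d) - a *\<^sub>C g d) \<in> {0}" using a by simp
        qed (use D d in \<open>auto intro: clin_ad subspace_zero_set\<close>)
        then show ?thesis by auto
      qed
      then show ?thesis using D(2)[OF d] by (auto simp: E_def)
    qed
    then have "g d \<in> cspan ?S" if "d \<in> D" for d using that complex_vector.span_base by blast
    then show "x \<in> cspan ?S" unfolding D(3) by (rule complex_vector.span_sum)
  qed
  then have "cspan {x. \<forall>y\<in>Y. \<exists>c. bracket y x = c *\<^sub>C x} \<subseteq> cspan ?S"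
    by (rule complex_vector.span_minimal) (rule complex_vector.subspace_span)
  moreover have "cspan {x. \<forall>y\<in>Y. \<exists>c. bracket y x = c *\<^sub>C x} = UNIV"
    using insert by blast
  ultimately show ?case by blast
qed

lemma finite_of_independent: "complex_vector.independent (B :: 'g set) \<Longrightarrow> finite B"
proof -
  assume B: "complex_vector.independent B"
  obtain G :: "'g set" where G: "finite G" "cspan G = UNIV"
    using finite_dimensional unfolding finite_dimensional_def by blast
  from complex_vector.independent_span_bound[OF G(1) B] G(2) show ?thesis by simp
qed

text \<open>Joint eigenvectors for a basis of \<open>H\<close> are weight vectors, because the eigenvalue depends linearly
  on the element of \<open>H\<close>.\<close>

lemma weight_spaces_span: "cspan (\<Union>\<beta>\<in>dual H. root_space H \<beta>) = (UNIV :: 'g set)"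
proof -
  obtain Y where Y: "Y \<subseteq> H" "complex_vector.independent Y" "H \<subseteq> cspan Y"
    by (rule complex_vector.basis_exists[of H])
  have "{x. \<forall>y\<in>Y. \<exists>c. bracket y x = c *\<^sub>C x} \<subseteq> cspan (\<Union>\<beta>\<in>dual H. root_space H \<beta>)"
  proof
    fix x assume x: "x \<in> {x. \<forall>y\<in>Y. \<exists>c. bracket y x = c *\<^sub>C x}"
    show "x \<in> cspan (\<Union>\<beta>\<in>dual H. root_space H \<beta>)"
    proof (cases "x = 0")
      case False
      have "csubspace {y. \<exists>c. bracket y x = c *\<^sub>C x}"
      proof (rule subspaceI)
        show "0 \<in> {y. \<exists>c. bracket y x = c *\<^sub>C x}" by (auto intro!: exI[of _ 0])
        show "y + z \<in> {y. \<exists>c. bracket y x = c *\<^sub>C x}"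
          if "y \<in> {y. \<exists>c. bracket y x = c *\<^sub>C x}" "z \<in> {y. \<exists>c. bracket y x = c *\<^sub>C x}" for y z
        proof -
          from that obtain c d where "bracket y x = c *\<^sub>C x" "bracket z x = d *\<^sub>C x" by blast
          then have "bracket (y + z) x = (c + d) *\<^sub>C x" by (simp add: bracket_add_left scaleC_add_left)
          then show ?thesis by blast
        qed
      qed (auto simp: bracket_scaleC_left)
      then have "cspan Y \<subseteq> {y. \<exists>c. bracket y x = c *\<^sub>C x}"
        using x by (intro complex_vector.span_minimal) auto
      then have ex: "\<exists>c. bracket y x = c *\<^sub>C x" if "y \<in> H" for y using Y(3) that by blast
      define \<beta> where "\<beta> y = (if y \<in> H then (THE c. bracket y x = c *\<^sub>C x) else 0)" for y
      have \<beta>: "bracket y x = \<beta> y *\<^sub>C x" if "y \<in> H" for y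
      proof -
        have "\<exists>!c. bracket y x = c *\<^sub>C x" using ex[OF that] False by auto
        from theI'[OF this] that show ?thesis by (simp add: \<beta>_def)
      qed
      have "\<beta> (y + z) *\<^sub>C x = (\<beta> y + \<beta> z) *\<^sub>C x" if "y \<in> H" "z \<in> H" for y z
        using that \<beta>[of y] \<beta>[of z] \<beta>[of "y + z"] subspace_add[OF H_subspace]
        by (simp add: bracket_add_left scaleC_add_left)
      moreover have "\<beta> (c *\<^sub>C y) *\<^sub>C x = (c * \<beta> y) *\<^sub>C x" if "y \<in> H" for y c
        using that \<beta>[of y] \<beta>[of "c *\<^sub>C y"] subspace_scale[OF H_subspace]
        by (auto simp: bracket_scaleC_left)
      ultimately have "\<beta> \<in> dual H" using False by (auto simp: dual_def \<beta>_def)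
      moreover have "x \<in> root_space H \<beta>" using \<beta> by (simp add: root_space_def)
      ultimately show ?thesis by (intro complex_vector.span_base) blast
    qed (simp add: complex_vector.span_zero)
  qed
  then have "cspan {x. \<forall>y\<in>Y. \<exists>c. bracket y x = c *\<^sub>C x} \<subseteq> cspan (\<Union>\<beta>\<in>dual H. root_space H \<beta>)"
    by (rule complex_vector.span_minimal) (rule complex_vector.subspace_span)
  then show ?thesis using joint_eigenvectors_span[OF finite_of_independent[OF Y(2)] Y(1)] by auto
qed

lemma weight_induct:
  assumes "csubspace S" "\<And>\<beta> x. \<beta> \<in> dual H \<Longrightarrow> x \<in> root_space H \<beta> \<Longrightarrow> x \<in> S"
  shows "(x::'g) \<in> S"
  using complex_vector.span_minimal[OF _ assms(1), of "\<Union>\<beta>\<in>dual H. root_space H \<beta>"] weight_spaces_span assms(2)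
  by blast

definition basis :: "'g set" where
  "basis = (SOME B. complex_vector.independent B \<and> cspan B = UNIV \<and> B \<subseteq> (\<Union>\<beta>\<in>dual H. root_space H \<beta>))"

lemma basis: "complex_vector.independent basis" "cspan basis = UNIV" "finite basis"
  and basis_weight: "basis \<subseteq> (\<Union>\<beta>\<in>dual H. root_space H \<beta>)"
proof -
  obtain B where B: "B \<subseteq> (\<Union>\<beta>\<in>dual H. root_space H \<beta>)" "complex_vector.independent B"
    "(\<Union>\<beta>\<in>dual H. root_space H \<beta>) \<subseteq> cspan B"
    by (rule complex_vector.maximal_independent_subset)
  have "cspan (\<Union>\<beta>\<in>dual H. root_space H \<beta>) \<subseteq> cspan B"
    by (rule complex_vector.span_minimal[OF B(3) complex_vector.subspace_span])
  then have "\<exists>B. complex_vector.independent B \<and> cspan B = UNIV \<and> B \<subseteq> (\<Union>\<beta>\<in>dual H. root_space H \<beta>)"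
    using B weight_spaces_span by blast
  from someI_ex[OF this] show "complex_vector.independent basis" "cspan basis = UNIV"
    "basis \<subseteq> (\<Union>\<beta>\<in>dual H. root_space H \<beta>)" unfolding basis_def by blast+
  then show "finite basis" using finite_of_independent by blast
qed

lemma in_span_basis: "(x::'g) \<in> cspan basis"
  by (simp add: basis)

definition wt :: "'g \<Rightarrow> 'g \<Rightarrow> complex" where
  "wt b = (SOME \<beta>. \<beta> \<in> dual H \<and> b \<in> root_space H \<beta>)"

lemma wt: "b \<in> basis \<Longrightarrow> wt b \<in> dual H" "b \<in> basis \<Longrightarrow> b \<in> root_space H (wt b)"
proof -
  have "wt b \<in> dual H \<and> b \<in> root_space H (wt b)" if "b \<in> basis"
  proof -
    have "\<exists>\<beta>. \<beta> \<in> dual H \<and> b \<in> root_space H \<beta>" using basis_weight that by blast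
    from someI_ex[OF this] show ?thesis unfolding wt_def .
  qed
  then show "b \<in> basis \<Longrightarrow> wt b \<in> dual H" "b \<in> basis \<Longrightarrow> b \<in> root_space H (wt b)" by auto
qed

lemma basis_nonzero: "b \<in> basis \<Longrightarrow> b \<noteq> 0"
  using basis(1) complex_vector.dependent_zero by blast

lemma weight_in_basis:
  assumes "\<beta> \<in> dual H" "x \<in> root_space H \<beta>" "x \<noteq> 0"
  shows "\<beta> \<in> wt ` basis"
proof (rule ccontr)
  assume not: "\<beta> \<notin> wt ` basis"
  have "basis \<subseteq> (\<Union>\<gamma>\<in>wt ` basis. root_space H \<gamma>)" using wt by auto
  then have "x \<in> cspan (\<Union>\<gamma>\<in>wt ` basis. root_space H \<gamma>)"
    using complex_vector.span_mono in_span_basis by blast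
  then obtain D g where D: "finite D" "D \<subseteq> wt ` basis" "\<And>d. d \<in> D \<Longrightarrow> g d \<in> root_space H d" "x = (\<Sum>d\<in>D. g d)"
    by (rule span_Union_subspaces[OF _ root_space_subspace]) blast
  define x' where "x' d = (if d = \<beta> then - x else g d)" for d
  have \<beta>D: "\<beta> \<notin> D" using D(2) not by blast
  have dual: "d \<in> dual H" if "d \<in> insert \<beta> D" for d using that D(2) wt(1) assms(1) by auto
  have x': "x' d \<in> root_space H d" if "d \<in> insert \<beta> D" for d
    using that D(3) assms(2) subspace_minus[OF root_space_subspace] by (auto simp: x'_def)
  have "x' \<beta> \<in> {0}"
  proof (rule eigen_separation[where D = "insert \<beta> D" and I = H and Y = bracket and \<chi> = "\<lambda>d y. d y"])
    have "(\<Sum>d\<in>insert \<beta> D. x' d) = x' \<beta> + (\<Sum>d\<in>D. x' d)" using D(1) \<beta>D by simp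
    also have "(\<Sum>d\<in>D. x' d) = x" unfolding D(4) using \<beta>D by (intro sum.cong) (auto simp: x'_def)
    finally show "(\<Sum>d\<in>insert \<beta> D. x' d) \<in> {0}" by (simp add: x'_def)
    show "\<exists>y\<in>H. d y \<noteq> d' y" if "d \<in> insert \<beta> D" "d' \<in> insert \<beta> D" "d \<noteq> d'" for d d'
      using that dual_distinct dual by blast
    show "bracket y (x' d) - d y *\<^sub>C x' d \<in> {0}" if "d \<in> insert \<beta> D" "y \<in> H" for d y
      using root_spaceD[OF x'[OF that(1)] that(2)] by simp
  qed (use D in \<open>auto intro: clin_ad subspace_zero_set\<close>)
  then show False using assms(3) by (simp add: x'_def)
qed

lemma finite_weights: "finite {\<beta> \<in> dual H. root_space H \<beta> \<noteq> {0}}"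
proof (rule finite_subset)
  show "{\<beta> \<in> dual H. root_space H \<beta> \<noteq> {0}} \<subseteq> wt ` basis"
    using weight_in_basis subspace_zero[OF root_space_subspace] by blast
qed (simp add: basis)

lemma ad_nilpotent:
  assumes "\<gamma> \<in> dual H" "\<gamma> \<noteq> (\<lambda>_. 0)" "x \<in> root_space H \<gamma>"
  shows "\<exists>d. ((bracket x) ^^ d) z = 0"
proof -
  obtain y where y: "y \<in> H" "\<gamma> y \<noteq> 0" using dual_distinct[OF assms(1) dual_zero assms(2)] by auto
  have "z \<in> {z. \<exists>d. ((bracket x) ^^ d) z = 0}"
  proof (rule weight_induct)
    have mono: "((bracket x) ^^ (d + k)) z = 0" if "((bracket x) ^^ d) z = 0" for d k z
      using that by (subst add.commute) (simp add: funpow_add clin_zero[OF clin_funpow[OF clin_ad]])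
    show "csubspace {z. \<exists>d. ((bracket x) ^^ d) z = 0}"
    proof (rule subspaceI)
      show "0 \<in> {z. \<exists>d. ((bracket x) ^^ d) z = 0}" by (auto intro!: exI[of _ 0])
    next
      fix z z' assume "z \<in> {z. \<exists>d. ((bracket x) ^^ d) z = 0}" "z' \<in> {z. \<exists>d. ((bracket x) ^^ d) z = 0}"
      then obtain d d' where "((bracket x) ^^ d) z = 0" "((bracket x) ^^ d') z' = 0" by blast
      then have "((bracket x) ^^ (d + d')) (z + z') = 0"
        using mono[of d z d'] mono[of d' z' d] by (simp add: clin_add[OF clin_funpow[OF clin_ad]] add.commute)
      then show "z + z' \<in> {z. \<exists>d. ((bracket x) ^^ d) z = 0}" by blast
    qed (auto simp: clin_scale[OF clin_funpow[OF clin_ad]])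
    fix \<beta> z assume \<beta>: "\<beta> \<in> dual H" "z \<in> root_space H \<beta>"
    show "z \<in> {z. \<exists>d. ((bracket x) ^^ d) z = 0}"
    proof (rule ccontr)
      assume "z \<notin> {z. \<exists>d. ((bracket x) ^^ d) z = 0}"
      then have nz: "((bracket x) ^^ d) z \<noteq> 0" for d by blast
      define w where "w d y = \<beta> y + of_nat d * \<gamma> y" for d :: nat and y
      have "w d \<in> {\<beta> \<in> dual H. root_space H \<beta> \<noteq> {0}}" for d
        using bracket_pow_root_space[OF assms(3) \<beta>(2), of d] nz[of d] dual_add[OF \<beta>(1) dual_scale[OF assms(1)]]
        unfolding w_def[abs_def] by blast
      then have "range w \<subseteq> {\<beta> \<in> dual H. root_space H \<beta> \<noteq> {0}}" by blast
      moreover have "inj w"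
      proof (rule injI)
        fix d d' assume "w d = w d'"
        then have "w d y = w d' y" by simp
        then show "d = d'" using y by (simp add: w_def)
      qed
      ultimately show False using finite_weights finite_imageD finite_subset infinite_UNIV_nat by blast
    qed
  qed
  then show ?thesis by blast
qed

subsection \<open>The \<open>sl\<^sub>2\<close>-triples of the simple roots\<close>

lemma simple_root: "i \<in> {1..n} \<Longrightarrow> \<alpha> i \<in> roots H"
  and base_independent: "(\<And>x. x \<in> H \<Longrightarrow> (\<Sum>i=1..n. c i * \<alpha> i x) = 0) \<Longrightarrow> i \<in> {1..n} \<Longrightarrow> c i = 0"
  and root_cases: "\<beta> \<in> roots H \<Longrightarrow> \<beta> \<in> positive_roots H n \<alpha> \<or> (\<lambda>x. - \<beta> x) \<in> positive_roots H n \<alpha>"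
  using base unfolding root_base_def by blast+

lemma roots_dual: "\<beta> \<in> roots H \<Longrightarrow> \<beta> \<in> dual H"
  by (simp add: roots_def)

lemma \<alpha>_dual: "i \<in> {1..n} \<Longrightarrow> \<alpha> i \<in> dual H"
  using simple_root roots_dual by blast

lemma positive_roots_root: "\<beta> \<in> positive_roots H n \<alpha> \<Longrightarrow> \<beta> \<in> roots H"
  by (simp add: positive_roots_def)

lemma positive_roots_dual: "\<beta> \<in> positive_roots H n \<alpha> \<Longrightarrow> \<beta> \<in> dual H"
  by (simp add: positive_roots_root roots_dual)

lemma indicator_sum:
  assumes "i \<in> {1..n}"
  shows "(\<Sum>j=1..n. of_nat (if j = i then a else 0) * \<alpha> j x) = of_nat a * \<alpha> i x"
proof -
  have "(\<Sum>j=1..n. of_nat (if j = i then a else 0) * \<alpha> j x) = (\<Sum>j=1..n. if j = i then of_nat a * \<alpha> i x else 0)"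
    by (intro sum.cong) auto
  then show ?thesis using assms by simp
qed

lemma simple_positive: "i \<in> {1..n} \<Longrightarrow> \<alpha> i \<in> positive_roots H n \<alpha>"
  unfolding positive_roots_def using simple_root[of i] indicator_sum[of i 1]
  by (auto intro!: exI[of _ "\<lambda>j. if j = i then 1 else 0"])

definition fv :: "nat \<Rightarrow> 'g" where "fv i = xm (\<alpha> i)"

definition ev :: "nat \<Rightarrow> 'g" where
  "ev i = (SOME x. x \<in> root_space H (\<alpha> i) \<and> bracket x (fv i) = h i)"

lemma xm_root_space: "\<beta> \<in> positive_roots H n \<alpha> \<Longrightarrow> xm \<beta> \<in> root_space H (\<lambda>y. - \<beta> y)"
  using negative_root_vector[of \<beta>] complex_vector.span_base by blast

lemma negative_root_space:
  assumes "\<beta> \<in> positive_roots H n \<alpha>" "x \<in> root_space H (\<lambda>y. - \<beta> y)"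
  obtains c where "x = c *\<^sub>C xm \<beta>"
  using assms negative_root_vector[of \<beta>] by (auto simp: complex_vector.span_singleton)

lemma fv_root_space: "i \<in> {1..n} \<Longrightarrow> fv i \<in> root_space H (\<lambda>y. - \<alpha> i y)"
  unfolding fv_def by (rule xm_root_space[OF simple_positive])

lemma ev: "i \<in> {1..n} \<Longrightarrow> ev i \<in> root_space H (\<alpha> i)" "i \<in> {1..n} \<Longrightarrow> bracket (ev i) (fv i) = h i"
proof -
  have "ev i \<in> root_space H (\<alpha> i) \<and> bracket (ev i) (fv i) = h i" if i: "i \<in> {1..n}"
  proof -
    let ?S = "(\<lambda>x. bracket x (fv i)) ` root_space H (\<alpha> i)"
    have "{bracket x y | x y. x \<in> root_space H (\<alpha> i) \<and> y \<in> root_space H (\<lambda>z. - \<alpha> i z)} \<subseteq> ?S"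
    proof clarify
      fix x y assume x: "x \<in> root_space H (\<alpha> i)" and "y \<in> root_space H (\<lambda>z. - \<alpha> i z)"
      then obtain c where "y = c *\<^sub>C fv i" unfolding fv_def using negative_root_space[OF simple_positive[OF i]] by blast
      then have "bracket x y = bracket (c *\<^sub>C x) (fv i)" by (simp add: bracket_scaleC_left bracket_scaleC_right)
      then show "bracket x y \<in> ?S"
        using subspace_scale[OF root_space_subspace x] by blast
    qed
    moreover have "csubspace ?S" by (rule subspace_image[OF clin_ad_left root_space_subspace])
    ultimately have "cspan {bracket x y | x y. x \<in> root_space H (\<alpha> i) \<and> y \<in> root_space H (\<lambda>z. - \<alpha> i z)} \<subseteq> ?S"
      by (rule complex_vector.span_minimal)
    then have "h i \<in> ?S" using coroot[OF i] unfolding is_coroot_def by blast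
    then have "\<exists>x. x \<in> root_space H (\<alpha> i) \<and> bracket x (fv i) = h i" by auto
    from someI_ex[OF this] show ?thesis unfolding ev_def .
  qed
  then show "i \<in> {1..n} \<Longrightarrow> ev i \<in> root_space H (\<alpha> i)" "i \<in> {1..n} \<Longrightarrow> bracket (ev i) (fv i) = h i" by auto
qed

lemma h_H: "i \<in> {1..n} \<Longrightarrow> h i \<in> H"
  using bracket_root_space[OF ev(1) fv_root_space, of i i] ev(2)[of i] root_space_zero by simp

lemma \<alpha>_h: "i \<in> {1..n} \<Longrightarrow> \<alpha> i (h i) = 2"
  using coroot by (simp add: is_coroot_def)

lemma h_ev: "i \<in> {1..n} \<Longrightarrow> bracket (h i) (ev i) = 2 *\<^sub>C ev i"
  and h_fv: "i \<in> {1..n} \<Longrightarrow> bracket (h i) (fv i) = (- 2) *\<^sub>C fv i"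
  using root_spaceD[OF ev(1) h_H, of i i] root_spaceD[OF fv_root_space h_H, of i i] \<alpha>_h[of i] by auto

lemma sl2_ad: "i \<in> {1..n} \<Longrightarrow> sl2_operators (bracket (ev i)) (bracket (fv i)) (bracket (h i)) {0}"
  by unfold_locales
    (auto simp: clin_ad subspace_zero_set ad_bracket[of "ev i" "fv i"] ad_bracket[of "h i"] ev(2) h_ev h_fv
      bracket_scaleC_left bracket_minus_left)

lemma \<alpha>_nonzero: "i \<in> {1..n} \<Longrightarrow> \<alpha> i \<noteq> (\<lambda>_. 0)" "i \<in> {1..n} \<Longrightarrow> (\<lambda>y. - \<alpha> i y) \<noteq> (\<lambda>_. 0)"
  using \<alpha>_h[of i] by (auto simp: fun_eq_iff intro!: exI[of _ "h i"])

lemma ev_nilpotent: "i \<in> {1..n} \<Longrightarrow> \<exists>d. ((bracket (ev i)) ^^ d) z = 0"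
  and fv_nilpotent: "i \<in> {1..n} \<Longrightarrow> \<exists>d. ((bracket (fv i)) ^^ d) z = 0"
  using ad_nilpotent[OF \<alpha>_dual \<alpha>_nonzero(1) ev(1)] ad_nilpotent[OF dual_minus[OF \<alpha>_dual] \<alpha>_nonzero(2) fv_root_space]
  by blast+

text \<open>The adjoint representation is locally finite for the \<open>sl\<^sub>2\<close>-triple of every simple root, so the
  symmetry of strings gives the reflected weight.\<close>

lemma root_reflection:
  assumes i: "i \<in> {1..n}" and x: "x \<in> root_space H \<beta>" "x \<noteq> 0"
  obtains m :: int where "\<beta> (h i) = of_int m"
    "root_space H (\<lambda>y. \<beta> y - of_int m * \<alpha> i y) \<noteq> {0}"
proof -
  interpret s: sl2_operators "bracket (ev i)" "bracket (fv i)" "bracket (h i)" "{0}" by (rule sl2_ad[OF i])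
  have wt: "bracket (h i) x - \<beta> (h i) *\<^sub>C x \<in> {0}" using root_spaceD[OF x(1) h_H[OF i]] by simp
  obtain m where m: "\<beta> (h i) = of_int m"
    "m \<ge> 0 \<Longrightarrow> \<exists>j. ((bracket (fv i)) ^^ (j + nat m)) (((bracket (ev i)) ^^ j) x) \<notin> {0}"
    "m \<le> 0 \<Longrightarrow> \<exists>j. ((bracket (ev i)) ^^ (j + nat (- m))) (((bracket (fv i)) ^^ j) x) \<notin> {0}"
    using s.reflection[OF wt] x(2) ev_nilpotent[OF i] fv_nilpotent[OF i] by auto
  have "\<exists>z\<in>root_space H (\<lambda>y. \<beta> y - of_int m * \<alpha> i y). z \<noteq> 0"
  proof (cases "m \<ge> 0")
    case True
    then obtain j where "((bracket (fv i)) ^^ (j + nat m)) (((bracket (ev i)) ^^ j) x) \<notin> {0}" using m by blast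
    moreover have "(\<lambda>y. \<beta> y + of_nat j * \<alpha> i y + of_nat (j + nat m) * - \<alpha> i y) = (\<lambda>y. \<beta> y - of_int m * \<alpha> i y)"
      using True by (auto simp: fun_eq_iff algebra_simps)
    moreover note bracket_pow_root_space[OF fv_root_space[OF i] bracket_pow_root_space[OF ev(1)[OF i] x(1), of j], of "j + nat m"]
    ultimately show ?thesis by auto
  next
    case False
    then obtain j where "((bracket (ev i)) ^^ (j + nat (- m))) (((bracket (fv i)) ^^ j) x) \<notin> {0}" using m by auto
    moreover have "(\<lambda>y. \<beta> y + of_nat j * - \<alpha> i y + of_nat (j + nat (- m)) * \<alpha> i y) = (\<lambda>y. \<beta> y - of_int m * \<alpha> i y)"
      using False by (auto simp: fun_eq_iff algebra_simps)
    moreover note bracket_pow_root_space[OF ev(1)[OF i] bracket_pow_root_space[OF fv_root_space[OF i] x(1), of j], of "j + nat (- m)"]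
    ultimately show ?thesis by auto
  qed
  then show thesis using that m(1) by blast
qed

subsection \<open>The Killing form\<close>

definition \<kappa> :: "'g \<Rightarrow> 'g \<Rightarrow> complex" where
  "\<kappa> x y = btrace basis (\<lambda>z. bracket x (bracket y z))"

lemma \<kappa>_sym: "\<kappa> x y = \<kappa> y x"
  unfolding \<kappa>_def by (intro btrace_commute basis clin_ad in_span_basis)

lemma clin_\<kappa>: "clin (\<kappa> x)"
proof (rule clinI)
  show "\<kappa> x (y + z) = \<kappa> x y + \<kappa> x z" for y z
    unfolding \<kappa>_def btrace_add[OF basis(1) in_span_basis in_span_basis, symmetric]
    by (simp add: bracket_add_left bracket_add_right)
  show "\<kappa> x (c *\<^sub>C y) = c *\<^sub>C \<kappa> x y" for c y
    unfolding \<kappa>_def scaleC_complex_def btrace_scale[OF basis(1) in_span_basis, symmetric]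
    by (simp add: bracket_scaleC_left bracket_scaleC_right)
qed

lemma clin_\<kappa>_left: "clin (\<lambda>x. \<kappa> x y)"
proof -
  have "(\<lambda>x. \<kappa> x y) = \<kappa> y" by (rule ext) (rule \<kappa>_sym)
  then show ?thesis using clin_\<kappa>[of y] by simp
qed

lemmas \<kappa>_add_right = clin_add[OF clin_\<kappa>] and \<kappa>_add_left = clin_add[OF clin_\<kappa>_left]
  and \<kappa>_scale_right = clin_scale[OF clin_\<kappa>, unfolded scaleC_complex_def]
  and \<kappa>_scale_left = clin_scale[OF clin_\<kappa>_left, unfolded scaleC_complex_def]
  and \<kappa>_zero_right = clin_zero[OF clin_\<kappa>] and \<kappa>_zero_left = clin_zero[OF clin_\<kappa>_left]
  and \<kappa>_diff_left = clin_diff[OF clin_\<kappa>_left]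
  and \<kappa>_minus_left = clin_minus[OF clin_\<kappa>_left]
  and \<kappa>_sum_left = clin_sum[OF clin_\<kappa>_left]

lemma \<kappa>_invariant: "\<kappa> (bracket x y) z = \<kappa> x (bracket y z)"
proof -
  have lin: "clin (\<lambda>v. bracket x (bracket y v))" for x y :: 'g
    by (intro clinI) (simp_all add: bracket_add_right bracket_scaleC_right)
  have t: "btrace basis (\<lambda>v. X v - Y v) = btrace basis X - btrace basis Y" for X Y
    by (intro btrace_diff basis in_span_basis)
  have "\<kappa> (bracket x y) z = btrace basis (\<lambda>v. bracket x (bracket y (bracket z v)) - bracket y (bracket x (bracket z v)))"
    by (simp add: \<kappa>_def ad_bracket_operator)
  also have "\<dots> = btrace basis (\<lambda>v. bracket x (bracket y (bracket z v))) - btrace basis (\<lambda>v. bracket y (bracket x (bracket z v)))"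
    by (rule t)
  also have "btrace basis (\<lambda>v. bracket y (bracket x (bracket z v))) = btrace basis (\<lambda>v. bracket x (bracket z (bracket y v)))"
    by (intro btrace_commute basis clin_ad lin in_span_basis)
  also have "btrace basis (\<lambda>v. bracket x (bracket y (bracket z v))) - \<dots> = \<kappa> x (bracket y z)"
    by (simp add: \<kappa>_def ad_bracket_operator bracket_diff_right t)
  finally show ?thesis .
qed

lemma \<kappa>_H: "y \<in> H \<Longrightarrow> z \<in> H \<Longrightarrow> \<kappa> y z = (\<Sum>b\<in>basis. wt b y * wt b z)"
  unfolding \<kappa>_def
  by (intro btrace_diagonal basis) (simp add: root_spaceD[OF wt(2)] bracket_scaleC_right mult.commute)

lemma \<kappa>_orthogonal:
  assumes "\<beta> \<in> dual H" "\<gamma> \<in> dual H" "\<gamma> \<noteq> (\<lambda>y. - \<beta> y)" "x \<in> root_space H \<beta>" "z \<in> root_space H \<gamma>"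
  shows "\<kappa> x z = 0"
proof -
  obtain y where y: "y \<in> H" "\<gamma> y \<noteq> - \<beta> y" using dual_distinct[OF assms(2) dual_minus[OF assms(1)] assms(3)] by auto
  have "\<beta> y * \<kappa> x z = \<kappa> (bracket y x) z" using root_spaceD[OF assms(4) y(1)] by (simp add: \<kappa>_scale_left)
  also have "\<dots> = - \<kappa> x (bracket y z)"
    using bracket_antisym[of y x] \<kappa>_invariant[of x y z] by (simp add: \<kappa>_minus_left)
  also have "\<dots> = - (\<gamma> y * \<kappa> x z)" using root_spaceD[OF assms(5) y(1)] by (simp add: \<kappa>_scale_right)
  finally have "(\<beta> y + \<gamma> y) * \<kappa> x z = 0" by (simp add: algebra_simps)
  with y(2) show ?thesis by (simp add: add_eq_0_iff)
qed

lemma \<kappa>_h_pos: "i \<in> {1..n} \<Longrightarrow> \<exists>r>0. \<kappa> (h i) (h i) = of_real r"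
proof -
  assume i: "i \<in> {1..n}"
  have int: "\<exists>m::int. wt b (h i) = of_int m" if "b \<in> basis" for b
    using root_reflection[OF i wt(2)[OF that] basis_nonzero[OF that]] by blast
  then obtain m :: "'g \<Rightarrow> int" where m: "\<And>b. b \<in> basis \<Longrightarrow> wt b (h i) = of_int (m b)" by metis
  have eq: "\<kappa> (h i) (h i) = of_real (\<Sum>b\<in>basis. (real_of_int (m b))\<^sup>2)"
    unfolding \<kappa>_H[OF h_H[OF i] h_H[OF i]] by (simp add: m power2_eq_square)
  have "\<exists>b\<in>basis. m b \<noteq> 0"
  proof (rule ccontr)
    assume "\<not> (\<exists>b\<in>basis. m b \<noteq> 0)"
    then have "bracket (h i) b = 0" if "b \<in> basis" for b
      using root_spaceD[OF wt(2)[OF that] h_H[OF i]] m[OF that] that by simp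
    then have "bracket (h i) (ev i) = 0"
      using span_induct_clin[OF in_span_basis clin_ad subspace_zero_set] by blast
    then have "ev i = 0" using h_ev[OF i] by simp
    then have "h i = 0" using ev(2)[OF i] by simp
    then show False using \<alpha>_h[OF i] dual_lin(3)[OF \<alpha>_dual[OF i] H_subspace h_H[OF i] h_H[OF i]] by simp
  qed
  then have "(\<Sum>b\<in>basis. (real_of_int (m b))\<^sup>2) > 0"
    using basis(3) by (auto intro!: sum_pos2)
  with eq show ?thesis by blast
qed

text \<open>The radical is an ideal, and simplicity leaves only the choice between \<open>0\<close> and everything;
  the positive value at a coroot excludes the latter.\<close>

lemma \<kappa>_nondegenerate:
  assumes "1 \<le> n" "\<And>y. \<kappa> x y = 0" shows "x = 0"
proof -
  let ?R = "{x. \<forall>y. \<kappa> x y = 0}"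
  have "lie_ideal ?R" unfolding lie_ideal_def
  proof (intro conjI allI ballI)
    show "csubspace ?R" by (intro subspaceI) (auto simp: \<kappa>_zero_left \<kappa>_add_left \<kappa>_scale_left)
    fix x y assume "y \<in> ?R"
    then show "bracket x y \<in> ?R"
      using \<kappa>_invariant[of y x] bracket_antisym[of x y] by (auto simp: \<kappa>_minus_left)
  qed
  moreover obtain r where "r > 0" "\<kappa> (h 1) (h 1) = of_real r" using \<kappa>_h_pos[of 1] assms(1) by auto
  then have "h 1 \<notin> ?R" by (auto intro!: exI[of _ "h 1"] simp del: One_nat_def)
  ultimately have "?R = {0}" using simple unfolding simple_lie_algebra_def by blast
  then show ?thesis using assms(2) by blast
qed

definition nrm :: "nat \<Rightarrow> real" where "nrm i = Re (\<kappa> (h i) (h i)) / 2"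

lemma nrm_pos: "i \<in> {1..n} \<Longrightarrow> nrm i > 0"
  using \<kappa>_h_pos[of i] by (auto simp: nrm_def)

lemma \<kappa>_h:
  assumes i: "i \<in> {1..n}" and y: "y \<in> H"
  shows "\<kappa> (h i) y = of_real (nrm i) * \<alpha> i y"
proof -
  have *: "\<kappa> (h i) y = \<alpha> i y * \<kappa> (ev i) (fv i)" if "y \<in> H" for y
  proof -
    have "\<kappa> (h i) y = \<kappa> (ev i) (bracket (fv i) y)" by (simp add: ev(2)[OF i, symmetric] \<kappa>_invariant)
    also have "bracket (fv i) y = \<alpha> i y *\<^sub>C fv i"
      using root_spaceD[OF fv_root_space[OF i] that] bracket_antisym[of "fv i" y] by simp
    finally show ?thesis by (simp add: \<kappa>_scale_right)
  qed
  have "\<kappa> (h i) (h i) = of_real (Re (\<kappa> (h i) (h i)))" using \<kappa>_h_pos[OF i] by auto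
  then have "\<kappa> (ev i) (fv i) = of_real (nrm i)"
    using *[OF h_H[OF i]] \<alpha>_h[OF i] by (simp add: nrm_def)
  then show ?thesis using *[OF y] by simp
qed

lemma \<kappa>_pairing:
  assumes "1 \<le> n" "\<beta> \<in> dual H" "x \<in> root_space H \<beta>" "x \<noteq> 0"
  shows "\<exists>y\<in>root_space H (\<lambda>y. - \<beta> y). \<kappa> x y \<noteq> 0"
proof (rule ccontr)
  assume *: "\<not> (\<exists>y\<in>root_space H (\<lambda>y. - \<beta> y). \<kappa> x y \<noteq> 0)"
  have "y \<in> {y. \<kappa> x y = 0}" for y
  proof (rule weight_induct)
    show "csubspace {y. \<kappa> x y = 0}" by (intro subspaceI) (auto simp: \<kappa>_zero_right \<kappa>_add_right \<kappa>_scale_right)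
    show "y \<in> {y. \<kappa> x y = 0}" if "\<gamma> \<in> dual H" "y \<in> root_space H \<gamma>" for \<gamma> y
      using * \<kappa>_orthogonal[OF assms(2) that(1) _ assms(3) that(2)] that by blast
  qed
  then show False using \<kappa>_nondegenerate[OF assms(1)] assms(4) by blast
qed

end

section \<open>Positive roots\<close>

context simple_lie
begin

abbreviation pos :: "('g \<Rightarrow> complex) set" where "pos \<equiv> positive_roots H n \<alpha>"

definition lincomb :: "(nat \<Rightarrow> int) \<Rightarrow> 'g \<Rightarrow> complex" where
  "lincomb c = (\<lambda>y. \<Sum>i=1..n. of_int (c i) * \<alpha> i y)"

lemma lincomb_dual: "lincomb c \<in> dual H"
  unfolding lincomb_def by (rule dual_sum) (rule \<alpha>_dual)

lemma lincomb_unique: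
  assumes "lincomb c = lincomb d" "i \<in> {1..n}" shows "c i = d i"
proof -
  have "(\<Sum>i=1..n. of_int (c i - d i) * \<alpha> i y) = 0" for y
    using fun_cong[OF assms(1), of y] by (simp add: lincomb_def left_diff_distrib sum_subtractf)
  then have "of_int (c i - d i) = (0::complex)"
    using base_independent[of "\<lambda>i. of_int (c i - d i)", OF _ assms(2)] by blast
  then have "c i - d i = 0" by (simp only: of_int_eq_0_iff)
  then show ?thesis by simp
qed

lemma lincomb_add: "lincomb (\<lambda>i. c i + d i) y = lincomb c y + lincomb d y"
  and lincomb_minus: "lincomb (\<lambda>i. - c i) y = - lincomb c y"
  and lincomb_zero: "lincomb (\<lambda>_. 0) = (\<lambda>_. 0)"
  by (simp_all add: lincomb_def distrib_right sum.distrib sum_negf)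

lemma lincomb_indicator: "i \<in> {1..n} \<Longrightarrow> lincomb (\<lambda>j. if j = i then k else 0) y = of_int k * \<alpha> i y"
proof -
  assume "i \<in> {1..n}"
  moreover have "lincomb (\<lambda>j. if j = i then k else 0) y = (\<Sum>j=1..n. if j = i then of_int k * \<alpha> i y else 0)"
    unfolding lincomb_def by (intro sum.cong) auto
  ultimately show ?thesis by simp
qed

lemma lincomb_cong: "(\<And>i. i \<in> {1..n} \<Longrightarrow> c i = d i) \<Longrightarrow> lincomb c = lincomb d"
  unfolding lincomb_def by (intro ext sum.cong) auto

text \<open>The coefficients vanish outside \<open>{1..n}\<close>, so that differences of neighbouring coefficients
  make sense at both ends of the Dynkin diagram.\<close>

definition coef :: "('g \<Rightarrow> complex) \<Rightarrow> nat \<Rightarrow> nat" where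
  "coef \<beta> = (SOME c. (\<forall>i. i \<notin> {1..n} \<longrightarrow> c i = 0) \<and> \<beta> = lincomb (\<lambda>i. int (c i)))"

lemma coef:
  assumes "\<beta> \<in> pos"
  shows "i \<notin> {1..n} \<Longrightarrow> coef \<beta> i = 0" "\<beta> = lincomb (\<lambda>i. int (coef \<beta> i))"
proof -
  obtain c :: "nat \<Rightarrow> nat" where c: "\<beta> = (\<lambda>x. \<Sum>i=1..n. of_nat (c i) * \<alpha> i x)"
    using assms unfolding positive_roots_def by blast
  define d where "d i = (if i \<in> {1..n} then c i else 0)" for i
  have "\<beta> = lincomb (\<lambda>i. int (d i))" unfolding c lincomb_def d_def by (intro ext sum.cong) auto
  moreover have "\<forall>i. i \<notin> {1..n} \<longrightarrow> d i = 0" by (simp add: d_def)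
  ultimately have "\<exists>c. (\<forall>i. i \<notin> {1..n} \<longrightarrow> c i = 0) \<and> \<beta> = lincomb (\<lambda>i. int (c i))" by blast
  from someI_ex[OF this] show "i \<notin> {1..n} \<Longrightarrow> coef \<beta> i = 0" "\<beta> = lincomb (\<lambda>i. int (coef \<beta> i))"
    unfolding coef_def by blast+
qed

lemma coef_unique: "\<beta> \<in> pos \<Longrightarrow> \<beta> = lincomb c \<Longrightarrow> i \<in> {1..n} \<Longrightarrow> int (coef \<beta> i) = c i"
  using coef(2)[of \<beta>] lincomb_unique[of "\<lambda>i. int (coef \<beta> i)" c i] by simp

lemma root_nonzero: "\<beta> \<in> roots H \<Longrightarrow> \<beta> \<noteq> (\<lambda>_. 0)"
  by (simp add: roots_def)

lemma positive_of_coefficient: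
  assumes "lincomb c \<in> roots H" "j \<in> {1..n}" "c j > 0"
  shows "lincomb c \<in> pos" "i \<in> {1..n} \<Longrightarrow> int (coef (lincomb c) i) = c i"
proof -
  show *: "lincomb c \<in> pos"
  proof (rule ccontr)
    assume "lincomb c \<notin> pos"
    then have p: "(\<lambda>x. - lincomb c x) \<in> pos" using root_cases[OF assms(1)] by blast
    have "(\<lambda>x. - lincomb c x) = lincomb (\<lambda>i. - c i)" by (simp add: lincomb_minus fun_eq_iff)
    from coef_unique[OF p this assms(2)] assms(3) show False by linarith
  qed
  show "i \<in> {1..n} \<Longrightarrow> int (coef (lincomb c) i) = c i" by (rule coef_unique[OF * refl])
qed

lemma coef_simple: "i \<in> {1..n} \<Longrightarrow> coef (\<alpha> i) j = (if j = i then 1 else 0)"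
proof (cases "j \<in> {1..n}")
  case True
  assume i: "i \<in> {1..n}"
  have "\<alpha> i = lincomb (\<lambda>j. if j = i then 1 else 0)" using lincomb_indicator[OF i, of 1] by (simp add: fun_eq_iff)
  from coef_unique[OF simple_positive[OF i] this True] show ?thesis by (simp split: if_splits)
next
  case False
  assume i: "i \<in> {1..n}"
  then show ?thesis using coef(1)[OF simple_positive[OF i] False] False by auto
qed

lemma finite_pos: "finite pos"
  by (rule finite_subset[OF _ finite_weights]) (auto simp: positive_roots_def roots_def)

lemma coef_nonzero: "\<beta> \<in> pos \<Longrightarrow> \<exists>i\<in>{1..n}. coef \<beta> i > 0"
proof (rule ccontr)
  assume \<beta>: "\<beta> \<in> pos" and "\<not> (\<exists>i\<in>{1..n}. coef \<beta> i > 0)"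
  then have "lincomb (\<lambda>i. int (coef \<beta> i)) = lincomb (\<lambda>_. 0)" by (intro lincomb_cong) auto
  then show False using coef(2)[OF \<beta>] lincomb_zero root_nonzero[OF positive_roots_root[OF \<beta>]] by simp
qed

lemma weight_cases:
  assumes "\<beta> \<in> dual H" "x \<in> root_space H \<beta>" "x \<noteq> 0"
  shows "\<beta> = (\<lambda>_. 0) \<or> \<beta> \<in> pos \<or> (\<lambda>y. - \<beta> y) \<in> pos"
  using assms root_cases[of \<beta>] unfolding roots_def by auto

lemma raising_vector:
  assumes "1 \<le> n" "\<beta> \<in> pos"
  obtains x where "x \<in> root_space H \<beta>" "\<kappa> x (xm \<beta>) = 1"
proof -
  obtain x where x: "x \<in> root_space H \<beta>" "x \<noteq> 0"
    using positive_roots_root[OF assms(2)] subspace_zero[OF root_space_subspace] unfolding roots_def by blast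
  obtain y where y: "y \<in> root_space H (\<lambda>y. - \<beta> y)" "\<kappa> x y \<noteq> 0"
    using \<kappa>_pairing[OF assms(1) positive_roots_dual[OF assms(2)] x] by blast
  obtain c where "y = c *\<^sub>C xm \<beta>" by (rule negative_root_space[OF assms(2) y(1)])
  then have nz: "\<kappa> x (xm \<beta>) \<noteq> 0" using y(2) by (simp add: \<kappa>_scale_right)
  show thesis
  proof (rule that[of "inverse (\<kappa> x (xm \<beta>)) *\<^sub>C x"])
    show "inverse (\<kappa> x (xm \<beta>)) *\<^sub>C x \<in> root_space H \<beta>" by (rule subspace_scale[OF root_space_subspace x(1)])
    show "\<kappa> (inverse (\<kappa> x (xm \<beta>)) *\<^sub>C x) (xm \<beta>) = 1" using nz by (simp add: \<kappa>_scale_left)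
  qed
qed

lemma xm_nonzero: "1 \<le> n \<Longrightarrow> \<beta> \<in> pos \<Longrightarrow> xm \<beta> \<noteq> 0"
  using raising_vector[of \<beta>] by (metis \<kappa>_zero_right zero_neq_one)

lemma raising_vector_unique:
  assumes "1 \<le> n" "\<beta> \<in> pos" "x \<in> root_space H \<beta>" "\<kappa> x (xm \<beta>) = 0"
  shows "x = 0"
proof (rule ccontr)
  assume "x \<noteq> 0"
  then obtain y where y: "y \<in> root_space H (\<lambda>y. - \<beta> y)" "\<kappa> x y \<noteq> 0"
    using \<kappa>_pairing[OF assms(1) positive_roots_dual[OF assms(2)] assms(3)] by blast
  obtain c where "y = c *\<^sub>C xm \<beta>" by (rule negative_root_space[OF assms(2) y(1)])
  then show False using y(2) assms(4) by (simp add: \<kappa>_scale_right)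
qed

lemma simple_root_space:
  assumes "1 \<le> n" "i \<in> {1..n}" "x \<in> root_space H (\<alpha> i)"
  obtains c where "x = c *\<^sub>C ev i"
proof -
  have nz: "\<kappa> (ev i) (fv i) \<noteq> 0"
  proof
    assume "\<kappa> (ev i) (fv i) = 0"
    then have "ev i = 0" unfolding fv_def
      by (rule raising_vector_unique[OF assms(1) simple_positive[OF assms(2)] ev(1)[OF assms(2)]])
    then have "h i = 0" using ev(2)[OF assms(2)] by simp
    then show False using \<alpha>_h[OF assms(2)]
        dual_lin(3)[OF \<alpha>_dual[OF assms(2)] H_subspace h_H[OF assms(2)] h_H[OF assms(2)]] by simp
  qed
  let ?c = "\<kappa> x (fv i) / \<kappa> (ev i) (fv i)"
  have "x - ?c *\<^sub>C ev i = 0"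
  proof (rule raising_vector_unique[OF assms(1) simple_positive[OF assms(2)]])
    show "x - ?c *\<^sub>C ev i \<in> root_space H (\<alpha> i)"
      by (intro subspace_diff subspace_scale root_space_subspace assms ev)
    show "\<kappa> (x - ?c *\<^sub>C ev i) (xm (\<alpha> i)) = 0"
      using nz by (simp add: fv_def[symmetric] \<kappa>_diff_left \<kappa>_scale_left)
  qed
  then show thesis using that by simp
qed

text \<open>The vector \<open>e\<^sub>i x\<close> below cannot be killed by \<open>f\<^sub>i\<close>, since otherwise \<open>x\<close> would be the start of a
  string of negative weight; one-dimensionality of the root space then shows that the lowest root
  vectors come from the simple ones.\<close>

lemma lowering_step:
  assumes n: "1 \<le> n" and \<beta>: "\<beta> \<in> pos" and i: "i \<in> {1..n}"
    and m: "\<beta> (h i) = of_int m" "m > 0" and ne: "\<beta> \<noteq> \<alpha> i"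
  obtains \<gamma> c where "\<gamma> \<in> pos" "\<gamma> = (\<lambda>y. \<beta> y - \<alpha> i y)" "xm \<beta> = c *\<^sub>C bracket (fv i) (xm \<gamma>)"
    "coef \<beta> = (coef \<gamma>)(i := Suc (coef \<gamma> i))"
proof -
  interpret s: sl2_operators "bracket (ev i)" "bracket (fv i)" "bracket (h i)" "{0}" by (rule sl2_ad[OF i])
  let ?x = "xm \<beta>" and ?\<gamma> = "\<lambda>y. \<beta> y - \<alpha> i y"
  have x: "?x \<in> root_space H (\<lambda>y. - \<beta> y)" "?x \<noteq> 0" by (rule xm_root_space[OF \<beta>], rule xm_nonzero[OF n \<beta>])
  have wt: "bracket (h i) ?x - (- of_int m) *\<^sub>C ?x \<in> {0}" using root_spaceD[OF x(1) h_H[OF i]] m by simp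
  \<comment> \<open>\<open>x\<close> has negative weight \<open>- m\<close>, but the weight of a primitive vector is never negative.\<close>
  have fe: "bracket (fv i) (bracket (ev i) ?x) \<noteq> 0"
  proof
    assume 0: "bracket (fv i) (bracket (ev i) ?x) = 0"
    obtain N where N: "((bracket (fv i)) ^^ N) ?x = 0" using fv_nilpotent[OF i] by blast
    obtain d where "- of_int m = (of_nat d :: complex)"
      by (rule s.primitive_string[OF wt]) (use 0 x(2) N in auto)
    then have "of_int (- m) = (of_int (int d) :: complex)" by simp
    then show False using m(2) by (simp only: of_int_eq_iff)
  qed
  have ex: "bracket (ev i) ?x \<in> root_space H (\<lambda>y. - ?\<gamma> y)"
    using bracket_root_space[OF ev(1)[OF i] x(1)] by (simp add: algebra_simps)
  have "bracket (fv i) (bracket (ev i) ?x) \<in> root_space H (\<lambda>y. - \<beta> y)"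
    using bracket_root_space[OF fv_root_space[OF i] ex] by simp
  then obtain c where c: "bracket (fv i) (bracket (ev i) ?x) = c *\<^sub>C ?x" by (rule negative_root_space[OF \<beta>])
  with fe have "c \<noteq> 0" by auto
  have e0: "bracket (ev i) ?x \<noteq> 0" using fe by auto
  let ?d = "\<lambda>j. int (coef \<beta> j) - (if j = i then 1 else 0)"
  have \<gamma>: "?\<gamma> = lincomb ?d"
    using coef(2)[OF \<beta>] lincomb_add[of "\<lambda>j. int (coef \<beta> j)" "\<lambda>j. - (if j = i then 1 else 0)"]
      lincomb_minus[of "\<lambda>j. (if j = i then 1 else 0)"] lincomb_indicator[OF i, of 1]
    by (simp add: fun_eq_iff)
  have nz: "(\<lambda>y. - ?\<gamma> y) \<noteq> (\<lambda>_. 0)"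
  proof
    assume 0: "(\<lambda>y. - ?\<gamma> y) = (\<lambda>_. 0)"
    have "\<beta> y = \<alpha> i y" for y using fun_cong[OF 0, of y] by simp
    then show False using ne by (simp add: fun_eq_iff)
  qed
  have root: "(\<lambda>y. - ?\<gamma> y) \<in> roots H"
    unfolding roots_def using ex e0 nz dual_minus[OF dual_diff[OF positive_roots_dual[OF \<beta>] \<alpha>_dual[OF i]]]
    by auto
  have "(\<lambda>y. - ?\<gamma> y) \<notin> pos"
  proof
    assume p: "(\<lambda>y. - ?\<gamma> y) \<in> pos"
    have eq: "(\<lambda>y. - ?\<gamma> y) = lincomb (\<lambda>j. - ?d j)" 
      by (rule ext) (simp only: lincomb_minus fun_cong[OF \<gamma>])
    have *: "?d j \<le> 0" if "j \<in> {1..n}" for j using coef_unique[OF p eq that] by linarith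
    have "coef \<beta> i \<noteq> 0"
    proof
      assume "coef \<beta> i = 0"
      then have "coef \<beta> j = 0" if "j \<in> {1..n}" for j using *[OF that] by (cases "j = i") auto
      then show False using coef_nonzero[OF \<beta>] by auto
    qed
    then have "int (coef \<beta> j) = (if j = i then 1 else 0)" if "j \<in> {1..n}" for j
      using *[OF that] by (cases "j = i") auto
    then have "lincomb (\<lambda>j. int (coef \<beta> j)) = lincomb (\<lambda>j. if j = i then 1 else 0)" by (rule lincomb_cong)
    then have "\<beta> = \<alpha> i" using coef(2)[OF \<beta>] lincomb_indicator[OF i, of 1] by (simp add: fun_eq_iff)
    then show False using ne by simp
  qed
  then have \<gamma>pos: "?\<gamma> \<in> pos" using root_cases[OF root] by simp
  obtain c' where c': "bracket (ev i) ?x = c' *\<^sub>C xm ?\<gamma>" by (rule negative_root_space[OF \<gamma>pos ex])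
  have "?x = (c' / c) *\<^sub>C bracket (fv i) (xm ?\<gamma>)"
  proof -
    have "?x = inverse c *\<^sub>C (c *\<^sub>C ?x)" using \<open>c \<noteq> 0\<close> by simp
    also have "\<dots> = inverse c *\<^sub>C bracket (fv i) (bracket (ev i) ?x)" by (simp only: c)
    also have "\<dots> = (c' / c) *\<^sub>C bracket (fv i) (xm ?\<gamma>)"
      by (simp add: c' bracket_scaleC_right divide_inverse mult.commute)
    finally show ?thesis .
  qed
  moreover have "coef \<beta> = (coef ?\<gamma>)(i := Suc (coef ?\<gamma> i))"
  proof (rule ext)
    fix j
    show "coef \<beta> j = ((coef ?\<gamma>)(i := Suc (coef ?\<gamma> i))) j"
      using coef_unique[OF \<gamma>pos \<gamma>, of j] coef(1)[OF \<beta>, of j] coef(1)[OF \<gamma>pos, of j] i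
      by (cases "j \<in> {1..n}") (auto split: if_splits)
  qed
  ultimately show thesis using that \<gamma>pos by blast
qed

text \<open>Such a \<open>y\<close> has weight \<open>0\<close> on all root spaces, hence lies in the radical of the Killing form.\<close>

lemma center_H:
  assumes "1 \<le> n" "y \<in> H" "\<And>i. i \<in> {1..n} \<Longrightarrow> \<alpha> i y = 0"
  shows "y = 0"
proof (rule \<kappa>_nondegenerate[OF assms(1)])
  have zero: "\<beta> y = 0" if "\<beta> \<in> pos" for \<beta>
    by (subst coef(2)[OF that]) (simp add: lincomb_def assms(3))
  have wt0: "wt b y = 0" if "b \<in> basis" for b
    using weight_cases[OF wt[OF that] basis_nonzero[OF that]] zero[of "wt b"] zero[of "\<lambda>y. - wt b y"] by auto
  fix z
  have "z \<in> {z. \<kappa> y z = 0}"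
  proof (rule weight_induct)
    show "csubspace {z. \<kappa> y z = 0}" by (intro subspaceI) (auto simp: \<kappa>_zero_right \<kappa>_add_right \<kappa>_scale_right)
    fix \<gamma> z assume \<gamma>: "\<gamma> \<in> dual H" "z \<in> root_space H \<gamma>"
    show "z \<in> {z. \<kappa> y z = 0}"
    proof (cases "\<gamma> = (\<lambda>_. 0)")
      case True
      then have "z \<in> H" using \<gamma>(2) root_space_zero by simp
      then show ?thesis using \<kappa>_H[OF assms(2)] wt0 by simp
    next
      case False
      have "y \<in> root_space H (\<lambda>_. 0)" using assms(2) root_space_zero by simp
      then show ?thesis using \<kappa>_orthogonal[OF dual_zero \<gamma>(1) _ _ \<gamma>(2), of y] False by simp
    qed
  qed
  then show "\<kappa> y z = 0" by simp
qed

text \<open>The map \<open>y \<mapsto> \<Sum>\<^sub>i \<kappa>(h\<^sub>i, y) h\<^sub>i\<close> is injective on \<open>H\<close>, so \<open>H\<close> is not larger than the span of the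
  coroots.\<close>

lemma H_span:
  assumes n: "1 \<le> n" shows "H = cspan (h ` {1..n})"
proof
  show sub: "cspan (h ` {1..n}) \<subseteq> H"
    using h_H by (intro complex_vector.span_minimal H_subspace) auto
  define \<psi> where "\<psi> y = (\<Sum>i=1..n. \<kappa> (h i) y *\<^sub>C h i)" for y
  have lin: "clin \<psi>"
    by (intro clinI) (simp_all add: \<psi>_def \<kappa>_add_right \<kappa>_scale_right scaleC_add_left sum.distrib complex_vector.scale_sum_right)
  obtain C where C: "C \<subseteq> h ` {1..n}" "complex_vector.independent C" "h ` {1..n} \<subseteq> cspan C"
    by (rule complex_vector.maximal_independent_subset)
  have spanC: "cspan (h ` {1..n}) \<subseteq> cspan C"
    by (rule complex_vector.span_minimal[OF C(3) complex_vector.subspace_span])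
  show "H \<subseteq> cspan (h ` {1..n})"
  proof
    fix y assume y: "y \<in> H"
    show "y \<in> cspan (h ` {1..n})"
    proof (rule ccontr)
      assume "y \<notin> cspan (h ` {1..n})"
      then have "y \<notin> cspan C" using complex_vector.span_mono[OF C(1)] by blast
      let ?D = "insert y C"
      have D: "complex_vector.independent ?D" by (rule complex_vector.independent_insertI[OF \<open>y \<notin> cspan C\<close> C(2)])
      have DH: "cspan ?D \<subseteq> H"
        using C(1) h_H y by (intro complex_vector.span_minimal H_subspace) auto
      have inj: "x = 0" if "x \<in> H" "\<psi> x = 0" for x
      proof (rule center_H[OF n that(1)])
        have "\<kappa> x' (\<psi> x) = 0" for x' using that(2) by (simp add: \<kappa>_zero_right)
        have sum0: "(\<Sum>i=1..n. (of_real (nrm i) * \<kappa> (h i) x) * \<alpha> i z) = 0" if "z \<in> H" for z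
        proof -
          have "0 = \<kappa> (\<psi> x) z" using \<open>\<psi> x = 0\<close> by (simp add: \<kappa>_zero_left)
          also have "\<dots> = (\<Sum>i=1..n. \<kappa> (h i) x * \<kappa> (h i) z)" by (simp add: \<psi>_def \<kappa>_sum_left \<kappa>_scale_left)
          also have "\<dots> = (\<Sum>i=1..n. (of_real (nrm i) * \<kappa> (h i) x) * \<alpha> i z)"
            by (intro sum.cong refl) (simp add: \<kappa>_h[OF _ that])
          finally show ?thesis by simp
        qed
        fix i assume i: "i \<in> {1..n}"
        have "of_real (nrm i) * \<kappa> (h i) x = 0" by (rule base_independent[OF sum0 i])
        then show "\<alpha> i x = 0" using nrm_pos[OF i] \<kappa>_h[OF i that(1)] by simp
      qed
      interpret vp: vector_space_pair "scaleC :: complex \<Rightarrow> 'g \<Rightarrow> 'g" "scaleC :: complex \<Rightarrow> 'g \<Rightarrow> 'g"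
        by (simp add: vector_space_pair_def complex_vector.vector_space_axioms)
      have vlin: "Vector_Spaces.linear scaleC scaleC \<psi>"
        using lin by (simp add: Vector_Spaces.linear_iff clin_def complex_vector.vector_space_axioms)
      have injD: "inj_on \<psi> (cspan ?D)"
      proof (rule inj_onI)
        fix a b assume ab: "a \<in> cspan ?D" "b \<in> cspan ?D" "\<psi> a = \<psi> b"
        then have "a - b \<in> H" "\<psi> (a - b) = 0"
          using DH subspace_diff[OF H_subspace] by (auto simp: clin_diff[OF lin])
        then show "a = b" using inj[of "a - b"] by simp
      qed
      have ind: "complex_vector.independent (\<psi> ` ?D)"
        by (rule vp.linear_independent_injective_image[OF vlin D injD[unfolded cspan_def]])
      have "\<psi> x \<in> cspan (h ` {1..n})" for x
        unfolding \<psi>_def by (intro complex_vector.span_sum complex_vector.span_scale complex_vector.span_base imageI)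
      then have "\<psi> ` ?D \<subseteq> cspan (h ` {1..n})" by blast
      then have "\<psi> ` ?D \<subseteq> cspan C" using spanC by blast
      from complex_vector.independent_span_bound[OF _ ind this]
      have le: "card (\<psi> ` ?D) \<le> card C" using C(1) finite_subset by blast
      have "card (\<psi> ` ?D) = card ?D"
        by (rule card_image) (rule inj_on_subset[OF injD], rule complex_vector.span_superset)
      also have "\<dots> = Suc (card C)"
        using C(1) finite_subset[of C] \<open>y \<notin> cspan C\<close> complex_vector.span_base[of y C] by (auto simp: card_insert_if)
      finally show False using le by simp
    qed
  qed
qed

lemma H_induct:
  assumes "1 \<le> n" "csubspace S" "\<And>i. i \<in> {1..n} \<Longrightarrow> h i \<in> S" "y \<in> H"
  shows "y \<in> S"
  using H_span[OF assms(1)] complex_vector.span_minimal[OF _ assms(2), of "h ` {1..n}"] assms(3,4) by blast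

end

section \<open>The roots of type \<open>B\<close>\<close>

locale type_B_lie = simple_lie H n \<alpha> h xm
  for H :: "'g::complex_lie_algebra set" and n \<alpha> h xm +
  assumes rank: "2 \<le> n" and type_B: type_B
begin

lemma n1: "1 \<le> n" using rank by simp

definition pairing :: "(nat \<Rightarrow> int) \<Rightarrow> nat \<Rightarrow> int" where
  "pairing c i = (if i = n then 2 * c n - 2 * c (n - 1) else 2 * c i - c (i - 1) - c (i + 1))"

lemma lincomb_h:
  assumes "i \<in> {1..n}" "c 0 = 0"
  shows "lincomb c (h i) = of_int (pairing c i)"
proof -
  have "lincomb c (h i) = of_int (\<Sum>j=1..n. c j * cartan_matrix_B n i j)"
    using type_B assms(1) unfolding type_B_def lincomb_def by simp
  also have "(\<Sum>j=1..n. c j * cartan_matrix_B n i j) = pairing c i"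
  proof (cases "i = n")
    case True
    have "(\<Sum>j=1..n. c j * cartan_matrix_B n i j)
        = (\<Sum>j=1..n. (if j = n then 2 * c n else 0) + (if j = n - 1 then - 2 * c (n - 1) else 0))"
      using True rank by (intro sum.cong refl) (auto simp: cartan_matrix_B_def)
    also have "\<dots> = pairing c i" using True rank by (simp add: sum.distrib pairing_def)
    finally show ?thesis .
  next
    case False
    have "(\<Sum>j=1..n. c j * cartan_matrix_B n i j)
        = (\<Sum>j=1..n. (if j = i then 2 * c i else 0) + (if j = i - 1 then - c (i - 1) else 0) + (if j = i + 1 then - c (i + 1) else 0))"
      using False assms(1) by (intro sum.cong refl) (auto simp: cartan_matrix_B_def)
    also have "\<dots> = pairing c i"
      using False assms by (cases "i = 1") (auto simp: sum.distrib pairing_def)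
    finally show ?thesis .
  qed
  finally show ?thesis .
qed

lemma root_h: "\<beta> \<in> pos \<Longrightarrow> i \<in> {1..n} \<Longrightarrow> \<beta> (h i) = of_int (pairing (\<lambda>j. int (coef \<beta> j)) i)"
  using coef(2)[of \<beta>] lincomb_h[of i "\<lambda>j. int (coef \<beta> j)"] coef(1)[of \<beta> 0] by simp

text \<open>In the standard coordinates \<open>\<alpha>\<^sub>i = \<epsilon>\<^sub>i - \<epsilon>\<^sub>i\<^sub>+\<^sub>1\<close>, \<open>\<alpha>\<^sub>n = \<epsilon>\<^sub>n\<close> the coordinates of \<open>\<Sum> c\<^sub>i \<alpha>\<^sub>i\<close> are
  \<open>c\<^sub>j - c\<^sub>j\<^sub>-\<^sub>1\<close>, and this is the squared length.\<close>

definition sqnorm :: "(nat \<Rightarrow> int) \<Rightarrow> int" where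
  "sqnorm c = (\<Sum>j=1..n. (c j - c (j - 1))\<^sup>2)"

lemma sqnorm_reflection:
  assumes i: "i \<in> {1..n}" and c0: "c 0 = 0"
  shows "sqnorm (c(i := c i - pairing c i)) = sqnorm c"
proof (cases "i = n")
  case True
  have split: "sqnorm d = (d n - d (n - 1))\<^sup>2 + (\<Sum>j\<in>{1..n} - {n}. (d j - d (j - 1))\<^sup>2)" for d
    unfolding sqnorm_def using rank by (subst sum.remove[of _ n]) auto
  have "(\<Sum>j\<in>{1..n} - {n}. ((c(i := c i - pairing c i)) j - (c(i := c i - pairing c i)) (j - 1))\<^sup>2)
      = (\<Sum>j\<in>{1..n} - {n}. (c j - c (j - 1))\<^sup>2)"
    using True by (intro sum.cong) auto
  then show ?thesis unfolding split using True rank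
    by (simp add: pairing_def power2_eq_square algebra_simps del: fun_upd_apply) (simp add: algebra_simps)
next
  case False
  have split: "sqnorm d = (d i - d (i - 1))\<^sup>2 + (d (i + 1) - d i)\<^sup>2 + (\<Sum>j\<in>{1..n} - {i} - {i + 1}. (d j - d (j - 1))\<^sup>2)" for d
    unfolding sqnorm_def using i False by (subst sum.remove[of _ i], simp, simp, subst sum.remove[of _ "i + 1"]) auto
  have "(\<Sum>j\<in>{1..n} - {i} - {i + 1}. ((c(i := c i - pairing c i)) j - (c(i := c i - pairing c i)) (j - 1))\<^sup>2)
      = (\<Sum>j\<in>{1..n} - {i} - {i + 1}. (c j - c (j - 1))\<^sup>2)"
    by (intro sum.cong) auto
  moreover have "i - 1 \<noteq> i" using i by auto
  ultimately show ?thesis unfolding split using i False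
    by (simp add: pairing_def power2_eq_square algebra_simps)
qed

lemma pairing_pos_exists:
  assumes \<beta>: "\<beta> \<in> pos"
  obtains i where "i \<in> {1..n}" "pairing (\<lambda>j. int (coef \<beta> j)) i > 0"
proof (rule ccontr)
  let ?c = "\<lambda>j. int (coef \<beta> j)"
  assume "\<not> thesis"
  with that have neg: "pairing ?c i \<le> 0" if "i \<in> {1..n}" for i using that by force
  have c0: "?c 0 = 0" using coef(1)[OF \<beta>, of 0] by simp
  have x: "k < n \<Longrightarrow> ?c (n - k) \<le> ?c (n - k - 1)" for k
  proof (induction k)
    case 0
    then show ?case using neg[of n] rank by (simp add: pairing_def)
  next
    case (Suc k)
    have "n - Suc k \<in> {1..n}" "n - Suc k \<noteq> n" "n - Suc k + 1 = n - k" "n - k - 1 = n - Suc k"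
      using Suc.prems by auto
    then have "2 * ?c (n - Suc k) - ?c (n - Suc k - 1) - ?c (n - k) \<le> 0" "?c (n - k) \<le> ?c (n - Suc k)"
      using neg[of "n - Suc k"] Suc by (simp_all only: pairing_def if_False)
    then show ?case by linarith
  qed
  have "?c j \<le> 0" if "j \<le> n" for j
    using that
  proof (induction j)
    case (Suc j)
    then show ?case using x[of "n - Suc j"] by simp
  qed (use c0 in simp)
  then show False using coef_nonzero[OF \<beta>] by auto
qed

text \<open>Reflection changes the \<open>i\<close>-th coefficient only; one positive coefficient that remains makes the
  reflected root positive.\<close>

lemma reflected_root:
  assumes \<beta>: "\<beta> \<in> pos" and i: "i \<in> {1..n}" and j: "j \<in> {1..n}"
    and cj: "((\<lambda>j. int (coef \<beta> j))(i := int (coef \<beta> i) - pairing (\<lambda>j. int (coef \<beta> j)) i)) j > 0"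
  obtains \<gamma> where "\<gamma> \<in> pos"
    "(\<lambda>j. int (coef \<gamma> j)) = (\<lambda>j. int (coef \<beta> j))(i := int (coef \<beta> i) - pairing (\<lambda>j. int (coef \<beta> j)) i)"
proof -
  let ?c = "\<lambda>j. int (coef \<beta> j)"
  let ?d = "?c(i := ?c i - pairing ?c i)"
  obtain x where x: "x \<in> root_space H \<beta>" "x \<noteq> 0"
    using positive_roots_root[OF \<beta>] subspace_zero[OF root_space_subspace] unfolding roots_def by blast
  obtain m where m: "\<beta> (h i) = of_int m" "root_space H (\<lambda>y. \<beta> y - of_int m * \<alpha> i y) \<noteq> {0}"
    by (rule root_reflection[OF i x])
  have mp: "m = pairing ?c i" using m(1) root_h[OF \<beta> i] by simp
  have "lincomb ?d = lincomb (\<lambda>j. ?c j + - (if j = i then m else 0))"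
    unfolding mp by (rule lincomb_cong) auto
  also have "\<dots> = (\<lambda>y. \<beta> y - of_int m * \<alpha> i y)"
    using coef(2)[OF \<beta>] lincomb_add[of ?c "\<lambda>j. - (if j = i then m else 0)"] lincomb_minus[of "\<lambda>j. if j = i then m else 0"]
      lincomb_indicator[OF i, of m] by (simp add: fun_eq_iff)
  finally have eq: "lincomb ?d = (\<lambda>y. \<beta> y - of_int m * \<alpha> i y)" .
  have "lincomb ?d \<noteq> (\<lambda>_. 0)"
  proof
    assume "lincomb ?d = (\<lambda>_. 0)"
    then have "lincomb ?d = lincomb (\<lambda>_. 0)" by (simp add: lincomb_zero)
    from lincomb_unique[OF this j] cj show False by simp
  qed
  then have root: "lincomb ?d \<in> roots H"
    using m(2) lincomb_dual[of ?d] unfolding roots_def eq by simp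
  note p = positive_of_coefficient[OF root j cj]
  show thesis
  proof (rule that[OF p(1)])
    show "(\<lambda>j. int (coef (lincomb ?d) j)) = ?d"
    proof (rule ext)
      fix k show "int (coef (lincomb ?d) k) = ?d k"
      proof (cases "k \<in> {1..n}")
        case True
        then show ?thesis by (rule p(2))
      next
        case False
        then have "?d k = 0" using coef(1)[OF \<beta> False] i by auto
        moreover have "coef (lincomb ?d) k = 0" by (rule coef(1)[OF p(1) False])
        ultimately show ?thesis by (simp only: of_nat_0)
      qed
    qed
  qed
qed

text \<open>Descending with \<open>lowering_step\<close> along the multiples of \<open>\<alpha>\<^sub>i\<close> would make the root vector for \<open>2 \<alpha>\<^sub>i\<close> a
  multiple of \<open>[f\<^sub>i, f\<^sub>i] = 0\<close>.\<close>

lemma no_multiple: "i \<in> {1..n} \<Longrightarrow> 2 \<le> k \<Longrightarrow> lincomb (\<lambda>j. if j = i then int k else 0) \<notin> pos"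
proof (induction k)
  case (Suc k)
  let ?d = "\<lambda>k j. if j = i then int k else 0"
  show ?case
  proof
    assume p: "lincomb (?d (Suc k)) \<in> pos" (is "?\<beta> \<in> pos")
    have c: "int (coef ?\<beta> j) = ?d (Suc k) j" for j
      using coef_unique[OF p refl, of j] coef(1)[OF p, of j] Suc.prems(1) by (cases "j \<in> {1..n}") auto
    obtain i' where i': "i' \<in> {1..n}" "pairing (\<lambda>j. int (coef ?\<beta> j)) i' > 0" by (rule pairing_pos_exists[OF p])
    then have "i' = i" unfolding c by (auto simp: pairing_def split: if_splits)
    have ne: "?\<beta> \<noteq> \<alpha> i"
    proof
      assume "?\<beta> = \<alpha> i"
      then show False using c[of i] coef_simple[OF Suc.prems(1), of i] Suc.prems(2) by simp
    qed
    obtain \<gamma> a where \<gamma>: "\<gamma> \<in> pos" "\<gamma> = (\<lambda>y. ?\<beta> y - \<alpha> i y)" "xm ?\<beta> = a *\<^sub>C bracket (fv i) (xm \<gamma>)"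
      by (rule lowering_step[OF n1 p Suc.prems(1) root_h[OF p Suc.prems(1)] _ ne]) (use i' \<open>i' = i\<close> in auto)
    have \<gamma>': "\<gamma> = lincomb (?d k)"
      unfolding \<gamma>(2) by (rule ext) (simp add: lincomb_indicator[OF Suc.prems(1)] algebra_simps)
    show False
    proof (cases "2 \<le> k")
      case True
      then show ?thesis using Suc.IH[OF Suc.prems(1)] \<gamma>(1) \<gamma>' by simp
    next
      case False
      then have "k = 1" using Suc.prems(2) by simp
      then have "\<gamma> = \<alpha> i" unfolding \<gamma>' by (simp add: lincomb_indicator[OF Suc.prems(1)] fun_eq_iff)
      then have "xm ?\<beta> = 0" using \<gamma>(3) by (simp add: fv_def bracket_self)
      then show False using xm_nonzero[OF n1 p] by simp
    qed
  qed
qed simp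

lemma two_coefficients:
  assumes \<beta>: "\<beta> \<in> pos" and i: "i \<in> {1..n}" and ne: "\<beta> \<noteq> \<alpha> i"
  obtains j where "j \<in> {1..n}" "j \<noteq> i" "coef \<beta> j > 0"
proof (rule ccontr)
  assume "\<not> thesis"
  with that have z: "coef \<beta> j = 0" if "j \<in> {1..n}" "j \<noteq> i" for j using that by blast
  have "lincomb (\<lambda>j. int (coef \<beta> j)) = lincomb (\<lambda>j. if j = i then int (coef \<beta> i) else 0)"
    by (rule lincomb_cong) (use z in auto)
  then have eq: "\<beta> = lincomb (\<lambda>j. if j = i then int (coef \<beta> i) else 0)" using coef(2)[OF \<beta>] by simp
  have "coef \<beta> i \<noteq> 0" using coef_nonzero[OF \<beta>] z by (metis less_numeral_extra(3))
  moreover have "coef \<beta> i \<noteq> 1"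
  proof
    assume "coef \<beta> i = 1"
    then have "lincomb (\<lambda>j. if j = i then int (coef \<beta> i) else 0) = lincomb (\<lambda>j. if j = i then 1 else 0)"
      by (intro lincomb_cong) auto
    then have "\<beta> = lincomb (\<lambda>j. if j = i then 1 else 0)" using eq by (rule trans[rotated])
    then have "\<beta> y = \<alpha> i y" for y using lincomb_indicator[OF i, of 1 y] by simp
    then show False using ne by (simp add: fun_eq_iff)
  qed
  ultimately show False using no_multiple[OF i, of "coef \<beta> i"] eq \<beta> by simp
qed

lemma sqnorm_simple: "i \<in> {1..n} \<Longrightarrow> sqnorm (\<lambda>j. int (coef (\<alpha> i) j)) = (if i = n then 1 else 2)"
proof -
  assume i: "i \<in> {1..n}"
  have "sqnorm (\<lambda>j. int (coef (\<alpha> i) j)) = (\<Sum>j=1..n. (if j = i then 1 else 0) + (if j = i + 1 then 1 else 0))"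
    unfolding sqnorm_def coef_simple[OF i] using i by (intro sum.cong) auto
  also have "\<dots> = (if i = n then 1 else 2)" using i by (simp add: sum.distrib)
  finally show ?thesis .
qed

text \<open>A positive root that is not simple has a positive pairing with some coroot, and the simple
  reflection shortens it, so every root is conjugate to a simple root.\<close>

lemma sqnorm_root: "\<beta> \<in> pos \<Longrightarrow> sqnorm (\<lambda>j. int (coef \<beta> j)) \<le> 2"
proof (induction "\<Sum>j=1..n. coef \<beta> j" arbitrary: \<beta> rule: less_induct)
  case less
  let ?c = "\<lambda>j. int (coef \<beta> j)"
  obtain i where i: "i \<in> {1..n}" "pairing ?c i > 0" by (rule pairing_pos_exists[OF less.prems])
  show ?case
  proof (cases "\<beta> = \<alpha> i")
    case True
    then show ?thesis using sqnorm_simple[OF i(1)] by simp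
  next
    case False
    obtain j where j: "j \<in> {1..n}" "j \<noteq> i" "coef \<beta> j > 0" by (rule two_coefficients[OF less.prems i(1) False])
    obtain \<gamma> where \<gamma>: "\<gamma> \<in> pos" "(\<lambda>j. int (coef \<gamma> j)) = ?c(i := ?c i - pairing ?c i)"
      by (rule reflected_root[OF less.prems i(1) j(1)]) (use j in auto)
    have le: "coef \<gamma> k \<le> coef \<beta> k" for k using fun_cong[OF \<gamma>(2), of k] i(2) by (auto split: if_splits)
    have "coef \<gamma> i < coef \<beta> i" using fun_cong[OF \<gamma>(2), of i] i(2) by auto
    then have "(\<Sum>j=1..n. coef \<gamma> j) < (\<Sum>j=1..n. coef \<beta> j)"
      using i(1) le by (intro sum_strict_mono_ex1) auto
    from less.hyps[OF this \<gamma>(1)] \<gamma>(2) sqnorm_reflection[OF i(1), of ?c] coef(1)[OF less.prems, of 0]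
    show ?thesis by simp
  qed
qed

lemma sqnorm_split: "sqnorm c = (c 1 - c 0)\<^sup>2 + (c 2 - c 1)\<^sup>2 + (\<Sum>j=3..n. (c j - c (j - 1))\<^sup>2)"
  unfolding sqnorm_def using rank by (simp add: sum.atLeast_Suc_atMost numeral_eq_Suc)

definition \<theta>coef :: "nat \<Rightarrow> nat" where
  "\<theta>coef j = (if j = 1 then 1 else if 2 \<le> j \<and> j \<le> n then 2 else 0)"

lemma theta11_lincomb: "theta11 = lincomb (\<lambda>j. int (\<theta>coef j))"
proof (rule ext)
  fix y
  have "lincomb (\<lambda>j. int (\<theta>coef j)) y = (\<Sum>k=1..n. \<alpha> k y + (if k = 1 then 0 else \<alpha> k y))"
    unfolding lincomb_def by (intro sum.cong) (auto simp: \<theta>coef_def)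
  also have "\<dots> = (\<Sum>k=1..n. \<alpha> k y) + (\<Sum>k=2..n. \<alpha> k y)"
    unfolding sum.distrib
    by (rule arg_cong[of _ _ "\<lambda>s. _ + s"], rule sum.mono_neutral_cong_right) auto
  finally show "theta11 y = lincomb (\<lambda>j. int (\<theta>coef j)) y" by (simp add: theta11_def)
qed

lemma equals_theta11:
  assumes \<beta>: "\<beta> \<in> pos" and c: "coef \<beta> 1 = 1" "coef \<beta> 2 = 2"
  shows "\<beta> = theta11"
proof -
  let ?c = "\<lambda>j. int (coef \<beta> j)"
  have "(\<Sum>j=3..n. (?c j - ?c (j - 1))\<^sup>2) \<le> 0"
    using sqnorm_root[OF \<beta>] sqnorm_split[of ?c] c coef(1)[OF \<beta>, of 0] by simp
  then have "(\<Sum>j=3..n. (?c j - ?c (j - 1))\<^sup>2) = 0" by (intro antisym sum_nonneg) auto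
  then have z: "?c j = ?c (j - 1)" if "j \<in> {3..n}" for j
    using that by (subst (asm) sum_nonneg_eq_0_iff) auto
  have "?c (k + 2) = 2" if "k + 2 \<le> n" for k
    using that
  proof (induction k)
    case (Suc k)
    then show ?case using z[of "Suc k + 2"] by simp
  qed (use c in \<open>simp add: numeral_2_eq_2\<close>)
  then have two: "?c j = 2" if "2 \<le> j" "j \<le> n" for j using that by (metis le_add_diff_inverse2)
  have "lincomb ?c = lincomb (\<lambda>j. int (\<theta>coef j))"
    by (rule lincomb_cong) (use two c in \<open>auto simp: \<theta>coef_def\<close>)
  then show ?thesis using coef(2)[OF \<beta>] theta11_lincomb by simp
qed

lemma coef_bounds:
  assumes \<beta>: "\<beta> \<in> pos"
  shows "coef \<beta> 1 \<le> 1" "coef \<beta> 2 \<le> 2" "coef \<beta> 2 = 2 \<Longrightarrow> \<beta> = theta11"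
proof -
  let ?c = "\<lambda>j. int (coef \<beta> j)"
  have "(\<Sum>j=3..n. (?c j - ?c (j - 1))\<^sup>2) \<ge> 0" by (rule sum_nonneg) simp
  then have q: "(?c 1)\<^sup>2 + (?c 2 - ?c 1)\<^sup>2 \<le> 2"
    using sqnorm_root[OF \<beta>] sqnorm_split[of ?c] coef(1)[OF \<beta>, of 0] by simp
  have *: "a \<le> 1" if "a\<^sup>2 \<le> 2" "a \<ge> 0" for a :: int
  proof (rule ccontr)
    assume "\<not> a \<le> 1"
    then have "2 * 2 \<le> a * a" by (intro mult_mono) auto
    with that show False by (simp add: power2_eq_square)
  qed
  have "(?c 1)\<^sup>2 \<le> 2" using q zero_le_power2[of "?c 2 - ?c 1"] by linarith
  then show c1: "coef \<beta> 1 \<le> 1" using *[of "?c 1"] by simp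
  have "(?c 2 - ?c 1)\<^sup>2 \<le> 2" using q zero_le_power2[of "?c 1"] by linarith
  then have c2: "?c 2 - ?c 1 \<le> 1" using *[of "?c 2 - ?c 1"] by linarith
  then show "coef \<beta> 2 \<le> 2" using c1 by linarith
  show "\<beta> = theta11" if "coef \<beta> 2 = 2"
    using c1 c2 that by (intro equals_theta11[OF \<beta>]) linarith+
qed

text \<open>Among the roots of squared length \<open>2\<close> one of maximal height pairs nonnegatively with all simple
  coroots; its coordinates are then nonnegative, weakly decreasing integers with square sum \<open>2\<close>.\<close>

lemma theta11_pos: "theta11 \<in> pos" and coef_theta11: "coef theta11 = \<theta>coef"
proof -
  let ?ht = "\<lambda>\<beta>. \<Sum>j=1..n. coef \<beta> j"
  let ?S = "{\<beta> \<in> pos. sqnorm (\<lambda>j. int (coef \<beta> j)) = 2}"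
  have "finite ?S" using finite_pos by simp
  moreover have "\<alpha> 1 \<in> ?S" using simple_positive[of 1] sqnorm_simple[of 1] rank by auto
  ultimately have "finite (?ht ` ?S)" "?ht ` ?S \<noteq> {}" by blast+
  then have "Max (?ht ` ?S) \<in> ?ht ` ?S" by (rule Max_in)
  then obtain \<beta> where \<beta>: "\<beta> \<in> ?S" "Max (?ht ` ?S) = ?ht \<beta>" by blast
  have max: "?ht \<gamma> \<le> ?ht \<beta>" if "\<gamma> \<in> ?S" for \<gamma>
    using \<beta>(2) Max_ge[OF \<open>finite (?ht ` ?S)\<close>, of "?ht \<gamma>"] that by simp
  have \<beta>pos: "\<beta> \<in> pos" and norm: "sqnorm (\<lambda>j. int (coef \<beta> j)) = 2" using \<beta> by auto
  let ?c = "\<lambda>j. int (coef \<beta> j)"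
  let ?x = "\<lambda>j. ?c j - ?c (j - 1)"
  have c0: "?c 0 = 0" using coef(1)[OF \<beta>pos, of 0] by simp
  \<comment> \<open>A negative pairing would allow a reflection to a higher root of the same length.\<close>
  have dom: "pairing ?c i \<ge> 0" if i: "i \<in> {1..n}" for i
  proof (rule ccontr)
    assume neg: "\<not> 0 \<le> pairing ?c i"
    obtain \<gamma> where \<gamma>: "\<gamma> \<in> pos" "(\<lambda>j. int (coef \<gamma> j)) = ?c(i := ?c i - pairing ?c i)"
      by (rule reflected_root[OF \<beta>pos i i]) (use neg in auto)
    have "\<gamma> \<in> ?S" using \<gamma> norm sqnorm_reflection[OF i, of ?c, OF c0] by simp
    have le: "coef \<beta> k \<le> coef \<gamma> k" for k using fun_cong[OF \<gamma>(2), of k] neg by (auto split: if_splits)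
    have "coef \<beta> i < coef \<gamma> i" using fun_cong[OF \<gamma>(2), of i] neg by auto
    then have "?ht \<beta> < ?ht \<gamma>" using i le by (intro sum_strict_mono_ex1) auto
    then show False using max[OF \<open>\<gamma> \<in> ?S\<close>] by simp
  qed
  \<comment> \<open>\<open>?x\<close> are the coordinates of \<open>\<beta>\<close> with respect to the \<open>\<epsilon>\<^sub>j\<close>.\<close>
  have step: "?x (Suc j) \<le> ?x j" if "1 \<le> j" "j < n" for j
    using dom[of j] that by (simp add: pairing_def)
  have last: "?x n \<ge> 0" using dom[of n] rank by (simp add: pairing_def)
  have nonneg: "k < n \<Longrightarrow> ?x (n - k) \<ge> 0" for k
  proof (induction k)
    case (Suc k)
    moreover have "Suc (n - Suc k) = n - k" using Suc.prems by simp
    ultimately show ?case using step[of "n - Suc k"] by (auto simp: Suc_le_eq)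
  qed (use last in simp)
  have x0: "?x j \<ge> 0" if "1 \<le> j" "j \<le> n" for j using nonneg[of "n - j"] that by simp
  have c1: "coef \<beta> 1 \<le> 1" and c2: "coef \<beta> 2 \<le> 2" by (rule coef_bounds[OF \<beta>pos])+
  have const: "?x (j + 2) \<le> ?x 2" if "j + 2 \<le> n" for j
    using that
  proof (induction j)
    case (Suc j)
    then show ?case using step[of "j + 2"] by simp
  qed (simp add: numeral_2_eq_2)
  have "coef \<beta> 2 = 2"
  proof (rule ccontr)
    assume "coef \<beta> 2 \<noteq> 2"
    then have "coef \<beta> 2 \<le> 1" using c2 by simp
    moreover have "?x 2 \<le> ?x 1" "?x 2 \<ge> 0" using step[of 1] x0[of 2] rank by (simp_all add: numeral_2_eq_2)
    ultimately have x2: "?x 2 = 0" using c0 by simp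
    have "?x j = 0" if "j \<in> {3..n}" for j
    proof -
      have "j - 2 + 2 = j" using that by auto
      then have "?x j \<le> ?x 2" using const[of "j - 2"] that by simp
      then show ?thesis using x0[of j] that x2 by simp
    qed
    then have "(\<Sum>j=3..n. (?x j)\<^sup>2) = 0" by simp
    then have "(?c 1)\<^sup>2 = 2" using norm sqnorm_split[of ?c] x2 c0 by simp
    moreover have "coef \<beta> 1 = 0 \<or> coef \<beta> 1 = 1" using c1 by linarith
    ultimately show False by auto
  qed
  then have eq: "\<beta> = theta11" by (rule coef_bounds(3)[OF \<beta>pos])
  then show t: "theta11 \<in> pos" using \<beta>pos by simp
  show "coef theta11 = \<theta>coef"
  proof (rule ext)
    fix j
    show "coef theta11 j = \<theta>coef j"
      using coef_unique[OF t theta11_lincomb, of j] coef(1)[OF t, of j] rank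
      by (cases "j \<in> {1..n}") (auto simp: \<theta>coef_def split: if_splits)
  qed
qed

lemma theta11_h: "i \<in> {1..n} \<Longrightarrow> theta11 (h i) = (if i = 2 then (if n = 2 then 2 else 1) else 0)"
  unfolding root_h[OF theta11_pos] coef_theta11 using rank by (auto simp: pairing_def \<theta>coef_def)

lemma theta11_dual: "theta11 \<in> dual H"
  by (rule positive_roots_dual[OF theta11_pos])

lemma theta11_highest: "\<beta> \<in> pos \<Longrightarrow> (\<lambda>y. \<beta> y + theta11 y) \<notin> pos"
proof
  assume \<beta>: "\<beta> \<in> pos" and p: "(\<lambda>y. \<beta> y + theta11 y) \<in> pos"
  have "(\<lambda>y. \<beta> y + theta11 y) = lincomb (\<lambda>j. int (coef \<beta> j) + int (\<theta>coef j))"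
    using coef(2)[OF \<beta>] theta11_lincomb by (simp add: fun_eq_iff lincomb_add)
  from coef_unique[OF p this, of 2] have "coef (\<lambda>y. \<beta> y + theta11 y) 2 = coef \<beta> 2 + 2"
    using rank by (simp add: \<theta>coef_def)
  with coef_bounds(2,3)[OF p] have "(\<lambda>y. \<beta> y + theta11 y) = theta11" by simp
  then have "\<beta> = (\<lambda>_. 0)" by (simp add: fun_eq_iff)
  then show False using root_nonzero[OF positive_roots_root[OF \<beta>]] by simp
qed

end

section \<open>The Casimir element\<close>

context simple_lie
begin

lemma rank_pos: "1 \<le> n"
proof (rule ccontr)
  assume "\<not> 1 \<le> n"
  then have "n = 0" by simp
  then have "pos = {}" by (auto simp: positive_roots_def roots_def)
  then have "roots H = {}" using root_cases by blast
  then have zero: "\<beta> = (\<lambda>_. 0)" if "\<beta> \<in> dual H" "x \<in> root_space H \<beta>" "x \<noteq> 0" for \<beta> x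
    using that unfolding roots_def by blast
  have inH: "x \<in> H" for x
  proof (rule weight_induct[OF H_subspace])
    show "x \<in> H" if "\<beta> \<in> dual H" "x \<in> root_space H \<beta>" for \<beta> x
      using zero[OF that] that(2) root_space_zero subspace_zero[OF H_subspace] by (cases "x = 0") auto
  qed
  obtain x y :: 'g where "bracket x y \<noteq> 0" using simple unfolding simple_lie_algebra_def by blast
  then show False using H_abelian[OF inH inH] by simp
qed

lemma dual_basis_exists: "\<exists>d. \<forall>b\<in>basis. \<forall>b'\<in>basis. \<kappa> b' (d b) = (if b' = b then 1 else 0)"
proof -
  define L where "L z = (\<Sum>b\<in>basis. \<kappa> b z *\<^sub>C b)" for z
  have lin: "clin L"
    by (intro clinI) (simp_all add: L_def \<kappa>_add_right \<kappa>_scale_right scaleC_add_left sum.distrib complex_vector.scale_sum_right)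
  interpret fd: finite_dimensional_vector_space "scaleC :: complex \<Rightarrow> 'g \<Rightarrow> 'g" basis
    using basis by unfold_locales (simp_all add: cspan_def)
  have coords: "u = w" if "(\<Sum>b\<in>basis. u b *\<^sub>C b) = (\<Sum>b\<in>basis. w b *\<^sub>C b)" "\<And>b. b \<notin> basis \<Longrightarrow> u b = w b" for u w :: "'g \<Rightarrow> complex"
  proof
    fix b
    have "(\<Sum>b\<in>basis. (u b - w b) *\<^sub>C b) = 0"
      using that(1) by (simp add: complex_vector.scale_left_diff_distrib sum_subtractf)
    from complex_vector.independentD[OF basis(1) basis(3) order_refl this, of b]
    show "u b = w b" using that(2)[of b] by (cases "b \<in> basis") auto
  qed
  have ker: "z = 0" if "L z = 0" for z
  proof (rule \<kappa>_nondegenerate[OF rank_pos])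
    fix x
    have "(\<Sum>b\<in>basis. \<kappa> b z *\<^sub>C b) = 0" using that by (simp add: L_def)
    from complex_vector.independentD[OF basis(1) basis(3) order_refl this]
    have "\<kappa> z b \<in> {0}" if "b \<in> basis" for b using that \<kappa>_sym[of z b] by simp
    from span_induct_clin[OF in_span_basis clin_\<kappa> subspace_zero_set this] show "\<kappa> z x = 0" by simp
  qed
  have "inj L"
    by (rule injI) (use ker clin_diff[OF lin] in \<open>metis eq_iff_diff_eq_0\<close>)
  moreover have "Vector_Spaces.linear scaleC scaleC L"
    using lin by (simp add: Vector_Spaces.linear_iff clin_def complex_vector.vector_space_axioms)
  ultimately have "surj L" using fd.linear_inj_imp_surj by blast
  have "\<exists>z. \<forall>b'\<in>basis. \<kappa> b' z = (if b' = b then 1 else 0)" if b: "b \<in> basis" for b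
  proof -
    obtain z where z: "L z = b" using \<open>surj L\<close> by (metis surjD)
    have "(\<Sum>b'\<in>basis. (if b' = b then 1 else 0) *\<^sub>C b') = (\<Sum>b'\<in>basis. if b' = b then b else 0)"
      by (intro sum.cong) auto
    also have "\<dots> = b" using b basis(3) by simp
    finally have "(\<Sum>b'\<in>basis. (if b' \<in> basis then \<kappa> b' z else 0) *\<^sub>C b') = (\<Sum>b'\<in>basis. (if b' = b then 1 else 0) *\<^sub>C b')"
      using z by (simp add: L_def)
    then have "(\<lambda>b'. if b' \<in> basis then \<kappa> b' z else 0) = (\<lambda>b'. if b' = b then 1 else 0)"
      by (rule coords) (use b in auto)
    then show ?thesis by (metis (no_types, lifting))
  qed
  then show ?thesis by (intro bchoice ballI)
qed

definition db :: "'g \<Rightarrow> 'g" where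
  "db = (SOME d. \<forall>b\<in>basis. \<forall>b'\<in>basis. \<kappa> b' (d b) = (if b' = b then 1 else 0))"

lemma db: "b \<in> basis \<Longrightarrow> b' \<in> basis \<Longrightarrow> \<kappa> b' (db b) = (if b' = b then 1 else 0)"
  using someI_ex[OF dual_basis_exists] unfolding db_def by blast

lemma db_left: "b \<in> basis \<Longrightarrow> b' \<in> basis \<Longrightarrow> \<kappa> (db b) b' = (if b' = b then 1 else 0)"
  using db[of b b'] \<kappa>_sym[of "db b" b'] by simp

lemma expand_basis: "x = (\<Sum>b\<in>basis. \<kappa> x (db b) *\<^sub>C b)"
proof -
  show ?thesis
  proof (rule clin_span_eq[where f = "\<lambda>x. x" and g = "\<lambda>x. \<Sum>b\<in>basis. \<kappa> x (db b) *\<^sub>C b", OF _ _ _ in_span_basis])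
    fix b' assume b': "b' \<in> basis"
    have "(\<Sum>b\<in>basis. \<kappa> b' (db b) *\<^sub>C b) = (\<Sum>b\<in>basis. if b' = b then b' else 0)"
      by (intro sum.cong refl) (simp add: db[OF _ b'])
    then show "b' = (\<Sum>b\<in>basis. \<kappa> b' (db b) *\<^sub>C b)" using b' basis(3) by simp
  qed (auto intro!: clinI simp: \<kappa>_add_left \<kappa>_scale_left scaleC_add_left sum.distrib complex_vector.scale_sum_right)
qed

lemma \<kappa>_basis_ext: "(\<And>b. b \<in> basis \<Longrightarrow> \<kappa> x b = \<kappa> y b) \<Longrightarrow> x = y"
proof -
  assume *: "\<And>b. b \<in> basis \<Longrightarrow> \<kappa> x b = \<kappa> y b"
  have "\<kappa> (x - y) z \<in> {0}" for z
    by (rule span_induct_clin[OF in_span_basis clin_\<kappa> subspace_zero_set]) (simp add: \<kappa>_diff_left *)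
  then show "x = y" using \<kappa>_nondegenerate[OF rank_pos, of "x - y"] by simp
qed

lemma expand_dual_basis: "x = (\<Sum>b\<in>basis. \<kappa> x b *\<^sub>C db b)"
proof (rule \<kappa>_basis_ext)
  fix b' assume b': "b' \<in> basis"
  have "\<kappa> (\<Sum>b\<in>basis. \<kappa> x b *\<^sub>C db b) b' = (\<Sum>b\<in>basis. if b = b' then \<kappa> x b' else 0)"
    unfolding \<kappa>_sum_left \<kappa>_scale_left by (intro sum.cong refl) (simp add: db_left[OF _ b'])
  then show "\<kappa> x b' = \<kappa> (\<Sum>b\<in>basis. \<kappa> x b *\<^sub>C db b) b'" using b' basis(3) by simp
qed

lemma db_weight: assumes b: "b \<in> basis" shows "db b \<in> root_space H (\<lambda>y. - wt b y)"
proof -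
  have "bracket y (db b) = (- wt b y) *\<^sub>C db b" if y: "y \<in> H" for y
  proof (rule \<kappa>_basis_ext)
    fix b' assume b': "b' \<in> basis"
    have "\<kappa> (bracket y (db b)) b' = - \<kappa> (db b) (bracket y b')"
      using bracket_antisym[of y "db b"] by (simp add: \<kappa>_minus_left \<kappa>_invariant)
    also have "\<dots> = - (wt b' y * \<kappa> b' (db b))"
      using root_spaceD[OF wt(2)[OF b'] y] \<kappa>_sym by (simp add: \<kappa>_scale_right)
    also have "\<dots> = - (wt b y * \<kappa> b' (db b))" using db[OF b b'] by auto
    finally show "\<kappa> (bracket y (db b)) b' = \<kappa> ((- wt b y) *\<^sub>C db b) b'"
      using \<kappa>_sym[of "db b" b'] by (simp add: \<kappa>_scale_left \<kappa>_minus_left)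
  qed
  then show ?thesis by (simp add: root_space_def)
qed

lemma weight_vector_span:
  assumes "\<gamma> \<in> dual H" "x \<in> root_space H \<gamma>"
  shows "x \<in> cspan {b \<in> basis. wt b = \<gamma>}"
proof -
  have z: "\<kappa> x (db b) = 0" if "b \<in> basis" "wt b \<noteq> \<gamma>" for b
    by (rule \<kappa>_orthogonal[OF assms(1) dual_minus[OF wt(1)[OF that(1)]] _ assms(2) db_weight[OF that(1)]])
      (use that in \<open>auto simp: fun_eq_iff\<close>)
  have "(\<Sum>b\<in>basis. \<kappa> x (db b) *\<^sub>C b) \<in> cspan {b \<in> basis. wt b = \<gamma>}"
  proof (rule complex_vector.span_sum)
    fix b assume "b \<in> basis"
    then show "\<kappa> x (db b) *\<^sub>C b \<in> cspan {b \<in> basis. wt b = \<gamma>}"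
      using z[of b] by (cases "wt b = \<gamma>") (auto intro: complex_vector.span_scale complex_vector.span_base complex_vector.span_zero)
  qed
  then show ?thesis using expand_basis[of x] by simp
qed

definition casimir :: "'g uea" where
  "casimir = (\<Sum>b\<in>basis. uea_embed b * uea_embed (db b))"

lemma casimir_embed: "uea_embed y * casimir = casimir * uea_embed y"
proof -
  have "uea_embed y * casimir - casimir * uea_embed y
      = (\<Sum>b\<in>basis. uea_embed (bracket y b) * uea_embed (db b) + uea_embed b * uea_embed (bracket y (db b)))"
    unfolding casimir_def sum_distrib_left sum_distrib_right sum_subtractf[symmetric]
    by (intro sum.cong refl) (simp add: embed_bracket algebra_simps)
  also have "\<dots> = (\<Sum>b\<in>basis. uea_embed (bracket y b) * uea_embed (db b)) + (\<Sum>b\<in>basis. uea_embed b * uea_embed (bracket y (db b)))"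
    by (rule sum.distrib)
  also have "(\<Sum>b\<in>basis. uea_embed (bracket y b) * uea_embed (db b))
      = (\<Sum>b\<in>basis. \<Sum>b'\<in>basis. \<kappa> (bracket y b) (db b') *\<^sub>C (uea_embed b' * uea_embed (db b)))"
    by (intro sum.cong refl, subst expand_basis[of "bracket y _"])
      (simp add: embed_sum embed_scaleC sum_distrib_right uea_scale_left)
  also have "\<dots> = (\<Sum>b'\<in>basis. \<Sum>b\<in>basis. \<kappa> (bracket y b) (db b') *\<^sub>C (uea_embed b' * uea_embed (db b)))"
    by (rule sum.swap)
  also have "(\<Sum>b\<in>basis. uea_embed b * uea_embed (bracket y (db b)))
      = (\<Sum>b\<in>basis. \<Sum>b'\<in>basis. \<kappa> (bracket y (db b)) b' *\<^sub>C (uea_embed b * uea_embed (db b')))"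
    by (intro sum.cong refl, subst expand_dual_basis[of "bracket y _"])
      (simp add: embed_sum embed_scaleC sum_distrib_left uea_scale_right)
  also have "\<dots> = (\<Sum>b\<in>basis. \<Sum>b'\<in>basis. (- \<kappa> (bracket y b') (db b)) *\<^sub>C (uea_embed b * uea_embed (db b')))"
  proof (intro sum.cong refl)
    fix b b'
    have "\<kappa> (bracket y (db b)) b' = - \<kappa> (bracket y b') (db b)"
      using bracket_antisym[of y "db b"] \<kappa>_invariant[of "db b" y b'] by (simp add: \<kappa>_minus_left \<kappa>_sym[of "db b" "bracket y b'"])
    then show "\<kappa> (bracket y (db b)) b' *\<^sub>C (uea_embed b * uea_embed (db b')) = (- \<kappa> (bracket y b') (db b)) *\<^sub>C (uea_embed b * uea_embed (db b'))"
      by simp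
  qed
  finally show ?thesis by (simp add: sum_negf)
qed

lemma casimir_central: "u * casimir = casimir * u"
proof (induction u rule: uea_induct)
  case (mult x u)
  then show ?case by (metis casimir_embed mult.assoc)
qed (simp_all add: distrib_left distrib_right uea_scale_left uea_scale_right)

definition cas_term :: "('g \<Rightarrow> complex) \<Rightarrow> 'g \<Rightarrow> complex" where
  "cas_term \<nu> b = (if wt b = (\<lambda>_. 0) then \<nu> b * \<nu> (db b) else if wt b \<in> pos then \<nu> (bracket b (db b)) else 0)"

definition cas :: "('g \<Rightarrow> complex) \<Rightarrow> complex" where
  "cas \<nu> = (\<Sum>b\<in>basis. cas_term \<nu> b)"

lemma basis_H: "b \<in> basis \<Longrightarrow> wt b = (\<lambda>_. 0) \<Longrightarrow> b \<in> H" "b \<in> basis \<Longrightarrow> wt b = (\<lambda>_. 0) \<Longrightarrow> db b \<in> H"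
  using wt(2)[of b] db_weight[of b] root_space_zero by auto

lemma bracket_db_H: "b \<in> basis \<Longrightarrow> bracket b (db b) \<in> H"
  using bracket_root_space[OF wt(2) db_weight, of b b] root_space_zero by simp

text \<open>Only the terms with \<open>b \<in> H\<close> and, after commuting, those with \<open>b\<close> a raising operator contribute.\<close>

lemma casimir_eigen:
  assumes J: "left_ideal J" and sing: "\<And>\<beta> x. \<beta> \<in> pos \<Longrightarrow> x \<in> root_space H \<beta> \<Longrightarrow> uea_embed x * u \<in> J"
    and wt': "\<And>y. y \<in> H \<Longrightarrow> uea_embed y * u - \<nu> y *\<^sub>C u \<in> J"
  shows "casimir * u - cas \<nu> *\<^sub>C u \<in> J"
proof -
  note Js = left_ideal_subspace[OF J]
  have "uea_embed b * (uea_embed (db b) * u) - cas_term \<nu> b *\<^sub>C u \<in> J" if b: "b \<in> basis" for b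
  proof -
    consider "wt b = (\<lambda>_. 0)" | "wt b \<in> pos" "wt b \<noteq> (\<lambda>_. 0)" | "(\<lambda>y. - wt b y) \<in> pos" "wt b \<notin> pos" "wt b \<noteq> (\<lambda>_. 0)"
      using weight_cases[OF wt[OF b] basis_nonzero[OF b]] by blast
    then show ?thesis
    proof cases
      case 1
      have "uea_embed b * (uea_embed (db b) * u) - (\<nu> b * \<nu> (db b)) *\<^sub>C u
          = uea_embed b * (uea_embed (db b) * u - \<nu> (db b) *\<^sub>C u) + \<nu> (db b) *\<^sub>C (uea_embed b * u - \<nu> b *\<^sub>C u)"
        by (simp add: right_diff_distrib uea_scale_right complex_vector.scale_right_diff_distrib mult.commute)
      also have "\<dots> \<in> J" by (intro subspace_add[OF Js] left_ideal_mult[OF J] subspace_scale[OF Js] wt' basis_H b 1)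
      finally show ?thesis using 1 by (simp add: cas_term_def)
    next
      case 2
      have "uea_embed b * (uea_embed (db b) * u) - \<nu> (bracket b (db b)) *\<^sub>C u
          = uea_embed (db b) * (uea_embed b * u) + (uea_embed (bracket b (db b)) * u - \<nu> (bracket b (db b)) *\<^sub>C u)"
        by (simp add: embed_bracket algebra_simps)
      also have "\<dots> \<in> J"
        by (intro subspace_add[OF Js] left_ideal_mult[OF J] sing[OF 2(1)] wt' wt bracket_db_H b)
      finally show ?thesis using 2 by (simp add: cas_term_def)
    next
      case 3
      have "uea_embed b * (uea_embed (db b) * u) \<in> J"
        by (intro left_ideal_mult[OF J] sing[OF 3(1)] db_weight b)
      then show ?thesis using 3 by (simp add: cas_term_def)
    qed
  qed
  then have "(\<Sum>b\<in>basis. uea_embed b * (uea_embed (db b) * u) - cas_term \<nu> b *\<^sub>C u) \<in> J"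
    by (rule subspace_sum[OF Js])
  then show ?thesis
    by (simp add: casimir_def cas_def sum_subtractf sum_distrib_right complex_vector.scale_sum_left mult.assoc)
qed

text \<open>Both sums expand \<open>h\<^sub>i\<close>, which up to the factor \<open>nrm i\<close> represents \<open>\<alpha>\<^sub>i\<close> in the Killing form, in a basis
  of \<open>H\<close>.\<close>

lemma cartan_part:
  assumes \<mu>: "\<mu> \<in> dual H" and i: "i \<in> {1..n}"
  shows "(\<Sum>b | b \<in> basis \<and> wt b = (\<lambda>_. 0). \<mu> b * \<alpha> i (db b)) = \<mu> (h i) / of_real (nrm i)"
    and "(\<Sum>b | b \<in> basis \<and> wt b = (\<lambda>_. 0). \<alpha> i b * \<mu> (db b)) = \<mu> (h i) / of_real (nrm i)"
proof -
  let ?B = "{b \<in> basis. wt b = (\<lambda>_. 0)}"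
  have hi: "h i \<in> root_space H (\<lambda>_. 0)" using h_H[OF i] root_space_zero by simp
  have orth: "\<kappa> (h i) (db b) = 0" "\<kappa> (h i) b = 0" if b: "b \<in> basis" "wt b \<noteq> (\<lambda>_. 0)" for b
    using \<kappa>_orthogonal[OF dual_zero dual_minus[OF wt(1)[OF b(1)]] _ hi db_weight[OF b(1)]]
      \<kappa>_orthogonal[OF dual_zero wt(1)[OF b(1)] _ hi wt(2)[OF b(1)]] b(2) by (auto simp: fun_eq_iff)
  have nz: "nrm i \<noteq> 0" using nrm_pos[OF i] by simp
  have "h i = (\<Sum>b\<in>?B. \<kappa> (h i) (db b) *\<^sub>C b)"
    by (subst expand_basis, rule sum.mono_neutral_right) (use basis(3) orth in auto)
  then have "\<mu> (h i) = \<mu> (\<Sum>b\<in>?B. \<kappa> (h i) (db b) *\<^sub>C b)" by simp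
  also have "\<dots> = (\<Sum>b\<in>?B. \<kappa> (h i) (db b) * \<mu> b)"
    by (rule dual_sum_arg[OF \<mu> H_subspace]) (use basis_H in auto)
  also have "\<dots> = (\<Sum>b\<in>?B. of_real (nrm i) * (\<mu> b * \<alpha> i (db b)))"
    by (intro sum.cong refl) (use \<kappa>_h[OF i] basis_H in auto)
  finally show "(\<Sum>b | b \<in> basis \<and> wt b = (\<lambda>_. 0). \<mu> b * \<alpha> i (db b)) = \<mu> (h i) / of_real (nrm i)"
    using nz by (simp add: sum_distrib_left[symmetric])
  have "h i = (\<Sum>b\<in>?B. \<kappa> (h i) b *\<^sub>C db b)"
    by (subst expand_dual_basis, rule sum.mono_neutral_right) (use basis(3) orth in auto)
  then have "\<mu> (h i) = \<mu> (\<Sum>b\<in>?B. \<kappa> (h i) b *\<^sub>C db b)" by simp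
  also have "\<dots> = (\<Sum>b\<in>?B. \<kappa> (h i) b * \<mu> (db b))"
    by (rule dual_sum_arg[OF \<mu> H_subspace]) (use basis_H in auto)
  also have "\<dots> = (\<Sum>b\<in>?B. of_real (nrm i) * (\<alpha> i b * \<mu> (db b)))"
    by (intro sum.cong refl) (use \<kappa>_h[OF i] basis_H in auto)
  finally show "(\<Sum>b | b \<in> basis \<and> wt b = (\<lambda>_. 0). \<alpha> i b * \<mu> (db b)) = \<mu> (h i) / of_real (nrm i)"
    using nz by (simp add: sum_distrib_left[symmetric])
qed

text \<open>The value of \<open>2\<rho>\<close> at \<open>h\<^sub>i\<close>, with root multiplicities.\<close>

definition twice_rho :: "nat \<Rightarrow> complex" where
  "twice_rho i = (\<Sum>b | b \<in> basis \<and> wt b \<in> pos. wt b (h i))"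

text \<open>The sum of all positive roots outside \<open>\<nat> \<alpha>\<^sub>i\<close> vanishes at \<open>h\<^sub>i = [e\<^sub>i, f\<^sub>i]\<close>, because it is
  the trace of a commutator of operators on the span of their root spaces; what remains is
  positive.\<close>

lemma twice_rho_pos:
  assumes i: "i \<in> {1..n}" obtains r :: real where "r > 0" "twice_rho i = of_real r"
proof -
  \<comment> \<open>\<open>U\<close> collects the roots that involve a simple root other than \<open>\<alpha>\<^sub>i\<close>, \<open>R\<close> the multiples of \<open>\<alpha>\<^sub>i\<close>.\<close>
  define U where "U = {b \<in> basis. wt b \<in> pos \<and> (\<exists>j\<in>{1..n}. j \<noteq> i \<and> coef (wt b) j > 0)}"
  define R where "R = {b \<in> basis. wt b \<in> pos \<and> \<not> (\<exists>j\<in>{1..n}. j \<noteq> i \<and> coef (wt b) j > 0)}"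
  have fin: "finite U" "finite R" "U \<inter> R = {}" "U \<union> R = {b \<in> basis. wt b \<in> pos}" using basis(3) by (auto simp: U_def R_def)
  have indU: "complex_vector.independent U"
    by (rule complex_vector.independent_mono[OF basis(1)]) (auto simp: U_def)
  have stable: "bracket x b \<in> cspan U"
    if b: "b \<in> U" and x: "x \<in> root_space H \<delta>" "\<delta> = lincomb c" "\<And>j. j \<noteq> i \<Longrightarrow> c j = 0" for x b \<delta> c
  proof (cases "bracket x b = 0")
    case False
    let ?\<gamma> = "\<lambda>y. \<delta> y + wt b y"
    have bb: "b \<in> basis" "wt b \<in> pos" using b by (auto simp: U_def)
    obtain j where j: "j \<in> {1..n}" "j \<noteq> i" "coef (wt b) j > 0" using b by (auto simp: U_def)
    have rs: "bracket x b \<in> root_space H ?\<gamma>" by (rule bracket_root_space[OF x(1) wt(2)[OF bb(1)]])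
    have eq: "?\<gamma> = lincomb (\<lambda>j. c j + int (coef (wt b) j))"
      using coef(2)[OF bb(2)] x(2) by (simp add: fun_eq_iff lincomb_add)
    have cj: "c j + int (coef (wt b) j) > 0" using x(3)[OF j(2)] j(3) by simp
    have nz: "?\<gamma> \<noteq> (\<lambda>_. 0)"
    proof
      assume "?\<gamma> = (\<lambda>_. 0)"
      then have "lincomb (\<lambda>j. c j + int (coef (wt b) j)) = lincomb (\<lambda>_. 0)" using eq lincomb_zero by simp
      from lincomb_unique[OF this j(1)] cj show False by simp
    qed
    have dual: "?\<gamma> \<in> dual H" unfolding eq by (rule lincomb_dual)
    have "?\<gamma> \<in> roots H" using dual nz rs False unfolding roots_def by blast
    then have "lincomb (\<lambda>j. c j + int (coef (wt b) j)) \<in> roots H" using eq by simp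
    note p = positive_of_coefficient[OF this j(1) cj]
    have "coef ?\<gamma> j > 0" using p(2)[OF j(1)] cj eq by simp
    then have "{b \<in> basis. wt b = ?\<gamma>} \<subseteq> U" using p(1) eq j by (auto simp: U_def)
    then show ?thesis using weight_vector_span[OF dual rs] complex_vector.span_mono by blast
  qed (simp add: complex_vector.span_zero)
  have \<alpha>l: "\<alpha> i = lincomb (\<lambda>j. if j = i then 1 else 0)" "(\<lambda>y. - \<alpha> i y) = lincomb (\<lambda>j. if j = i then - 1 else 0)"
    using lincomb_indicator[OF i, of 1] lincomb_indicator[OF i, of "- 1"] by (simp_all add: fun_eq_iff)
  have e: "bracket (ev i) b \<in> cspan U" and f: "bracket (fv i) b \<in> cspan U" if "b \<in> U" for b
    using stable[OF that ev(1)[OF i] \<alpha>l(1)] stable[OF that fv_root_space[OF i] \<alpha>l(2)] by auto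
  have comp: "bracket x (bracket z b) \<in> cspan U"
    if "\<And>b. b \<in> U \<Longrightarrow> bracket x b \<in> cspan U" "\<And>b. b \<in> U \<Longrightarrow> bracket z b \<in> cspan U" "b \<in> U" for x z b
    by (rule span_induct_clin[OF that(2)[OF that(3)] clin_ad complex_vector.subspace_span that(1)])
  have "btrace U (\<lambda>v. bracket (h i) v) = btrace U (\<lambda>v. bracket (ev i) (bracket (fv i) v) - bracket (fv i) (bracket (ev i) v))"
    by (simp add: ev(2)[OF i, symmetric] ad_bracket_operator)
  also have "\<dots> = btrace U (\<lambda>v. bracket (ev i) (bracket (fv i) v)) - btrace U (\<lambda>v. bracket (fv i) (bracket (ev i) v))"
    by (rule btrace_diff[OF indU]) (intro comp e f; assumption)+
  also have "\<dots> = 0"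
    by (simp add: btrace_commute[OF fin(1) indU clin_ad clin_ad e f])
  finally have "btrace U (\<lambda>v. bracket (h i) v) = 0" .
  moreover have "btrace U (\<lambda>v. bracket (h i) v) = (\<Sum>b\<in>U. wt b (h i))"
    by (rule btrace_diagonal[OF indU]) (auto simp: U_def intro: root_spaceD wt h_H i)
  ultimately have U0: "(\<Sum>b\<in>U. wt b (h i)) = 0" by simp
  have R: "wt b (h i) = of_real (2 * real (coef (wt b) i))" "coef (wt b) i > 0" if "b \<in> R" for b
  proof -
    have p: "wt b \<in> pos" and z: "coef (wt b) j = 0" if "j \<in> {1..n}" "j \<noteq> i" for j using \<open>b \<in> R\<close> that by (auto simp: R_def)
    have p: "wt b \<in> pos" using that by (simp add: R_def)
    have "lincomb (\<lambda>j. int (coef (wt b) j)) = lincomb (\<lambda>j. if j = i then int (coef (wt b) i) else 0)"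
      by (rule lincomb_cong) (use z in auto)
    then have "wt b (h i) = of_int (int (coef (wt b) i)) * \<alpha> i (h i)"
      using coef(2)[OF p] lincomb_indicator[OF i, of "int (coef (wt b) i)" "h i"] by metis
    then show "wt b (h i) = of_real (2 * real (coef (wt b) i))" using \<alpha>_h[OF i] by simp
    show "coef (wt b) i > 0" using coef_nonzero[OF p] z by (metis less_numeral_extra(3))
  qed
  have "ev i \<noteq> 0" using ev(2)[OF i] \<alpha>_h[OF i] dual_lin(3)[OF \<alpha>_dual[OF i] H_subspace h_H[OF i] h_H[OF i]] by auto
  then obtain b where b: "b \<in> basis" "wt b = \<alpha> i" using weight_in_basis[OF \<alpha>_dual[OF i] ev(1)[OF i]] by auto
  have "b \<in> R" using b simple_positive[OF i] coef_simple[OF i] by (simp add: R_def)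
  then have "R \<noteq> {}" by blast
  have "twice_rho i = (\<Sum>b\<in>U \<union> R. wt b (h i))" unfolding twice_rho_def fin(4) ..
  also have "\<dots> = (\<Sum>b\<in>R. wt b (h i))" using sum.union_disjoint[OF fin(1,2,3), of "\<lambda>b. wt b (h i)"] U0 by simp
  also have "\<dots> = of_real (\<Sum>b\<in>R. 2 * real (coef (wt b) i))" using R(1) by simp
  finally have "twice_rho i = of_real (\<Sum>b\<in>R. 2 * real (coef (wt b) i))" .
  moreover have "(\<Sum>b\<in>R. 2 * real (coef (wt b) i)) > 0" using fin(2) \<open>R \<noteq> {}\<close> R(2) by (intro sum_pos) auto
  ultimately show thesis using that by blast
qed

lemma sum_lincomb:
  "(\<Sum>b\<in>S. lincomb c (p b) * q b) = (\<Sum>i=1..n. of_int (c i) * (\<Sum>b\<in>S. \<alpha> i (p b) * q b))"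
  unfolding lincomb_def sum_distrib_right sum_distrib_left by (subst sum.swap) (simp add: mult.assoc)

text \<open>The formula \<open>(\<mu> + \<nu> + 2\<rho>, \<mu> - \<nu>)\<close>, with \<open>\<mu> - \<nu>\<close> expanded in simple roots.\<close>

lemma cas_difference:
  assumes \<nu>: "\<nu> \<in> dual H" and \<mu>: "\<mu> = (\<lambda>y. \<nu> y + lincomb c y)"
  shows "cas \<mu> - cas \<nu> = (\<Sum>i=1..n. of_int (c i) * ((\<mu> (h i) + \<nu> (h i) + twice_rho i) / of_real (nrm i)))"
proof -
  let ?B = "{b \<in> basis. wt b = (\<lambda>_. 0)}" and ?P = "{b \<in> basis. wt b \<in> pos}"
  have disj: "?B \<inter> ?P = {}" using root_nonzero positive_roots_root by auto
  have \<mu>d: "\<mu> \<in> dual H" unfolding \<mu> by (rule dual_add[OF \<nu> lincomb_dual])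
  have split: "cas \<xi> = (\<Sum>b\<in>?B. \<xi> b * \<xi> (db b)) + (\<Sum>b\<in>?P. \<xi> (bracket b (db b)))" for \<xi>
  proof -
    have "cas \<xi> = (\<Sum>b\<in>?B \<union> ?P. cas_term \<xi> b)"
      unfolding cas_def using basis(3) by (intro sum.mono_neutral_right) (auto simp: cas_term_def)
    also have "\<dots> = (\<Sum>b\<in>?B. cas_term \<xi> b) + (\<Sum>b\<in>?P. cas_term \<xi> b)"
      using basis(3) disj by (intro sum.union_disjoint) auto
    also have "(\<Sum>b\<in>?B. cas_term \<xi> b) = (\<Sum>b\<in>?B. \<xi> b * \<xi> (db b))" by (intro sum.cong) (auto simp: cas_term_def)
    also have "(\<Sum>b\<in>?P. cas_term \<xi> b) = (\<Sum>b\<in>?P. \<xi> (bracket b (db b)))"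
      using disj by (intro sum.cong) (auto simp: cas_term_def)
    finally show ?thesis .
  qed
  have "(\<Sum>b\<in>?B. \<mu> b * \<mu> (db b)) - (\<Sum>b\<in>?B. \<nu> b * \<nu> (db b))
      = (\<Sum>b\<in>?B. lincomb c b * \<mu> (db b)) + (\<Sum>b\<in>?B. \<nu> b * lincomb c (db b))"
    unfolding sum_subtractf[symmetric] sum.distrib[symmetric] by (intro sum.cong refl) (simp add: \<mu> algebra_simps)
  also have "(\<Sum>b\<in>?B. lincomb c b * \<mu> (db b)) = (\<Sum>i=1..n. of_int (c i) * (\<Sum>b\<in>?B. \<alpha> i b * \<mu> (db b)))"
    by (rule sum_lincomb)
  also have "\<dots> = (\<Sum>i=1..n. of_int (c i) * (\<mu> (h i) / of_real (nrm i)))"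
    by (intro sum.cong refl) (simp add: cartan_part(2)[OF \<mu>d])
  also have "(\<Sum>b\<in>?B. \<nu> b * lincomb c (db b)) = (\<Sum>i=1..n. of_int (c i) * (\<Sum>b\<in>?B. \<nu> b * \<alpha> i (db b)))"
    using sum_lincomb[of c db \<nu> ?B] by (simp add: mult.commute)
  also have "\<dots> = (\<Sum>i=1..n. of_int (c i) * (\<nu> (h i) / of_real (nrm i)))"
    by (intro sum.cong refl) (simp add: cartan_part(1)[OF \<nu>])
  finally have 1: "(\<Sum>b\<in>?B. \<mu> b * \<mu> (db b)) - (\<Sum>b\<in>?B. \<nu> b * \<nu> (db b))
      = (\<Sum>i=1..n. of_int (c i) * (\<mu> (h i) / of_real (nrm i))) + (\<Sum>i=1..n. of_int (c i) * (\<nu> (h i) / of_real (nrm i)))" .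
  have br: "\<alpha> i (bracket b (db b)) = wt b (h i) / of_real (nrm i)" if i: "i \<in> {1..n}" and b: "b \<in> ?P" for i b
  proof -
    have bb: "b \<in> basis" using b by simp
    have "of_real (nrm i) * \<alpha> i (bracket b (db b)) = \<kappa> (bracket (h i) b) (db b)"
      using \<kappa>_h[OF i bracket_db_H[OF bb]] by (simp add: \<kappa>_invariant)
    also have "\<dots> = wt b (h i)" using root_spaceD[OF wt(2)[OF bb] h_H[OF i]] db[OF bb bb] by (simp add: \<kappa>_scale_left)
    finally show ?thesis using nrm_pos[OF i] by (simp add: field_simps)
  qed
  have "(\<Sum>b\<in>?P. \<mu> (bracket b (db b))) - (\<Sum>b\<in>?P. \<nu> (bracket b (db b))) = (\<Sum>b\<in>?P. lincomb c (bracket b (db b)))"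
    unfolding sum_subtractf[symmetric] by (intro sum.cong refl) (simp add: \<mu>)
  also have "\<dots> = (\<Sum>i=1..n. of_int (c i) * (\<Sum>b\<in>?P. \<alpha> i (bracket b (db b))))"
    using sum_lincomb[of c "\<lambda>b. bracket b (db b)" "\<lambda>_. 1" ?P] by simp
  also have "\<dots> = (\<Sum>i=1..n. of_int (c i) * (twice_rho i / of_real (nrm i)))"
    unfolding twice_rho_def by (intro sum.cong refl) (simp add: br sum_divide_distrib)
  finally have 2: "(\<Sum>b\<in>?P. \<mu> (bracket b (db b))) - (\<Sum>b\<in>?P. \<nu> (bracket b (db b)))
      = (\<Sum>i=1..n. of_int (c i) * (twice_rho i / of_real (nrm i)))" .
  have "cas \<mu> - cas \<nu> = ((\<Sum>b\<in>?B. \<mu> b * \<mu> (db b)) - (\<Sum>b\<in>?B. \<nu> b * \<nu> (db b)))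
      + ((\<Sum>b\<in>?P. \<mu> (bracket b (db b))) - (\<Sum>b\<in>?P. \<nu> (bracket b (db b))))" by (simp add: split)
  also have "\<dots> = (\<Sum>i=1..n. of_int (c i) * ((\<mu> (h i) + \<nu> (h i) + twice_rho i) / of_real (nrm i)))"
    unfolding 1 2 by (simp add: sum.distrib[symmetric] add_divide_distrib distrib_left)
  finally show ?thesis .
qed

text \<open>\<open>(\<mu> + \<nu> + 2\<rho>, \<mu> - \<nu>) > 0\<close> for dominant \<open>\<mu> > \<nu>\<close>.\<close>

lemma cas_distinct:
  assumes \<nu>: "\<nu> \<in> dual H" and \<mu>: "\<mu> = (\<lambda>y. \<nu> y + lincomb (\<lambda>i. int (c i)) y)"
    and dom: "\<And>i. i \<in> {1..n} \<Longrightarrow> \<mu> (h i) \<in> \<nat>" "\<And>i. i \<in> {1..n} \<Longrightarrow> \<nu> (h i) \<in> \<nat>"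
    and c: "j \<in> {1..n}" "c j > 0"
  shows "cas \<mu> \<noteq> cas \<nu>"
proof -
  have "\<exists>r>0. (\<mu> (h i) + \<nu> (h i) + twice_rho i) / of_real (nrm i) = of_real r" if i: "i \<in> {1..n}" for i
  proof -
    obtain a b :: nat where "\<mu> (h i) = of_nat a" "\<nu> (h i) = of_nat b" using dom[OF i] by (auto elim!: Nats_cases)
    moreover obtain r where "r > 0" "twice_rho i = of_real r" by (rule twice_rho_pos[OF i])
    ultimately show ?thesis using nrm_pos[OF i] by (intro exI[of _ "(real a + real b + r) / nrm i"]) auto
  qed
  then obtain r where r: "\<And>i. i \<in> {1..n} \<Longrightarrow> r i > 0"
    "\<And>i. i \<in> {1..n} \<Longrightarrow> (\<mu> (h i) + \<nu> (h i) + twice_rho i) / of_real (nrm i) = of_real (r i)" by metis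
  have "cas \<mu> - cas \<nu> = (\<Sum>i=1..n. of_real (real (c i) * r i))"
    unfolding cas_difference[OF \<nu> \<mu>] by (intro sum.cong refl) (simp add: r(2))
  also have "\<dots> = of_real (\<Sum>i=1..n. real (c i) * r i)" by simp
  finally have eq: "cas \<mu> - cas \<nu> = of_real (\<Sum>i=1..n. real (c i) * r i)" .
  have "(\<Sum>i=1..n. real (c i) * r i) > 0"
  proof (rule sum_pos2[OF _ c(1)])
    show "0 < real (c j) * r j" using c r(1)[OF c(1)] by simp
    show "0 \<le> real (c i) * r i" if "i \<in> {1..n}" for i using r(1)[OF that] by simp
  qed simp
  with eq show ?thesis by (metis eq_iff_diff_eq_0 less_irrefl of_real_eq_0_iff)
qed

end

section \<open>Highest weight modules\<close>

context simple_lie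
begin

lemma verma_relations_subset:
  assumes A: "left_ideal A"
    and "\<And>\<beta> x. \<beta> \<in> pos \<Longrightarrow> x \<in> root_space H \<beta> \<Longrightarrow> uea_embed x \<in> A"
    and "\<And>y. y \<in> H \<Longrightarrow> uea_embed y - \<mu> y *\<^sub>C 1 \<in> A"
  shows "verma_relations \<mu> \<subseteq> A"
proof -
  have "uea_embed x \<in> A" if "x \<in> n_plus" for x
    using that unfolding n_plus_def
    by (rule span_induct_clin[OF _ clin_embed left_ideal_subspace[OF A]]) (use assms(2) in blast)
  then show ?thesis using assms(3) by (auto simp: verma_relations_def)
qed

lemma verma_relations_raising:
  assumes "verma_relations \<mu> \<subseteq> A" "\<beta> \<in> pos" "x \<in> root_space H \<beta>"
  shows "uea_embed x \<in> A"
proof -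
  have "x \<in> n_plus" unfolding n_plus_def using assms(2,3) by (intro complex_vector.span_base) blast
  then show ?thesis using assms(1) by (auto simp: verma_relations_def)
qed

lemma verma_relations_H: "verma_relations \<mu> \<subseteq> A \<Longrightarrow> y \<in> H \<Longrightarrow> uea_embed y - \<mu> y *\<^sub>C 1 \<in> A"
  by (auto simp: verma_relations_def)

inductive lower_mon :: "(nat \<Rightarrow> nat) \<Rightarrow> 'g uea \<Rightarrow> bool" where
  one: "lower_mon (\<lambda>_. 0) 1"
| step: "lower_mon c u \<Longrightarrow> \<beta> \<in> pos \<Longrightarrow> lower_mon (\<lambda>i. c i + coef \<beta> i) (uea_embed (xm \<beta>) * u)"

definition depths :: "(nat \<Rightarrow> nat) set" where
  "depths = {c. \<forall>i. i \<notin> {1..n} \<longrightarrow> c i = 0}"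

definition lower :: "(nat \<Rightarrow> nat) \<Rightarrow> 'g \<Rightarrow> complex" where
  "lower c = lincomb (\<lambda>i. int (c i))"

lemma lower_inj: "c \<in> depths \<Longrightarrow> d \<in> depths \<Longrightarrow> lower c = lower d \<Longrightarrow> c = d"
proof (rule ext)
  fix i assume *: "c \<in> depths" "d \<in> depths" "lower c = lower d"
  then show "c i = d i"
    using lincomb_unique[of "\<lambda>i. int (c i)" "\<lambda>i. int (d i)" i] by (cases "i \<in> {1..n}") (auto simp: lower_def depths_def)
qed

lemma lower_add: "lower (\<lambda>i. c i + d i) y = lower c y + lower d y"
  by (simp add: lower_def lincomb_add)

lemma lower_zero: "lower (\<lambda>_. 0) = (\<lambda>_. 0)"
  by (simp add: lower_def lincomb_zero)

lemma lower_coef: "\<beta> \<in> pos \<Longrightarrow> lower (coef \<beta>) = \<beta>"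
  using coef(2) by (simp add: lower_def)

lemma lower_dual: "lower c \<in> dual H"
  unfolding lower_def by (rule lincomb_dual)

lemma lower_mon_depth: "lower_mon c u \<Longrightarrow> c \<in> depths" "lower_mon c u \<Longrightarrow> c = (\<lambda>_. 0) \<Longrightarrow> u = 1"
proof -
  show "lower_mon c u \<Longrightarrow> c \<in> depths"
    by (induction rule: lower_mon.induct) (auto simp: depths_def coef(1))
  show "lower_mon c u \<Longrightarrow> c = (\<lambda>_. 0) \<Longrightarrow> u = 1"
  proof (induction rule: lower_mon.induct)
    case (step c u \<beta>)
    then show ?case using coef_nonzero[OF step.hyps(2)] by (auto simp: fun_eq_iff)
  qed simp
qed

text \<open>A vector of weight \<open>\<mu> - lower c\<close>; in depth \<open>0\<close> it has to be a multiple of the generator.\<close>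

definition weight_vectors :: "'g uea set \<Rightarrow> ('g \<Rightarrow> complex) \<Rightarrow> (nat \<Rightarrow> nat) \<Rightarrow> 'g uea set" where
  "weight_vectors A \<mu> c = {u. (\<forall>y\<in>H. uea_embed y * u - (\<mu> y - lower c y) *\<^sub>C u \<in> A) \<and>
     (c = (\<lambda>_. 0) \<longrightarrow> (\<exists>z. u - z *\<^sub>C 1 \<in> A))}"

lemma weight_vectors_subspace: "csubspace A \<Longrightarrow> csubspace (weight_vectors A \<mu> c)"
proof (rule subspaceI)
  assume A: "csubspace A"
  show "0 \<in> weight_vectors A \<mu> c"
    using subspace_zero[OF A] by (auto simp: weight_vectors_def intro!: exI[of _ 0])
next
  fix u v assume A: "csubspace A" and u: "u \<in> weight_vectors A \<mu> c" and v: "v \<in> weight_vectors A \<mu> c"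
  have "uea_embed y * (u + v) - (\<mu> y - lower c y) *\<^sub>C (u + v) \<in> A" if "y \<in> H" for y
    using subspace_add[OF A, of "uea_embed y * u - (\<mu> y - lower c y) *\<^sub>C u" "uea_embed y * v - (\<mu> y - lower c y) *\<^sub>C v"] u v that
    by (simp add: weight_vectors_def distrib_left scaleC_add_right algebra_simps)
  moreover have "\<exists>z. u + v - z *\<^sub>C 1 \<in> A" if c: "c = (\<lambda>_. 0)"
  proof -
    obtain a b where "u - a *\<^sub>C 1 \<in> A" "v - b *\<^sub>C 1 \<in> A" using u v c by (auto simp: weight_vectors_def)
    from subspace_add[OF A this] show ?thesis
      by (intro exI[of _ "a + b"]) (simp add: scaleC_add_left algebra_simps)
  qed
  ultimately show "u + v \<in> weight_vectors A \<mu> c" by (simp add: weight_vectors_def)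
next
  fix k u assume A: "csubspace A" and u: "u \<in> weight_vectors A \<mu> c"
  have "uea_embed y * (k *\<^sub>C u) - (\<mu> y - lower c y) *\<^sub>C (k *\<^sub>C u) \<in> A" if "y \<in> H" for y
    using subspace_scale[OF A, of "uea_embed y * u - (\<mu> y - lower c y) *\<^sub>C u" k] u that
    by (simp add: weight_vectors_def uea_scale_right complex_vector.scale_right_diff_distrib mult.commute)
  moreover have "\<exists>z. k *\<^sub>C u - z *\<^sub>C 1 \<in> A" if c: "c = (\<lambda>_. 0)"
  proof -
    obtain a where "u - a *\<^sub>C 1 \<in> A" using u c by (auto simp: weight_vectors_def)
    from subspace_scale[OF A this, of k] show ?thesis
      by (intro exI[of _ "k * a"]) (simp add: complex_vector.scale_right_diff_distrib)
  qed
  ultimately show "k *\<^sub>C u \<in> weight_vectors A \<mu> c" by (simp add: weight_vectors_def)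
qed

lemma lower_vector_shift:
  assumes A: "left_ideal A" and \<beta>: "\<beta> \<in> pos" and u: "u \<in> weight_vectors A \<mu> c"
  shows "uea_embed (xm \<beta>) * u \<in> weight_vectors A \<mu> (\<lambda>i. c i + coef \<beta> i)"
proof -
  have "uea_embed y * (uea_embed (xm \<beta>) * u) - (\<mu> y - lower (\<lambda>i. c i + coef \<beta> i) y) *\<^sub>C (uea_embed (xm \<beta>) * u) \<in> A"
    if y: "y \<in> H" for y
  proof -
    have "uea_embed y * (uea_embed (xm \<beta>) * u) = uea_embed (xm \<beta>) * (uea_embed y * u) + (- \<beta> y) *\<^sub>C (uea_embed (xm \<beta>) * u)"
      using embed_commute[of y "xm \<beta>"] root_spaceD[OF xm_root_space[OF \<beta>] y]
      by (simp add: mult.assoc[symmetric] left_diff_distrib embed_scaleC embed_minus uea_scale_left)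
    then have "uea_embed y * (uea_embed (xm \<beta>) * u) - (\<mu> y - lower (\<lambda>i. c i + coef \<beta> i) y) *\<^sub>C (uea_embed (xm \<beta>) * u)
      = uea_embed (xm \<beta>) * (uea_embed y * u - (\<mu> y - lower c y) *\<^sub>C u)"
      by (simp add: lower_add lower_coef[OF \<beta>] right_diff_distrib uea_scale_right complex_vector.scale_left_diff_distrib
          scaleC_add_left algebra_simps)
    also have "\<dots> \<in> A" using u y by (intro left_ideal_mult[OF A]) (simp add: weight_vectors_def)
    finally show ?thesis .
  qed
  moreover have "(\<lambda>i. c i + coef \<beta> i) \<noteq> (\<lambda>_. 0)" using coef_nonzero[OF \<beta>] by (auto simp: fun_eq_iff)
  ultimately show ?thesis unfolding weight_vectors_def by blast
qed

lemma lower_mon_weight: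
  assumes A: "left_ideal A" "verma_relations \<mu> \<subseteq> A"
  shows "lower_mon c u \<Longrightarrow> u \<in> weight_vectors A \<mu> c"
proof (induction rule: lower_mon.induct)
  case one
  show ?case using verma_relations_H[OF A(2)] subspace_zero[OF left_ideal_subspace[OF A(1)]]
    by (auto simp: weight_vectors_def lower_zero intro!: exI[of _ 1])
next
  case (step c u \<beta>)
  then show ?case using lower_vector_shift[OF A(1)] by blast
qed

text \<open>\<open>U = U(n\<^sup>-) + A\<close>: commuting \<open>x\<close> past the first factor of a lowering monomial leaves shorter
  monomials, which drives the induction.\<close>

lemma lower_span:
  assumes A: "left_ideal A" "verma_relations \<mu> \<subseteq> A"
  obtains l a where "l \<in> cspan {u. \<exists>c. lower_mon c u}" "a \<in> A" "u = l + a"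
proof -
  let ?L = "cspan {u. \<exists>c. lower_mon c u}"
  define S where "S = {l + a | l a. l \<in> ?L \<and> a \<in> A}"
  have S: "csubspace S" unfolding S_def
    by (intro subspace_plus complex_vector.subspace_span left_ideal_subspace A)
  have LS: "?L \<subseteq> S" and AS: "A \<subseteq> S"
    unfolding S_def using subspace_zero[OF left_ideal_subspace[OF A(1)]] complex_vector.span_zero by force+
  have low: "uea_embed (xm \<beta>) * s \<in> S" if sS: "s \<in> S" and "\<beta> \<in> pos" for s \<beta>
  proof -
    obtain l a where s: "s = l + a" "l \<in> ?L" "a \<in> A" using sS unfolding S_def by blast
    have "uea_embed (xm \<beta>) * l \<in> ?L"
      by (rule span_induct_clin[OF s(2) clin_mult_left complex_vector.subspace_span])
        (auto intro: complex_vector.span_base lower_mon.step that)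
    then show ?thesis unfolding S_def s(1) distrib_left using left_ideal_mult[OF A(1) s(3)] by blast
  qed
  have mon: "uea_embed x * u \<in> S" if "lower_mon c u" for x c u
    using that
  proof (induction arbitrary: x rule: lower_mon.induct)
    case one
    have "x \<in> {x. uea_embed x * 1 \<in> S}"
    proof (rule weight_induct)
      show "csubspace {x. uea_embed x * 1 \<in> S}" using subspace_vimage[OF clin_embed S] by simp
      fix \<beta> x assume x: "\<beta> \<in> dual H" "x \<in> root_space H \<beta>"
      have "uea_embed x \<in> S"
      proof (cases "x = 0")
        case False
        from weight_cases[OF x False] show ?thesis
        proof (elim disjE)
          assume "\<beta> = (\<lambda>_. 0)"
          then have "x \<in> H" using x(2) root_space_zero by simp
          then have "uea_embed x - \<mu> x *\<^sub>C 1 \<in> S" using verma_relations_H[OF A(2)] AS by blast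
          moreover have "\<mu> x *\<^sub>C 1 \<in> S" using LS
            by (auto intro!: subspace_scale[OF S] complex_vector.span_base lower_mon.one)
          ultimately show ?thesis using subspace_diff_cancel[OF S] by blast
        next
          assume "\<beta> \<in> pos" then show ?thesis using verma_relations_raising[OF A(2) _ x(2)] AS by blast
        next
          assume p: "(\<lambda>y. - \<beta> y) \<in> pos"
          obtain k where "x = k *\<^sub>C xm (\<lambda>y. - \<beta> y)" by (rule negative_root_space[OF p]) (use x(2) in auto)
          moreover have "uea_embed (xm (\<lambda>y. - \<beta> y)) * 1 \<in> S"
            by (rule low[OF _ p]) (use LS in \<open>auto intro: complex_vector.span_base lower_mon.one\<close>)
          ultimately show ?thesis by (simp add: embed_scaleC subspace_scale[OF S])
        qed
      qed (simp add: embed_zero subspace_zero[OF S])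
      then show "x \<in> {x. uea_embed x * 1 \<in> S}" by simp
    qed
    then show ?case by simp
  next
    case (step c u \<beta>)
    have "uea_embed x * (uea_embed (xm \<beta>) * u) = uea_embed (xm \<beta>) * (uea_embed x * u) + uea_embed (bracket x (xm \<beta>)) * u"
      by (simp add: embed_bracket algebra_simps)
    also have "\<dots> \<in> S" by (intro subspace_add[OF S] low step)
    finally show ?case .
  qed
  have "left_ideal S"
  proof (rule left_idealI[OF S])
    fix x s assume "s \<in> S"
    then obtain l a where s: "s = l + a" "l \<in> ?L" "a \<in> A" unfolding S_def by blast
    have "uea_embed x * l \<in> S" by (rule span_induct_clin[OF s(2) clin_mult_left S]) (use mon in blast)
    moreover have "uea_embed x * a \<in> S" using left_ideal_mult[OF A(1) s(3)] AS by blast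
    ultimately show "uea_embed x * s \<in> S" unfolding s(1) distrib_left by (rule subspace_add[OF S])
  qed
  moreover have "1 \<in> S" using LS by (auto intro: complex_vector.span_base lower_mon.one)
  ultimately have "u \<in> S" using left_ideal_UNIV by blast
  then show thesis using that unfolding S_def by blast
qed

lemma weight_decomposition:
  assumes A: "left_ideal A" "verma_relations \<mu> \<subseteq> A"
  obtains D g a where "finite D" "D \<subseteq> depths" "\<And>d. d \<in> D \<Longrightarrow> g d \<in> weight_vectors A \<mu> d" "a \<in> A"
    "u = (\<Sum>d\<in>D. g d) + a"
proof -
  obtain l a where l: "l \<in> cspan {u. \<exists>c. lower_mon c u}" "a \<in> A" "u = l + a" by (rule lower_span[OF A])
  have "{u. \<exists>c. lower_mon c u} \<subseteq> (\<Union>c\<in>depths. weight_vectors A \<mu> c)"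
    using lower_mon_weight[OF A] lower_mon_depth(1) by blast
  then have "l \<in> cspan (\<Union>c\<in>depths. weight_vectors A \<mu> c)" using l(1) complex_vector.span_mono by blast
  then obtain D g where "finite D" "D \<subseteq> depths" "\<And>d. d \<in> D \<Longrightarrow> g d \<in> weight_vectors A \<mu> d" "l = (\<Sum>d\<in>D. g d)"
    by (rule span_Union_subspaces[OF _ weight_vectors_subspace[OF left_ideal_subspace[OF A(1)]]]) blast
  then show thesis using that l by blast
qed

lemma weights_distinct:
  assumes \<mu>: "\<mu> \<in> dual H" and "c \<in> depths" "d \<in> depths" "c \<noteq> d"
  shows "\<exists>y\<in>H. \<mu> y - lower c y \<noteq> \<mu> y - lower d y"
  using dual_distinct[OF lower_dual lower_dual, of c d] lower_inj[of c d] assms by auto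

lemma weight_components:
  assumes \<mu>: "\<mu> \<in> dual H" and A: "csubspace A" and J: "left_ideal J" "A \<subseteq> J"
    and D: "finite D" "D \<subseteq> depths" "\<And>d. d \<in> D \<Longrightarrow> g d \<in> weight_vectors A \<mu> d"
    and sum: "(\<Sum>d\<in>D. g d) \<in> J" and d: "d \<in> D"
  shows "g d \<in> J"
proof (rule eigen_separation[where D = D and I = H and Y = "\<lambda>y u. uea_embed y * u" and \<chi> = "\<lambda>d y. \<mu> y - lower d y" and x = g])
  show "uea_embed y * g d - (\<mu> y - lower d y) *\<^sub>C g d \<in> J" if "d \<in> D" "y \<in> H" for d y
    using D(3)[OF that(1)] that(2) J(2) by (auto simp: weight_vectors_def)
  show "\<exists>y\<in>H. \<mu> y - lower d y \<noteq> \<mu> y - lower d' y" if "d \<in> D" "d' \<in> D" "d \<noteq> d'" for d d'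
    using weights_distinct[OF \<mu>] that D(2) by blast
qed (use assms left_ideal_subspace[OF J(1)] in \<open>auto intro: clin_mult_left left_ideal_mult\<close>)

text \<open>A weight that does not occur in the decomposition of \<open>v\<close> would be separated from all that do.\<close>

lemma weight_vector_component:
  assumes \<mu>: "\<mu> \<in> dual H" and \<chi>: "\<chi> \<in> dual H" and A: "left_ideal A" "verma_relations \<mu> \<subseteq> A"
    and v: "\<And>y. y \<in> H \<Longrightarrow> uea_embed y * v - \<chi> y *\<^sub>C v \<in> A" and "v \<notin> A"
  obtains c where "c \<in> depths" "\<chi> = (\<lambda>y. \<mu> y - lower c y)" "v \<in> weight_vectors A \<mu> c"
proof -
  note As = left_ideal_subspace[OF A(1)]
  obtain D g a where D: "finite D" "D \<subseteq> depths" "\<And>d. d \<in> D \<Longrightarrow> g d \<in> weight_vectors A \<mu> d" "a \<in> A"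
    "v = (\<Sum>d\<in>D. g d) + a" by (rule weight_decomposition[OF A, where u = v], rule that)
  have wd: "(\<lambda>y. \<mu> y - lower d y) \<in> dual H" for d by (rule dual_diff[OF \<mu> lower_dual])
  show thesis
  proof (cases "\<exists>c\<in>D. \<chi> = (\<lambda>y. \<mu> y - lower c y)")
    case True
    then obtain c where c: "c \<in> D" "\<chi> = (\<lambda>y. \<mu> y - lower c y)" by blast
    define x where "x d = (if d = c then g c - v else g d)" for d
    have "(\<Sum>d\<in>D. x d) = x c + (\<Sum>d\<in>D - {c}. g d)"
      using D(1) c(1) by (simp add: sum.remove x_def)
    also have "\<dots> = (\<Sum>d\<in>D. g d) - v" using D(1) c(1) by (simp add: sum.remove x_def)
    also have "\<dots> = - a" by (simp add: D(5))
    finally have s: "(\<Sum>d\<in>D. x d) \<in> A" using subspace_minus[OF As D(4)] by simp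
    have "x c \<in> A"
    proof (rule eigen_separation[where D = D and I = H and Y = "\<lambda>y u. uea_embed y * u" and \<chi> = "\<lambda>d y. \<mu> y - lower d y" and x = x])
      fix d y assume dy: "d \<in> D" "y \<in> H"
      have g: "uea_embed y * g d - (\<mu> y - lower d y) *\<^sub>C g d \<in> A" using D(3)[OF dy(1)] dy(2) by (auto simp: weight_vectors_def)
      show "uea_embed y * x d - (\<mu> y - lower d y) *\<^sub>C x d \<in> A"
      proof (cases "d = c")
        case True
        have "uea_embed y * x d - (\<mu> y - lower d y) *\<^sub>C x d
          = (uea_embed y * g d - (\<mu> y - lower d y) *\<^sub>C g d) - (uea_embed y * v - \<chi> y *\<^sub>C v)"
          using True c(2) by (simp add: x_def right_diff_distrib complex_vector.scale_right_diff_distrib)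
        also have "\<dots> \<in> A" by (intro subspace_diff[OF As] g v dy)
        finally show ?thesis .
      qed (use g in \<open>simp add: x_def\<close>)
    next
      show "\<exists>y\<in>H. \<mu> y - lower d y \<noteq> \<mu> y - lower d' y" if "d \<in> D" "d' \<in> D" "d \<noteq> d'" for d d'
        using weights_distinct[OF \<mu>] that D(2) by blast
    qed (use As A D(1) s c(1) in \<open>auto intro: clin_mult_left left_ideal_mult\<close>)
    then have gv: "g c - v \<in> A" by (simp add: x_def)
    have "\<exists>z. v - z *\<^sub>C 1 \<in> A" if "c = (\<lambda>_. 0)"
    proof -
      obtain z where "g c - z *\<^sub>C 1 \<in> A" using D(3)[OF c(1)] \<open>c = (\<lambda>_. 0)\<close> by (auto simp: weight_vectors_def)
      from subspace_diff[OF As this gv] show ?thesis by (auto simp: algebra_simps)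
    qed
    then have "v \<in> weight_vectors A \<mu> c" using v c(2) by (auto simp: weight_vectors_def)
    then show thesis using that c D(2) by blast
  next
    case False
    define x where "x d = (case d of None \<Rightarrow> - v | Some d \<Rightarrow> g d)" for d
    \<comment> \<open>The index \<open>None\<close> stands for \<open>v\<close> itself, with its weight \<open>\<chi>\<close>.\<close>
    define X where "X d y = (case d of None \<Rightarrow> \<chi> y | Some d \<Rightarrow> \<mu> y - lower d y)" for d y
    let ?D = "insert None (Some ` D)"
    have "(\<Sum>d\<in>?D. x d) = - v + (\<Sum>d\<in>D. g d)"
      using D(1) by (subst sum.insert) (auto simp: x_def sum.reindex)
    then have s: "(\<Sum>d\<in>?D. x d) \<in> A" using subspace_minus[OF As D(4)] by (simp add: D(5))
    have "x None \<in> A"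
    proof (rule eigen_separation[where D = ?D and I = H and Y = "\<lambda>y u. uea_embed y * u" and \<chi> = X and x = x])
      fix d y assume dy: "d \<in> ?D" "y \<in> H"
      show "uea_embed y * x d - X d y *\<^sub>C x d \<in> A"
      proof (cases d)
        case None
        then show ?thesis using subspace_minus[OF As v[OF dy(2)]] by (simp add: x_def X_def algebra_simps)
      next
        case (Some d')
        then show ?thesis using D(3)[of d'] dy by (auto simp: x_def X_def weight_vectors_def)
      qed
    next
      fix d d' assume dd: "d \<in> ?D" "d' \<in> ?D" "d \<noteq> d'"
      have Xd: "X d \<in> dual H" for d using \<chi> wd by (cases d) (simp_all add: X_def[abs_def])
      have ne: "X None \<noteq> X (Some e)" if "e \<in> D" for e
      proof
        assume "X None = X (Some e)"
        then have "\<chi> = (\<lambda>y. \<mu> y - lower e y)" by (simp add: X_def[abs_def])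
        then show False using False that by blast
      qed
      have ne2: "X (Some e) \<noteq> X (Some e')" if "e \<in> D" "e' \<in> D" "e \<noteq> e'" for e e'
        using weights_distinct[OF \<mu>, of e e'] that D(2) by (auto simp: X_def[abs_def] fun_eq_iff)
      have "X d \<noteq> X d'" using dd ne ne2 by (cases d; cases d') (auto simp: eq_commute[of _ "X None"])
      then show "\<exists>y\<in>H. X d y \<noteq> X d' y" by (rule dual_distinct[OF Xd Xd])
    qed (use As A D(1) s in \<open>auto intro: clin_mult_left left_ideal_mult\<close>)
    then have "v \<in> A" using subspace_minus[OF As, of "- v"] by (simp add: x_def)
    then show thesis using \<open>v \<notin> A\<close> by blast
  qed
qed

lemma singular_dominant:
  assumes A: "left_ideal A" and i: "i \<in> {1..n}" and u: "u \<notin> A" "uea_embed (ev i) * u \<in> A"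
    "uea_embed (h i) * u - c *\<^sub>C u \<in> A" and nil: "\<exists>N. uea_embed (fv i) ^ N * u \<in> A"
  obtains d where "c = of_nat d" "uea_embed (fv i) ^ Suc d * u \<in> A"
proof -
  interpret s: sl2_operators "\<lambda>u. uea_embed (ev i) * u" "\<lambda>u. uea_embed (fv i) * u" "\<lambda>u. uea_embed (h i) * u" A
    by (rule sl2_left_mult[OF A ev(2)[OF i] h_ev[OF i] h_fv[OF i]])
  obtain N where N: "((\<lambda>u. uea_embed (fv i) * u) ^^ N) u \<in> A" using nil by (auto simp: funpow_mult)
  obtain d where "c = of_nat d" "((\<lambda>u. uea_embed (fv i) * u) ^^ Suc d) u \<in> A"
    by (rule s.primitive_string[OF u(3) s.stable(2)[OF u(2)] u(1) N])
  then show thesis using that by (simp add: funpow_mult del: funpow.simps)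
qed

text \<open>A vector of minimal depth in a nonzero proper submodule would be singular. Singular vectors have
  dominant weights by integrability, and the Casimir element acts on this one by the scalar of the
  generator, although its weight is strictly smaller; that contradicts \<open>cas_distinct\<close>.\<close>

lemma integrable_irreducible:
  assumes \<mu>: "\<mu> \<in> dual H" and A: "left_ideal A" "verma_relations \<mu> \<subseteq> A"
    and nil: "\<And>i. i \<in> {1..n} \<Longrightarrow> \<exists>N. uea_embed (fv i) ^ N \<in> A"
    and J: "left_ideal J" "A \<subseteq> J" "1 \<notin> J"
  shows "J \<subseteq> A"
proof (rule ccontr)
  assume "\<not> J \<subseteq> A"
  then obtain u0 where u0: "u0 \<in> J" "u0 \<notin> A" by blast
  note As = left_ideal_subspace[OF A(1)]
  define P where "P c \<longleftrightarrow> c \<in> depths \<and> (\<exists>u\<in>J - A. u \<in> weight_vectors A \<mu> c)" for c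
  obtain D g a where D: "finite D" "D \<subseteq> depths" "\<And>d. d \<in> D \<Longrightarrow> g d \<in> weight_vectors A \<mu> d" "a \<in> A"
    "u0 = (\<Sum>d\<in>D. g d) + a" by (rule weight_decomposition[OF A, where u = u0], rule that)
  have "(\<Sum>d\<in>D. g d) = u0 - a" using D(5) by simp
  also have "\<dots> \<in> J" using subspace_diff[OF left_ideal_subspace[OF J(1)] u0(1)] D(4) J(2) by blast
  finally have gJ: "g d \<in> J" if "d \<in> D" for d using weight_components[OF \<mu> As J(1,2) D(1,2,3)] that by blast
  have "\<exists>d\<in>D. g d \<notin> A"
  proof (rule ccontr)
    assume "\<not> (\<exists>d\<in>D. g d \<notin> A)"
    then have "(\<Sum>d\<in>D. g d) \<in> A" by (intro subspace_sum[OF As]) blast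
    then show False using u0(2) D(4,5) subspace_add[OF As] by simp
  qed
  then have "\<exists>c. P c" unfolding P_def using gJ D(2,3) by blast
  then obtain c where c: "P c" "\<And>d. P d \<Longrightarrow> (\<Sum>i=1..n. c i) \<le> (\<Sum>i=1..n. d i)"
    using ex_has_least_nat[of P _ "\<lambda>c. \<Sum>i=1..n. c i"] by blast
  then obtain u where cd: "c \<in> depths" and u: "u \<in> J" "u \<notin> A" "u \<in> weight_vectors A \<mu> c" by (auto simp: P_def)
  have uw: "uea_embed y * u - (\<mu> y - lower c y) *\<^sub>C u \<in> A" if "y \<in> H" for y
    using u(3) that by (simp add: weight_vectors_def)
  \<comment> \<open>In depth \<open>0\<close> the ideal \<open>J\<close> would contain the generator.\<close>
  have c0: "c \<noteq> (\<lambda>_. 0)"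
  proof
    assume "c = (\<lambda>_. 0)"
    then obtain z where z: "u - z *\<^sub>C 1 \<in> A" using u(3) by (auto simp: weight_vectors_def)
    show False
    proof (cases "z = 0")
      case True
      then show ?thesis using z u(2) by simp
    next
      case False
      have "u - (u - z *\<^sub>C 1) \<in> J"
        by (rule subspace_diff[OF left_ideal_subspace[OF J(1)] u(1) subsetD[OF J(2) z]])
      then have "z *\<^sub>C 1 \<in> J" by simp
      from subspace_scale[OF left_ideal_subspace[OF J(1)] this, of "inverse z"]
      show ?thesis using False J(3) by simp
    qed
  qed
  have sing: "uea_embed x * u \<in> A" if \<beta>: "\<beta> \<in> pos" and x: "x \<in> root_space H \<beta>" for \<beta> x
  proof (rule ccontr)
    assume v: "uea_embed x * u \<notin> A"
    let ?\<chi> = "\<lambda>y. \<mu> y - lower c y + \<beta> y"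
    have \<chi>: "?\<chi> \<in> dual H" by (intro dual_add dual_diff \<mu> lower_dual positive_roots_dual \<beta>)
    have vw: "uea_embed y * (uea_embed x * u) - ?\<chi> y *\<^sub>C (uea_embed x * u) \<in> A" if y: "y \<in> H" for y
    proof -
      have "uea_embed y * (uea_embed x * u) = uea_embed x * (uea_embed y * u) + \<beta> y *\<^sub>C (uea_embed x * u)"
        using embed_commute[of y x] root_spaceD[OF x y]
        by (simp add: mult.assoc[symmetric] distrib_right embed_scaleC uea_scale_left)
      then have "uea_embed y * (uea_embed x * u) - ?\<chi> y *\<^sub>C (uea_embed x * u)
        = uea_embed x * (uea_embed y * u - (\<mu> y - lower c y) *\<^sub>C u)"
        by (simp add: right_diff_distrib uea_scale_right scaleC_add_left complex_vector.scale_left_diff_distrib algebra_simps)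
      then show ?thesis using left_ideal_mult[OF A(1) uw[OF y]] by simp
    qed
    \<comment> \<open>Raising \<open>u\<close> would produce an element of \<open>J\<close> outside \<open>A\<close> of smaller depth.\<close>
    obtain d where d: "d \<in> depths" "?\<chi> = (\<lambda>y. \<mu> y - lower d y)" "uea_embed x * u \<in> weight_vectors A \<mu> d"
      by (rule weight_vector_component[OF \<mu> \<chi> A vw v])
    have "P d" unfolding P_def using d left_ideal_mult[OF J(1) u(1)] v by blast
    have "lower (\<lambda>i. d i + coef \<beta> i) y = lower c y" for y
      using fun_cong[OF d(2), of y] by (simp add: lower_add lower_coef[OF \<beta>] algebra_simps)
    then have "lower (\<lambda>i. d i + coef \<beta> i) = lower c" by blast
    moreover have "(\<lambda>i. d i + coef \<beta> i) \<in> depths" using d(1) coef(1)[OF \<beta>] by (simp add: depths_def)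
    ultimately have eq: "(\<lambda>i. d i + coef \<beta> i) = c" using lower_inj cd by blast
    obtain j where "j \<in> {1..n}" "coef \<beta> j > 0" using coef_nonzero[OF \<beta>] by blast
    then have "(\<Sum>i=1..n. d i) < (\<Sum>i=1..n. c i)" unfolding eq[symmetric] by (intro sum_strict_mono_ex1) auto
    then show False using c(2)[OF \<open>P d\<close>] by simp
  qed
  let ?\<nu> = "\<lambda>y. \<mu> y - lower c y"
  have \<nu>: "?\<nu> \<in> dual H" by (rule dual_diff[OF \<mu> lower_dual])
  have 1: "casimir * u - cas ?\<nu> *\<^sub>C u \<in> A" by (rule casimir_eigen[OF A(1) sing uw])
  have "casimir * 1 - cas \<mu> *\<^sub>C 1 \<in> A"
    using verma_relations_raising[OF A(2)] verma_relations_H[OF A(2)] by (intro casimir_eigen[OF A(1)]) auto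
  from left_ideal_mult[OF A(1) this, of u] have 2: "casimir * u - cas \<mu> *\<^sub>C u \<in> A"
    using casimir_central[of u] by (simp add: right_diff_distrib uea_scale_right)
  have "(cas \<mu> - cas ?\<nu>) *\<^sub>C u \<in> A" using subspace_diff[OF As 1 2]
    by (simp add: complex_vector.scale_left_diff_distrib)
  then have "cas \<mu> = cas ?\<nu>"
    using subspace_scale[OF As, of "(cas \<mu> - cas ?\<nu>) *\<^sub>C u" "inverse (cas \<mu> - cas ?\<nu>)"] u(2)
    by (cases "cas \<mu> = cas ?\<nu>") auto
  moreover have "1 \<notin> A" using J by blast
  have "\<mu> (h i) \<in> \<nat>" if i: "i \<in> {1..n}" for i
  proof -
    obtain d where "\<mu> (h i) = of_nat d"
      by (rule singular_dominant[OF A(1) i, of 1])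
        (use \<open>1 \<notin> A\<close> verma_relations_raising[OF A(2) simple_positive[OF i] ev(1)[OF i]] verma_relations_H[OF A(2) h_H[OF i]] nil[OF i] in auto)
    then show ?thesis by simp
  qed
  moreover have "?\<nu> (h i) \<in> \<nat>" if i: "i \<in> {1..n}" for i
  proof -
    obtain N where "uea_embed (fv i) ^ N \<in> A" using nil[OF i] by blast
    from locally_nilpotent[OF A(1) fv_nilpotent[OF i] this, of u]
    obtain d where "?\<nu> (h i) = of_nat d"
      using singular_dominant[OF A(1) i u(2) sing[OF simple_positive[OF i] ev(1)[OF i]] uw[OF h_H[OF i]]] by blast
    then show ?thesis by simp
  qed
  moreover obtain j where "c j \<noteq> 0" using c0 by auto
  moreover from this have "j \<in> {1..n}" using cd by (auto simp: depths_def)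
  ultimately show False
    using cas_distinct[OF \<nu>, of \<mu> c j] by (simp add: lower_def)
qed

definition verma_ideal :: "('g \<Rightarrow> complex) \<Rightarrow> 'g uea set" where
  "verma_ideal \<mu> = left_ideal_generated (verma_relations \<mu>)"

definition maximal_ideal :: "('g \<Rightarrow> complex) \<Rightarrow> 'g uea set" where
  "maximal_ideal \<mu> = left_ideal_generated
     (verma_relations \<mu> \<union> \<Union> {J. left_ideal J \<and> verma_relations \<mu> \<subseteq> J \<and> J \<noteq> UNIV})"

lemma V_maximal_ideal: "V \<mu> = uea_quotient (maximal_ideal \<mu>)"
  by (simp add: V_def maximal_ideal_def)

lemma verma_ideal: "left_ideal (verma_ideal \<mu>)" "verma_relations \<mu> \<subseteq> verma_ideal \<mu>"
  "left_ideal J \<Longrightarrow> verma_relations \<mu> \<subseteq> J \<Longrightarrow> verma_ideal \<mu> \<subseteq> J"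
  unfolding verma_ideal_def
  by (rule left_ideal_generated, rule left_ideal_generated_base, rule left_ideal_generated_least)

text \<open>The sum of all weight spaces of the Verma module below the top one.\<close>

definition below :: "('g \<Rightarrow> complex) \<Rightarrow> 'g uea set" where
  "below \<mu> = {l + a | l a. l \<in> cspan (\<Union>c\<in>depths - {\<lambda>_. 0}. weight_vectors (verma_ideal \<mu>) \<mu> c) \<and> a \<in> verma_ideal \<mu>}"

lemma below_subspace: "csubspace (below \<mu>)"
  unfolding below_def by (intro subspace_plus complex_vector.subspace_span left_ideal_subspace verma_ideal)

lemma verma_below: "verma_ideal \<mu> \<subseteq> below \<mu>"
  unfolding below_def using complex_vector.span_zero by force

lemma weight_vectors_below: "c \<in> depths \<Longrightarrow> c \<noteq> (\<lambda>_. 0) \<Longrightarrow> weight_vectors (verma_ideal \<mu>) \<mu> c \<subseteq> below \<mu>"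
proof
  fix x assume "c \<in> depths" "c \<noteq> (\<lambda>_. 0)" "x \<in> weight_vectors (verma_ideal \<mu>) \<mu> c"
  then have "x \<in> cspan (\<Union>c\<in>depths - {\<lambda>_. 0}. weight_vectors (verma_ideal \<mu>) \<mu> c)"
    by (intro complex_vector.span_base) blast
  moreover have "0 \<in> verma_ideal \<mu>" by (rule subspace_zero[OF left_ideal_subspace[OF verma_ideal(1)]])
  ultimately show "x \<in> below \<mu>" unfolding below_def by (metis (mono_tags, lifting) add.right_neutral mem_Collect_eq)
qed

lemma one_not_below:
  assumes \<mu>: "\<mu> \<in> dual H" and "1 \<notin> verma_ideal \<mu>" shows "1 \<notin> below \<mu>"
proof
  let ?A = "verma_ideal \<mu>"
  assume "1 \<in> below \<mu>"
  then obtain l a where la: "l \<in> cspan (\<Union>c\<in>depths - {\<lambda>_. 0}. weight_vectors ?A \<mu> c)" "a \<in> ?A" "1 = l + a"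
    by (auto simp: below_def)
  have As: "csubspace ?A" by (rule left_ideal_subspace[OF verma_ideal(1)])
  obtain D g where D: "finite D" "D \<subseteq> depths - {\<lambda>_. 0}" "\<And>d. d \<in> D \<Longrightarrow> g d \<in> weight_vectors ?A \<mu> d" "l = (\<Sum>d\<in>D. g d)"
    by (rule span_Union_subspaces[OF la(1) weight_vectors_subspace[OF As]]) blast
  define x where "x d = (if d = (\<lambda>_. 0) then - 1 else g d)" for d
  have "x (\<lambda>_. 0) \<in> ?A"
  proof (rule weight_components[OF \<mu> As verma_ideal(1) order_refl, of "insert (\<lambda>_. 0) D" x])
    have "(\<Sum>d\<in>insert (\<lambda>_. 0) D. x d) = - 1 + (\<Sum>d\<in>D. x d)"
      using D(1,2) by (subst sum.insert) (auto simp: x_def)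
    also have "(\<Sum>d\<in>D. x d) = l" unfolding D(4) using D(2) by (intro sum.cong) (auto simp: x_def)
    also have "- 1 + l = - a" using la(3) by (simp add: algebra_simps)
    finally show "(\<Sum>d\<in>insert (\<lambda>_. 0) D. x d) \<in> ?A" using subspace_minus[OF As la(2)] by simp
    show "x d \<in> weight_vectors ?A \<mu> d" if "d \<in> insert (\<lambda>_. 0) D" for d
    proof (cases "d = (\<lambda>_. 0)")
      case True
      have "1 \<in> weight_vectors ?A \<mu> (\<lambda>_. 0)" by (rule lower_mon_weight[OF verma_ideal(1,2) lower_mon.one])
      then show ?thesis using subspace_minus[OF weight_vectors_subspace[OF As]] True by (simp add: x_def)
    qed (use that D(3) in \<open>auto simp: x_def\<close>)
  qed (use D in \<open>auto simp: depths_def\<close>)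
  then show False using subspace_minus[OF As, of "- 1"] assms(2) by (simp add: x_def)
qed

text \<open>The component of depth \<open>0\<close> of an element of \<open>J\<close> is a multiple of the generator in \<open>J\<close>, hence \<open>0\<close>.\<close>

lemma proper_below:
  assumes \<mu>: "\<mu> \<in> dual H" and J: "left_ideal J" "verma_relations \<mu> \<subseteq> J" "1 \<notin> J"
  shows "J \<subseteq> below \<mu>"
proof
  let ?A = "verma_ideal \<mu>"
  have As: "csubspace ?A" by (rule left_ideal_subspace[OF verma_ideal(1)])
  have AJ: "?A \<subseteq> J" by (rule verma_ideal(3)[OF J(1,2)])
  note Js = left_ideal_subspace[OF J(1)]
  fix u assume u: "u \<in> J"
  obtain D g a where D: "finite D" "D \<subseteq> depths" "\<And>d. d \<in> D \<Longrightarrow> g d \<in> weight_vectors ?A \<mu> d" "a \<in> ?A"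
    "u = (\<Sum>d\<in>D. g d) + a" by (rule weight_decomposition[OF verma_ideal(1)[of \<mu>] verma_ideal(2)[of \<mu>], where u = u], rule that)
  have "(\<Sum>d\<in>D. g d) = u - a" using D(5) by simp
  also have "\<dots> \<in> J" using subspace_diff[OF Js u] D(4) AJ by blast
  finally have gJ: "g d \<in> J" if "d \<in> D" for d using weight_components[OF \<mu> As J(1) AJ D(1,2,3)] that by blast
  have "g d \<in> below \<mu>" if d: "d \<in> D" for d
  proof (cases "d = (\<lambda>_. 0)")
    case True
    then obtain z where z: "g d - z *\<^sub>C 1 \<in> ?A" using D(3)[OF d] by (auto simp: weight_vectors_def)
    have "g d - (g d - z *\<^sub>C 1) \<in> J" by (rule subspace_diff[OF Js gJ[OF d] subsetD[OF AJ z]])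
    then have "z *\<^sub>C 1 \<in> J" by simp
    from subspace_scale[OF Js this, of "inverse z"] have "z = 0" using J(3) by (cases "z = 0") auto
    then show ?thesis using z verma_below by auto
  next
    case False
    then show ?thesis using weight_vectors_below D(2,3) d by blast
  qed
  then show "u \<in> below \<mu>"
    unfolding D(5) using verma_below D(4) by (intro subspace_add[OF below_subspace] subspace_sum[OF below_subspace]) auto
qed

text \<open>If \<open>A\<close> is proper, the sum of all proper ideals stays inside the weight spaces below the top, hence is
  proper and contains \<open>A\<close>; irreducibility makes them equal. If \<open>A\<close> is everything, so are both sides.\<close>

lemma maximal_ideal_eq:
  assumes \<mu>: "\<mu> \<in> dual H" and A: "left_ideal A" "verma_relations \<mu> \<subseteq> A"
    and nil: "\<And>i. i \<in> {1..n} \<Longrightarrow> \<exists>N. uea_embed (fv i) ^ N \<in> A"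
    and proper: "1 \<in> A \<Longrightarrow> 1 \<in> verma_ideal \<mu>"
  shows "maximal_ideal \<mu> = A"
proof (cases "1 \<in> A")
  case True
  have "verma_ideal \<mu> \<subseteq> maximal_ideal \<mu>"
    unfolding maximal_ideal_def by (intro verma_ideal(3) left_ideal_generated) (use left_ideal_generated_base in blast)
  then have "maximal_ideal \<mu> = UNIV"
    using proper[OF True] left_ideal_UNIV[of "maximal_ideal \<mu>"] left_ideal_generated unfolding maximal_ideal_def by blast
  then show ?thesis using left_ideal_UNIV[OF A(1) True] by simp
next
  case False
  have "J \<subseteq> A" if J: "left_ideal J" "verma_relations \<mu> \<subseteq> J" "J \<noteq> UNIV" for J
  proof -
    have J1: "1 \<notin> J" using left_ideal_UNIV[OF J(1)] J(3) by blast
    let ?S = "{a + b | a b. a \<in> A \<and> b \<in> J}"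
    have "?S \<subseteq> below \<mu>"
      using proper_below[OF \<mu> A False] proper_below[OF \<mu> J(1,2) J1] subspace_add[OF below_subspace] by blast
    moreover have "1 \<notin> verma_ideal \<mu>" using verma_ideal(3)[OF A] False by blast
    ultimately have 1: "1 \<notin> ?S" using one_not_below[OF \<mu>] by blast
    have sub: "A \<subseteq> ?S" "J \<subseteq> ?S"
      using subspace_zero[OF left_ideal_subspace[OF J(1)]] subspace_zero[OF left_ideal_subspace[OF A(1)]] by force+
    have "?S \<subseteq> A"
      by (rule integrable_irreducible[OF \<mu> A nil left_ideal_sum[OF A(1) J(1)] sub(1) 1])
    with sub(2) show ?thesis by (rule subset_trans)
  qed
  then have "maximal_ideal \<mu> \<subseteq> A"
    unfolding maximal_ideal_def by (intro left_ideal_generated_least A) (use A(2) in blast)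
  moreover have "A \<noteq> UNIV" using False by blast
  then have "A \<subseteq> \<Union> {J. left_ideal J \<and> verma_relations \<mu> \<subseteq> J \<and> J \<noteq> UNIV}"
    using A by (intro Union_upper) simp
  then have "A \<subseteq> maximal_ideal \<mu>"
    unfolding maximal_ideal_def
    by (rule subset_trans[OF subset_trans[OF _ Un_upper2] left_ideal_generated_base])
  ultimately show ?thesis by (rule subset_antisym)
qed

text \<open>The Harish-Chandra projection at \<open>\<mu>\<close>: the coefficient of the generator. Lowering operators shift
  every weight space strictly down, so nothing in \<open>x\<^sub>\<beta>\<^sup>- U(g)\<close> contributes to it.\<close>

lemma harish_chandra_functional:
  assumes \<mu>: "\<mu> \<in> dual H" and proper: "1 \<notin> verma_ideal \<mu>"
  obtains \<phi> where "clin \<phi>" "\<phi> 1 = (1::complex)" "\<And>u. u \<in> verma_ideal \<mu> \<Longrightarrow> \<phi> u = 0"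
    "\<And>\<beta> u. \<beta> \<in> pos \<Longrightarrow> \<phi> (uea_embed (xm \<beta>) * u) = 0"
proof -
  let ?A = "verma_ideal \<mu>"
  obtain \<phi> where \<phi>: "clin \<phi>" "\<And>j. j \<in> below \<mu> \<Longrightarrow> \<phi> j = (0::complex)" "\<phi> 1 = 1"
    by (rule exists_functional[OF below_subspace one_not_below[OF assms]], rule that)
  have "uea_embed (xm \<beta>) * u \<in> below \<mu>" if \<beta>: "\<beta> \<in> pos" for \<beta> u
  proof -
    obtain D g a where D: "finite D" "D \<subseteq> depths" "\<And>d. d \<in> D \<Longrightarrow> g d \<in> weight_vectors ?A \<mu> d" "a \<in> ?A"
      "u = (\<Sum>d\<in>D. g d) + a" by (rule weight_decomposition[OF verma_ideal(1)[of \<mu>] verma_ideal(2)[of \<mu>], where u = u], rule that)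
    have "uea_embed (xm \<beta>) * g d \<in> below \<mu>" if d: "d \<in> D" for d
    proof -
      have "(\<lambda>i. d i + coef \<beta> i) \<in> depths" using D(2) d coef(1)[OF \<beta>] by (auto simp: depths_def)
      moreover have "(\<lambda>i. d i + coef \<beta> i) \<noteq> (\<lambda>_. 0)" using coef_nonzero[OF \<beta>] by (auto simp: fun_eq_iff)
      ultimately show ?thesis
        using weight_vectors_below lower_vector_shift[OF verma_ideal(1) \<beta> D(3)[OF d]] by blast
    qed
    moreover have "uea_embed (xm \<beta>) * a \<in> below \<mu>"
      using left_ideal_mult[OF verma_ideal(1) D(4)] verma_below by blast
    ultimately show ?thesis unfolding D(5) distrib_left sum_distrib_left
      by (intro subspace_add[OF below_subspace] subspace_sum[OF below_subspace]) auto
  qed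
  then show thesis using that \<phi> verma_below by blast
qed

end

context type_B_lie
begin

text \<open>For \<open>\<beta> = \<alpha>\<^sub>i\<close> this is the \<open>sl\<^sub>2\<close>-computation at the end of a string. Any other \<open>\<beta>\<close> contains a second
  simple root, so commuting with \<open>f\<^sub>i\<close> only leads to further positive roots different from \<open>\<alpha>\<^sub>i\<close>.\<close>

lemma raising_kills_power:
  assumes i: "i \<in> {1..n}" and \<mu>: "\<mu> (h i) = of_nat m" and \<beta>: "\<beta> \<in> pos" and x: "x \<in> root_space H \<beta>"
  shows "uea_embed x * uea_embed (fv i) ^ Suc m \<in> verma_ideal \<mu>"
proof (cases "\<beta> = \<alpha> i")
  case True
  interpret s: sl2_operators "\<lambda>u. uea_embed (ev i) * u" "\<lambda>u. uea_embed (fv i) * u" "\<lambda>u. uea_embed (h i) * u" "verma_ideal \<mu>"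
    by (rule sl2_left_mult[OF verma_ideal(1) ev(2)[OF i] h_ev[OF i] h_fv[OF i]])
  have e: "uea_embed (ev i) \<in> verma_ideal \<mu>"
    by (rule verma_relations_raising[OF verma_ideal(2) simple_positive[OF i] ev(1)[OF i]])
  have "uea_embed (h i) * 1 - of_nat m *\<^sub>C 1 \<in> verma_ideal \<mu>"
    using verma_relations_H[OF verma_ideal(2) h_H[OF i], of \<mu>] \<mu> by simp
  from s.e_f_pow[OF this, of m]
  have "uea_embed (ev i) * uea_embed (fv i) ^ Suc m - uea_embed (fv i) ^ Suc m * uea_embed (ev i) \<in> verma_ideal \<mu>"
    by (simp add: funpow_mult del: funpow.simps power_Suc)
  moreover have "uea_embed (fv i) ^ Suc m * uea_embed (ev i) \<in> verma_ideal \<mu>"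
    by (rule left_ideal_mult[OF verma_ideal(1) e])
  ultimately have "uea_embed (ev i) * uea_embed (fv i) ^ Suc m \<in> verma_ideal \<mu>"
    using subspace_diff_cancel[OF left_ideal_subspace[OF verma_ideal(1)]] by blast
  moreover obtain c where "x = c *\<^sub>C ev i" using simple_root_space[OF n1 i] x True by blast
  ultimately show ?thesis
    by (simp add: embed_scaleC uea_scale_left subspace_scale[OF left_ideal_subspace[OF verma_ideal(1)]] del: power_Suc)
next
  case False
  have "uea_embed x * uea_embed (fv i) ^ k \<in> verma_ideal \<mu>" for k
    using \<beta> x False
  proof (induction k arbitrary: \<beta> x)
    case 0
    then show ?case using verma_relations_raising[OF verma_ideal(2)] by simp
  next
    case (Suc k)
    let ?\<gamma> = "\<lambda>y. \<beta> y + - \<alpha> i y"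
    have br: "bracket x (fv i) \<in> root_space H ?\<gamma>" by (rule bracket_root_space[OF Suc.prems(2) fv_root_space[OF i]])
    have "uea_embed (bracket x (fv i)) * uea_embed (fv i) ^ k \<in> verma_ideal \<mu>"
    proof (cases "bracket x (fv i) = 0")
      case True
      then show ?thesis by (simp add: embed_zero subspace_zero[OF left_ideal_subspace[OF verma_ideal(1)]])
    next
      case nz: False
      obtain j where j: "j \<in> {1..n}" "j \<noteq> i" "coef \<beta> j > 0" by (rule two_coefficients[OF Suc.prems(1) i Suc.prems(3)])
      let ?d = "\<lambda>j. int (coef \<beta> j) + (if j = i then - 1 else 0)"
      have eq: "?\<gamma> = lincomb ?d"
        using coef(2)[OF Suc.prems(1)] lincomb_indicator[OF i, of "- 1"] by (simp add: fun_eq_iff lincomb_add)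
      have dj: "?d j > 0" using j by simp
      have "lincomb ?d \<noteq> lincomb (\<lambda>_. 0)" using lincomb_unique[of ?d "\<lambda>_. 0" j] j by auto
      then have "lincomb ?d \<in> roots H"
        using br nz lincomb_dual[of ?d] lincomb_zero unfolding roots_def eq by auto
      note p = positive_of_coefficient[OF this j(1) dj]
      have "lincomb ?d \<noteq> \<alpha> i" using p(2)[OF j(1)] dj coef_simple[OF i, of j] j(2) by auto
      from Suc.IH[OF p(1) _ this] br eq show ?thesis by simp
    qed
    moreover have "uea_embed (fv i) * (uea_embed x * uea_embed (fv i) ^ k) \<in> verma_ideal \<mu>"
      by (rule left_ideal_mult[OF verma_ideal(1) Suc.IH[OF Suc.prems]])
    ultimately show ?case
      using subspace_add[OF left_ideal_subspace[OF verma_ideal(1)]] embed_commute[of x "fv i"]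
      by (simp add: mult.assoc[symmetric] distrib_right)
  qed
  then show ?thesis .
qed

text \<open>Since \<open>f\<^sub>i\<^sup>m\<^sup>+\<^sup>1\<close> is singular, it spans a highest weight module of weight \<open>\<mu> - (m + 1) \<alpha>\<^sub>i\<close>, on
  which the projection vanishes.\<close>

lemma harish_chandra_integrable:
  assumes \<mu>: "\<mu> \<in> dual H" and i: "i \<in> {1..n}" and m: "\<mu> (h i) = of_nat m"
    and \<phi>: "clin \<phi>" "\<And>u. u \<in> verma_ideal \<mu> \<Longrightarrow> \<phi> u = (0::complex)"
    "\<And>\<beta> u. \<beta> \<in> pos \<Longrightarrow> \<phi> (uea_embed (xm \<beta>) * u) = 0"
  shows "\<phi> (u * uea_embed (fv i) ^ Suc m) = 0"
proof -
  let ?F = "uea_embed (fv i) ^ Suc m" and ?\<mu>' = "\<lambda>y. \<mu> y - of_nat (Suc m) * \<alpha> i y"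
  let ?J = "{j. j * ?F \<in> verma_ideal \<mu>}"
  have J: "left_ideal ?J"
    using subspace_vimage[OF clin_mult_right left_ideal_subspace[OF verma_ideal(1)]] left_ideal_mult[OF verma_ideal(1)]
    by (intro left_idealI) (auto simp: mult.assoc)
  have F: "?F \<in> weight_vectors (verma_ideal \<mu>) \<mu> (\<lambda>j. if j = i then k else 0)" if "k = Suc m" for k
  proof -
    have "uea_embed (fv i) ^ k \<in> weight_vectors (verma_ideal \<mu>) \<mu> (\<lambda>j. if j = i then k else 0)" for k
    proof (induction k)
      case 0
      then show ?case using lower_mon_weight[OF verma_ideal(1,2) lower_mon.one] by (simp cong: if_cong)
    next
      case (Suc k)
      have "(\<lambda>j. (if j = i then k else 0) + coef (\<alpha> i) j) = (\<lambda>j. if j = i then Suc k else 0)"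
        using coef_simple[OF i] by (auto simp: fun_eq_iff)
      then show ?case using lower_vector_shift[OF verma_ideal(1) simple_positive[OF i] Suc] by (simp add: fv_def)
    qed
    then show ?thesis using that by blast
  qed
  have "verma_relations ?\<mu>' \<subseteq> ?J"
  proof (rule verma_relations_subset[OF J])
    fix y assume y: "y \<in> H"
    have "lower (\<lambda>j. if j = i then Suc m else 0) y = of_nat (Suc m) * \<alpha> i y"
      using lincomb_indicator[OF i, of "int (Suc m)" y] by (simp add: lower_def if_distrib[of int] del: of_nat_Suc cong: if_cong)
    moreover have "uea_embed y * ?F - (\<mu> y - lower (\<lambda>j. if j = i then Suc m else 0) y) *\<^sub>C ?F \<in> verma_ideal \<mu>"
      using F[OF refl] y unfolding weight_vectors_def by blast
    ultimately have "uea_embed y * ?F - ?\<mu>' y *\<^sub>C ?F \<in> verma_ideal \<mu>" by simp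
    then show "uea_embed y - ?\<mu>' y *\<^sub>C 1 \<in> ?J" by (simp add: left_diff_distrib uea_scale_left)
  qed (use raising_kills_power[OF i, of \<mu>, OF m] in auto)
  then have J': "verma_ideal ?\<mu>' \<subseteq> ?J" by (rule verma_ideal(3)[OF J])
  obtain l a where l: "l \<in> cspan {u. \<exists>c. lower_mon c u}" "a \<in> verma_ideal ?\<mu>'" "u = l + a"
    by (rule lower_span[OF verma_ideal(1,2)])
  have "(\<lambda>l. \<phi> (l * ?F)) l \<in> {0}"
  proof (rule span_induct_clin[OF l(1) _ subspace_zero_set])
    show "clin (\<lambda>l. \<phi> (l * ?F))"
      by (intro clinI) (simp_all add: distrib_right uea_scale_left clin_add[OF \<phi>(1)] clin_scale[OF \<phi>(1)] del: power_Suc)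
    show "\<phi> (s * ?F) \<in> {0}" if "s \<in> {u. \<exists>c. lower_mon c u}" for s
    proof -
      from that obtain c where "lower_mon c s" by blast
      then show ?thesis
      proof cases
        case one
        then show ?thesis using \<phi>(3)[OF simple_positive[OF i]] by (simp add: fv_def)
      next
        case (step c u \<beta>)
        then show ?thesis using \<phi>(3)[of \<beta> "u * ?F"] by (simp add: mult.assoc del: power_Suc)
      qed
    qed
  qed
  moreover have "\<phi> (a * ?F) = 0" using l(2) J' \<phi>(2) by blast
  ultimately show ?thesis unfolding l(3) distrib_right by (simp add: clin_add[OF \<phi>(1)] del: power_Suc)
qed

end

section \<open>Highest weight ideals of the current algebra\<close>

text \<open>The degree \<open>1\<close> in \<open>t\<close> is to stay a literal under simplification.\<close>

declare One_nat_def [simp del]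

lemma clin_cur: "clin (\<lambda>x. cur x r)"
  by (intro clinI) (simp_all add: embed_add embed_scaleC add_monom[symmetric] scaleC_monom[symmetric])

lemmas cur_add = clin_add[OF clin_cur] and cur_scale = clin_scale[OF clin_cur]
  and cur_zero = clin_zero[OF clin_cur]

lemma cur_bracket: "cur (bracket x y) (r + s) = cur x r * cur y s - cur y s * cur x r"
  by (simp add: embed_bracket[symmetric] bracket_monom)

lemma cur_commute: "cur x r * (cur y s * u) = cur y s * (cur x r * u) + cur (bracket x y) (r + s) * u"
  by (simp add: cur_bracket algebra_simps)

lemma cur_bracket_mem:
  "left_ideal J \<Longrightarrow> cur x r \<in> J \<Longrightarrow> cur y s \<in> J \<Longrightarrow> cur (bracket x y) (r + s) \<in> J"
  using left_ideal_bracket[of J "monom x r" 1 "monom y s"] by (simp add: bracket_monom)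

text \<open>The embedding of \<open>U(g)\<close> that extends \<open>x \<mapsto> x \<otimes> 1\<close>.\<close>

definition \<iota> :: "'g::complex_lie_algebra uea \<Rightarrow> 'g poly uea" where
  "\<iota> u = uea_act (\<lambda>x v. cur x 0 * v) u 1"

lemma \<iota>_representation: "representation_mod (\<lambda>x v. cur x 0 * v) UNIV {0 :: 'g::complex_lie_algebra poly uea}"
proof
  show "cur x 0 * (cur y 0 * a) - cur y 0 * (cur x 0 * a) - cur (bracket x y) 0 * a \<in> {0}" for x y :: 'g and a
    using cur_commute[of x 0 y 0 a] by simp
qed (auto simp: clin_mult_left subspace_zero_set cur_add cur_scale distrib_right uea_scale_left complex_vector.subspace_UNIV)

lemma clin_\<iota>: "clin \<iota>"
proof -
  interpret r: representation_mod "\<lambda>x v. cur x 0 * v" UNIV "{0 :: 'a poly uea}" by (rule \<iota>_representation)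
  show ?thesis using r.uea_plus r.uea_scale by (intro clinI) (auto simp: \<iota>_def)
qed

lemma \<iota>_one: "\<iota> 1 = 1"
proof -
  interpret r: representation_mod "\<lambda>x v. cur x 0 * v" UNIV "{0 :: 'a poly uea}" by (rule \<iota>_representation)
  show ?thesis using r.uea_one[of 1] by (simp add: \<iota>_def)
qed

lemma \<iota>_embed_mult: "\<iota> (uea_embed x * u) = cur x 0 * \<iota> u"
proof -
  interpret r: representation_mod "\<lambda>x v. cur x 0 * v" UNIV "{0 :: 'a poly uea}" by (rule \<iota>_representation)
  show ?thesis using r.uea_times[of 1 "uea_embed x" u] r.uea_letter[of "\<iota> u" x] by (simp add: \<iota>_def)
qed

lemma \<iota>_embed: "\<iota> (uea_embed x) = cur x 0"
  using \<iota>_embed_mult[of x 1] by (simp add: \<iota>_one)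

lemma \<iota>_mult: "\<iota> (u * v) = \<iota> u * \<iota> v"
proof (induction u rule: uea_induct)
  case (add u u')
  then show ?case by (simp add: distrib_right clin_add[OF clin_\<iota>])
next
  case (scale c u)
  then show ?case by (simp add: uea_scale_left clin_scale[OF clin_\<iota>])
qed (simp_all add: \<iota>_one \<iota>_embed_mult mult.assoc)

lemma \<iota>_power: "\<iota> (u ^ N) = \<iota> u ^ N"
  by (induction N) (simp_all add: \<iota>_one \<iota>_mult)

lemma uea_degree_mult: "v \<in> uea_degree k \<Longrightarrow> cur x r * v \<in> uea_degree (r + k)"
  for v :: "'g::complex_lie_algebra poly uea"
  unfolding uea_degree_def
proof (erule span_induct_clin[OF _ clin_mult_left complex_vector.subspace_span])
  fix s :: "'g poly uea" assume "s \<in> {prod_list (map (\<lambda>(x, r). cur x r) ws) |ws. sum_list (map snd ws) = k}"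
  then obtain ws where "s = prod_list (map (\<lambda>(x, r). cur x r) ws)" "sum_list (map snd ws) = k" by blast
  then have "cur x r * s = prod_list (map (\<lambda>(x, r). cur x r) ((x, r) # ws))" "sum_list (map snd ((x, r) # ws)) = r + k" by auto
  then show "cur x r * s \<in> cspan {prod_list (map (\<lambda>(x, r). cur x r) ws) |ws. sum_list (map snd ws) = r + k}"
    by (intro complex_vector.span_base) blast
qed

lemma uea_degree_one: "1 \<in> uea_degree 0"
  unfolding uea_degree_def by (rule complex_vector.span_base) (auto intro!: exI[of _ "[]"])

lemma uea_degree_subspace: "csubspace (uea_degree k)"
  unfolding uea_degree_def by (rule complex_vector.subspace_span)

lemma embed_poly: "uea_embed p = (\<Sum>i\<le>degree p. cur (coeff p i) i)"
  by (subst poly_as_sum_of_monoms[symmetric]) (simp only: embed_sum)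

lemma left_ideal_of_cur:
  fixes S :: "'g::complex_lie_algebra poly uea set"
  assumes S: "csubspace S" and "\<And>x r u. u \<in> S \<Longrightarrow> cur x r * u \<in> S"
  shows "left_ideal S"
proof (rule left_idealI[OF S])
  fix p u assume "u \<in> S"
  then show "uea_embed p * u \<in> S"
    by (subst embed_poly) (simp add: sum_distrib_right subspace_sum[OF S] assms(2))
qed

context simple_lie
begin

lemma current_relations_raising: "current_relations \<subseteq> J \<Longrightarrow> \<beta> \<in> pos \<Longrightarrow> x \<in> root_space H \<beta> \<Longrightarrow> cur x r \<in> J"
proof -
  assume *: "current_relations \<subseteq> J" "\<beta> \<in> pos" "x \<in> root_space H \<beta>"
  have "x \<in> n_plus" unfolding n_plus_def using * by (intro complex_vector.span_base) blast
  moreover have "0 \<in> n_plus" unfolding n_plus_def by (rule complex_vector.span_zero)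
  ultimately have "monom x r \<in> current n_plus" by (simp add: current_def)
  then show ?thesis using * by (auto simp: current_relations_def)
qed

lemma current_relations_H: "current_relations \<subseteq> J \<Longrightarrow> y \<in> H \<Longrightarrow> 1 \<le> r \<Longrightarrow> cur y r \<in> J"
  using subspace_zero[OF H_subspace] by (auto simp: current_relations_def current_def)

lemma current_relations_subset:
  assumes J: "left_ideal J" and "\<And>\<beta> x r. \<beta> \<in> pos \<Longrightarrow> x \<in> root_space H \<beta> \<Longrightarrow> cur x r \<in> J"
    and "\<And>y r. y \<in> H \<Longrightarrow> 1 \<le> r \<Longrightarrow> cur y r \<in> J"
  shows "current_relations \<subseteq> J"
proof -
  note Js = left_ideal_subspace[OF J]
  have n: "cur x r \<in> J" if "x \<in> n_plus" for x r
    using that unfolding n_plus_def by (rule span_induct_clin[OF _ clin_cur Js]) (use assms(2) in blast)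
  have "uea_embed p \<in> J" if "p \<in> current n_plus" for p
    using that by (subst embed_poly) (intro subspace_sum[OF Js] n, simp add: current_def)
  moreover have "uea_embed p \<in> J" if "p \<in> current H" "coeff p 0 = 0" for p
  proof (subst embed_poly, rule subspace_sum[OF Js])
    fix i show "cur (coeff p i) i \<in> J"
      using assms(3)[of "coeff p i" i] that subspace_zero[OF Js] by (cases "i = 0") (auto simp: current_def embed_zero)
  qed
  ultimately show ?thesis by (auto simp: current_relations_def)
qed

lemma weight_relations_H:
  assumes J: "left_ideal J" and \<mu>: "\<mu> \<in> dual H" and "\<And>i. i \<in> {1..n} \<Longrightarrow> cur (h i) 0 - \<mu> (h i) *\<^sub>C 1 \<in> J"
    and y: "y \<in> H"
  shows "cur y 0 - \<mu> y *\<^sub>C 1 \<in> J"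
proof -
  note Js = left_ideal_subspace[OF J]
  have "y \<in> {y \<in> H. cur y 0 - \<mu> y *\<^sub>C 1 \<in> J}"
  proof (rule H_induct[OF rank_pos _ _ y])
    show "csubspace {y \<in> H. cur y 0 - \<mu> y *\<^sub>C 1 \<in> J}"
    proof (rule subspaceI)
      show "0 \<in> {y \<in> H. cur y 0 - \<mu> y *\<^sub>C 1 \<in> J}"
        using dual_lin(3)[OF \<mu> H_subspace, of 0 0] by (simp add: subspace_zero[OF H_subspace] subspace_zero[OF Js] cur_zero embed_zero)
      fix x y assume x: "x \<in> {y \<in> H. cur y 0 - \<mu> y *\<^sub>C 1 \<in> J}"
      { assume z: "y \<in> {y \<in> H. cur y 0 - \<mu> y *\<^sub>C 1 \<in> J}"
        have "cur (x + y) 0 - \<mu> (x + y) *\<^sub>C 1 = (cur x 0 - \<mu> x *\<^sub>C 1) + (cur y 0 - \<mu> y *\<^sub>C 1)"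
          using x z dual_lin(1)[OF \<mu> H_subspace, of x y] by (simp add: cur_add scaleC_add_left)
        then show "x + y \<in> {y \<in> H. cur y 0 - \<mu> y *\<^sub>C 1 \<in> J}"
          using x z subspace_add[OF H_subspace] subspace_add[OF Js] by simp }
      fix c
      have "cur (c *\<^sub>C x) 0 - \<mu> (c *\<^sub>C x) *\<^sub>C 1 = c *\<^sub>C (cur x 0 - \<mu> x *\<^sub>C 1)"
        using x dual_lin(2)[OF \<mu> H_subspace, of x x c] by (simp add: cur_scale complex_vector.scale_right_diff_distrib)
      then show "c *\<^sub>C x \<in> {y \<in> H. cur y 0 - \<mu> y *\<^sub>C 1 \<in> J}"
        using x subspace_scale[OF H_subspace] subspace_scale[OF Js] by simp
    qed
  qed (use assms(3) h_H in auto)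
  then show ?thesis by simp
qed

end

context type_B_lie
begin

definition e\<theta> :: 'g where
  "e\<theta> = (SOME x. x \<in> root_space H theta11 \<and> \<kappa> x (xm theta11) = 1)"

lemma e\<theta>: "e\<theta> \<in> root_space H theta11" "\<kappa> e\<theta> (xm theta11) = 1"
proof -
  obtain x where "x \<in> root_space H theta11" "\<kappa> x (xm theta11) = 1" by (rule raising_vector[OF n1 theta11_pos])
  then have "\<exists>x. x \<in> root_space H theta11 \<and> \<kappa> x (xm theta11) = 1" by blast
  from someI_ex[OF this] show "e\<theta> \<in> root_space H theta11" "\<kappa> e\<theta> (xm theta11) = 1" unfolding e\<theta>_def by blast+
qed

lemma raising_e\<theta>:
  assumes \<beta>: "\<beta> \<in> pos" and x: "x \<in> root_space H \<beta>" shows "bracket x e\<theta> = 0"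
proof (rule ccontr)
  assume nz: "bracket x e\<theta> \<noteq> 0"
  have br: "bracket x e\<theta> \<in> root_space H (\<lambda>y. \<beta> y + theta11 y)" by (rule bracket_root_space[OF x e\<theta>(1)])
  let ?d = "\<lambda>j. int (coef \<beta> j) + int (\<theta>coef j)"
  have eq: "(\<lambda>y. \<beta> y + theta11 y) = lincomb ?d"
    using coef(2)[OF \<beta>] theta11_lincomb by (simp add: fun_eq_iff lincomb_add)
  have one: "1 \<in> {1..n}" "?d 1 > 0" using n1 by (auto simp: \<theta>coef_def)
  have "lincomb ?d \<noteq> lincomb (\<lambda>_. 0)" using lincomb_unique[of ?d "\<lambda>_. 0" 1] one by auto
  then have "lincomb ?d \<in> roots H" using br nz lincomb_dual[of ?d] lincomb_zero unfolding roots_def eq by auto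
  from positive_of_coefficient(1)[OF this one] theta11_highest[OF \<beta>] eq show False by simp
qed

lemma H_e\<theta>: "y \<in> H \<Longrightarrow> bracket y e\<theta> = theta11 y *\<^sub>C e\<theta>"
  by (rule root_spaceD[OF e\<theta>(1)])

lemma \<kappa>_e\<theta>_zero: "\<gamma> \<in> dual H \<Longrightarrow> \<gamma> \<noteq> (\<lambda>y. - theta11 y) \<Longrightarrow> x \<in> root_space H \<gamma> \<Longrightarrow> \<kappa> e\<theta> x = 0"
  by (rule \<kappa>_orthogonal[OF theta11_dual _ _ e\<theta>(1)])

abbreviation ft :: "'g poly uea" where "ft \<equiv> cur (xm theta11) 1"

definition shifted :: "('g \<Rightarrow> complex) \<Rightarrow> nat \<Rightarrow> 'g \<Rightarrow> complex" where
  "shifted \<mu> k = (\<lambda>y. \<mu> y - of_nat k * theta11 y)"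

lemma shifted_dual: "\<mu> \<in> dual H \<Longrightarrow> shifted \<mu> k \<in> dual H"
  unfolding shifted_def by (intro dual_diff dual_scale theta11_dual)

text \<open>The common shape of the ideals that define \<open>M(\<lambda>)\<close> and the \<open>M(m\<omega>\<^sub>i)\<close>: among the elements
  \<open>x \<otimes> t\<^sup>r\<close> with \<open>r \<ge> 1\<close> at most \<open>x\<^sub>\<theta>\<^sup>- \<otimes> t\<close> acts nontrivially on the generator.\<close>

definition current_hw :: "'g poly uea set \<Rightarrow> ('g \<Rightarrow> complex) \<Rightarrow> bool" where
  "current_hw J \<mu> \<longleftrightarrow> left_ideal J \<and> \<mu> \<in> dual H \<and> current_relations \<subseteq> J \<and>
     (\<forall>y\<in>H. cur y 0 - \<mu> y *\<^sub>C 1 \<in> J) \<and>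
     (\<forall>\<beta>\<in>pos. \<forall>r. 2 \<le> r \<or> (r = 1 \<and> \<beta> \<noteq> theta11) \<longrightarrow> cur (xm \<beta>) r \<in> J) \<and>
     (\<forall>i\<in>{1..n}. \<exists>N. cur (fv i) 0 ^ N \<in> J)"

context
  fixes J :: "'g poly uea set" and \<mu> :: "'g \<Rightarrow> complex"
  assumes hw: "current_hw J \<mu>"
begin

lemma hw_ideal: "left_ideal J" and hw_dual: "\<mu> \<in> dual H" and hw_relations: "current_relations \<subseteq> J"
  and hw_weight: "y \<in> H \<Longrightarrow> cur y 0 - \<mu> y *\<^sub>C 1 \<in> J"
  and hw_lowering: "\<beta> \<in> pos \<Longrightarrow> 2 \<le> r \<or> (r = 1 \<and> \<beta> \<noteq> theta11) \<Longrightarrow> cur (xm \<beta>) r \<in> J"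
  and hw_integrable: "i \<in> {1..n} \<Longrightarrow> \<exists>N. cur (fv i) 0 ^ N \<in> J"
  using hw by (simp_all only: current_hw_def)

lemmas hw_subspace = left_ideal_subspace[OF hw_ideal]
  and hw_raising = current_relations_raising[OF hw_relations]
  and hw_H = current_relations_H[OF hw_relations]

lemma hw_mult: "u \<in> J \<Longrightarrow> v * u \<in> J"
  by (rule left_ideal_mult[OF hw_ideal])

lemma hw_root_vector:
  assumes "\<gamma> \<in> dual H" "x \<in> root_space H \<gamma>" "1 \<le> r" "2 \<le> r \<or> \<gamma> \<noteq> (\<lambda>y. - theta11 y)"
  shows "cur x r \<in> J"
proof (cases "x = 0")
  case False
  from weight_cases[OF assms(1,2) False] show ?thesis
  proof (elim disjE)
    assume "\<gamma> = (\<lambda>_. 0)"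
    then show ?thesis using assms hw_H root_space_zero by simp
  next
    assume p: "(\<lambda>y. - \<gamma> y) \<in> pos"
    obtain c where c: "x = c *\<^sub>C xm (\<lambda>y. - \<gamma> y)" by (rule negative_root_space[OF p]) (use assms(2) in auto)
    have "2 \<le> r \<or> (r = 1 \<and> (\<lambda>y. - \<gamma> y) \<noteq> theta11)"
    proof (cases "2 \<le> r")
      case False
      have "(\<lambda>y. - \<gamma> y) \<noteq> theta11"
      proof
        assume *: "(\<lambda>y. - \<gamma> y) = theta11"
        have "\<gamma> = (\<lambda>y. - theta11 y)" by (rule ext) (simp add: *[symmetric])
        then show False using False assms(4) by simp
      qed
      then show ?thesis using False assms(3) by simp
    qed simp
    from hw_lowering[OF p this] show ?thesis by (simp add: c cur_scale subspace_scale[OF hw_subspace])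
  qed (rule hw_raising[OF _ assms(2)])
qed (simp add: cur_zero subspace_zero[OF hw_subspace] embed_zero)

lemma hw_second: "2 \<le> r \<Longrightarrow> cur x r \<in> J"
proof -
  assume r: "2 \<le> r"
  have "x \<in> {x. cur x r \<in> J}"
    by (rule weight_induct[OF subspace_vimage[OF clin_cur hw_subspace]]) (use hw_root_vector r in auto)
  then show ?thesis by simp
qed

lemma hw_first: "cur x 1 - \<kappa> e\<theta> x *\<^sub>C ft \<in> J"
proof -
  have lin: "clin (\<lambda>x. cur x 1 - \<kappa> e\<theta> x *\<^sub>C ft)"
    by (intro clinI) (simp_all add: cur_add cur_scale \<kappa>_add_right \<kappa>_scale_right scaleC_add_left complex_vector.scale_right_diff_distrib)
  have "x \<in> {x. cur x 1 - \<kappa> e\<theta> x *\<^sub>C ft \<in> J}"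
  proof (rule weight_induct[OF subspace_vimage[OF lin hw_subspace]])
    fix \<gamma> x assume \<gamma>: "\<gamma> \<in> dual H" "x \<in> root_space H \<gamma>"
    show "x \<in> {x. cur x 1 - \<kappa> e\<theta> x *\<^sub>C ft \<in> J}"
    proof (cases "\<gamma> = (\<lambda>y. - theta11 y)")
      case True
      obtain c where "x = c *\<^sub>C xm theta11" by (rule negative_root_space[OF theta11_pos]) (use \<gamma> True in auto)
      then show ?thesis using e\<theta>(2) by (simp add: \<kappa>_scale_right cur_scale subspace_zero[OF hw_subspace] scaleC_monom[symmetric] embed_scaleC)
    next
      case False
      then show ?thesis using hw_root_vector[OF \<gamma>, of 1] \<kappa>_e\<theta>_zero[OF \<gamma>(1) False \<gamma>(2)] by simp
    qed
  qed
  then show ?thesis by simp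
qed

lemma hw_second_power: "2 \<le> r \<Longrightarrow> cur x r * ft ^ k \<in> J"
proof (induction k arbitrary: x r)
  case 0
  then show ?case using hw_second by simp
next
  case (Suc k)
  then show ?case using subspace_add[OF hw_subspace hw_mult[OF Suc.IH[OF Suc.prems]] Suc.IH[of "r + 1" "bracket x (xm theta11)"], of ft]
      Suc.prems
    by (simp add: cur_commute[of x r "xm theta11" 1])
qed

lemma hw_first_power: "cur x 1 * ft ^ k - \<kappa> e\<theta> x *\<^sub>C ft ^ Suc k \<in> J"
proof (induction k)
  case 0
  then show ?case using hw_first by simp
next
  case (Suc k)
  have "cur x 1 * ft ^ Suc k - \<kappa> e\<theta> x *\<^sub>C ft ^ Suc (Suc k)
    = ft * (cur x 1 * ft ^ k - \<kappa> e\<theta> x *\<^sub>C ft ^ Suc k) + cur (bracket x (xm theta11)) (1 + 1) * ft ^ k"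
    by (simp add: cur_commute[of x 1 "xm theta11" 1] right_diff_distrib uea_scale_right)
  also have "\<dots> \<in> J" by (intro subspace_add[OF hw_subspace] hw_mult Suc hw_second_power) simp
  finally show ?case .
qed

text \<open>\<open>\<kappa>(e\<^sub>\<theta>, [x, x\<^sub>\<theta>\<^sup>-]) = \<kappa>([e\<^sub>\<theta>, x], x\<^sub>\<theta>\<^sup>-) = 0\<close>, so the powers of \<open>x\<^sub>\<theta>\<^sup>- \<otimes> t\<close> are singular.\<close>

lemma hw_raising_power: "\<beta> \<in> pos \<Longrightarrow> x \<in> root_space H \<beta> \<Longrightarrow> cur x 0 * ft ^ k \<in> J"
proof (induction k)
  case 0
  then show ?case using hw_raising by simp
next
  case (Suc k)
  have "\<kappa> e\<theta> (bracket x (xm theta11)) = \<kappa> (bracket e\<theta> x) (xm theta11)" by (simp add: \<kappa>_invariant)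
  also have "\<dots> = 0" using raising_e\<theta>[OF Suc.prems] bracket_antisym[of e\<theta> x] by (simp add: \<kappa>_zero_left)
  finally have "cur (bracket x (xm theta11)) 1 * ft ^ k \<in> J" using hw_first_power[of "bracket x (xm theta11)" k] by simp
  then show ?case using subspace_add[OF hw_subspace hw_mult[OF Suc.IH[OF Suc.prems], of ft]]
    by (simp add: cur_commute[of x 0 "xm theta11" 1])
qed

lemma hw_weight_power: "y \<in> H \<Longrightarrow> cur y 0 * ft ^ k - shifted \<mu> k y *\<^sub>C ft ^ k \<in> J"
proof (induction k)
  case 0
  then show ?case using hw_weight by (simp add: shifted_def)
next
  case (Suc k)
  have "bracket y (xm theta11) = (- theta11 y) *\<^sub>C xm theta11"
    using root_spaceD[OF xm_root_space[OF theta11_pos] Suc.prems] by simp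
  then have "cur y 0 * ft ^ Suc k = ft * (cur y 0 * ft ^ k) + (- theta11 y) *\<^sub>C ft ^ Suc k"
    using cur_commute[of y 0 "xm theta11" 1 "ft ^ k"] cur_scale[of "- theta11 y" "xm theta11" 1]
    by (simp only: uea_scale_left power_Suc add_0)
  then have "cur y 0 * ft ^ Suc k - shifted \<mu> (Suc k) y *\<^sub>C ft ^ Suc k = ft * (cur y 0 * ft ^ k - shifted \<mu> k y *\<^sub>C ft ^ k)"
    by (simp add: shifted_def right_diff_distrib uea_scale_right scaleC_add_left complex_vector.scale_left_diff_distrib algebra_simps)
  then show ?case using hw_mult[OF Suc.IH[OF Suc.prems], of ft] by simp
qed

text \<open>The annihilator in \<open>U(g)\<close> of the image of \<open>(x\<^sub>\<theta>\<^sup>- \<otimes> t)\<^sup>k\<close> in the quotient by \<open>J\<close>.\<close>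

definition degree_annihilator :: "nat \<Rightarrow> 'g uea set" where
  "degree_annihilator k = {u. \<iota> u * ft ^ k \<in> J}"

lemma degree_annihilator:
  "left_ideal (degree_annihilator k)" "verma_relations (shifted \<mu> k) \<subseteq> degree_annihilator k"
  "i \<in> {1..n} \<Longrightarrow> \<exists>N. uea_embed (fv i) ^ N \<in> degree_annihilator k"
proof -
  have lin: "clin (\<lambda>u. \<iota> u * ft ^ k)"
    by (intro clinI) (simp_all add: clin_add[OF clin_\<iota>] clin_scale[OF clin_\<iota>] distrib_right uea_scale_left)
  show A: "left_ideal (degree_annihilator k)"
    unfolding degree_annihilator_def
    by (rule left_idealI[OF subspace_vimage[OF lin hw_subspace]]) (simp add: \<iota>_embed_mult mult.assoc hw_mult)
  show "verma_relations (shifted \<mu> k) \<subseteq> degree_annihilator k"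
    by (rule verma_relations_subset[OF A])
      (simp_all add: degree_annihilator_def \<iota>_embed \<iota>_one hw_raising_power hw_weight_power left_diff_distrib uea_scale_left
        clin_diff[OF clin_\<iota>] clin_scale[OF clin_\<iota>])
  assume i: "i \<in> {1..n}"
  have "\<exists>d. ((bracket (monom (fv i) 0)) ^^ d) p = 0" for p :: "'g poly"
  proof (induction p rule: poly_additive_induct)
    case (monom a r)
    have "((bracket (monom (fv i) 0)) ^^ d) (monom a r) = monom (((bracket (fv i)) ^^ d) a) r" for d
      by (induction d) (simp_all add: bracket_monom)
    moreover obtain d where "((bracket (fv i)) ^^ d) a = 0" using fv_nilpotent[OF i] by blast
    ultimately show ?case by (intro exI[of _ d]) simp
  next
    case (add p q)
    then obtain c d where cd: "((bracket (monom (fv i) 0)) ^^ c) p = 0" "((bracket (monom (fv i) 0)) ^^ d) q = 0" by blast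
    note z = clin_zero[OF clin_funpow[OF clin_ad]]
    have "((bracket (monom (fv i) 0)) ^^ (d + c)) p = 0" "((bracket (monom (fv i) 0)) ^^ (c + d)) q = 0"
      unfolding funpow_add o_apply cd z by (rule refl)+
    then show ?case by (intro exI[of _ "c + d"]) (simp add: clin_add[OF clin_funpow[OF clin_ad]] add.commute)
  qed
  moreover obtain N where "cur (fv i) 0 ^ N \<in> J" using hw_integrable[OF i] by blast
  ultimately obtain N' where "cur (fv i) 0 ^ N' * ft ^ k \<in> J" using locally_nilpotent[OF hw_ideal] by blast
  then show "\<exists>N. uea_embed (fv i) ^ N \<in> degree_annihilator k"
    by (intro exI[of _ N']) (simp add: degree_annihilator_def \<iota>_power \<iota>_embed)
qed

lemma one_degree_annihilator: "1 \<in> degree_annihilator k \<longleftrightarrow> ft ^ k \<in> J"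
  by (simp add: degree_annihilator_def \<iota>_one)

lemma degree_dominant:
  assumes "ft ^ k \<notin> J" and i: "i \<in> {1..n}" shows "shifted \<mu> k (h i) \<in> \<nat>"
proof -
  note A = degree_annihilator(1,2)[of k]
  obtain d where "shifted \<mu> k (h i) = of_nat d"
    by (rule singular_dominant[OF A(1) i, of 1])
      (use assms one_degree_annihilator verma_relations_raising[OF A(2) simple_positive[OF i] ev(1)[OF i]]
        verma_relations_H[OF A(2) h_H[OF i]] degree_annihilator(3)[OF i] in auto)
  then show ?thesis by simp
qed

definition degree_part :: "nat \<Rightarrow> 'g poly uea set" where
  "degree_part k = {\<iota> u * ft ^ k + j | u j. j \<in> J}"

lemma degree_part_subspace: "csubspace (degree_part k)"
proof -
  have lin: "clin (\<lambda>u. \<iota> u * ft ^ k)"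
    by (intro clinI) (simp_all add: clin_add[OF clin_\<iota>] clin_scale[OF clin_\<iota>] distrib_right uea_scale_left)
  have "degree_part k = {a + b | a b. a \<in> range (\<lambda>u. \<iota> u * ft ^ k) \<and> b \<in> J}" by (auto simp: degree_part_def)
  then show ?thesis
    using subspace_plus[OF subspace_image[OF lin complex_vector.subspace_UNIV] hw_subspace] by simp
qed

lemma degree_partI: "\<iota> u * ft ^ k \<in> degree_part k" "j \<in> J \<Longrightarrow> j \<in> degree_part k"
proof -
  show "\<iota> u * ft ^ k \<in> degree_part k" unfolding degree_part_def using subspace_zero[OF hw_subspace] by force
  have "\<iota> 0 = (0 :: 'g poly uea)" by (rule clin_zero[OF clin_\<iota>])
  then show "j \<in> J \<Longrightarrow> j \<in> degree_part k" unfolding degree_part_def by (force intro: exI[of _ 0])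
qed

text \<open>\<open>x \<otimes> t\<^sup>r\<close> raises the degree by \<open>r\<close>; commuting it past \<open>U(g)\<close> keeps \<open>r\<close>, and the powers of
  \<open>x\<^sub>\<theta>\<^sup>- \<otimes> t\<close> absorb it by the two previous computations.\<close>

lemma cur_degree_part: "cur x r * (\<iota> u * ft ^ k) \<in> degree_part (r + k)"
proof (induction u arbitrary: x rule: uea_induct)
  case one
  consider "r = 0" | "r = 1" | "2 \<le> r" by linarith
  then show ?case
  proof cases
    case 1
    then show ?thesis using degree_partI(1)[of "uea_embed x" k] by (simp add: \<iota>_one \<iota>_embed)
  next
    case 2
    have "\<kappa> e\<theta> x *\<^sub>C ft ^ Suc k \<in> degree_part (Suc k)"
      using degree_partI(1)[of 1 "Suc k"] by (intro subspace_scale[OF degree_part_subspace]) (simp add: \<iota>_one)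
    from subspace_add[OF degree_part_subspace degree_partI(2)[OF hw_first_power[of x k], of "Suc k"] this]
    show ?thesis using 2 by (simp add: \<iota>_one Suc_eq_plus1_left del: power_Suc)
  next
    case 3
    then show ?thesis using degree_partI(2)[OF hw_second_power] by (simp add: \<iota>_one)
  qed
next
  case (mult y u)
  obtain v j where vj: "cur x r * (\<iota> u * ft ^ k) = \<iota> v * ft ^ (r + k) + j" "j \<in> J"
    using mult[of x] by (auto simp: degree_part_def)
  have "cur y 0 * (cur x r * (\<iota> u * ft ^ k)) = \<iota> (uea_embed y * v) * ft ^ (r + k) + cur y 0 * j"
    by (simp add: vj(1) distrib_left \<iota>_embed_mult mult.assoc)
  also have "\<dots> \<in> degree_part (r + k)"
    by (intro subspace_add[OF degree_part_subspace] degree_partI hw_mult vj)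
  finally show ?case
    using subspace_add[OF degree_part_subspace _ mult[of "bracket x y"]] by (simp add: \<iota>_embed_mult mult.assoc cur_commute[of x r y 0])
next
  case (add u v)
  then show ?case by (simp add: clin_add[OF clin_\<iota>] distrib_left distrib_right subspace_add[OF degree_part_subspace])
next
  case (scale c u)
  then show ?case by (simp add: clin_scale[OF clin_\<iota>] uea_scale_left uea_scale_right subspace_scale[OF degree_part_subspace])
qed

lemma cur_degree_part': "v \<in> degree_part k \<Longrightarrow> cur x r * v \<in> degree_part (r + k)"
  unfolding degree_part_def[of k] using cur_degree_part degree_partI(2)[OF hw_mult]
  by (auto simp: distrib_left intro!: subspace_add[OF degree_part_subspace])

lemma one_degree_part: "1 \<in> degree_part 0"
  using degree_partI(1)[of 1 0] by (simp add: \<iota>_one)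

lemma uea_degree_part: "uea_degree k \<subseteq> degree_part k"
  unfolding uea_degree_def
proof (rule complex_vector.span_minimal[OF _ degree_part_subspace])
  have "prod_list (map (\<lambda>(x, r). cur x r) ws) \<in> degree_part (sum_list (map snd ws))" for ws
    by (induction ws) (auto simp: one_degree_part cur_degree_part')
  then show "{prod_list (map (\<lambda>(x, r). cur x r) ws) |ws. sum_list (map snd ws) = k} \<subseteq> degree_part k" by auto
qed

lemma degree_part_uea: "\<iota> u * ft ^ k \<in> uea_degree k"
proof (induction u rule: uea_induct)
  case one
  show ?case unfolding \<iota>_one
  proof (induction k)
    case (Suc k)
    then show ?case using uea_degree_mult[of "ft ^ k" k "xm theta11" 1] by (simp add: Suc_eq_plus1_left[symmetric])
  qed (simp add: uea_degree_one)
next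
  case (mult x u)
  then show ?case using uea_degree_mult[of _ k x 0] by (simp add: \<iota>_embed_mult mult.assoc)
next
  case (add u v)
  then show ?case by (simp add: clin_add[OF clin_\<iota>] distrib_right subspace_add[OF uea_degree_subspace])
next
  case (scale c u)
  then show ?case by (simp add: clin_scale[OF clin_\<iota>] uea_scale_left subspace_scale[OF uea_degree_subspace])
qed

lemma degree_parts_span:
  obtains D g where "finite D" "\<And>k. k \<in> D \<Longrightarrow> g k \<in> degree_part k" "u = (\<Sum>k\<in>D. g k)"
proof -
  let ?S = "cspan (\<Union>k\<in>UNIV. degree_part k)"
  have "left_ideal ?S"
  proof (rule left_ideal_of_cur[OF complex_vector.subspace_span])
    fix x r u assume "u \<in> ?S"
    then show "cur x r * u \<in> ?S"
      by (rule span_induct_clin[OF _ clin_mult_left complex_vector.subspace_span])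
        (use cur_degree_part' in \<open>blast intro: complex_vector.span_base\<close>)
  qed
  moreover have "1 \<in> ?S" using one_degree_part by (intro complex_vector.span_base) blast
  ultimately have "u \<in> ?S" using left_ideal_UNIV by blast
  then show thesis by (rule span_Union_subspaces[OF _ degree_part_subspace]) (use that in blast)
qed

text \<open>The Casimir element separates the degrees, because its eigenvalues on the highest weights
  \<open>\<mu> - k \<theta>\<close> differ; inside one degree irreducibility applies.\<close>

lemma larger_ideal_eq:
  assumes K: "left_ideal K" "J \<subseteq> K" and powers: "\<And>k. ft ^ k \<in> K \<Longrightarrow> ft ^ k \<in> J"
  shows "K = J"
proof (rule subset_antisym[OF subsetI K(2)])
  fix u assume u: "u \<in> K"
  note Ks = left_ideal_subspace[OF K(1)]
  obtain D g where D: "finite D" "\<And>k. k \<in> D \<Longrightarrow> g k \<in> degree_part k" "u = (\<Sum>k\<in>D. g k)" by (rule degree_parts_span[where u = u], rule that)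
  have "\<exists>v. g k - \<iota> v * ft ^ k \<in> J" if k: "k \<in> D" for k
  proof -
    obtain v j where "g k = \<iota> v * ft ^ k + j" "j \<in> J" using D(2)[OF k] by (auto simp: degree_part_def)
    then show ?thesis by (intro exI[of _ v]) simp
  qed
  then have "\<forall>k\<in>D. \<exists>v. g k - \<iota> v * ft ^ k \<in> J" by blast
  from bchoice[OF this] obtain v where v: "\<And>k. k \<in> D \<Longrightarrow> g k - \<iota> (v k) * ft ^ k \<in> J" by blast
  define x where "x k = \<iota> (v k) * ft ^ k" for k
  define D' where "D' = {k \<in> D. ft ^ k \<notin> J}"
  have out: "x k \<in> J" if "k \<in> D - D'" for k using that by (simp add: D'_def x_def hw_mult)
  have ux: "u - (\<Sum>k\<in>D. x k) \<in> J"
    unfolding D(3) sum_subtractf[symmetric] by (rule subspace_sum[OF hw_subspace]) (use v in \<open>simp add: x_def\<close>)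
  then have "(\<Sum>k\<in>D. x k) \<in> K" using subspace_diff[OF Ks u, of "u - (\<Sum>k\<in>D. x k)"] K(2) by auto
  moreover have "(\<Sum>k\<in>D. x k) = (\<Sum>k\<in>D'. x k) + (\<Sum>k\<in>D - D'. x k)"
    using D(1) by (subst sum.subset_diff[of D']) (auto simp: D'_def)
  moreover have "(\<Sum>k\<in>D - D'. x k) \<in> K" using K(2) out by (intro subspace_sum[OF Ks]) blast
  ultimately have sum: "(\<Sum>k\<in>D'. x k) \<in> K"
    using subspace_diff[OF Ks, of "(\<Sum>k\<in>D. x k)" "(\<Sum>k\<in>D - D'. x k)"] by simp
  \<comment> \<open>The Casimir element is central in \<open>U(g)\<close>, so it acts on the whole degree part as on its generator.\<close>
  have cas: "\<iota> casimir * x k - cas (shifted \<mu> k) *\<^sub>C x k \<in> J" for k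
  proof -
    note A = degree_annihilator(1,2)[of k]
    have "casimir * 1 - cas (shifted \<mu> k) *\<^sub>C 1 \<in> degree_annihilator k"
      using verma_relations_raising[OF A(2)] verma_relations_H[OF A(2)] by (intro casimir_eigen[OF A(1)]) auto
    from left_ideal_mult[OF A(1) this, of "v k"] have "casimir * v k - cas (shifted \<mu> k) *\<^sub>C v k \<in> degree_annihilator k"
      using casimir_central[of "v k"] by (simp add: right_diff_distrib uea_scale_right)
    then show ?thesis
      by (simp add: degree_annihilator_def x_def clin_diff[OF clin_\<iota>] clin_scale[OF clin_\<iota>] \<iota>_mult left_diff_distrib uea_scale_left mult.assoc)
  qed
  have less: "cas (shifted \<mu> k) \<noteq> cas (shifted \<mu> l)" if "k \<in> D'" "l \<in> D'" "k < l" for k l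
  proof (rule cas_distinct[where c = "\<lambda>i. (l - k) * \<theta>coef i" and j = 1])
    show "shifted \<mu> l \<in> dual H" by (rule shifted_dual[OF hw_dual])
    have "lincomb (\<lambda>i. int ((l - k) * \<theta>coef i)) y = of_nat (l - k) * theta11 y" for y
      by (simp add: theta11_lincomb lincomb_def sum_distrib_left mult.assoc)
    then show "shifted \<mu> k = (\<lambda>y. shifted \<mu> l y + lincomb (\<lambda>i. int ((l - k) * \<theta>coef i)) y)"
      using that(3) by (simp add: shifted_def fun_eq_iff of_nat_diff algebra_simps)
    show "shifted \<mu> k (h i) \<in> \<nat>" "shifted \<mu> l (h i) \<in> \<nat>" if i: "i \<in> {1..n}" for i
      using degree_dominant[OF _ i] \<open>k \<in> D'\<close> \<open>l \<in> D'\<close> by (auto simp: D'_def)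
  qed (use n1 that in \<open>auto simp: \<theta>coef_def\<close>)
  have "x k \<in> J" if k: "k \<in> D'" for k
  proof -
    have xK: "x k \<in> K"
    proof (rule eigen_separation[where D = D' and I = "{()}" and Y = "\<lambda>_ u. \<iota> casimir * u" and \<chi> = "\<lambda>k _. cas (shifted \<mu> k)" and x = x])
      show "\<exists>i\<in>{()}. cas (shifted \<mu> d) \<noteq> cas (shifted \<mu> d')" if "d \<in> D'" "d' \<in> D'" "d \<noteq> d'" for d d'
        using less[of d d'] less[of d' d] that by (auto simp: neq_iff)
      show "finite D'" using D(1) by (simp add: D'_def)
    qed (use K Ks sum k cas in \<open>auto intro: clin_mult_left left_ideal_mult\<close>)
    have lin: "clin (\<lambda>u. \<iota> u * ft ^ k)"
      by (intro clinI) (simp_all add: clin_add[OF clin_\<iota>] clin_scale[OF clin_\<iota>] distrib_right uea_scale_left)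
    have 1: "left_ideal {u. \<iota> u * ft ^ k \<in> K}"
      by (rule left_idealI[OF subspace_vimage[OF lin Ks]]) (simp add: \<iota>_embed_mult mult.assoc left_ideal_mult[OF K(1)])
    have 2: "degree_annihilator k \<subseteq> {u. \<iota> u * ft ^ k \<in> K}" using K(2) by (auto simp: degree_annihilator_def)
    have 3: "1 \<notin> {u. \<iota> u * ft ^ k \<in> K}" using powers[of k] k by (auto simp: \<iota>_one D'_def)
    have "{u. \<iota> u * ft ^ k \<in> K} \<subseteq> degree_annihilator k"
      by (rule integrable_irreducible[OF shifted_dual[OF hw_dual, of k] degree_annihilator(1)[of k]
            degree_annihilator(2)[of k] _ 1 2 3]) (rule degree_annihilator(3))
    then show ?thesis using xK by (auto simp: x_def degree_annihilator_def)
  qed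
  then have "x k \<in> J" if "k \<in> D" for k using out that by blast
  then have "(\<Sum>k\<in>D. x k) \<in> J" by (rule subspace_sum[OF hw_subspace])
  then show "u \<in> J" using subspace_diff_cancel[OF hw_subspace ux] by simp
qed

text \<open>A weight vector of weight \<open>\<mu> - lower c\<close> in the quotient by \<open>J\<close>.\<close>

definition current_weight :: "(nat \<Rightarrow> nat) \<Rightarrow> 'g poly uea set" where
  "current_weight c = {u. \<forall>y\<in>H. cur y 0 * u - (\<mu> y - lower c y) *\<^sub>C u \<in> J}"

text \<open>The quotient is the sum of its degree parts \<open>U(g) (x\<^sub>\<theta>\<^sup>- \<otimes> t)\<^sup>k\<close>; each is a highest weight module, whose
  weights lie below \<open>\<mu>\<close>, strictly so for \<open>k > 0\<close>.\<close>

lemma current_weight_span: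
  obtains z D g j where "finite D" "D \<subseteq> depths - {\<lambda>_. 0}" "\<And>d. d \<in> D \<Longrightarrow> g d \<in> current_weight d" "j \<in> J"
    "u = z *\<^sub>C 1 + (\<Sum>d\<in>D. g d) + j"
proof -
  have cw: "csubspace (current_weight c)" for c
  proof -
    have "csubspace {u. cur y 0 * u - (\<mu> y - lower c y) *\<^sub>C u \<in> J}" for y
      by (rule subspace_vimage[OF _ hw_subspace])
        (intro clinI, simp_all add: distrib_left scaleC_add_right uea_scale_right complex_vector.scale_right_diff_distrib mult.commute)
    then have "csubspace (\<Inter>y\<in>H. {u. cur y 0 * u - (\<mu> y - lower c y) *\<^sub>C u \<in> J})"
      by (intro complex_vector.subspace_Inter) auto
    moreover have "(\<Inter>y\<in>H. {u. cur y 0 * u - (\<mu> y - lower c y) *\<^sub>C u \<in> J}) = current_weight c"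
      by (auto simp: current_weight_def)
    ultimately show ?thesis by simp
  qed
  let ?C = "cspan (\<Union>c\<in>depths - {\<lambda>_. 0}. current_weight c)"
  let ?S = "{a + b | a b. a \<in> {a + b | a b. a \<in> cspan {1} \<and> b \<in> ?C} \<and> b \<in> J}"
  have S: "csubspace ?S" by (intro subspace_plus complex_vector.subspace_span hw_subspace)
  have sub: "1 \<in> ?S" "?C \<subseteq> ?S" "J \<subseteq> ?S"
  proof -
    have z: "0 \<in> cspan {1}" "0 \<in> ?C" "0 \<in> J" "1 \<in> cspan {1}"
      by (auto intro: complex_vector.span_zero complex_vector.span_base subspace_zero[OF hw_subspace])
    then show "1 \<in> ?S" "?C \<subseteq> ?S" "J \<subseteq> ?S" by force+
  qed
  have "\<iota> v * ft ^ k \<in> ?S" for v k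
  proof -
    note A = degree_annihilator(1,2)[of k]
    obtain D g a where D: "finite D" "D \<subseteq> depths" "\<And>d. d \<in> D \<Longrightarrow> g d \<in> weight_vectors (degree_annihilator k) (shifted \<mu> k) d"
      "a \<in> degree_annihilator k" "v = (\<Sum>d\<in>D. g d) + a" by (rule weight_decomposition[OF A, where u = v], rule that)
    have "\<iota> (g d) * ft ^ k \<in> ?S" if d: "d \<in> D" for d
    proof (cases "(\<lambda>i. d i + k * \<theta>coef i) = (\<lambda>_. 0)")
      case True
      then have "d = (\<lambda>_. 0)" "d 1 + k * \<theta>coef 1 = 0" by (auto simp: fun_eq_iff)
      then have k: "k = 0" by (simp add: \<theta>coef_def)
      obtain z where "g d - z *\<^sub>C 1 \<in> degree_annihilator k" using D(3)[OF d] \<open>d = (\<lambda>_. 0)\<close> by (auto simp: weight_vectors_def)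
      then have "\<iota> (g d) * ft ^ k - z *\<^sub>C 1 \<in> ?S" using sub(3) k
        by (auto simp: degree_annihilator_def clin_diff[OF clin_\<iota>] clin_scale[OF clin_\<iota>] \<iota>_one)
      then show ?thesis using subspace_diff_cancel[OF S] subspace_scale[OF S sub(1)] by blast
    next
      case False
      let ?d = "\<lambda>i. d i + k * \<theta>coef i"
      have low: "lower ?d y = lower d y + of_nat k * theta11 y" for y
        by (simp add: lower_add) (simp add: lower_def theta11_lincomb lincomb_def sum_distrib_left mult.assoc)
      have "?d \<in> depths" using D(2) d n1 by (auto simp: depths_def \<theta>coef_def)
      moreover have "\<iota> (g d) * ft ^ k \<in> current_weight ?d"
        unfolding current_weight_def
      proof (intro CollectI ballI)
        fix y assume y: "y \<in> H"
        have "uea_embed y * g d - (shifted \<mu> k y - lower d y) *\<^sub>C g d \<in> degree_annihilator k"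
          using D(3)[OF d] y by (simp add: weight_vectors_def)
        then have "cur y 0 * (\<iota> (g d) * ft ^ k) - (shifted \<mu> k y - lower d y) *\<^sub>C (\<iota> (g d) * ft ^ k) \<in> J"
          by (simp add: degree_annihilator_def clin_diff[OF clin_\<iota>] clin_scale[OF clin_\<iota>] \<iota>_embed_mult left_diff_distrib
              uea_scale_left mult.assoc)
        moreover have "shifted \<mu> k y - lower d y = \<mu> y - lower ?d y" by (simp add: low shifted_def)
        ultimately show "cur y 0 * (\<iota> (g d) * ft ^ k) - (\<mu> y - lower ?d y) *\<^sub>C (\<iota> (g d) * ft ^ k) \<in> J" by simp
      qed
      ultimately have "\<iota> (g d) * ft ^ k \<in> ?C" using False by (intro complex_vector.span_base) blast
      then show ?thesis using sub(2) by blast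
    qed
    moreover have "\<iota> a * ft ^ k \<in> ?S" using D(4) sub(3) by (auto simp: degree_annihilator_def)
    ultimately show ?thesis unfolding D(5) clin_add[OF clin_\<iota>] clin_sum[OF clin_\<iota>] distrib_right sum_distrib_right
      by (intro subspace_add[OF S] subspace_sum[OF S]) auto
  qed
  then have part: "x \<in> ?S" if xk: "x \<in> degree_part k" for x k
  proof -
    obtain v j where x: "x = \<iota> v * ft ^ k + j" "j \<in> J" using xk by (auto simp: degree_part_def)
    show ?thesis unfolding x(1) by (rule subspace_add[OF S \<open>\<And>v k. \<iota> v * ft ^ k \<in> ?S\<close> subsetD[OF sub(3) x(2)]])
  qed
  obtain D g where D: "finite D" "\<And>k. k \<in> D \<Longrightarrow> g k \<in> degree_part k" "u = (\<Sum>k\<in>D. g k)" by (rule degree_parts_span[where u = u], rule that)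
  have "u \<in> ?S" unfolding D(3) by (rule subspace_sum[OF S]) (rule part[OF D(2)])
  then obtain a b j where u: "a \<in> cspan {1}" "b \<in> ?C" "j \<in> J" "u = a + b + j" by auto
  obtain z where z: "a = z *\<^sub>C 1" using u(1) by (auto simp: complex_vector.span_singleton)
  obtain D g where "finite D" "D \<subseteq> depths - {\<lambda>_. 0}" "\<And>d. d \<in> D \<Longrightarrow> g d \<in> current_weight d" "b = (\<Sum>d\<in>D. g d)"
    by (rule span_Union_subspaces[OF u(2) cw]) blast
  then show thesis using that u z by blast
qed

end

subsection \<open>The defining ideals\<close>

text \<open>With \<open>d\<close> the indicator function of \<open>i\<close> (or \<open>0\<close>) this bounds the sets \<open>R\<^sup>+(i, m, r)\<close> from below:
  \<open>x\<^sub>\<beta>\<^sup>- \<otimes> t\<^sup>r\<close> is an iterated bracket of elements \<open>x\<^sub>j\<^sup>- \<otimes> t\<^sup>d\<^sup>j\<close> that kill the generator.\<close>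

lemma lowering_in_ideal:
  assumes J: "left_ideal J" "current_relations \<subseteq> J" and d: "\<And>j. j \<in> {1..n} \<Longrightarrow> d j \<le> (1::nat)"
    and base: "\<And>j. j \<in> {1..n} \<Longrightarrow> coef \<beta> j > 0 \<Longrightarrow> cur (fv j) (d j) \<in> J"
    and \<beta>: "\<beta> \<in> pos" and r: "(\<Sum>j=1..n. d j * coef \<beta> j) \<le> r"
  shows "cur (xm \<beta>) r \<in> J"
  using \<beta> r base
proof (induction "\<Sum>j=1..n. coef \<beta> j" arbitrary: \<beta> r rule: less_induct)
  case less
  note Js = left_ideal_subspace[OF J(1)]
  obtain i where i: "i \<in> {1..n}" "pairing (\<lambda>j. int (coef \<beta> j)) i > 0" by (rule pairing_pos_exists[OF less.prems(1)])
  show ?case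
  proof (cases "\<beta> = \<alpha> i")
    case True
    have base: "cur (fv i) (d i) \<in> J" using less.prems(3)[OF i(1)] coef_simple[OF i(1), of i] True by simp
    have "(\<Sum>j=1..n. d j * coef \<beta> j) = (\<Sum>j=1..n. if j = i then d i else 0)"
      unfolding True coef_simple[OF i(1)] by (intro sum.cong) auto
    then have r: "d i \<le> r" using less.prems(2) i(1) by simp
    show ?thesis
    proof (cases "r = d i")
      case False
      then have "1 \<le> r - d i" using r by simp
      from cur_bracket_mem[OF J(1) current_relations_H[OF J(2) h_H[OF i(1)] this] base]
      have "(- 2) *\<^sub>C cur (fv i) r \<in> J" using r h_fv[OF i(1)] cur_scale[of "- 2" "fv i" r] by simp
      from subspace_scale[OF Js this, of "- 1 / 2"] show ?thesis using True by (simp add: fv_def)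
    qed (use base True in \<open>simp add: fv_def\<close>)
  next
    case False
    obtain \<gamma> c where \<gamma>: "\<gamma> \<in> pos" "xm \<beta> = c *\<^sub>C bracket (fv i) (xm \<gamma>)" "coef \<beta> = (coef \<gamma>)(i := Suc (coef \<gamma> i))"
      by (rule lowering_step[OF n1 less.prems(1) i(1) root_h[OF less.prems(1) i(1)] i(2) False])
    have sum: "(\<Sum>j=1..n. a j * coef \<beta> j) = (\<Sum>j=1..n. a j * coef \<gamma> j) + a i" for a
    proof -
      have "(\<Sum>j=1..n. a j * coef \<beta> j) = (\<Sum>j=1..n. a j * coef \<gamma> j + (if j = i then a i else 0))"
        unfolding \<gamma>(3) by (intro sum.cong) auto
      then show ?thesis using i(1) by (simp add: sum.distrib)
    qed
    have base: "cur (fv i) (d i) \<in> J" using less.prems(3)[OF i(1)] by (simp add: \<gamma>(3))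
    have "coef \<gamma> j > 0 \<Longrightarrow> coef \<beta> j > 0" for j by (simp add: \<gamma>(3))
    then have base': "cur (fv j) (d j) \<in> J" if "j \<in> {1..n}" "coef \<gamma> j > 0" for j using less.prems(3) that by blast
    have "(\<Sum>j=1..n. coef \<gamma> j) < (\<Sum>j=1..n. coef \<beta> j)" using sum[of "\<lambda>_. 1"] by simp
    then have "cur (xm \<gamma>) (r - d i) \<in> J"
      by (rule less.hyps[OF _ \<gamma>(1) _ base']) (use sum[of d] less.prems(2) in auto)
    from cur_bracket_mem[OF J(1) base this] have "cur (bracket (fv i) (xm \<gamma>)) r \<in> J"
      using sum[of d] less.prems(2) by simp
    then show ?thesis unfolding \<gamma>(2) cur_scale by (rule subspace_scale[OF Js])
  qed
qed

lemma fund_ideal: "left_ideal (M_fund_ideal i m)" "current_relations \<subseteq> M_fund_ideal i m"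
  "cur (h i) 0 - of_nat m \<in> M_fund_ideal i m" "cur (fv i) 0 ^ Suc m \<in> M_fund_ideal i m" "cur (fv i) 1 \<in> M_fund_ideal i m"
  "j \<in> {1..n} - {i} \<Longrightarrow> cur (h j) 0 \<in> M_fund_ideal i m" "j \<in> {1..n} - {i} \<Longrightarrow> cur (fv j) 0 \<in> M_fund_ideal i m"
proof -
  let ?R = "current_relations \<union> {cur (h i) 0 - of_nat m, cur (xm (\<alpha> i)) 0 ^ (m + 1), cur (xm (\<alpha> i)) 1} \<union>
      (\<Union>j\<in>{1..n} - {i}. {cur (h j) 0, cur (xm (\<alpha> j)) 0})"
  have *: "?R \<subseteq> M_fund_ideal i m" unfolding M_fund_ideal_def by (rule left_ideal_generated_base)
  show "left_ideal (M_fund_ideal i m)" unfolding M_fund_ideal_def by (rule left_ideal_generated)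
  show "current_relations \<subseteq> M_fund_ideal i m"
    "cur (h i) 0 - of_nat m \<in> M_fund_ideal i m" "cur (fv i) 0 ^ Suc m \<in> M_fund_ideal i m" "cur (fv i) 1 \<in> M_fund_ideal i m"
    using * by (auto simp: fv_def Suc_eq_plus1 simp del: power_Suc)
  show "j \<in> {1..n} - {i} \<Longrightarrow> cur (h j) 0 \<in> M_fund_ideal i m" "j \<in> {1..n} - {i} \<Longrightarrow> cur (fv j) 0 \<in> M_fund_ideal i m"
    using * by (force simp: fv_def)+
qed

lemma of_nat_scaleC_one: "(of_nat m :: 'l::complex_lie_algebra uea) = of_nat m *\<^sub>C 1"
  by (induction m) (simp_all add: scaleC_add_left)

lemma fund_lowering:
  assumes i: "i \<in> {1..n}" and \<beta>: "\<beta> \<in> pos" and r: "coef \<beta> i \<le> r"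
  shows "cur (xm \<beta>) r \<in> M_fund_ideal i m"
proof (rule lowering_in_ideal[OF fund_ideal(1,2) _ _ \<beta>, of "\<lambda>j. if j = i then 1 else 0"])
  have "(\<Sum>j=1..n. (if j = i then 1 else 0) * coef \<beta> j) = (\<Sum>j=1..n. if j = i then coef \<beta> i else 0)"
    by (intro sum.cong) auto
  then show "(\<Sum>j=1..n. (if j = i then 1 else 0) * coef \<beta> j) \<le> r" using i r by simp
qed (use fund_ideal(5)[of i m] fund_ideal(7)[of _ i m] in auto)

lemma fund_zero_lowering: "i \<in> {1..n} \<Longrightarrow> \<beta> \<in> pos \<Longrightarrow> cur (xm \<beta>) r \<in> M_fund_ideal i 0"
proof -
  assume i: "i \<in> {1..n}" and \<beta>: "\<beta> \<in> pos"
  have "cur (fv j) 0 \<in> M_fund_ideal i 0" if "j \<in> {1..n}" for j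
    using fund_ideal(4)[of i 0] fund_ideal(7)[of j i 0] that by (cases "j = i") auto
  then show ?thesis by (intro lowering_in_ideal[OF fund_ideal(1,2) _ _ \<beta>, of "\<lambda>_. 0"]) auto
qed

lemma R_fund_iff: "\<beta> \<in> R_fund i m r \<longleftrightarrow> \<beta> \<in> pos \<and> cur (xm \<beta>) r \<in> M_fund_ideal i m"
proof -
  have J: "left_ideal (M_fund_ideal i m)" by (rule fund_ideal(1))
  note Js = left_ideal_subspace[OF J]
  have "{cur (xm \<beta>) r * x + b | x b. x \<in> {1 + b |b. b \<in> M_fund_ideal i m} \<and> b \<in> M_fund_ideal i m} = M_fund_ideal i m
    \<longleftrightarrow> cur (xm \<beta>) r \<in> M_fund_ideal i m" (is "?X = _ \<longleftrightarrow> _")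
  proof
    assume "?X = M_fund_ideal i m"
    moreover have "cur (xm \<beta>) r * (1 + 0) + 0 \<in> ?X" using subspace_zero[OF Js] by blast
    ultimately show "cur (xm \<beta>) r \<in> M_fund_ideal i m" by simp
  next
    assume c: "cur (xm \<beta>) r \<in> M_fund_ideal i m"
    show "?X = M_fund_ideal i m"
    proof (rule subset_antisym)
      show "?X \<subseteq> M_fund_ideal i m"
        using c left_ideal_mult[OF J] subspace_add[OF Js] by (auto simp: distrib_left)
      show "M_fund_ideal i m \<subseteq> ?X"
      proof
        fix b assume b: "b \<in> M_fund_ideal i m"
        have "b = cur (xm \<beta>) r * (1 + 0) + (b - cur (xm \<beta>) r)" by simp
        moreover have "b - cur (xm \<beta>) r \<in> M_fund_ideal i m" by (rule subspace_diff[OF Js b c])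
        ultimately show "b \<in> ?X" using subspace_zero[OF Js] by blast
      qed
    qed
  qed
  then show ?thesis by (simp add: R_fund_def M_fund_def M_fund_gen_def uea_quotient_def quotient_module_def coset_def)
qed

lemma fund_hw:
  assumes i: "i \<in> {1..n}" "i \<le> 2 \<or> m = 0" and \<omega>: "\<omega> \<in> dual H" "\<And>j. j \<in> {1..n} \<Longrightarrow> \<omega> (h j) = (if j = i then of_nat m else 0)"
  shows "current_hw (M_fund_ideal i m) \<omega>"
  unfolding current_hw_def
proof (intro conjI ballI allI impI)
  show "cur y 0 - \<omega> y *\<^sub>C 1 \<in> M_fund_ideal i m" if "y \<in> H" for y
  proof (rule weight_relations_H[OF fund_ideal(1) \<omega>(1) _ that])
    fix j assume j: "j \<in> {1..n}"
    show "cur (h j) 0 - \<omega> (h j) *\<^sub>C 1 \<in> M_fund_ideal i m"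
      using fund_ideal(3)[of i m] fund_ideal(6)[of j i m] j \<omega>(2)[OF j] by (cases "j = i") (auto simp: of_nat_scaleC_one)
  qed
  show "\<exists>N. cur (fv j) 0 ^ N \<in> M_fund_ideal i m" if "j \<in> {1..n}" for j
    using fund_ideal(4)[of i m] fund_ideal(7)[of j i m] that by (cases "j = i") (blast, auto intro: exI[of _ 1])
  fix \<beta> and r :: nat assume \<beta>: "\<beta> \<in> pos" and r: "2 \<le> r \<or> (r = 1 \<and> \<beta> \<noteq> theta11)"
  show "cur (xm \<beta>) r \<in> M_fund_ideal i m"
  proof (cases "m = 0")
    case True
    then show ?thesis using fund_zero_lowering[OF i(1) \<beta>] by simp
  next
    case False
    then have "i = 1 \<or> i = 2" using i by auto
    then have "coef \<beta> i \<le> r" using coef_bounds[OF \<beta>] r by (elim disjE) (force, cases "coef \<beta> 2 = 2", auto)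
    then show ?thesis by (rule fund_lowering[OF i(1) \<beta>])
  qed
qed (use fund_ideal \<omega> in auto)

end

section \<open>Formal functions on the Lie algebra\<close>

instantiation "fun" :: (type, complex_vector) complex_vector
begin

definition scaleC_fun :: "complex \<Rightarrow> ('a \<Rightarrow> 'b) \<Rightarrow> 'a \<Rightarrow> 'b" where
  "scaleC_fun c f = (\<lambda>x. c *\<^sub>C f x)"

instance
  by standard (simp_all add: scaleC_fun_def fun_eq_iff plus_fun_def scaleC_add_right scaleC_add_left scaleC_scaleC scaleC_one)

end

lemma fun_apply [simp]: "(f + g) x = f x + g x" "(f - g) x = f x - g x" "(- f) x = - f x" "(c *\<^sub>C f) x = c *\<^sub>C f x" "(0 :: 'a \<Rightarrow> 'b::complex_vector) x = 0"
  for f g :: "'a \<Rightarrow> 'b::complex_vector"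
  by (simp_all add: plus_fun_def fun_diff_def fun_Compl_def scaleC_fun_def zero_fun_def)

lemma sum_fun_apply: "(\<Sum>i\<in>S. f i) x = (\<Sum>i\<in>S. f i x)" for f :: "'i \<Rightarrow> 'a \<Rightarrow> 'b::complex_vector"
  by (induction S rule: infinite_finite_induct) simp_all

text \<open>A function of \<open>y \<in> g\<close> with values in functionals on \<open>U(g)\<close>, given by its Taylor coefficients:
  symmetric multilinear forms, evaluated at lists. In these terms \<open>x \<otimes> t\<close> acts as the derivative in
  direction \<open>x\<close>, and \<open>x\<close> by right multiplication on \<open>U(g)\<close> and the vector field \<open>y \<mapsto> - [x, y]\<close>;
  the constant and the linear vector fields form the quotient \<open>g[t] / t\<^sup>2 g[t]\<close>.\<close>

type_synonym 'g forms = "'g list \<Rightarrow> 'g uea \<Rightarrow> complex"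

definition act_right :: "'g::complex_lie_algebra \<Rightarrow> 'g forms \<Rightarrow> 'g forms" where
  "act_right x F = (\<lambda>ys u. F ys (u * uea_embed x))"

definition act_slots :: "'g::complex_lie_algebra \<Rightarrow> 'g forms \<Rightarrow> 'g forms" where
  "act_slots x F = (\<lambda>ys. \<Sum>i<length ys. F (ys[i := bracket x (ys ! i)]))"

definition act_insert :: "'g::complex_lie_algebra \<Rightarrow> 'g forms \<Rightarrow> 'g forms" where
  "act_insert x F = (\<lambda>ys. F (x # ys))"

definition forms :: "'g::complex_lie_algebra forms set" where
  "forms = {F. (\<forall>ys. clin (F ys)) \<and> (\<forall>ys i. i < length ys \<longrightarrow> clin (\<lambda>a. F (ys[i := a]))) \<and>
     (\<forall>ys zs. mset ys = mset zs \<longrightarrow> F ys = F zs)}"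

definition act_forms :: "'g::complex_lie_algebra poly \<Rightarrow> 'g forms \<Rightarrow> 'g forms" where
  "act_forms p F = act_right (coeff p 0) F - act_slots (coeff p 0) F + act_insert (coeff p 1) F"

lemma clin_sum_fun: "(\<And>i. i \<in> S \<Longrightarrow> clin (f i)) \<Longrightarrow> clin (\<lambda>a. \<Sum>i\<in>S. f i a)"
  by (induction S rule: infinite_finite_induct) (auto simp: clin_def scaleC_add_right)

lemma clin_comp: "clin f \<Longrightarrow> clin g \<Longrightarrow> clin (\<lambda>x. f (g x))"
  by (simp add: clin_def)

lemma formsD:
  assumes "F \<in> forms"
  shows "clin (F ys)" "i < length ys \<Longrightarrow> clin (\<lambda>a. F (ys[i := a]))" "mset ys = mset zs \<Longrightarrow> F ys = F zs"
  using assms unfolding forms_def by blast+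

lemma clin_plus: "clin f \<Longrightarrow> clin g \<Longrightarrow> clin (\<lambda>x. f x + g x)"
  by (intro clinI) (simp_all add: clin_def scaleC_add_right add_ac)

lemma clin_scaled: "clin f \<Longrightarrow> clin (\<lambda>x. c *\<^sub>C f x)"
  by (intro clinI) (simp_all add: clin_def scaleC_add_right mult.commute)

lemma forms_subspace: "csubspace forms"
proof (rule subspaceI)
  show "0 \<in> forms" by (simp add: forms_def clin_def)
next
  fix F G :: "'a forms" assume "F \<in> forms" "G \<in> forms"
  note F = formsD[OF this(1)] and G = formsD[OF this(2)]
  have "clin ((F + G) ys)" for ys
    using clin_plus[OF F(1) G(1), of ys ys] by (simp add: plus_fun_def)
  moreover have "clin (\<lambda>a. (F + G) (ys[i := a]))" if "i < length ys" for ys i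
    using clin_plus[OF F(2)[OF that] G(2)[OF that]] by simp
  moreover have "(F + G) ys = (F + G) zs" if "mset ys = mset zs" for ys zs using F(3)[OF that] G(3)[OF that] by simp
  ultimately show "F + G \<in> forms" unfolding forms_def by blast
next
  fix c and F :: "'a forms" assume "F \<in> forms"
  note F = formsD[OF this]
  have "clin ((c *\<^sub>C F) ys)" for ys
    using clin_scaled[OF F(1), of c ys] by (simp add: scaleC_fun_def)
  moreover have "clin (\<lambda>a. (c *\<^sub>C F) (ys[i := a]))" if "i < length ys" for ys i
    using clin_scaled[OF F(2)[OF that], of c] by simp
  moreover have "(c *\<^sub>C F) ys = (c *\<^sub>C F) zs" if "mset ys = mset zs" for ys zs using F(3)[OF that] by simp
  ultimately show "c *\<^sub>C F \<in> forms" unfolding forms_def by blast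
qed

lemma act_right_forms: "F \<in> forms \<Longrightarrow> act_right x F \<in> forms"
proof -
  assume "F \<in> forms"
  note F = formsD[OF this]
  have "clin (\<lambda>u. F ys (u * uea_embed x))" for ys by (rule clin_comp[OF F(1) clin_mult_right])
  moreover have "clin (\<lambda>a u. F (ys[i := a]) (u * uea_embed x))" if "i < length ys" for ys i
    using F(2)[OF that] by (auto simp: clin_def fun_eq_iff)
  moreover have "(\<lambda>u. F ys (u * uea_embed x)) = (\<lambda>u. F zs (u * uea_embed x))" if "mset ys = mset zs" for ys zs
    using F(3)[OF that] by simp
  ultimately show ?thesis unfolding forms_def act_right_def by blast
qed

lemma act_insert_forms: "F \<in> forms \<Longrightarrow> act_insert x F \<in> forms"
proof -
  assume "F \<in> forms"
  note F = formsD[OF this]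
  have "clin (\<lambda>a. F (x # ys[i := a]))" if "i < length ys" for ys i
    using F(2)[of "Suc i" "x # ys"] that by simp
  moreover have "F (x # ys) = F (x # zs)" if "mset ys = mset zs" for ys zs
    by (rule F(3)) (simp add: that)
  ultimately show ?thesis unfolding forms_def act_insert_def using F(1) by blast
qed

lemma act_slots_symmetric:
  assumes F: "F \<in> forms" and eq: "mset ys = mset zs"
  shows "act_slots x F ys = act_slots x F zs"
proof -
  define G where "G y = F (SOME l. mset l = add_mset (bracket x y) (mset ys - {#y#}))" for y
  have G: "F (ws[i := bracket x (ws ! i)]) = G (ws ! i)" if "mset ws = mset ys" "i < length ws" for ws i
  proof -
    have m: "mset (ws[i := bracket x (ws ! i)]) = add_mset (bracket x (ws ! i)) (mset ys - {#ws ! i#})"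
      using mset_update[OF that(2)] that(1) by simp
    then have "\<exists>l. mset l = add_mset (bracket x (ws ! i)) (mset ys - {#ws ! i#})" by blast
    from someI_ex[OF this] show ?thesis unfolding G_def by (intro formsD(3)[OF F]) (simp only: m)
  qed
  have "act_slots x F ws = sum_mset (image_mset G (mset ys))" if "mset ws = mset ys" for ws
  proof -
    have "act_slots x F ws = (\<Sum>i<length ws. G (ws ! i))"
      unfolding act_slots_def by (intro sum.cong refl G that) simp
    also have "\<dots> = sum_list (map G ws)" by (simp add: sum_list_sum_nth atLeast0LessThan)
    also have "\<dots> = sum_mset (image_mset G (mset ws))" by (simp add: sum_mset_sum_list[symmetric])
    finally show ?thesis using that by simp
  qed
  then show ?thesis using eq by simp
qed

lemma act_slots_forms: "F \<in> forms \<Longrightarrow> act_slots x F \<in> forms"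
proof -
  assume F: "F \<in> forms"
  have "clin (\<lambda>a. act_slots x F (ys[i := a]))" if i: "i < length ys" for ys i
  proof -
    have "clin (\<lambda>a. F (ys[i := a, j := bracket x (ys[i := a] ! j)]))" if j: "j < length ys" for j
    proof (cases "j = i")
      case True
      have "clin (\<lambda>a. F (ys[i := bracket x a]))" by (rule clin_comp[OF formsD(2)[OF F i] clin_ad])
      then show ?thesis using True i by simp
    next
      case False
      have "clin (\<lambda>a. F ((ys[j := bracket x (ys ! j)])[i := a]))" using i by (intro formsD(2)[OF F]) simp
      then show ?thesis using False by (simp add: list_update_swap)
    qed
    then show ?thesis unfolding act_slots_def length_list_update by (intro clin_sum_fun) simp
  qed
  moreover have "clin (act_slots x F ys)" for ys
  proof -
    have "act_slots x F ys = (\<lambda>u. \<Sum>i<length ys. F (ys[i := bracket x (ys ! i)]) u)"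
      by (rule ext) (simp add: act_slots_def sum_fun_apply)
    then show ?thesis using clin_sum_fun[of "{..<length ys}" "\<lambda>i. F (ys[i := bracket x (ys ! i)])"] formsD(1)[OF F] by simp
  qed
  ultimately show ?thesis unfolding forms_def using act_slots_symmetric[OF F] by blast
qed

lemma act_right_bracket: "F \<in> forms \<Longrightarrow> act_right x (act_right y F) - act_right y (act_right x F) = act_right (bracket x y) F"
  by (auto simp: act_right_def fun_eq_iff embed_bracket right_diff_distrib clin_diff[OF formsD(1)] mult.assoc)

lemma act_slots_bracket:
  fixes x y :: "'g::complex_lie_algebra" and F :: "'g forms"
  assumes F: "F \<in> forms"
  shows "act_slots x (act_slots y F) - act_slots y (act_slots x F) = - act_slots (bracket x y) F"
proof
  fix ys :: "'g list"
  let ?n = "length ys"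
  let ?E = "\<lambda>x y i j. F (ys[i := bracket x (ys ! i), j := bracket y (ys ! j)])"
  have expand: "act_slots x (act_slots y F) ys
      = (\<Sum>i<?n. \<Sum>j<?n. if j = i then F (ys[i := bracket y (bracket x (ys ! i))]) else ?E x y i j)" for x y
  proof -
    have "F ((ys[i := bracket x (ys ! i)])[j := bracket y ((ys[i := bracket x (ys ! i)]) ! j)])
        = (if j = i then F (ys[i := bracket y (bracket x (ys ! i))]) else ?E x y i j)" if "i < ?n" for i j
      using that by simp
    then show ?thesis unfolding act_slots_def by simp
  qed
  have "act_slots y (act_slots x F) ys
      = (\<Sum>i<?n. \<Sum>j<?n. if i = j then F (ys[j := bracket x (bracket y (ys ! j))]) else ?E y x j i)"
    unfolding expand[of y x] by (rule sum.swap)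
  also have "\<dots> = (\<Sum>i<?n. \<Sum>j<?n. if j = i then F (ys[i := bracket x (bracket y (ys ! i))]) else ?E x y i j)"
    by (intro sum.cong refl) (auto simp: list_update_swap)
  finally have "act_slots x (act_slots y F) ys - act_slots y (act_slots x F) ys
      = (\<Sum>i<?n. \<Sum>j<?n. if j = i then F (ys[i := bracket y (bracket x (ys ! i))]) - F (ys[i := bracket x (bracket y (ys ! i))]) else 0)"
    unfolding expand[of x y] by (simp only: sum_subtractf[symmetric]) (intro sum.cong refl, simp)
  also have "\<dots> = (\<Sum>i<?n. F (ys[i := bracket y (bracket x (ys ! i))]) - F (ys[i := bracket x (bracket y (ys ! i))]))"
    by simp
  also have "\<dots> = (\<Sum>i<?n. - F (ys[i := bracket (bracket x y) (ys ! i)]))"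
  proof (intro sum.cong refl)
    fix i assume "i \<in> {..<?n}"
    then have lin: "clin (\<lambda>a. F (ys[i := a]))" using formsD(2)[OF F] by simp
    have "bracket y (bracket x (ys ! i)) - bracket x (bracket y (ys ! i)) = - bracket (bracket x y) (ys ! i)"
      by (simp add: ad_bracket_operator)
    with clin_diff[OF lin, of "bracket y (bracket x (ys ! i))" "bracket x (bracket y (ys ! i))"]
      clin_minus[OF lin, of "bracket (bracket x y) (ys ! i)"]
    show "F (ys[i := bracket y (bracket x (ys ! i))]) - F (ys[i := bracket x (bracket y (ys ! i))]) = - F (ys[i := bracket (bracket x y) (ys ! i)])"
      by simp
  qed
  finally show "(act_slots x (act_slots y F) - act_slots y (act_slots x F)) ys = (- act_slots (bracket x y) F) ys"
    by (simp add: act_slots_def sum_negf)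
qed

lemma act_slots_insert: "act_insert y (act_slots x F) - act_slots x (act_insert y F) = act_insert (bracket x y) F"
proof
  fix ys
  show "(act_insert y (act_slots x F) - act_slots x (act_insert y F)) ys = act_insert (bracket x y) F ys"
    by (simp add: act_slots_def act_insert_def sum.lessThan_Suc_shift fun_eq_iff sum_fun_apply del: sum.lessThan_Suc)
qed

lemma act_insert_commute: "F \<in> forms \<Longrightarrow> act_insert x (act_insert y F) = act_insert y (act_insert x F)"
  unfolding act_insert_def by (intro ext) (rule arg_cong[of _ _ "\<lambda>f. f _"], rule formsD(3), auto)

lemma act_right_commute: "act_right x (act_slots y F) = act_slots y (act_right x F)"
  "act_right x (act_insert y F) = act_insert y (act_right x F)"
  by (auto simp: act_right_def act_slots_def act_insert_def fun_eq_iff sum_fun_apply)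

lemma clin_act: "clin (act_right x)" "clin (act_slots x)" "clin (act_insert x)"
  by (intro clinI; simp add: act_right_def act_slots_def act_insert_def fun_eq_iff sum.distrib complex_vector.scale_sum_right sum_fun_apply)+

lemma clin_act_arg:
  assumes F: "F \<in> forms"
  shows "clin (\<lambda>x. act_right x F)" "clin (\<lambda>x. act_slots x F)" "clin (\<lambda>x. act_insert x F)"
proof -
  show "clin (\<lambda>x. act_right x F)"
    by (intro clinI) (auto simp: act_right_def fun_eq_iff embed_add embed_scaleC distrib_left uea_scale_right
        clin_add[OF formsD(1)[OF F]] clin_scale[OF formsD(1)[OF F]])
  have "clin (\<lambda>a. F (a # ys))" for ys
    using formsD(2)[OF F, of 0 "undefined # ys"] by simp
  note head = clin_add[OF this] clin_scale[OF this]
  show "clin (\<lambda>x. act_insert x F)"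
  proof (rule clinI)
    show "act_insert (x + y) F = act_insert x F + act_insert y F" for x y
      by (simp add: act_insert_def head fun_eq_iff)
    show "act_insert (c *\<^sub>C x) F = c *\<^sub>C act_insert x F" for c x
      by (simp add: act_insert_def head fun_eq_iff)
  qed
  have lin: "clin (\<lambda>x. F (ys[i := bracket x (ys ! i)]))" if "i < length ys" for ys i
    by (rule clin_comp[OF formsD(2)[OF F that] clin_ad_left])
  have "clin (\<lambda>x. \<Sum>i<length ys. F (ys[i := bracket x (ys ! i)]))" for ys
    by (rule clin_sum_fun) (simp add: lin)
  then show "clin (\<lambda>x. act_slots x F)" unfolding act_slots_def by (auto simp: clin_def fun_eq_iff)
qed

lemma coeff_bracket:
  "coeff (bracket p q) 0 = bracket (coeff p 0) (coeff q 0)"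
  "coeff (bracket p q) 1 = bracket (coeff p 0) (coeff q 1) + bracket (coeff p 1) (coeff q 0)"
  for p q :: "'g::complex_lie_algebra poly"
proof -
  have "coeff (bracket p q) 0 = bracket (coeff p 0) (coeff q 0) \<and>
     coeff (bracket p q) 1 = bracket (coeff p 0) (coeff q 1) + bracket (coeff p 1) (coeff q 0)"
  proof (induction p rule: poly_additive_induct)
    case (monom a i)
    show ?case
    proof (induction q rule: poly_additive_induct)
      case (monom b j)
      show ?case by (cases "i = 0"; cases "j = 0"; cases "i = 1"; cases "j = 1") (auto simp: bracket_monom)
    qed (simp add: bracket_add_right)
  qed (simp add: bracket_add_left)
  then show "coeff (bracket p q) 0 = bracket (coeff p 0) (coeff q 0)"
    "coeff (bracket p q) 1 = bracket (coeff p 0) (coeff q 1) + bracket (coeff p 1) (coeff q 0)" by auto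
qed

lemma clin_act_forms: "clin (act_forms p)"
  unfolding act_forms_def[abs_def] using clin_act[of "coeff p 0"] clin_act(3)[of "coeff p 1"]
  by (intro clinI) (simp_all add: clin_def scaleC_add_right complex_vector.scale_right_diff_distrib)

lemma act_forms_bracket:
  assumes F: "F \<in> forms"
  shows "act_forms p (act_forms q F) - act_forms q (act_forms p F) = act_forms (bracket p q) F"
proof -
  let ?p = "coeff p 0" and ?q = "coeff q 0" and ?p1 = "coeff p 1" and ?q1 = "coeff q 1"
  note lin = clin_diff[OF clin_act(1)] clin_add[OF clin_act(1)] clin_diff[OF clin_act(2)] clin_add[OF clin_act(2)]
    clin_diff[OF clin_act(3)] clin_add[OF clin_act(3)]
  have "bracket ?p1 ?q = - bracket ?q ?p1" by (rule bracket_antisym)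
  then have "act_insert (bracket ?p1 ?q) F = - act_insert (bracket ?q ?p1) F"
    by (simp add: clin_minus[OF clin_act_arg(3)[OF F]])
  then have "act_forms (bracket p q) F
      = act_right (bracket ?p ?q) F - act_slots (bracket ?p ?q) F + (act_insert (bracket ?p ?q1) F - act_insert (bracket ?q ?p1) F)"
    unfolding act_forms_def coeff_bracket by (simp add: clin_add[OF clin_act_arg(3)[OF F]])
  also have "\<dots> = (act_right ?p (act_right ?q F) - act_right ?q (act_right ?p F))
      + (act_slots ?p (act_slots ?q F) - act_slots ?q (act_slots ?p F))
      + ((act_insert ?q1 (act_slots ?p F) - act_slots ?p (act_insert ?q1 F)) - (act_insert ?p1 (act_slots ?q F) - act_slots ?q (act_insert ?p1 F)))"
    unfolding act_right_bracket[OF F] act_slots_bracket[OF F] act_slots_insert by simp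
  also have "\<dots> = act_forms p (act_forms q F) - act_forms q (act_forms p F)"
    unfolding act_forms_def lin act_right_commute act_insert_commute[OF F, of ?q1 ?p1] by (simp add: algebra_simps)
  finally show ?thesis by simp
qed

lemma act_forms_closed: "F \<in> forms \<Longrightarrow> act_forms p F \<in> forms"
  unfolding act_forms_def
  by (intro subspace_add[OF forms_subspace] subspace_diff[OF forms_subspace] act_right_forms act_slots_forms act_insert_forms)

lemma act_forms_linear: "F \<in> forms \<Longrightarrow> clin (\<lambda>p. act_forms p F)"
  unfolding act_forms_def
  by (intro clinI) (simp_all add: clin_add[OF clin_act_arg(1)] clin_add[OF clin_act_arg(2)] clin_add[OF clin_act_arg(3)]
     clin_scale[OF clin_act_arg(1)] clin_scale[OF clin_act_arg(2)] clin_scale[OF clin_act_arg(3)]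
     scaleC_add_right complex_vector.scale_right_diff_distrib)

lemma forms_representation: "representation_mod act_forms forms {0 :: 'g::complex_lie_algebra forms}"
  by unfold_locales
    (auto simp: clin_act_forms forms_subspace subspace_zero_set subspace_zero[OF forms_subspace] act_forms_closed
      clin_zero[OF clin_act_forms] clin_add[OF act_forms_linear] clin_scale[OF act_forms_linear] act_forms_bracket)

text \<open>The same space as a representation of \<open>g\<close> itself, after moving the base point of the Taylor
  expansion from \<open>0\<close> to \<open>z\<close>.\<close>

definition act_based :: "'g::complex_lie_algebra \<Rightarrow> 'g \<Rightarrow> 'g forms \<Rightarrow> 'g forms" where
  "act_based z x = act_forms (monom x 0 - monom (bracket x z) 1)"

lemma based_representation: "representation_mod (act_based z) forms {0 :: 'g::complex_lie_algebra forms}"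
proof unfold_locales
  fix x y :: 'g and F :: "'g forms" assume F: "F \<in> forms"
  let ?P = "\<lambda>x. monom x 0 - monom (bracket x z) 1"
  have depends: "act_forms p F = act_forms q F" if "coeff p 0 = coeff q 0" "coeff p 1 = coeff q 1" for p q
    using that by (simp add: act_forms_def)
  have "act_forms (bracket (?P x) (?P y)) F = act_forms (?P (bracket x y)) F"
    using bracket_antisym[of "bracket x z" y]
    by (intro depends) (simp_all only: coeff_bracket, simp_all add: ad_bracket_operator[of x y z] bracket_minus_right bracket_minus_left)
  then show "act_based z x (act_based z y F) - act_based z y (act_based z x F) - act_based z (bracket x y) F \<in> {0}"
    using act_forms_bracket[OF F, of "?P x" "?P y"] by (simp add: act_based_def)
  have "?P (x + y) = ?P x + ?P y" by (simp add: bracket_add_left add_monom[symmetric])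
  then show "act_based z (x + y) F - act_based z x F - act_based z y F \<in> {0}"
    unfolding act_based_def by (simp only: clin_add[OF act_forms_linear[OF F]]) simp
  fix c
  have "?P (c *\<^sub>C x) = c *\<^sub>C ?P x"
    by (simp add: bracket_scaleC_left scaleC_monom complex_vector.scale_right_diff_distrib)
  then show "act_based z (c *\<^sub>C x) F - c *\<^sub>C act_based z x F \<in> {0}"
    unfolding act_based_def by (simp only: clin_scale[OF act_forms_linear[OF F]]) simp
qed (auto simp: act_based_def clin_act_forms forms_subspace subspace_zero_set subspace_zero[OF forms_subspace] act_forms_closed
      clin_zero[OF clin_act_forms])

context simple_lie
begin

text \<open>The function \<open>y \<mapsto> s(\<kappa>(e, y)) \<phi>\<close>, where the \<open>k\<close>-th derivative of \<open>s\<close> is \<open>s k\<close>.\<close>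

definition power_form :: "'g \<Rightarrow> (nat \<Rightarrow> complex) \<Rightarrow> ('g uea \<Rightarrow> complex) \<Rightarrow> 'g forms" where
  "power_form e s \<phi> ys = (s (length ys) * prod_list (map (\<kappa> e) ys)) *\<^sub>C \<phi>"

lemma prod_list_slot:
  assumes "i < length ys"
  obtains K where "\<And>a. prod_list (map (\<kappa> e) (ys[i := a])) = K * \<kappa> e a"
proof -
  have "prod_list (map (\<kappa> e) (ys[i := a]))
      = (prod_list (map (\<kappa> e) (take i ys)) * prod_list (map (\<kappa> e) (drop (Suc i) ys))) * \<kappa> e a" for a
    unfolding upd_conv_take_nth_drop[OF assms] by simp
  then show thesis using that by blast
qed

lemma power_form_forms: assumes \<phi>: "clin \<phi>" shows "power_form e s \<phi> \<in> forms"
proof -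
  have "clin (power_form e s \<phi> ys)" for ys
    using \<phi> by (auto simp: power_form_def clin_def scaleC_complex_def algebra_simps)
  moreover have "clin (\<lambda>a. power_form e s \<phi> (ys[i := a]))" if i: "i < length ys" for ys i
  proof -
    obtain K where K: "\<And>a. prod_list (map (\<kappa> e) (ys[i := a])) = K * \<kappa> e a" by (rule prod_list_slot[OF i, where e = e], rule that)
    show ?thesis unfolding power_form_def K
      by (intro clinI) (simp_all add: \<kappa>_add_right \<kappa>_scale_right distrib_left scaleC_add_left mult.left_commute)
  qed
  moreover have "power_form e s \<phi> ys = power_form e s \<phi> zs" if eq: "mset ys = mset zs" for ys zs
  proof -
    have "prod_list (map (\<kappa> e) ys) = prod_mset (image_mset (\<kappa> e) (mset ys))" for ys
      by (simp add: prod_mset_prod_list[symmetric])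
    then show ?thesis using eq size_mset[of ys] size_mset[of zs] by (simp add: power_form_def)
  qed
  ultimately show ?thesis unfolding forms_def by blast
qed

lemma act_right_power_form:
  assumes "\<And>u. \<phi> (u * uea_embed x) = c * \<phi> u"
  shows "act_right x (power_form e s \<phi>) = c *\<^sub>C power_form e s \<phi>"
  by (auto simp: act_right_def power_form_def fun_eq_iff scaleC_complex_def assms)

lemma act_slots_power_form:
  assumes "\<And>y. \<kappa> e (bracket x y) = c * \<kappa> e y"
  shows "act_slots x (power_form e s \<phi>) = power_form e (\<lambda>k. of_nat k * c * s k) \<phi>"
proof
  fix ys
  have "power_form e s \<phi> (ys[i := bracket x (ys ! i)]) = (c * s (length ys) * prod_list (map (\<kappa> e) ys)) *\<^sub>C \<phi>"
    if i: "i < length ys" for i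
  proof -
    obtain K where K: "\<And>a. prod_list (map (\<kappa> e) (ys[i := a])) = K * \<kappa> e a" by (rule prod_list_slot[OF i, where e = e], rule that)
    have "prod_list (map (\<kappa> e) (ys[i := bracket x (ys ! i)])) = c * prod_list (map (\<kappa> e) (ys[i := ys ! i]))"
      unfolding K by (simp add: assms)
    then show ?thesis by (simp add: power_form_def mult.assoc mult.left_commute)
  qed
  then have "act_slots x (power_form e s \<phi>) ys = (\<Sum>i<length ys. (c * s (length ys) * prod_list (map (\<kappa> e) ys)) *\<^sub>C \<phi>)"
    unfolding act_slots_def by (intro sum.cong) auto
  also have "\<dots> = (of_nat (length ys) * (c * s (length ys) * prod_list (map (\<kappa> e) ys))) *\<^sub>C \<phi>"
    unfolding complex_vector.scale_sum_left[symmetric] by simp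
  finally show "act_slots x (power_form e s \<phi>) ys = power_form e (\<lambda>k. of_nat k * c * s k) \<phi> ys"
    by (simp add: power_form_def mult.assoc)
qed

lemma act_insert_power_form: "act_insert x (power_form e s \<phi>) = \<kappa> e x *\<^sub>C power_form e (\<lambda>k. s (Suc k)) \<phi>"
  by (rule ext) (simp add: act_insert_def power_form_def mult_ac fun_eq_iff)

lemma power_form_scale: "c *\<^sub>C power_form e s \<phi> = power_form e (\<lambda>k. c * s k) \<phi>"
  by (rule ext) (simp add: power_form_def mult.assoc)

lemma power_form_diff: "power_form e s \<phi> - power_form e s' \<phi> = power_form e (\<lambda>k. s k - s' k) \<phi>"
  by (rule ext) (simp add: power_form_def left_diff_distrib complex_vector.scale_left_diff_distrib)

lemma power_form_zero: "power_form e (\<lambda>_. 0) \<phi> = 0"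
  by (rule ext) (simp add: power_form_def)

text \<open>Multiplication by the linear function \<open>\<kappa>(g, \<cdot>)\<close>, with the slot for the new factor fixed at the
  front. The result is not symmetric in general, but the operators below still act on it by the
  Leibniz rule, and on power forms this is the passage to the next exponent, up to a factor.\<close>

definition times_linear :: "'g \<Rightarrow> 'g forms \<Rightarrow> 'g forms" where
  "times_linear g F ys = (case ys of [] \<Rightarrow> 0 | y # zs \<Rightarrow> \<kappa> g y *\<^sub>C F zs)"

lemma act_times_linear:
  "act_right x (times_linear g F) - act_slots x (times_linear g F)
    = times_linear (bracket x g) F + times_linear g (act_right x F - act_slots x F)"
proof
  fix ys
  show "(act_right x (times_linear g F) - act_slots x (times_linear g F)) ys
    = (times_linear (bracket x g) F + times_linear g (act_right x F - act_slots x F)) ys"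
  proof (cases ys)
    case Nil
    then show ?thesis by (simp add: times_linear_def act_right_def act_slots_def fun_eq_iff)
  next
    case (Cons y zs)
    have k: "\<kappa> (bracket x g) y = - \<kappa> g (bracket x y)"
      using bracket_antisym[of x g] by (simp add: \<kappa>_minus_left \<kappa>_invariant)
    have s: "act_slots x (times_linear g F) ys = \<kappa> g (bracket x y) *\<^sub>C F zs + \<kappa> g y *\<^sub>C act_slots x F zs"
      by (simp add: Cons act_slots_def times_linear_def sum.lessThan_Suc_shift complex_vector.scale_sum_right del: sum.lessThan_Suc)
    have r: "act_right x (times_linear g F) ys = \<kappa> g y *\<^sub>C act_right x F zs"
      by (simp add: Cons act_right_def times_linear_def fun_eq_iff)
    have "(times_linear (bracket x g) F + times_linear g (act_right x F - act_slots x F)) ys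
      = (- \<kappa> g (bracket x y)) *\<^sub>C F zs + \<kappa> g y *\<^sub>C (act_right x F zs - act_slots x F zs)"
      by (simp add: Cons times_linear_def k)
    then show ?thesis by (simp add: s r complex_vector.scale_right_diff_distrib)
  qed
qed

text \<open>By the Leibniz rule each term of the expansion carries many derivatives on one of the two factors.\<close>

lemma times_linear_nilpotent:
  defines "X \<equiv> \<lambda>x F. act_right x F - act_slots x F"
  assumes "((bracket x) ^^ a) g = 0" "((X x) ^^ b) F = 0"
  shows "((X x) ^^ (a + b)) (times_linear g F) = 0"
  using assms(2,3)
proof (induction "a + b" arbitrary: a b g F)
  case 0
  then show ?case by (auto simp: times_linear_def fun_eq_iff \<kappa>_zero_left split: list.split)
next
  case (Suc k)
  have lin: "clin (X x)" unfolding X_def using clin_act(1,2)[of x]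
    by (intro clinI) (simp_all add: clin_def scaleC_add_right complex_vector.scale_right_diff_distrib)
  note zero = clin_zero[OF clin_funpow[OF lin]]
  show ?case
  proof (cases "a = 0 \<or> b = 0")
    case True
    then have "times_linear g F = 0"
      using Suc.prems by (auto simp: times_linear_def fun_eq_iff \<kappa>_zero_left split: list.split)
    show ?thesis unfolding \<open>times_linear g F = 0\<close> by (rule zero)
  next
    case False
    then obtain a' b' where ab: "a = Suc a'" "b = Suc b'" by (cases a; cases b) auto
    have "((X x) ^^ (a + b)) (times_linear g F) = ((X x) ^^ k) (X x (times_linear g F))"
      unfolding Suc.hyps(2)[symmetric] by (simp only: funpow_Suc_right o_apply)
    also have "X x (times_linear g F) = times_linear (bracket x g) F + times_linear g (X x F)"
      unfolding X_def by (rule act_times_linear)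
    also have "((X x) ^^ k) \<dots> = ((X x) ^^ k) (times_linear (bracket x g) F) + ((X x) ^^ k) (times_linear g (X x F))"
      by (rule clin_add[OF clin_funpow[OF lin]])
    also have "((X x) ^^ k) (times_linear (bracket x g) F) = 0"
      using Suc.hyps(1)[of a' b "bracket x g" F] Suc.hyps(2) Suc.prems ab by (simp add: funpow_swap1)
    also have "((X x) ^^ k) (times_linear g (X x F)) = 0"
      using Suc.hyps(1)[of a b' g "X x F"] Suc.hyps(2) Suc.prems ab by (simp add: funpow_swap1)
    finally show ?thesis by (simp only: add_0)
  qed
qed

end

context type_B_lie
begin

lemma act_forms_monom:
  assumes F: "F \<in> forms"
  shows "act_forms (monom x 0) F = act_right x F - act_slots x F"
    and "act_forms (monom x 1) F = act_insert x F"
    and "2 \<le> r \<Longrightarrow> act_forms (monom x r) F = 0"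
    and "act_based z x F = act_right x F - act_slots x F - act_insert (bracket x z) F"
  by (simp_all add: act_forms_def act_based_def clin_minus[OF clin_act_arg(3)[OF F]]
      clin_zero[OF clin_act_arg(1)[OF F]] clin_zero[OF clin_act_arg(2)[OF F]] clin_zero[OF clin_act_arg(3)[OF F]])

text \<open>On \<open>s(\<kappa>(e\<^sub>\<theta>, y)) \<phi>\<close> the raising operators vanish, and \<open>H\<close> acts through the weight of \<open>\<phi>\<close> and
  the Euler operator.\<close>

lemma power_form_raising:
  assumes \<phi>: "\<And>u. u \<in> verma_ideal \<mu> \<Longrightarrow> \<phi> u = 0" and \<beta>: "\<beta> \<in> pos" "x \<in> root_space H \<beta>"
  shows "act_right x (power_form e\<theta> s \<phi>) = 0" "act_slots x (power_form e\<theta> s \<phi>) = 0" "\<kappa> e\<theta> (bracket x y) = 0"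
proof -
  have "\<kappa> e\<theta> (bracket x y) = - \<kappa> (bracket x e\<theta>) y" for y
    using \<kappa>_invariant[of e\<theta> x y] bracket_antisym[of e\<theta> x] by (simp add: \<kappa>_minus_left)
  then have z: "\<kappa> e\<theta> (bracket x y) = 0 * \<kappa> e\<theta> y" for y by (simp add: raising_e\<theta>[OF \<beta>] \<kappa>_zero_left)
  then show "\<kappa> e\<theta> (bracket x y) = 0" by simp
  from act_slots_power_form[of e\<theta> x 0, OF z] show "act_slots x (power_form e\<theta> s \<phi>) = 0" by (simp add: power_form_zero)
  have "\<phi> (u * uea_embed x) = 0 * \<phi> u" for u
    using \<phi>[OF left_ideal_mult[OF verma_ideal(1) verma_relations_raising[OF verma_ideal(2) \<beta>]]] by simp
  from act_right_power_form[of \<phi> x 0, OF this] show "act_right x (power_form e\<theta> s \<phi>) = 0" by simp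
qed

lemma power_form_H:
  assumes \<phi>: "clin \<phi>" "\<And>u. u \<in> verma_ideal \<mu> \<Longrightarrow> \<phi> u = 0" and y: "y \<in> H"
  shows "act_right y (power_form e\<theta> s \<phi>) - act_slots y (power_form e\<theta> s \<phi>)
    = power_form e\<theta> (\<lambda>k. (\<mu> y + of_nat k * theta11 y) * s k) \<phi>"
proof -
  have "\<kappa> e\<theta> (bracket y z) = - \<kappa> (bracket y e\<theta>) z" for z
    using \<kappa>_invariant[of e\<theta> y z] bracket_antisym[of e\<theta> y] by (simp add: \<kappa>_minus_left)
  then have s: "\<kappa> e\<theta> (bracket y z) = (- theta11 y) * \<kappa> e\<theta> z" for z by (simp add: H_e\<theta>[OF y] \<kappa>_scale_left)
  have "\<phi> (u * uea_embed y) = \<mu> y * \<phi> u" for u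
  proof -
    have "u * (uea_embed y - \<mu> y *\<^sub>C 1) = u * uea_embed y - \<mu> y *\<^sub>C u"
      by (simp add: right_diff_distrib uea_scale_right)
    then show ?thesis
      using \<phi>(2)[OF left_ideal_mult[OF verma_ideal(1) verma_relations_H[OF verma_ideal(2) y]], of u]
      by (simp add: clin_diff[OF \<phi>(1)] clin_scale[OF \<phi>(1)] scaleC_complex_def)
  qed
  from act_right_power_form[of \<phi> y "\<mu> y", OF this] show ?thesis
    unfolding act_slots_power_form[of e\<theta> y "- theta11 y", OF s] power_form_scale power_form_diff
    by (simp only: power_form_scale power_form_diff) (simp add: algebra_simps)
qed

text \<open>Multiply the Harish-Chandra projection \<open>\<phi>\<close> at \<open>\<mu>\<close> with the \<open>t\<close>-th power of the linear function
  \<open>\<kappa>(e\<^sub>\<theta>, \<cdot>)\<close>, which has weight \<open>t\<theta>\<close> and is annihilated by the raising vector fields. For an arbitrary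
  complex \<open>t\<close> this power exists as a Taylor series at \<open>x\<^sub>\<theta>\<^sup>-\<close>, where the linear function takes the value
  \<open>1\<close>; its derivatives there are the falling factorials of \<open>t\<close>.\<close>

lemma proper_shift:
  assumes \<mu>: "\<mu> \<in> dual H" and proper: "1 \<notin> verma_ideal \<mu>"
  shows "1 \<notin> verma_ideal (\<lambda>y. \<mu> y + t * theta11 y)" (is "_ \<notin> verma_ideal ?\<nu>")
proof
  assume one: "1 \<in> verma_ideal ?\<nu>"
  obtain \<phi> where \<phi>: "clin \<phi>" "\<phi> 1 = (1::complex)" "\<And>u. u \<in> verma_ideal \<mu> \<Longrightarrow> \<phi> u = 0"
    by (rule harish_chandra_functional[OF \<mu> proper], rule that)
  define s where "s k = (\<Prod>j<k. t - of_nat j)" for k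
  have s: "s (Suc k) = (t - of_nat k) * s k" for k by (simp add: s_def mult.commute)
  define F where "F = power_form e\<theta> s \<phi>"
  let ?z = "xm theta11"
  have F: "F \<in> forms" unfolding F_def by (rule power_form_forms[OF \<phi>(1)])
  interpret r: representation_mod "act_based ?z" forms "{0 :: 'g forms}" by (rule based_representation)
  have "verma_relations ?\<nu> \<subseteq> r.annihilator F"
  proof (rule verma_relations_subset[OF r.annihilator_left_ideal[OF F]])
    fix \<beta> x assume x: "\<beta> \<in> pos" "x \<in> root_space H \<beta>"
    show "uea_embed x \<in> r.annihilator F"
      unfolding r.annihilator_letter[OF F] act_forms_monom(4)[OF F]
      by (simp add: F_def power_form_raising[OF \<phi>(3) x] act_insert_power_form)
  next
    fix y assume y: "y \<in> H"
    have "bracket y ?z = (- theta11 y) *\<^sub>C ?z" using root_spaceD[OF xm_root_space[OF theta11_pos] y] by simp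
    then have "\<kappa> e\<theta> (bracket y ?z) = - theta11 y" using e\<theta>(2) by (simp only: \<kappa>_scale_right) simp
    moreover have "act_right y F - act_slots y F = power_form e\<theta> (\<lambda>k. (\<mu> y + of_nat k * theta11 y) * s k) \<phi>"
      unfolding F_def by (rule power_form_H[OF \<phi>(1) _ y]) (rule \<phi>(3))
    ultimately have "act_based ?z y F = power_form e\<theta> (\<lambda>k. (\<mu> y + of_nat k * theta11 y) * s k) \<phi>
        - (- theta11 y) *\<^sub>C power_form e\<theta> (\<lambda>k. s (Suc k)) \<phi>"
      unfolding act_forms_monom(4)[OF F] by (simp add: F_def act_insert_power_form)
    also have "\<dots> = power_form e\<theta> (\<lambda>k. ?\<nu> y * s k) \<phi>"
      unfolding s power_form_scale power_form_diff by (simp add: algebra_simps)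
    also have "\<dots> = ?\<nu> y *\<^sub>C F" unfolding F_def power_form_scale ..
    finally show "uea_embed y - ?\<nu> y *\<^sub>C 1 \<in> r.annihilator F" by (simp add: r.annihilator_letter_minus[OF F])
  qed
  then have "1 \<in> r.annihilator F" using verma_ideal(3)[OF r.annihilator_left_ideal[OF F]] one by blast
  then have "F = 0" by (simp add: r.annihilator_one[OF F])
  moreover have "F [] 1 = 1" by (simp add: F_def power_form_def s_def scaleC_complex_def \<phi>(2))
  ultimately show False by simp
qed

text \<open>The relations hold in the trivial representation.\<close>

lemma proper_zero: "1 \<notin> verma_ideal (\<lambda>_. 0)"
proof
  assume one: "1 \<in> verma_ideal (\<lambda>_. 0)"
  interpret r: representation_mod "\<lambda>(x::'g) z. 0" "UNIV" "{0 :: complex}"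
    by unfold_locales (auto simp: clin_def subspace_zero_set complex_vector.subspace_UNIV)
  have L: "left_ideal (r.annihilator 1)" by (rule r.annihilator_left_ideal) simp
  have "verma_relations (\<lambda>_. 0) \<subseteq> r.annihilator 1"
    by (rule verma_relations_subset[OF L])
      (simp_all add: r.annihilator_letter r.annihilator_letter_minus[of _ _ 0, simplified])
  then have "1 \<in> r.annihilator 1" using verma_ideal(3)[OF L] one by blast
  then show False by (simp add: r.annihilator_one)
qed

lemma proper_multiple: "1 \<notin> verma_ideal (\<lambda>y. t * theta11 y)"
  using proper_shift[OF dual_zero proper_zero, of t] by simp

text \<open>Induction on \<open>p\<close>: for \<open>p = 0\<close> this is a property of \<open>\<phi>\<close>, and each further factor \<open>\<kappa>(e\<^sub>\<theta>, \<cdot>)\<close> is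
  handled by the nilpotency of \<open>ad f\<^sub>i\<close>.\<close>

lemma power_form_nilpotent:
  assumes \<mu>: "\<mu> \<in> dual H" "\<And>i. i \<in> {1..n} \<Longrightarrow> \<mu> (h i) \<in> \<nat>" and i: "i \<in> {1..n}"
    and \<phi>: "clin \<phi>" "\<And>u. u \<in> verma_ideal \<mu> \<Longrightarrow> \<phi> u = 0" "\<And>\<beta> u. \<beta> \<in> pos \<Longrightarrow> \<phi> (uea_embed (xm \<beta>) * u) = 0"
  shows "\<exists>N. ((\<lambda>F. act_right (fv i) F - act_slots (fv i) F) ^^ N)
      (power_form e\<theta> (\<lambda>k. if k = p then 1 else 0) \<phi>) = 0"
proof (induction p)
  case 0
  let ?X = "\<lambda>F. act_right (fv i) F - act_slots (fv i) F" and ?\<delta> = "\<lambda>k. if k = 0 then 1 else (0::complex)"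
  have step: "?X (power_form e\<theta> ?\<delta> \<psi>) = power_form e\<theta> ?\<delta> (\<lambda>u. \<psi> (u * uea_embed (fv i)))" for \<psi>
  proof
    fix ys :: "'g list"
    have "act_slots (fv i) (power_form e\<theta> ?\<delta> \<psi>) ys = 0"
      by (cases ys) (simp_all add: act_slots_def power_form_def)
    moreover have "act_right (fv i) (power_form e\<theta> ?\<delta> \<psi>) ys = power_form e\<theta> ?\<delta> (\<lambda>u. \<psi> (u * uea_embed (fv i))) ys"
      by (simp add: act_right_def power_form_def fun_eq_iff)
    ultimately show "?X (power_form e\<theta> ?\<delta> \<psi>) ys = power_form e\<theta> ?\<delta> (\<lambda>u. \<psi> (u * uea_embed (fv i))) ys" by simp
  qed
  have pow: "(?X ^^ N) (power_form e\<theta> ?\<delta> \<phi>) = power_form e\<theta> ?\<delta> (\<lambda>u. \<phi> (u * uea_embed (fv i) ^ N))" for N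
  proof (induction N)
    case (Suc N)
    show ?case unfolding funpow.simps(2) o_apply Suc step by (simp add: mult.assoc)
  qed simp
  obtain m where m: "\<mu> (h i) = of_nat m" using \<mu>(2)[OF i] by (elim Nats_cases)
  have "(\<lambda>u. \<phi> (u * uea_embed (fv i) ^ Suc m)) = 0"
    using harish_chandra_integrable[OF \<mu>(1) i m \<phi>] by (intro ext) (simp del: power_Suc)
  then have "(?X ^^ Suc m) (power_form e\<theta> ?\<delta> \<phi>) = 0"
    unfolding pow by (simp add: power_form_def fun_eq_iff del: power_Suc)
  then show ?case by blast
next
  case (Suc p)
  obtain b where b: "((\<lambda>F. act_right (fv i) F - act_slots (fv i) F) ^^ b) (power_form e\<theta> (\<lambda>k. if k = p then 1 else 0) \<phi>) = 0"
    using Suc by blast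
  obtain a where a: "((bracket (fv i)) ^^ a) e\<theta> = 0" using fv_nilpotent[OF i] by blast
  have "power_form e\<theta> (\<lambda>k. if k = Suc p then 1 else 0) \<phi> = times_linear e\<theta> (power_form e\<theta> (\<lambda>k. if k = p then 1 else 0) \<phi>)"
    by (rule ext) (simp add: times_linear_def power_form_def split: list.split)
  note eq = this
  show ?case unfolding eq by (intro exI[of _ "a + b"]) (rule times_linear_nilpotent[OF a b])
qed

text \<open>The ideal \<open>J\<close> is the annihilator of the function \<open>\<kappa>(e\<^sub>\<theta>, y)\<^sup>p \<phi> / p!\<close>. The element \<open>x\<^sub>\<theta>\<^sup>- \<otimes> t\<close> differentiates it
  in direction \<open>x\<^sub>\<theta>\<^sup>-\<close>, which lowers the exponent by one each time. The exact power of \<open>f\<^sub>i\<close> in \<open>J\<close> follows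
  from mere nilpotency by \<open>sl\<^sub>2\<close>-theory.\<close>

lemma nonvanishing_powers:
  assumes \<mu>: "\<mu> \<in> dual H" "\<forall>i\<in>{1..n}. \<mu> (h i) \<in> \<nat>" and proper: "1 \<notin> verma_ideal \<mu>"
  shows "\<exists>J. current_hw J (\<lambda>y. \<mu> y + of_nat p * theta11 y) \<and> (\<forall>k\<le>p. ft ^ k \<notin> J) \<and> (p = 0 \<longrightarrow> ft \<in> J) \<and>
    (\<forall>i\<in>{1..n}. \<forall>d. \<mu> (h i) + of_nat p * theta11 (h i) = of_nat d \<longrightarrow> cur (fv i) 0 ^ Suc d \<in> J)"
proof -
  let ?\<nu> = "\<lambda>y. \<mu> y + of_nat p * theta11 y"
  obtain \<phi> where \<phi>: "clin \<phi>" "\<phi> 1 = (1::complex)" "\<And>u. u \<in> verma_ideal \<mu> \<Longrightarrow> \<phi> u = 0"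
    "\<And>\<beta> u. \<beta> \<in> pos \<Longrightarrow> \<phi> (uea_embed (xm \<beta>) * u) = 0"
    by (rule harish_chandra_functional[OF \<mu>(1) proper], rule that)
  define F where "F = power_form e\<theta> (\<lambda>k. if k = p then 1 else 0) \<phi>"
  have F: "F \<in> forms" unfolding F_def by (rule power_form_forms[OF \<phi>(1)])
  interpret r: representation_mod act_forms forms "{0 :: 'g forms}" by (rule forms_representation)
  let ?J = "r.annihilator F"
  have J: "left_ideal ?J" by (rule r.annihilator_left_ideal[OF F])
  note letter = r.annihilator_letter[OF F] and power = r.annihilator_power[OF F] and monom = act_forms_monom[OF F]
  have kill: "cur x r \<in> ?J" if "1 \<le> r" "2 \<le> r \<or> \<kappa> e\<theta> x = 0" for x r
  proof (cases "2 \<le> r")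
    case True
    then show ?thesis by (simp add: letter monom(3))
  next
    case False
    then have "r = 1" "\<kappa> e\<theta> x = 0" using that by auto
    then show ?thesis by (simp add: letter monom(2)) (simp add: F_def act_insert_power_form)
  qed
  have raising: "\<kappa> e\<theta> x = 0" if \<beta>: "\<beta> \<in> pos" "x \<in> root_space H \<beta>" for \<beta> x
  proof (rule \<kappa>_e\<theta>_zero[OF positive_roots_dual[OF \<beta>(1)] _ \<beta>(2)])
    show "\<beta> \<noteq> (\<lambda>y. - theta11 y)"
    proof
      let ?d = "\<lambda>j. int (coef \<beta> j) + int (\<theta>coef j)"
      assume *: "\<beta> = (\<lambda>y. - theta11 y)"
      have "lincomb ?d y = \<beta> y + theta11 y" for y
        unfolding lincomb_add using coef(2)[OF \<beta>(1)] theta11_lincomb by metis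
      then have "lincomb ?d = lincomb (\<lambda>_. 0)" unfolding lincomb_zero by (intro ext) (simp only: fun_cong[OF *], simp)
      from lincomb_unique[OF this, of 1] show False using n1 by (simp add: \<theta>coef_def)
    qed
  qed
  have H_zero: "\<kappa> e\<theta> y = 0" if "y \<in> H" for y
  proof (rule \<kappa>_e\<theta>_zero[OF dual_zero])
    show "(\<lambda>_. 0) \<noteq> (\<lambda>y. - theta11 y)"
      using root_nonzero[OF positive_roots_root[OF theta11_pos]] by (auto simp: fun_eq_iff)
  qed (use that root_space_zero in simp)
  have lowering: "\<kappa> e\<theta> (xm \<beta>) = 0" if \<beta>: "\<beta> \<in> pos" "\<beta> \<noteq> theta11" for \<beta>
    by (rule \<kappa>_e\<theta>_zero[OF dual_minus[OF positive_roots_dual[OF \<beta>(1)]] _ xm_root_space[OF \<beta>(1)]])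
      (use \<beta>(2) in \<open>auto simp: fun_eq_iff\<close>)
  have relations: "current_relations \<subseteq> ?J"
  proof (rule current_relations_subset[OF J])
    fix \<beta> x and r :: nat assume \<beta>: "\<beta> \<in> pos" "x \<in> root_space H \<beta>"
    show "cur x r \<in> ?J"
    proof (cases "r = 0")
      case True
      then show ?thesis by (simp add: letter monom(1)) (simp add: F_def power_form_raising[OF \<phi>(3) \<beta>])
    qed (use kill raising[OF \<beta>] in simp)
  qed (use kill H_zero in auto)
  have weight: "cur y 0 - ?\<nu> y *\<^sub>C 1 \<in> ?J" if y: "y \<in> H" for y
  proof -
    have "act_forms (monom y 0) F = power_form e\<theta> (\<lambda>k. (\<mu> y + of_nat k * theta11 y) * (if k = p then 1 else 0)) \<phi>"
      unfolding monom(1) unfolding F_def by (rule power_form_H[OF \<phi>(1) _ y]) (rule \<phi>(3))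
    also have "\<dots> = ?\<nu> y *\<^sub>C F" unfolding F_def power_form_scale
      by (rule arg_cong[of _ _ "\<lambda>s. power_form e\<theta> s \<phi>"]) auto
    finally show ?thesis by (simp add: r.annihilator_letter_minus[OF F])
  qed
  have integrable: "\<exists>N. cur (fv i) 0 ^ N \<in> ?J" if i: "i \<in> {1..n}" for i
  proof -
    have pow: "(act_forms (monom (fv i) 0) ^^ N) F = ((\<lambda>F. act_right (fv i) F - act_slots (fv i) F) ^^ N) F
      \<and> (act_forms (monom (fv i) 0) ^^ N) F \<in> forms" for N
    proof (induction N)
      case (Suc N)
      note IH = conjunct1[OF Suc] conjunct2[OF Suc]
      have "act_forms (monom (fv i) 0) ((act_forms (monom (fv i) 0) ^^ N) F)
        = act_right (fv i) (((\<lambda>F. act_right (fv i) F - act_slots (fv i) F) ^^ N) F)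
          - act_slots (fv i) (((\<lambda>F. act_right (fv i) F - act_slots (fv i) F) ^^ N) F)"
        using act_forms_monom(1)[OF IH(2), of "fv i"] unfolding IH(1) .
      then show ?case unfolding funpow.simps(2) o_apply by (rule conjI[OF _ act_forms_closed[OF IH(2)]])
    qed (simp add: F)
    obtain N where "((\<lambda>F. act_right (fv i) F - act_slots (fv i) F) ^^ N) F = 0"
      unfolding F_def using power_form_nilpotent[OF \<mu>(1) bspec[OF \<mu>(2)] i \<phi>(1,3,4), of p] by blast
    then have "(act_forms (monom (fv i) 0) ^^ N) F = 0" using pow[of N] by simp
    then have "cur (fv i) 0 ^ N \<in> ?J" by (simp add: power)
    then show ?thesis by blast
  qed
  have hw: "current_hw ?J ?\<nu>"
    unfolding current_hw_def
  proof (intro conjI ballI allI impI)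
    show "?\<nu> \<in> dual H" by (intro dual_add dual_scale \<mu> theta11_dual)
    fix \<beta> and r :: nat assume "\<beta> \<in> pos" "2 \<le> r \<or> (r = 1 \<and> \<beta> \<noteq> theta11)"
    then show "cur (xm \<beta>) r \<in> ?J" by (intro kill) (auto intro: lowering)
  qed (use J relations weight integrable in auto)
  have shift: "(act_forms (monom (xm theta11) 1) ^^ k) F = power_form e\<theta> (\<lambda>j. if j + k = p then 1 else 0) \<phi>" for k
  proof (induction k)
    case (Suc k)
    show ?case unfolding funpow.simps(2) o_apply Suc act_forms_monom(2)[OF power_form_forms[OF \<phi>(1)]] act_insert_power_form
      using e\<theta>(2) by (simp add: scaleC_one)
  qed (simp add: F_def)
  have nonzero: "ft ^ k \<notin> ?J" if "k \<le> p" for k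
  proof
    assume "ft ^ k \<in> ?J"
    then have "power_form e\<theta> (\<lambda>j. if j + k = p then 1 else 0) \<phi> = 0" by (simp add: power shift)
    moreover have "power_form e\<theta> (\<lambda>j. if j + k = p then 1 else 0) \<phi> (replicate (p - k) (xm theta11)) 1 = 1"
      using that by (simp add: power_form_def e\<theta>(2) \<phi>(2) scaleC_complex_def)
    ultimately show False by simp
  qed
  have zero: "ft \<in> ?J" if "p = 0"
    using shift[of 1] that power_form_zero by (simp add: letter One_nat_def)
  have exact: "cur (fv i) 0 ^ Suc d \<in> ?J" if i: "i \<in> {1..n}" and d: "\<mu> (h i) + of_nat p * theta11 (h i) = of_nat d" for i d
  proof -
    interpret s: sl2_operators "\<lambda>u. cur (ev i) 0 * u" "\<lambda>u. cur (fv i) 0 * u" "\<lambda>u. cur (h i) 0 * u" ?J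
      by (rule sl2_left_mult[OF J]) (simp_all only: bracket_monom ev(2)[OF i] h_ev[OF i] h_fv[OF i] scaleC_monom add_0)
    obtain N where N: "cur (fv i) 0 ^ N \<in> ?J" using integrable[OF i] by blast
    have "((\<lambda>u. cur (fv i) 0 * u) ^^ Suc d) 1 \<in> ?J"
    proof (rule s.lowest_string)
      show "cur (h i) 0 * 1 - of_nat d *\<^sub>C 1 \<in> ?J" using weight[OF h_H[OF i]] d by simp
      show "cur (ev i) 0 * 1 \<in> ?J" using current_relations_raising[OF relations simple_positive[OF i] ev(1)[OF i], of 0] by simp
      show "((\<lambda>u. cur (fv i) 0 * u) ^^ N) 1 \<in> ?J" using N by (simp add: funpow_mult)
    qed
    then show ?thesis unfolding funpow_mult by simp
  qed
  show ?thesis by (intro exI[of _ ?J] conjI hw allI impI ballI nonzero zero exact)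
qed


end

section \<open>Isomorphisms of quotient modules\<close>

lemma coset_eq: "csubspace B \<Longrightarrow> coset B v = coset B w \<longleftrightarrow> v - w \<in> B"
proof
  assume B: "csubspace B" and eq: "coset B v = coset B w"
  have "v \<in> coset B v" unfolding coset_def using subspace_zero[OF B] by (intro CollectI exI[of _ 0]) simp
  then have "v \<in> coset B w" unfolding eq .
  then show "v - w \<in> B" by (auto simp: coset_def)
next
  assume B: "csubspace B" and d: "v - w \<in> B"
  have "v + b \<in> coset B w" if "b \<in> B" for b
    unfolding coset_def using subspace_add[OF B d that] by (force intro: exI[of _ "v - w + b"])
  moreover have "w + b \<in> coset B v" if "b \<in> B" for b
    unfolding coset_def using subspace_diff[OF B that d] by (force intro: exI[of _ "b - (v - w)"])
  ultimately show "coset B v = coset B w" by (auto simp: coset_def)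
qed

lemma coset_zero: "csubspace B \<Longrightarrow> coset B 0 = B"
  by (auto simp: coset_def)

lemma coset_image:
  assumes B: "csubspace B" and f: "\<And>v w. v - w \<in> B \<Longrightarrow> f v - f w \<in> B'" and B': "csubspace B'"
  shows "{f x + b | x b. x \<in> coset B v \<and> b \<in> B'} = coset B' (f v)"
proof -
  have "{f x + b | x b. x \<in> coset B v \<and> b \<in> B'} = (\<Union>x\<in>coset B v. coset B' (f x))" by (auto simp: coset_def)
  also have "\<dots> = (\<Union>x\<in>coset B v. coset B' (f v))"
    unfolding coset_eq[OF B'] by (intro SUP_cong refl) (use coset_eq[OF B'] f in \<open>auto simp: coset_def\<close>)
  also have "\<dots> = coset B' (f v)" using subspace_zero[OF B] by (auto simp: coset_def)
  finally show ?thesis .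
qed

lemma quotient_operations:
  assumes B: "csubspace B" and \<rho>: "clin (\<rho> x)" "\<And>b. b \<in> B \<Longrightarrow> \<rho> x b \<in> B"
  shows "lie_module.add (quotient_module \<rho> A B) (coset B v) (coset B w) = coset B (v + w)"
    and "lie_module.smult (quotient_module \<rho> A B) c (coset B v) = coset B (c *\<^sub>C v)"
    and "lie_module.action (quotient_module \<rho> A B) x (coset B v) = coset B (\<rho> x v)"
proof -
  have "\<exists>a b. v + w + d = a + b \<and> (\<exists>d. a = v + d \<and> d \<in> B) \<and> (\<exists>d. b = w + d \<and> d \<in> B)" if "d \<in> B" for d
    using that subspace_zero[OF B] by (intro exI[of _ "v + d"] exI[of _ w]) (auto simp: algebra_simps)
  then show "lie_module.add (quotient_module \<rho> A B) (coset B v) (coset B w) = coset B (v + w)"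
    using subspace_add[OF B] by (auto simp: quotient_module_def coset_def) (metis add.assoc add.left_commute)?
  show "lie_module.smult (quotient_module \<rho> A B) c (coset B v) = coset B (c *\<^sub>C v)"
    using coset_image[OF B _ B, of "\<lambda>v. c *\<^sub>C v" v] subspace_scale[OF B, of _ c]
    by (simp add: quotient_module_def complex_vector.scale_right_diff_distrib[symmetric])
  show "lie_module.action (quotient_module \<rho> A B) x (coset B v) = coset B (\<rho> x v)"
    using coset_image[OF B _ B, of "\<rho> x" v] \<rho>(2) by (simp add: quotient_module_def clin_diff[OF \<rho>(1), symmetric])
qed

text \<open>Linearity of \<open>g\<close> is required modulo \<open>B'\<close> only, because the action of an enveloping algebra through
  representatives has no more.\<close>

lemma quotient_iso:
  assumes A: "csubspace A" and B: "csubspace B" and B': "csubspace B'"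
    and \<rho>: "\<And>x. clin (\<rho> x)" "\<And>x b. b \<in> B \<Longrightarrow> \<rho> x b \<in> B"
    and \<sigma>: "\<And>x. clin (\<sigma> x)" "\<And>x b. b \<in> B' \<Longrightarrow> \<sigma> x b \<in> B'"
    and g: "\<And>v w. g (v + w) - (g v + g w) \<in> B'" "\<And>c v. g (c *\<^sub>C v) - c *\<^sub>C g v \<in> B'"
    and kernel: "\<And>v. g v \<in> B' \<longleftrightarrow> v \<in> B"
    and into: "\<And>v. v \<in> A \<Longrightarrow> g v \<in> A'" and onto: "\<And>w. w \<in> A' \<Longrightarrow> \<exists>v\<in>A. w - g v \<in> B'"
    and equivariant: "\<And>x v. v \<in> A \<Longrightarrow> g (\<rho> x v) - \<sigma> x (g v) \<in> B'"
  shows "quotient_module \<rho> A B \<cong>\<^sub>L quotient_module \<sigma> A' B'"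
proof -
  have gd: "g (v - w) - (g v - g w) \<in> B'" for v w
    using subspace_minus[OF B' g(1)[of "v - w" w]] by (simp add: algebra_simps)
  have diff: "g v - g w \<in> B' \<longleftrightarrow> v - w \<in> B" for v w
    using subspace_diff_cancel[OF B' gd[of v w]] kernel[of "v - w"] by simp
  define F where "F X = {g v + b | v b. v \<in> X \<and> b \<in> B'}" for X
  have F: "F (coset B v) = coset B' (g v)" for v
    unfolding F_def by (rule coset_image[OF B _ B']) (simp add: diff)
  have bij: "bij_betw F (coset B ` A) (coset B' ` A')"
    unfolding bij_betw_def
  proof
    show "inj_on F (coset B ` A)"
    proof (rule inj_onI)
      fix X Y assume "X \<in> coset B ` A" "Y \<in> coset B ` A" and eq: "F X = F Y"
      then obtain v w where "X = coset B v" "Y = coset B w" by blast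
      then show "X = Y" using eq unfolding F by (simp add: F coset_eq[OF B'] diff coset_eq[OF B])
    qed
    show "F ` coset B ` A = coset B' ` A'"
    proof (intro subset_antisym subsetI)
      fix Y assume "Y \<in> coset B' ` A'"
      then obtain w where w: "w \<in> A'" "Y = coset B' w" by blast
      obtain v where "v \<in> A" "w - g v \<in> B'" using onto[OF w(1)] by blast
      then show "Y \<in> F ` coset B ` A" using w coset_eq[OF B', of w "g v"] F by auto
    qed (use F into in auto)
  qed
  have carrier: "lie_module.carrier (quotient_module \<rho> A B) = coset B ` A"
    "lie_module.carrier (quotient_module \<sigma> A' B') = coset B' ` A'" by (simp_all add: quotient_module_def)
  note ops = quotient_operations[where \<rho> = \<rho>, OF B \<rho>] quotient_operations[where \<rho> = \<sigma>, OF B' \<sigma>]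
  show ?thesis unfolding lie_module_iso_def carrier
  proof (intro exI[of _ F] conjI ballI allI)
    fix X Y assume "X \<in> coset B ` A" "Y \<in> coset B ` A"
    then obtain v w where "X = coset B v" "Y = coset B w" by blast
    then show "F (lie_module.add (quotient_module \<rho> A B) X Y) = lie_module.add (quotient_module \<sigma> A' B') (F X) (F Y)"
      by (simp add: ops F coset_eq[OF B'] g(1))
  next
    fix c X assume "X \<in> coset B ` A"
    then obtain v where "X = coset B v" by blast
    then show "F (lie_module.smult (quotient_module \<rho> A B) c X) = lie_module.smult (quotient_module \<sigma> A' B') c (F X)"
      by (simp add: ops F coset_eq[OF B'] g(2))
  next
    fix x X assume "X \<in> coset B ` A"
    then obtain v where "X = coset B v" "v \<in> A" by blast
    then show "F (lie_module.action (quotient_module \<rho> A B) x X) = lie_module.action (quotient_module \<sigma> A' B') x (F X)"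
      by (simp add: ops F coset_eq[OF B'] equivariant)
  qed (rule bij)
qed

lemma iso_sym:
  assumes iso: "M \<cong>\<^sub>L N" and closed: "submodule M (lie_module.carrier M)"
  shows "N \<cong>\<^sub>L M"
proof -
  let ?C = "lie_module.carrier M" and ?D = "lie_module.carrier N"
  obtain f where f: "bij_betw f ?C ?D"
    and hom: "\<And>u v. u \<in> ?C \<Longrightarrow> v \<in> ?C \<Longrightarrow> f (lie_module.add M u v) = lie_module.add N (f u) (f v)"
      "\<And>c u. u \<in> ?C \<Longrightarrow> f (lie_module.smult M c u) = lie_module.smult N c (f u)"
      "\<And>x u. u \<in> ?C \<Longrightarrow> f (lie_module.action M x u) = lie_module.action N x (f u)"
    using iso unfolding lie_module_iso_def by blast
  let ?g = "the_inv_into ?C f"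
  have g: "?g (f u) = u" if "u \<in> ?C" for u
    using f that by (simp add: bij_betw_def the_inv_into_f_f)
  have D: "\<exists>u\<in>?C. w = f u" if "w \<in> ?D" for w using f that by (auto simp: bij_betw_def)
  show ?thesis unfolding lie_module_iso_def
  proof (intro exI[of _ ?g] conjI ballI allI)
    show "bij_betw ?g ?D ?C" by (rule bij_betw_the_inv_into[OF f])
  next
    fix w z assume "w \<in> ?D" "z \<in> ?D"
    then obtain u v where uv: "u \<in> ?C" "v \<in> ?C" "w = f u" "z = f v" using D by blast
    then have "lie_module.add M u v \<in> ?C" using closed by (auto simp: submodule_def)
    from g[OF this] show "?g (lie_module.add N w z) = lie_module.add M (?g w) (?g z)" using uv by (simp add: g hom)
  next
    fix c w assume "w \<in> ?D"
    then obtain u where u: "u \<in> ?C" "w = f u" using D by blast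
    then have "lie_module.smult M c u \<in> ?C" using closed by (auto simp: submodule_def)
    from g[OF this] show "?g (lie_module.smult N c w) = lie_module.smult M c (?g w)" using u by (simp add: g hom)
  next
    fix x w assume "w \<in> ?D"
    then obtain u where u: "u \<in> ?C" "w = f u" using D by blast
    then have "lie_module.action M x u \<in> ?C" using closed by (auto simp: submodule_def)
    from g[OF this] show "?g (lie_module.action N x w) = lie_module.action M x (?g w)" using u by (simp add: g hom)
  qed
qed

lemma uea_quotient_submodule:
  assumes J: "left_ideal J" shows "submodule (uea_quotient J) (lie_module.carrier (uea_quotient J))"
proof -
  note Js = left_ideal_subspace[OF J]
  have stable: "\<And>x b. b \<in> J \<Longrightarrow> uea_embed x * b \<in> J" by (rule left_ideal_mult[OF J])
  note ops = quotient_operations[where \<rho> = "\<lambda>x u. uea_embed x * u" and A = UNIV, OF Js clin_mult_left stable]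
  have carrier: "lie_module.carrier (quotient_module (\<lambda>x u. uea_embed x * u) UNIV J) = range (coset J)"
    "lie_module.zero (quotient_module (\<lambda>x u. uea_embed x * u) UNIV J) = coset J 0"
    by (simp_all add: quotient_module_def coset_zero[OF Js])
  show ?thesis unfolding submodule_def uea_quotient_def carrier by (auto simp: ops)
qed

section \<open>The graded pieces of \<open>M(\<Lambda>)\<close>\<close>

context type_B_lie
begin

lemma weight_coeff: "\<Lambda> \<in> dominant_weights \<Longrightarrow> i \<in> {1..n} \<Longrightarrow> \<Lambda> (h i) = of_nat (weight_coeff \<Lambda> i)"
proof -
  assume "\<Lambda> \<in> dominant_weights" "i \<in> {1..n}"
  then have "\<Lambda> (h i) \<in> \<nat>" by (simp add: dominant_weights_def)
  then obtain m where "\<Lambda> (h i) = of_nat m" by (elim Nats_cases)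
  then show ?thesis unfolding weight_coeff_def by (intro theI[of "\<lambda>m. \<Lambda> (h i) = of_nat m" m]) auto
qed

lemma fund_ideal_subset:
  assumes i: "i \<in> {1..n}" and J: "current_hw J \<nu>" and \<nu>: "\<And>j. j \<in> {1..n} \<Longrightarrow> \<nu> (h j) = (if j = i then of_nat m else 0)"
    and exact: "\<And>j d. j \<in> {1..n} \<Longrightarrow> \<nu> (h j) = of_nat d \<Longrightarrow> cur (fv j) 0 ^ Suc d \<in> J"
  shows "M_fund_ideal i m \<subseteq> J"
  unfolding M_fund_ideal_def
proof (rule left_ideal_generated_least[OF hw_ideal[OF J]], intro Un_least)
  \<comment> \<open>The first two coefficients of \<open>\<theta>\<close> are \<open>1\<close> and \<open>2\<close>, so \<open>\<theta>\<close> is not simple.\<close>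
  have "coef (\<alpha> i) 1 + coef (\<alpha> i) 2 < coef theta11 1 + coef theta11 2"
    unfolding coef_simple[OF i] coef_theta11 using rank by (simp add: \<theta>coef_def)
  then have "\<alpha> i \<noteq> theta11" by auto
  then have "cur (fv i) 1 \<in> J" unfolding fv_def by (intro hw_lowering[OF J simple_positive[OF i]]) simp
  moreover have "cur (fv i) 0 ^ Suc m \<in> J" using exact[OF i] \<nu>[OF i] by simp
  moreover have "cur (h i) 0 - of_nat m \<in> J"
    using hw_weight[OF J h_H[OF i]] \<nu>[OF i] by (simp add: of_nat_scaleC_one[symmetric])
  ultimately show "{cur (h i) 0 - of_nat m, cur (xm (\<alpha> i)) 0 ^ (m + 1), cur (xm (\<alpha> i)) 1} \<subseteq> J"
    by (simp add: fv_def Suc_eq_plus1 del: power_Suc)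
  have "cur (h j) 0 \<in> J \<and> cur (fv j) 0 \<in> J" if "j \<in> {1..n} - {i}" for j
    using exact[of j 0] \<nu>[of j] hw_weight[OF J h_H, of j] that by auto
  then show "(\<Union>j\<in>{1..n} - {i}. {cur (h j) 0, cur (xm (\<alpha> j)) 0}) \<subseteq> J" unfolding fv_def by blast
qed (rule hw_relations[OF J])

text \<open>If \<open>x\<^sub>\<beta>\<^sup>-\<close> kills the generator, then so does the coroot \<open>[x\<^sub>\<beta>\<^sup>+, x\<^sub>\<beta>\<^sup>-]\<close>, on which \<open>m\<omega>\<^sub>i\<close> takes a
  positive multiple of the value \<open>m coef \<beta> i\<close>.\<close>

lemma killed_coefficient:
  assumes L: "current_hw L \<omega>" "1 \<notin> L" and \<omega>: "\<And>j. j \<in> {1..n} \<Longrightarrow> \<omega> (h j) = (if j = i then of_nat m else 0)"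
    and i: "i \<in> {1..n}" "m > 0" and \<beta>: "\<beta> \<in> pos" "cur (xm \<beta>) 0 \<in> L"
  shows "coef \<beta> i = 0"
proof -
  note Ls = hw_subspace[OF L(1)]
  obtain x where x: "x \<in> root_space H \<beta>" "\<kappa> x (xm \<beta>) = 1" by (rule raising_vector[OF n1 \<beta>(1)])
  let ?t = "bracket x (xm \<beta>)" and ?c = "\<lambda>j. complex_of_real (of_nat (coef \<beta> j) / nrm j)"
  let ?s = "\<Sum>j=1..n. ?c j *\<^sub>C h j"
  have "?t \<in> root_space H (\<lambda>y. \<beta> y + - \<beta> y)" by (rule bracket_root_space[OF x(1) xm_root_space[OF \<beta>(1)]])
  then have t: "?t \<in> H" by (simp add: root_space_zero)
  have s: "?s \<in> H" by (intro subspace_sum[OF H_subspace] subspace_scale[OF H_subspace] h_H)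
  have "cur ?t 0 \<in> L" using cur_bracket_mem[OF hw_ideal[OF L(1)] hw_raising[OF L(1) \<beta>(1) x(1), of 0] \<beta>(2)] by simp
  from subspace_diff[OF Ls this hw_weight[OF L(1) t]] have z: "\<omega> ?t *\<^sub>C 1 \<in> L" by simp
  have "\<omega> ?t = 0"
  proof (rule ccontr)
    assume "\<omega> ?t \<noteq> 0"
    then show False using subspace_scale[OF Ls z, of "inverse (\<omega> ?t)"] L(2) by simp
  qed
  \<comment> \<open>Under the Killing form both represent \<open>\<beta>\<close> on \<open>H\<close>.\<close>
  moreover have "?t = ?s"
  proof -
    have "?t - ?s = 0"
    proof (rule \<kappa>_nondegenerate[OF n1])
      fix y
      have "y \<in> {y. \<kappa> (?t - ?s) y = 0}"
      proof (rule weight_induct)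
        show "csubspace {y. \<kappa> (?t - ?s) y = 0}"
          using subspace_vimage[OF clin_\<kappa> subspace_zero_set, of "?t - ?s"] by simp
        fix \<gamma> y assume \<gamma>: "\<gamma> \<in> dual H" and y: "y \<in> root_space H \<gamma>"
        have ts: "?t - ?s \<in> H" by (rule subspace_diff[OF H_subspace t s])
        show "y \<in> {y. \<kappa> (?t - ?s) y = 0}"
        proof (cases "\<gamma> = (\<lambda>_. 0)")
          case False
          have "\<gamma> \<noteq> (\<lambda>y. - (\<lambda>_. 0) y)" using False by simp
          from \<kappa>_orthogonal[OF dual_zero \<gamma> this _ y] ts show ?thesis by (simp add: root_space_zero)
        next
          case True
          then have yH: "y \<in> H" using y root_space_zero by simp
          have "\<kappa> ?t y = \<kappa> x (bracket (xm \<beta>) y)" by (rule \<kappa>_invariant)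
          also have "bracket (xm \<beta>) y = \<beta> y *\<^sub>C xm \<beta>"
            using root_spaceD[OF xm_root_space[OF \<beta>(1)] yH] bracket_antisym[of "xm \<beta>" y] by simp
          finally have "\<kappa> ?t y = \<beta> y" using x(2) by (simp add: \<kappa>_scale_right)
          moreover have "\<kappa> ?s y = (\<Sum>j=1..n. ?c j * \<kappa> (h j) y)"
            using clin_sum[OF clin_\<kappa>_left[of y], of "\<lambda>j. ?c j *\<^sub>C h j"] by (simp add: \<kappa>_scale_left)
          moreover have "\<dots> = (\<Sum>j=1..n. of_int (int (coef \<beta> j)) * \<alpha> j y)"
          proof (intro sum.cong refl)
            fix j assume j: "j \<in> {1..n}"
            show "?c j * \<kappa> (h j) y = of_int (int (coef \<beta> j)) * \<alpha> j y"
              using nrm_pos[OF j] by (simp add: \<kappa>_h[OF j yH])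
          qed
          moreover have "\<dots> = \<beta> y" using fun_cong[OF coef(2)[OF \<beta>(1)], of y] by (simp add: lincomb_def)
          ultimately show ?thesis by (simp add: clin_diff[OF clin_\<kappa>_left])
        qed
      qed
      then show "\<kappa> (?t - ?s) y = 0" by simp
    qed
    then show ?thesis by simp
  qed
  moreover have "\<omega> ?s = (\<Sum>j=1..n. ?c j * \<omega> (h j))"
    by (rule dual_sum_arg[OF hw_dual[OF L(1)] H_subspace h_H])
  moreover have "\<dots> = (\<Sum>j=1..n. if j = i then ?c i * of_nat m else 0)"
    by (intro sum.cong) (auto simp: \<omega>)
  ultimately have "?c i * of_nat m = 0" using i(1) by simp
  then show ?thesis using i(2) nrm_pos[OF i(1)] by simp
qed

context
  fixes \<Lambda> :: "'g \<Rightarrow> complex"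
  assumes \<Lambda>: "\<Lambda> \<in> dominant_weights" and support: "\<And>i. i \<in> {1..n} \<Longrightarrow> i > 2 \<Longrightarrow> \<Lambda> (h i) = 0"
begin

abbreviation wc :: "nat \<Rightarrow> nat" where "wc \<equiv> weight_coeff \<Lambda>"

abbreviation fund :: "nat \<Rightarrow> 'g poly uea set" where "fund i \<equiv> M_fund_ideal i (wc i)"

definition top_degree :: nat where "top_degree = wc 2 div (if n = 2 then 2 else 1)"

lemma \<Lambda>_dual: "\<Lambda> \<in> dual H"
  using \<Lambda> by (simp add: dominant_weights_def)

lemma wc: "i \<in> {1..n} \<Longrightarrow> \<Lambda> (h i) = of_nat (wc i)"
  by (rule weight_coeff[OF \<Lambda>])

lemma wc_zero: "i \<in> {1..n} \<Longrightarrow> i > 2 \<Longrightarrow> wc i = 0"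
  using wc[of i] support[of i] by simp

lemma top_degree_floor: "int k \<le> \<lfloor>d_prime n 2 * real (wc 2)\<rfloor> \<longleftrightarrow> k \<le> top_degree"
proof -
  have "int k \<le> \<lfloor>d_prime n 2 * real (wc 2)\<rfloor> \<longleftrightarrow> real k \<le> d_prime n 2 * real (wc 2)"
    by (simp add: le_floor_iff)
  also have "\<dots> \<longleftrightarrow> k * (if n = 2 then 2 else 1) \<le> wc 2"
  proof -
    have "real (k * 2) \<le> real (wc 2) \<longleftrightarrow> k * 2 \<le> wc 2" by (rule of_nat_le_iff)
    then show ?thesis using rank by (auto simp: d_prime_def)
  qed
  also have "\<dots> \<longleftrightarrow> k \<le> top_degree" by (simp add: top_degree_def less_eq_div_iff_mult_less_eq)
  finally show ?thesis .
qed

lemma shifted_\<Lambda>: "i \<in> {1..n} \<Longrightarrow>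
    shifted \<Lambda> k (h i) = of_nat (wc i) - (if i = 2 then of_nat (k * (if n = 2 then 2 else 1)) else 0)"
  by (simp add: shifted_def wc theta11_h)

lemma shifted_dominant: "k \<le> top_degree \<Longrightarrow> i \<in> {1..n} \<Longrightarrow> shifted \<Lambda> k (h i) \<in> \<nat>"
proof -
  assume k: "k \<le> top_degree" and i: "i \<in> {1..n}"
  have "k * (if n = 2 then 2 else 1) \<le> wc 2" using k by (simp add: top_degree_def less_eq_div_iff_mult_less_eq split: if_splits)
  then have "of_nat (wc 2) - of_nat (k * (if n = 2 then 2 else 1)) = (of_nat (wc 2 - k * (if n = 2 then 2 else 1)) :: complex)"
    by (simp only: of_nat_diff)
  then show ?thesis unfolding shifted_\<Lambda>[OF i] by (cases "i = 2") (metis of_nat_in_Nats, simp)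
qed

lemma shifted_not_dominant: "top_degree < k \<Longrightarrow> shifted \<Lambda> k (h 2) \<notin> \<nat>"
proof
  assume "top_degree < k" and "shifted \<Lambda> k (h 2) \<in> \<nat>"
  then obtain d where "shifted \<Lambda> k (h 2) = of_nat d" by (elim Nats_cases)
  then have "of_nat (wc 2) = (of_nat (d + k * (if n = 2 then 2 else 1)) :: complex)"
    using rank shifted_\<Lambda>[of 2 k] by (auto simp: algebra_simps split: if_splits)
  then have "wc 2 = d + k * (if n = 2 then 2 else 1)" by (simp only: of_nat_eq_iff)
  then have "k \<le> top_degree" by (simp add: top_degree_def less_eq_div_iff_mult_less_eq)
  then show False using \<open>top_degree < k\<close> by simp
qed

text \<open>These are the weights \<open>\<lambda>(h\<^sub>i) \<omega>\<^sub>i\<close>. As \<open>\<theta>\<close> is a multiple of \<open>\<omega>\<^sub>2\<close>, the first differs from every \<open>\<Lambda> - k\<theta>\<close>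
  by a complex multiple of \<open>\<theta>\<close>, and the second is such a multiple itself.\<close>

definition ratio :: complex where "ratio = of_nat (wc 2) / theta11 (h 2)"

definition fund_weight :: "nat \<Rightarrow> 'g \<Rightarrow> complex" where
  "fund_weight i = (\<lambda>y. if i = 1 then \<Lambda> y - ratio * theta11 y else if i = 2 then ratio * theta11 y else 0)"

lemma fund_weight_dual: "fund_weight i \<in> dual H"
  using dual_diff[OF \<Lambda>_dual dual_scale[OF theta11_dual]] dual_scale[OF theta11_dual] dual_zero
  by (cases "i = 1"; cases "i = 2") (auto simp: fund_weight_def)

lemma fund_weight: "i \<in> {1..n} \<Longrightarrow> j \<in> {1..n} \<Longrightarrow> fund_weight i (h j) = (if j = i then of_nat (wc i) else 0)"
proof -
  assume i: "i \<in> {1..n}" and j: "j \<in> {1..n}"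
  have "ratio * theta11 (h j) = (if j = 2 then of_nat (wc 2) else 0)"
    using theta11_h[OF j] by (auto simp: ratio_def)
  then show ?thesis using i j wc[OF j] wc_zero[of i] wc_zero[of j] by (auto simp: fund_weight_def)
qed

lemma fund_weight_sum: "(\<Sum>i=1..n. fund_weight i y) = \<Lambda> y"
proof -
  have "(\<Sum>i=1..n. fund_weight i y) = (\<Sum>i=1..n. (if i = 1 then \<Lambda> y - ratio * theta11 y else 0) + (if i = 2 then ratio * theta11 y else 0))"
    by (intro sum.cong) (auto simp: fund_weight_def)
  then show ?thesis using rank by (simp add: sum.distrib)
qed

lemma fund_current_hw: "i \<in> {1..n} \<Longrightarrow> current_hw (fund i) (fund_weight i)"
  by (rule fund_hw[OF _ _ fund_weight_dual fund_weight]) (use wc_zero[of i] not_le[of i 2] in auto)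

text \<open>All these weights lie on one line \<open>\<Lambda> + \<complex>\<theta>\<close>, along which properness is constant.\<close>

lemma proper_fund_weight: "1 \<notin> verma_ideal (shifted \<Lambda> k) \<longleftrightarrow> 1 \<notin> verma_ideal (fund_weight 1)"
proof -
  have "shifted \<Lambda> k = (\<lambda>y. fund_weight 1 y + (ratio - of_nat k) * theta11 y)"
    "fund_weight 1 = (\<lambda>y. shifted \<Lambda> k y + (of_nat k - ratio) * theta11 y)"
    by (auto simp: fund_weight_def shifted_def fun_eq_iff algebra_simps)
  then show ?thesis
    using proper_shift[OF fund_weight_dual, of 1 "ratio - of_nat k"] proper_shift[OF shifted_dual[OF \<Lambda>_dual], of k "of_nat k - ratio"]
    by metis
qed

lemma fund_1: "1 \<notin> verma_ideal (fund_weight 1) \<Longrightarrow> 1 \<notin> fund 1"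
proof -
  have i: "1 \<in> {1..n}" using n1 by simp
  assume proper: "1 \<notin> verma_ideal (fund_weight 1)"
  have nat: "\<forall>j\<in>{1..n}. fund_weight 1 (h j) \<in> \<nat>" using fund_weight[OF i] by simp
  obtain J where J: "current_hw J (\<lambda>y. fund_weight 1 y + of_nat 0 * theta11 y)" "\<And>k. k \<le> 0 \<Longrightarrow> ft ^ k \<notin> J"
    "\<And>i d. i \<in> {1..n} \<Longrightarrow> fund_weight 1 (h i) + of_nat 0 * theta11 (h i) = of_nat d \<Longrightarrow> cur (fv i) 0 ^ Suc d \<in> J"
    using nonvanishing_powers[where p = 0, OF fund_weight_dual nat proper] by blast
  have "fund 1 \<subseteq> J" by (rule fund_ideal_subset[OF i J(1)]) (use J(3) fund_weight[OF i] in simp_all)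
  then show ?thesis using J(2)[of 0] by auto
qed

lemma fund_2: "k \<le> top_degree \<Longrightarrow> ft ^ k \<notin> fund 2"
proof -
  have i: "2 \<in> {1..n}" using rank by simp
  let ?\<mu> = "\<lambda>y. (ratio - of_nat top_degree) * theta11 y"
  have nat: "\<forall>j\<in>{1..n}. ?\<mu> (h j) \<in> \<nat>"
  proof
    fix j assume j: "j \<in> {1..n}"
    show "?\<mu> (h j) \<in> \<nat>"
    proof (cases "j = 2")
      case True
      have "?\<mu> (h 2) = shifted \<Lambda> top_degree (h 2)"
        using theta11_h[OF i] wc[OF i] by (simp add: ratio_def shifted_def algebra_simps)
      then show ?thesis using shifted_dominant[OF order_refl i] True by simp
    next
      case False
      then show ?thesis using theta11_h[OF j] by simp
    qed
  qed
  obtain J where J: "current_hw J (\<lambda>y. ?\<mu> y + of_nat top_degree * theta11 y)" "\<And>k. k \<le> top_degree \<Longrightarrow> ft ^ k \<notin> J"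
    "\<And>i d. i \<in> {1..n} \<Longrightarrow> ?\<mu> (h i) + of_nat top_degree * theta11 (h i) = of_nat d \<Longrightarrow> cur (fv i) 0 ^ Suc d \<in> J"
    using nonvanishing_powers[where p = top_degree, OF dual_scale[OF theta11_dual] nat proper_multiple] by blast
  have eq: "?\<mu> y + of_nat top_degree * theta11 y = fund_weight 2 y" for y
    by (simp add: fund_weight_def algebra_simps)
  have "fund 2 \<subseteq> J"
    by (rule fund_ideal_subset[OF i J(1)[unfolded eq]]) (use J(3)[unfolded eq] fund_weight[OF i] in simp_all)
  moreover assume "k \<le> top_degree"
  ultimately show ?thesis using J(2) by auto
qed

lemma fund_trivial: "i \<in> {1..n} \<Longrightarrow> i > 2 \<Longrightarrow> 1 \<notin> fund i"
proof -
  assume i: "i \<in> {1..n}" "i > 2"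
  obtain J where J: "current_hw J (\<lambda>y. (\<lambda>_. 0) y + of_nat 0 * theta11 y)" "\<And>k. k \<le> 0 \<Longrightarrow> ft ^ k \<notin> J"
    "\<And>i d. i \<in> {1..n} \<Longrightarrow> (\<lambda>_. 0) (h i) + of_nat 0 * theta11 (h i) = of_nat d \<Longrightarrow> cur (fv i) 0 ^ Suc d \<in> J"
    using nonvanishing_powers[where p = 0, OF dual_zero _ proper_zero] by auto
  have "fund i \<subseteq> J" by (rule fund_ideal_subset[OF i(1) J(1)]) (use J(3) wc_zero[OF i] in simp_all)
  then show ?thesis using J(2)[of 0] by auto
qed

lemma ft_fund: "i \<in> {1..n} \<Longrightarrow> i \<noteq> 2 \<Longrightarrow> ft \<in> fund i"
proof (cases "i = 1")
  case True
  assume i: "i \<in> {1..n}"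
  show ?thesis by (rule fund_lowering[OF i theta11_pos]) (use True in \<open>simp add: coef_theta11 \<theta>coef_def\<close>)
next
  case False
  assume i: "i \<in> {1..n}" "i \<noteq> 2"
  then show ?thesis using False fund_zero_lowering[OF i(1) theta11_pos, of 1] wc_zero[OF i(1)] by simp
qed

lemma M_ideal: "left_ideal (M_ideal \<Lambda>)" "current_relations \<subseteq> M_ideal \<Lambda>"
  "i \<in> {1..n} \<Longrightarrow> cur (h i) 0 - \<Lambda> (h i) *\<^sub>C 1 \<in> M_ideal \<Lambda>"
  "i \<in> {1..n} \<Longrightarrow> cur (fv i) 0 ^ Suc (wc i) \<in> M_ideal \<Lambda>"
  "\<beta> \<in> R_weight \<Lambda> r \<Longrightarrow> cur (xm \<beta>) r \<in> M_ideal \<Lambda>"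
proof -
  let ?R = "current_relations \<union>
      (\<Union>i\<in>{1..n}. {cur (h i) 0 - \<Lambda> (h i) *\<^sub>C 1, cur (xm (\<alpha> i)) 0 ^ (wc i + 1)}) \<union>
      (\<Union>r. (\<lambda>\<beta>. cur (xm \<beta>) r) ` R_weight \<Lambda> r)"
  have *: "?R \<subseteq> M_ideal \<Lambda>" unfolding M_ideal_def by (rule left_ideal_generated_base)
  show "left_ideal (M_ideal \<Lambda>)" unfolding M_ideal_def by (rule left_ideal_generated)
  show "current_relations \<subseteq> M_ideal \<Lambda>"
    "i \<in> {1..n} \<Longrightarrow> cur (h i) 0 - \<Lambda> (h i) *\<^sub>C 1 \<in> M_ideal \<Lambda>"
    "i \<in> {1..n} \<Longrightarrow> cur (fv i) 0 ^ Suc (wc i) \<in> M_ideal \<Lambda>"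
    "\<beta> \<in> R_weight \<Lambda> r \<Longrightarrow> cur (xm \<beta>) r \<in> M_ideal \<Lambda>"
    using * unfolding fv_def Suc_eq_plus1 by blast+
qed

lemma M_ideal_least:
  assumes "left_ideal J" "current_relations \<subseteq> J" "\<And>i. i \<in> {1..n} \<Longrightarrow> cur (h i) 0 - \<Lambda> (h i) *\<^sub>C 1 \<in> J"
    "\<And>i. i \<in> {1..n} \<Longrightarrow> cur (fv i) 0 ^ Suc (wc i) \<in> J"
    "\<And>\<beta> r. \<beta> \<in> pos \<Longrightarrow> (\<And>i. i \<in> {1..n} \<Longrightarrow> cur (xm \<beta>) r \<in> fund i) \<Longrightarrow> cur (xm \<beta>) r \<in> J"
  shows "M_ideal \<Lambda> \<subseteq> J"
  unfolding M_ideal_def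
proof (rule left_ideal_generated_least[OF assms(1)], intro Un_least assms(2))
  show "(\<Union>i\<in>{1..n}. {cur (h i) 0 - \<Lambda> (h i) *\<^sub>C 1, cur (xm (\<alpha> i)) 0 ^ (wc i + 1)}) \<subseteq> J"
    using assms(3,4) by (auto simp: fv_def Suc_eq_plus1 simp del: power_Suc)
  have "cur (xm \<beta>) r \<in> J" if "\<beta> \<in> R_weight \<Lambda> r" for \<beta> r
  proof (rule assms(5))
    have "\<beta> \<in> R_fund 1 (wc 1) r" using that n1 by (simp add: R_weight_def)
    then show "\<beta> \<in> pos" by (simp only: R_fund_iff)
    show "cur (xm \<beta>) r \<in> fund i" if "i \<in> {1..n}" for i
    proof -
      have "\<beta> \<in> R_fund i (wc i) r" using \<open>\<beta> \<in> R_weight \<Lambda> r\<close> that by (simp add: R_weight_def)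
      then show ?thesis by (simp only: R_fund_iff)
    qed
  qed
  then show "(\<Union>r. (\<lambda>\<beta>. cur (xm \<beta>) r) ` R_weight \<Lambda> r) \<subseteq> J" by auto
qed

lemma M_ideal_hw: "current_hw (M_ideal \<Lambda>) \<Lambda>"
  unfolding current_hw_def
proof (intro conjI ballI allI impI)
  show "cur y 0 - \<Lambda> y *\<^sub>C 1 \<in> M_ideal \<Lambda>" if "y \<in> H" for y
    by (rule weight_relations_H[OF M_ideal(1) \<Lambda>_dual M_ideal(3) that])
  show "\<exists>N. cur (fv i) 0 ^ N \<in> M_ideal \<Lambda>" if "i \<in> {1..n}" for i using M_ideal(4)[OF that] by blast
  fix \<beta> and r :: nat assume \<beta>: "\<beta> \<in> pos" "2 \<le> r \<or> (r = 1 \<and> \<beta> \<noteq> theta11)"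
  have "\<beta> \<in> R_weight \<Lambda> r"
    unfolding R_weight_def using hw_lowering[OF fund_current_hw \<beta>] \<beta>(1) by (auto simp: R_fund_iff)
  then show "cur (xm \<beta>) r \<in> M_ideal \<Lambda>" by (rule M_ideal(5))
qed (rule M_ideal \<Lambda>_dual)+

text \<open>The generator of the module constructed from \<open>\<Lambda> - p\<theta>\<close> satisfies the relations of \<open>M(\<Lambda>)\<close>. The delicate
  ones are the elements of \<open>R\<^sup>+(\<Lambda>, r)\<close> for \<open>r \<le> 1\<close>: that \<open>\<beta>\<close> belongs to it forces \<open>\<beta> \<noteq> \<theta>\<close> or \<open>p = 0\<close> if
  \<open>r = 1\<close>, and \<open>\<lambda>(h\<^sub>j) = 0\<close> on the support of \<open>\<beta>\<close> if \<open>r = 0\<close>, since the modules \<open>M(\<lambda>(h\<^sub>j) \<omega>\<^sub>j)\<close> do not vanish.\<close>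

lemma power_not_in_M_ideal:
  assumes proper: "1 \<notin> verma_ideal (fund_weight 1)" and k: "k \<le> top_degree"
  shows "ft ^ k \<notin> M_ideal \<Lambda>"
proof -
  let ?p = top_degree
  have proper': "1 \<notin> verma_ideal (shifted \<Lambda> ?p)" using proper proper_fund_weight by blast
  have nat: "\<forall>i\<in>{1..n}. shifted \<Lambda> ?p (h i) \<in> \<nat>" using shifted_dominant by blast
  obtain J where J: "current_hw J (\<lambda>y. shifted \<Lambda> ?p y + of_nat ?p * theta11 y)" "\<And>k. k \<le> ?p \<Longrightarrow> ft ^ k \<notin> J" "?p = 0 \<Longrightarrow> ft \<in> J"
    "\<And>i d. i \<in> {1..n} \<Longrightarrow> shifted \<Lambda> ?p (h i) + of_nat ?p * theta11 (h i) = of_nat d \<Longrightarrow> cur (fv i) 0 ^ Suc d \<in> J"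
    using nonvanishing_powers[where p = ?p, OF shifted_dual[OF \<Lambda>_dual] nat proper'] by (elim exE conjE) (rule that, auto simp del: power_Suc)
  have eq: "shifted \<Lambda> ?p y + of_nat ?p * theta11 y = \<Lambda> y" for y by (simp add: shifted_def)
  note hw = J(1)[unfolded eq] and exact = J(4)[unfolded eq]
  have "M_ideal \<Lambda> \<subseteq> J"
  proof (rule M_ideal_least[OF hw_ideal[OF hw] hw_relations[OF hw]])
    fix \<beta> r assume \<beta>: "\<beta> \<in> pos" and fund: "\<And>i. i \<in> {1..n} \<Longrightarrow> cur (xm \<beta>) r \<in> fund i"
    consider "2 \<le> r \<or> (r = 1 \<and> \<beta> \<noteq> theta11)" | "r = 1" "\<beta> = theta11" | "r = 0" by linarith
    then show "cur (xm \<beta>) r \<in> J"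
    proof cases
      case 1
      then show ?thesis by (rule hw_lowering[OF hw \<beta>])
    next
      case 2
      then have "ft ^ 1 \<in> fund 2" using fund[of 2] rank by simp
      then have "\<not> 1 \<le> ?p" using fund_2[of 1] by blast
      then show ?thesis using J(3) 2 by (simp add: One_nat_def)
    next
      case 3
      have "cur (fv j) 0 \<in> J" if j: "j \<in> {1..n}" "coef \<beta> j > 0" for j
      proof -
        have "1 \<notin> fund j"
          using fund_1[OF proper] fund_2[of 0] fund_trivial[of j] j(1) by (cases "j = 1"; cases "j = 2") auto
        then have "wc j = 0"
          using killed_coefficient[OF fund_current_hw[OF j(1)] _ fund_weight[OF j(1)] j(1) _ \<beta>] fund[OF j(1)] 3 j(2) by auto
        then show ?thesis using exact[OF j(1), of 0] wc[OF j(1)] by simp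
      qed
      then show ?thesis unfolding 3
        by (intro lowering_in_ideal[OF hw_ideal[OF hw] hw_relations[OF hw] _ _ \<beta>, of "\<lambda>_. 0"]) auto
    qed
  qed (use exact wc hw_weight[OF hw h_H] in \<open>auto simp del: power_Suc\<close>)
  then show ?thesis using J(2)[OF k] by blast
qed

text \<open>Beyond the top degree the weight \<open>\<Lambda> - k\<theta>\<close> is not dominant. If the Verma ideals on the line \<open>\<Lambda> + \<complex>\<theta>\<close> are
  not proper, then no highest weight vector of any of these weights survives.\<close>

lemma power_in_M_ideal: "ft ^ k \<in> M_ideal \<Lambda> \<longleftrightarrow> top_degree < k \<or> 1 \<in> verma_ideal (fund_weight 1)"
proof
  show "ft ^ k \<in> M_ideal \<Lambda> \<Longrightarrow> top_degree < k \<or> 1 \<in> verma_ideal (fund_weight 1)"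
    using power_not_in_M_ideal[of k] by (cases "k \<le> top_degree") auto
next
  assume "top_degree < k \<or> 1 \<in> verma_ideal (fund_weight 1)"
  then show "ft ^ k \<in> M_ideal \<Lambda>"
  proof
    assume k: "top_degree < k"
    have "2 \<in> {1..n}" using rank by simp
    from degree_dominant[OF M_ideal_hw _ this, of k] show ?thesis using shifted_not_dominant[OF k] by blast
  next
    assume "1 \<in> verma_ideal (fund_weight 1)"
    then have "1 \<in> verma_ideal (shifted \<Lambda> k)" using proper_fund_weight by blast
    then have "1 \<in> degree_annihilator (M_ideal \<Lambda>) k"
      using verma_ideal(3)[OF degree_annihilator(1,2)[OF M_ideal_hw]] by blast
    then show ?thesis using one_degree_annihilator[OF M_ideal_hw] by blast
  qed
qed

lemma graded_module: "M_graded \<Lambda> k = quotient_module (\<lambda>x u. cur x 0 * u) (uea_degree k) (M_ideal \<Lambda>)"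
  by (simp add: M_graded_def restrict_to_constants_def M_def uea_quotient_def quotient_module_def)

lemma graded_zero:
  assumes k: "top_degree < k"
  shows "lie_module.carrier (M_graded \<Lambda> k) = {lie_module.zero (M_graded \<Lambda> k)}"
proof -
  note Js = left_ideal_subspace[OF M_ideal(1)]
  have "u \<in> M_ideal \<Lambda>" if u: "u \<in> uea_degree k" for u
  proof -
    obtain v j where "u = \<iota> v * ft ^ k + j" "j \<in> M_ideal \<Lambda>"
      using uea_degree_part[OF M_ideal_hw] u unfolding degree_part_def[OF M_ideal_hw] by blast
    then show ?thesis
      using subspace_add[OF Js left_ideal_mult[OF M_ideal(1)]] power_in_M_ideal k by blast
  qed
  then have "coset (M_ideal \<Lambda>) u = coset (M_ideal \<Lambda>) 0" if "u \<in> uea_degree k" for u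
    using that by (simp add: coset_eq[OF Js])
  moreover have "0 \<in> uea_degree k" by (rule subspace_zero[OF uea_degree_subspace])
  ultimately have "coset (M_ideal \<Lambda>) ` uea_degree k = {coset (M_ideal \<Lambda>) 0}" by auto
  then show ?thesis by (simp add: graded_module quotient_module_def coset_zero[OF Js])
qed

text \<open>\<open>u \<mapsto> u (x\<^sub>\<theta>\<^sup>- \<otimes> t)\<^sup>k\<close> maps \<open>U(g)\<close> onto the degree \<open>k\<close> part, and its kernel is the annihilator of an
  integrable highest weight vector, hence equal to the ideal that defines \<open>V(\<Lambda> - k\<theta>)\<close>.\<close>

lemma graded_iso:
  assumes k: "k \<le> top_degree"
  shows "M_graded \<Lambda> k \<cong>\<^sub>L V (\<lambda>y. \<Lambda> y - of_nat k * theta11 y)"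
proof -
  let ?J = "M_ideal \<Lambda>" and ?A = "degree_annihilator (M_ideal \<Lambda>) k" and ?\<mu> = "shifted \<Lambda> k"
  note hw = M_ideal_hw
  note A = degree_annihilator[OF hw, of k] and Js = hw_subspace[OF hw]
  have "1 \<in> verma_ideal ?\<mu>" if "1 \<in> ?A"
    using that k one_degree_annihilator[OF hw] power_in_M_ideal proper_fund_weight by auto
  then have V: "V ?\<mu> = uea_quotient ?A"
    unfolding V_maximal_ideal by (subst maximal_ideal_eq[OF shifted_dual[OF \<Lambda>_dual] A(1,2)]) (use degree_annihilator(3)[OF hw] in blast)+
  have "uea_quotient ?A \<cong>\<^sub>L M_graded \<Lambda> k"
    unfolding graded_module uea_quotient_def
  proof (rule quotient_iso[where g = "\<lambda>u. \<iota> u * ft ^ k"])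
    fix w :: "'g poly uea" assume "w \<in> uea_degree k"
    then obtain v j where "w = \<iota> v * ft ^ k + j" "j \<in> ?J"
      using uea_degree_part[OF hw] unfolding degree_part_def[OF hw] by blast
    then show "\<exists>v\<in>UNIV. w - \<iota> v * ft ^ k \<in> ?J" by (intro bexI[of _ v]) auto
  qed (auto simp: complex_vector.subspace_UNIV left_ideal_subspace[OF A(1), unfolded degree_annihilator_def[OF hw]] Js clin_mult_left left_ideal_mult[OF A(1), unfolded degree_annihilator_def[OF hw]]
      left_ideal_mult[OF hw_ideal[OF hw]] clin_add[OF clin_\<iota>] clin_scale[OF clin_\<iota>] distrib_right uea_scale_left
      subspace_zero[OF Js] degree_annihilator_def[OF hw] degree_part_uea[OF hw] \<iota>_embed_mult mult.assoc)
  then have "M_graded \<Lambda> k \<cong>\<^sub>L V ?\<mu>" unfolding V by (rule iso_sym[OF _ uea_quotient_submodule[OF A(1)]])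
  then show ?thesis by (simp only: shifted_def)
qed

end

end

section \<open>Cyclic submodules\<close>

context representation_mod
begin

lemma uea_letter_times: "a \<in> A \<Longrightarrow> uea_act \<rho> (uea_embed x * u) a - \<rho> x (uea_act \<rho> u a) \<in> B"
proof -
  assume a: "a \<in> A"
  have "uea_act \<rho> (uea_embed x * u) a - \<rho> x (uea_act \<rho> u a)
     = (uea_act \<rho> (uea_embed x * u) a - uea_act \<rho> (uea_embed x) (uea_act \<rho> u a))
       + (uea_act \<rho> (uea_embed x) (uea_act \<rho> u a) - \<rho> x (uea_act \<rho> u a))" by simp
  also have "\<dots> \<in> B" by (intro subspace_add[OF B] uea_times uea_letter uea_A a)
  finally show ?thesis .
qed

text \<open>The submodule generated by \<open>v\<close>, as a subspace of the ambient space that contains \<open>B\<close>.\<close>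

definition cyclic :: "'p \<Rightarrow> 'p set" where
  "cyclic v = {a \<in> A. \<exists>u. a - uea_act \<rho> u v \<in> B}"

lemma cyclic_iso:
  assumes v: "v \<in> A" shows "uea_quotient (annihilator v) \<cong>\<^sub>L quotient_module \<rho> (cyclic v) B"
  unfolding uea_quotient_def
proof (rule quotient_iso[where g = "\<lambda>u. uea_act \<rho> u v"])
  note J = annihilator_left_ideal[OF v]
  show "csubspace (annihilator v)" by (rule left_ideal_subspace[OF J])
  show "uea_embed x * b \<in> annihilator v" if "b \<in> annihilator v" for x b by (rule left_ideal_mult[OF J that])
  show "uea_act \<rho> u v \<in> cyclic v" for u
    unfolding cyclic_def using uea_A[OF v] subspace_zero[OF B] by (auto intro!: exI[of _ u])
  show "\<exists>u\<in>UNIV. w - uea_act \<rho> u v \<in> B" if "w \<in> cyclic v" for w using that by (auto simp: cyclic_def)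
  show "uea_act \<rho> u v \<in> B \<longleftrightarrow> u \<in> annihilator v" for u by (simp add: annihilator_def)
qed (auto simp: complex_vector.subspace_UNIV clin_mult_left B lin act_B uea_plus[OF v] uea_scale[OF v] uea_letter_times[OF v])

lemma generated_cyclic:
  assumes v: "v \<in> A" and W: "coset B v \<in> W" "\<And>X. X \<in> W \<Longrightarrow> \<exists>c. X = coset B (c *\<^sub>C v)"
  shows "generated_submodule (quotient_module \<rho> A B) W = quotient_module \<rho> (cyclic v) B"
proof -
  let ?N = "quotient_module \<rho> A B" and ?g = "\<lambda>u. uea_act \<rho> u v"
  have ops: "lie_module.add ?N (coset B a) (coset B b) = coset B (a + b)"
    "lie_module.smult ?N c (coset B a) = coset B (c *\<^sub>C a)"
    "lie_module.action ?N x (coset B a) = coset B (\<rho> x a)" for a b c x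
    by (rule quotient_operations[OF B lin act_B], assumption)+
  have carrier: "lie_module.carrier ?N = coset B ` A" "lie_module.zero ?N = coset B 0"
    by (simp_all add: quotient_module_def coset_zero[OF B])
  have gA: "?g u \<in> A" for u by (rule uea_A[OF v])
  have near: "coset B a = coset B b" if "a - b \<in> B" for a b using that coset_eq[OF B] by blast
  have "submodule ?N (coset B ` cyclic v)"
    unfolding submodule_def carrier
  proof (intro conjI ballI allI)
    have "?g 0 \<in> B" using left_ideal_subspace[OF annihilator_left_ideal[OF v]] subspace_zero[of "annihilator v"]
      by (simp add: annihilator_def)
    then have "0 \<in> cyclic v" using subspace_zero[OF A] subspace_minus[OF B] by (auto simp: cyclic_def intro!: exI[of _ 0])
    then show "coset B 0 \<in> coset B ` cyclic v" by blast
  next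
    fix X Y assume "X \<in> coset B ` cyclic v" "Y \<in> coset B ` cyclic v"
    then obtain a b u w where ab: "X = coset B a" "Y = coset B b" "a \<in> A" "b \<in> A" "a - ?g u \<in> B" "b - ?g w \<in> B"
      by (auto simp: cyclic_def)
    have "a + b - ?g (u + w) = (a - ?g u) + (b - ?g w) - (?g (u + w) - (?g u + ?g w))" by simp
    also have "\<dots> \<in> B" by (rule subspace_diff[OF B subspace_add[OF B ab(5,6)] uea_plus[OF v]])
    finally have "a + b \<in> cyclic v" using subspace_add[OF A ab(3,4)] by (auto simp: cyclic_def)
    then show "lie_module.add ?N X Y \<in> coset B ` cyclic v" by (simp add: ab(1,2) ops)
  next
    fix c X assume "X \<in> coset B ` cyclic v"
    then obtain a u where a: "X = coset B a" "a \<in> A" "a - ?g u \<in> B" by (auto simp: cyclic_def)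
    have "c *\<^sub>C a - ?g (c *\<^sub>C u) = c *\<^sub>C (a - ?g u) - (?g (c *\<^sub>C u) - c *\<^sub>C ?g u)"
      by (simp add: complex_vector.scale_right_diff_distrib)
    also have "\<dots> \<in> B" by (rule subspace_diff[OF B subspace_scale[OF B a(3)] uea_scale[OF v]])
    finally have "c *\<^sub>C a \<in> cyclic v" using subspace_scale[OF A a(2)] by (auto simp: cyclic_def)
    then show "lie_module.smult ?N c X \<in> coset B ` cyclic v" by (simp add: a(1) ops)
  next
    fix x X assume "X \<in> coset B ` cyclic v"
    then obtain a u where a: "X = coset B a" "a \<in> A" "a - ?g u \<in> B" by (auto simp: cyclic_def)
    have "\<rho> x a - ?g (uea_embed x * u) = \<rho> x (a - ?g u) - (?g (uea_embed x * u) - \<rho> x (?g u))"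
      by (simp add: clin_diff[OF lin])
    also have "\<dots> \<in> B" by (rule subspace_diff[OF B act_B[OF a(3)] uea_letter_times[OF v]])
    finally have "\<rho> x a \<in> cyclic v" using act_A[OF a(2)] by (auto simp: cyclic_def)
    then show "lie_module.action ?N x X \<in> coset B ` cyclic v" by (simp add: a(1) ops)
  qed (auto simp: cyclic_def)
  moreover have "W \<subseteq> coset B ` cyclic v"
  proof
    fix X assume "X \<in> W"
    then obtain c where c: "X = coset B (c *\<^sub>C v)" using W(2) by blast
    have "c *\<^sub>C v - ?g (c *\<^sub>C 1) = - (c *\<^sub>C (?g 1 - v) + (?g (c *\<^sub>C 1) - c *\<^sub>C ?g 1))"
      by (simp add: complex_vector.scale_right_diff_distrib)
    also have "\<dots> \<in> B"
      by (rule subspace_minus[OF B subspace_add[OF B subspace_scale[OF B uea_one[OF v]] uea_scale[OF v]]])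
    finally show "X \<in> coset B ` cyclic v" using c subspace_scale[OF A v] by (auto simp: cyclic_def)
  qed
  moreover have "coset B ` cyclic v \<subseteq> S" if S: "submodule ?N S" "W \<subseteq> S" for S
  proof -
    have closed: "lie_module.add ?N X Y \<in> S" "lie_module.smult ?N c X \<in> S" "lie_module.action ?N x X \<in> S"
      if "X \<in> S" "Y \<in> S" for X Y c x using S(1) that by (auto simp: submodule_def)
    have "coset B (?g u) \<in> S" for u
    proof (induction u rule: uea_induct)
      case one
      have "coset B v \<in> S" using S(2) W(1) by blast
      then show ?case by (simp only: near[OF uea_one[OF v]])
    next
      case (mult x u)
      from closed(3)[OF this this] show ?case by (simp only: near[OF uea_letter_times[OF v]] ops)
    next
      case (add u w)
      from closed(1)[OF this] show ?case by (simp only: near[OF uea_plus[OF v]] ops)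
    next
      case (scale c u)
      from closed(2)[OF this this] show ?case by (simp only: near[OF uea_scale[OF v]] ops)
    qed
    then show ?thesis using near by (auto simp: cyclic_def)
  qed
  ultimately have "\<Inter> {S. submodule ?N S \<and> W \<subseteq> S} = coset B ` cyclic v"
    by (intro subset_antisym Inter_greatest Inter_lower) blast+
  then show ?thesis by (simp add: generated_submodule_def quotient_module_def)
qed

end

section \<open>Tensor products of cyclic modules\<close>

lemma clin_extend:
  fixes g :: "'a \<Rightarrow> 'v::complex_vector"
  shows "clin (\<lambda>p :: 'a \<Rightarrow>\<^sub>0 complex. \<Sum>f\<in>Poly_Mapping.keys p. Poly_Mapping.lookup p f *\<^sub>C g f)"
proof -
  let ?E = "\<lambda>p :: 'a \<Rightarrow>\<^sub>0 complex. \<Sum>f\<in>Poly_Mapping.keys p. Poly_Mapping.lookup p f *\<^sub>C g f"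
  have superset: "?E p = (\<Sum>f\<in>S. Poly_Mapping.lookup p f *\<^sub>C g f)" if "finite S" "Poly_Mapping.keys p \<subseteq> S" for p S
    using that by (intro sum.mono_neutral_left) (auto simp: in_keys_iff)
  show ?thesis
  proof (rule clinI)
    fix p q :: "'a \<Rightarrow>\<^sub>0 complex"
    let ?S = "Poly_Mapping.keys p \<union> Poly_Mapping.keys q"
    have "Poly_Mapping.keys (p + q) \<subseteq> ?S" by (rule Poly_Mapping.keys_add)
    then show "?E (p + q) = ?E p + ?E q"
      using superset[of ?S "p + q"] superset[of ?S p] superset[of ?S q] by (simp add: lookup_add scaleC_add_left sum.distrib)
  next
    fix c and p :: "'a \<Rightarrow>\<^sub>0 complex"
    have l: "Poly_Mapping.lookup (c *\<^sub>C p) f = c * Poly_Mapping.lookup p f" for f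
      by transfer (simp add: scaleC_complex_def)
    then have "Poly_Mapping.keys (c *\<^sub>C p) \<subseteq> Poly_Mapping.keys p" by (auto simp: in_keys_iff)
    from superset[OF finite_keys this] show "?E (c *\<^sub>C p) = c *\<^sub>C ?E p"
      by (simp add: l complex_vector.scale_sum_right)
  qed
qed

lemma extend_pure: "(\<Sum>f\<in>Poly_Mapping.keys (pure w). Poly_Mapping.lookup (pure w) f *\<^sub>C g f) = g w"
  by (simp add: pure_def scaleC_one)

text \<open>Tensor products of cyclic modules \<open>U / L i\<close>. A family of representatives in \<open>U\<close> stands for the pure
  tensor of their cosets.\<close>

locale cyclic_tensor =
  fixes I :: "nat set" and L :: "nat \<Rightarrow> 'l::complex_lie_algebra uea set"
  assumes fin: "finite I" and L: "\<And>i. i \<in> I \<Longrightarrow> left_ideal (L i)"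
begin

abbreviation factors :: "nat \<Rightarrow> ('l, 'l uea set) lie_module" where "factors \<equiv> \<lambda>i. uea_quotient (L i)"

abbreviation relations :: "((nat \<Rightarrow> 'l uea set) \<Rightarrow>\<^sub>0 complex) set" where "relations \<equiv> tensor_relations I factors"

abbreviation act :: "'l \<Rightarrow> ((nat \<Rightarrow> 'l uea set) \<Rightarrow>\<^sub>0 complex) \<Rightarrow> ((nat \<Rightarrow> 'l uea set) \<Rightarrow>\<^sub>0 complex)" where
  "act \<equiv> tensor_action I factors"

definition family :: "(nat \<Rightarrow> 'l uea) \<Rightarrow> nat \<Rightarrow> 'l uea set" where
  "family u = (\<lambda>i\<in>I. coset (L i) (u i))"

definition tensor :: "(nat \<Rightarrow> 'l uea) \<Rightarrow> (nat \<Rightarrow> 'l uea set) \<Rightarrow>\<^sub>0 complex" where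
  "tensor u = pure (family u)"

definition tensors :: "((nat \<Rightarrow> 'l uea set) \<Rightarrow>\<^sub>0 complex) set" where
  "tensors = cspan (range tensor)"

lemma subspace_L: "i \<in> I \<Longrightarrow> csubspace (L i)"
  by (rule left_ideal_subspace[OF L])

lemma operations:
  assumes i: "i \<in> I"
  shows "lie_module.carrier (factors i) = range (coset (L i))"
    "lie_module.add (factors i) (coset (L i) a) (coset (L i) b) = coset (L i) (a + b)"
    "lie_module.smult (factors i) c (coset (L i) a) = coset (L i) (c *\<^sub>C a)"
    "lie_module.action (factors i) x (coset (L i) a) = coset (L i) (uea_embed x * a)"
proof -
  have stable: "\<And>x b. b \<in> L i \<Longrightarrow> uea_embed x * b \<in> L i" by (rule left_ideal_mult[OF L[OF i]])
  note ops = quotient_operations[where \<rho> = "\<lambda>x u. uea_embed x * u" and A = UNIV, OF subspace_L[OF i] clin_mult_left stable]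
  show "lie_module.carrier (factors i) = range (coset (L i))"
    "lie_module.add (factors i) (coset (L i) a) (coset (L i) b) = coset (L i) (a + b)"
    "lie_module.smult (factors i) c (coset (L i) a) = coset (L i) (c *\<^sub>C a)"
    "lie_module.action (factors i) x (coset (L i) a) = coset (L i) (uea_embed x * a)"
    unfolding uea_quotient_def by (simp add: quotient_module_def) (rule ops, assumption)+
qed

lemma families: "tensor_families I factors = range family"
proof (intro subset_antisym subsetI)
  fix f assume f: "f \<in> tensor_families I factors"
  then have "\<forall>i\<in>I. \<exists>a. f i = coset (L i) a" using operations(1) by (fastforce simp: tensor_families_def PiE_iff)
  from bchoice[OF this] obtain u where "\<And>i. i \<in> I \<Longrightarrow> f i = coset (L i) (u i)" by blast
  then have "f = family u" using f by (intro extensionalityI[of _ I]) (auto simp: tensor_families_def PiE_iff family_def)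
  then show "f \<in> range family" by blast
next
  fix f assume "f \<in> range family"
  then show "f \<in> tensor_families I factors" using operations(1) by (auto simp: tensor_families_def family_def)
qed

lemma family_update: "i \<in> I \<Longrightarrow> (family u)(i := coset (L i) a) = family (u(i := a))"
  by (auto simp: family_def fun_eq_iff)

lemma tensor_add: "i \<in> I \<Longrightarrow> tensor (u(i := a + b)) - tensor (u(i := a)) - tensor (u(i := b)) \<in> relations"
proof -
  assume i: "i \<in> I"
  have "tensor (u(i := a + b)) - tensor (u(i := a)) - tensor (u(i := b))
      = pure ((family u)(i := lie_module.add (factors i) (coset (L i) a) (coset (L i) b)))
        - pure ((family u)(i := coset (L i) a)) - pure ((family u)(i := coset (L i) b))"
    by (simp add: tensor_def operations[OF i] family_update[OF i])
  then show ?thesis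
    unfolding tensor_relations_def using i operations(1)[OF i] families by (intro complex_vector.span_base UnI1 CollectI) blast
qed

lemma tensor_scale: "i \<in> I \<Longrightarrow> tensor (u(i := c *\<^sub>C a)) - c *\<^sub>C tensor (u(i := a)) \<in> relations"
proof -
  assume i: "i \<in> I"
  have "tensor (u(i := c *\<^sub>C a)) - c *\<^sub>C tensor (u(i := a))
      = pure ((family u)(i := lie_module.smult (factors i) c (coset (L i) a))) - c *\<^sub>C pure ((family u)(i := coset (L i) a))"
    by (simp add: tensor_def operations[OF i] family_update[OF i])
  then show ?thesis
    unfolding tensor_relations_def using i operations(1)[OF i] families by (intro complex_vector.span_base UnI2 CollectI) blast
qed

lemma relations_least:
  assumes S: "csubspace S"
    and add: "\<And>u i a b. i \<in> I \<Longrightarrow> tensor (u(i := a + b)) - tensor (u(i := a)) - tensor (u(i := b)) \<in> S"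
    and scale: "\<And>u i c a. i \<in> I \<Longrightarrow> tensor (u(i := c *\<^sub>C a)) - c *\<^sub>C tensor (u(i := a)) \<in> S"
  shows "relations \<subseteq> S"
  unfolding tensor_relations_def
proof (rule complex_vector.span_minimal[OF _ S], intro Un_least subsetI)
  fix p assume "p \<in> {pure (f(i := lie_module.add (factors i) a b)) - pure (f(i := a)) - pure (f(i := b)) | f i a b.
         f \<in> tensor_families I factors \<and> i \<in> I \<and> a \<in> lie_module.carrier (factors i) \<and> b \<in> lie_module.carrier (factors i)}"
  then obtain f i a b where p: "p = pure (f(i := lie_module.add (factors i) a b)) - pure (f(i := a)) - pure (f(i := b))"
    "f \<in> range family" "i \<in> I" "a \<in> range (coset (L i))" "b \<in> range (coset (L i))" using families operations(1) by auto
  then obtain u a' b' where "f = family u" "a = coset (L i) a'" "b = coset (L i) b'" by blast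
  then show "p \<in> S" using add[OF p(3), of u a' b'] p(1) by (simp add: tensor_def operations[OF p(3)] family_update[OF p(3)])
next
  fix p assume "p \<in> {pure (f(i := lie_module.smult (factors i) c a)) - c *\<^sub>C pure (f(i := a)) | f i c a.
         f \<in> tensor_families I factors \<and> i \<in> I \<and> a \<in> lie_module.carrier (factors i)}"
  then obtain f i c a where p: "p = pure (f(i := lie_module.smult (factors i) c a)) - c *\<^sub>C pure (f(i := a))"
    "f \<in> range family" "i \<in> I" "a \<in> range (coset (L i))" using families operations(1) by auto
  then obtain u a' where "f = family u" "a = coset (L i) a'" by blast
  then show "p \<in> S" using scale[OF p(3), of u c a'] p(1) by (simp add: tensor_def operations[OF p(3)] family_update[OF p(3)])
qed

lemma subspace_relations: "csubspace relations"
  unfolding tensor_relations_def by (rule complex_vector.subspace_span)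

lemma tensor_cong: "i \<in> I \<Longrightarrow> a - b \<in> L i \<Longrightarrow> tensor (u(i := a)) = tensor (u(i := b))"
  by (simp add: tensor_def family_update[symmetric] coset_eq[OF subspace_L, THEN iffD2])

lemma tensor_zero: assumes i: "i \<in> I" and a: "a \<in> L i" shows "tensor (u(i := a)) \<in> relations"
proof -
  have "tensor (u(i := a)) = tensor (u(i := 0))" by (rule tensor_cong[OF i]) (simp add: a)
  then show ?thesis using tensor_scale[OF i, of u 0 0] by simp
qed

lemma slot_subspace:
  assumes S: "csubspace S" "relations \<subseteq> S" and i: "i \<in> I"
  shows "csubspace {a. tensor (u(i := a)) \<in> S}"
proof (rule subspaceI)
  show "0 \<in> {a. tensor (u(i := a)) \<in> S}" using tensor_zero[OF i subspace_zero[OF subspace_L[OF i]]] S(2) by blast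
next
  fix a b assume ab: "a \<in> {a. tensor (u(i := a)) \<in> S}" "b \<in> {a. tensor (u(i := a)) \<in> S}"
  have "tensor (u(i := a + b)) - (tensor (u(i := a)) + tensor (u(i := b))) \<in> S"
    using tensor_add[OF i, of u a b] S(2) by (auto simp: diff_diff_eq)
  then show "a + b \<in> {a. tensor (u(i := a)) \<in> S}"
    using subspace_diff_cancel[OF S(1)] subspace_add[OF S(1)] ab by blast
next
  fix c a assume a: "a \<in> {a. tensor (u(i := a)) \<in> S}"
  have "tensor (u(i := c *\<^sub>C a)) - c *\<^sub>C tensor (u(i := a)) \<in> S" using tensor_scale[OF i] S(2) by blast
  then show "c *\<^sub>C a \<in> {a. tensor (u(i := a)) \<in> S}"
    using subspace_diff_cancel[OF S(1)] subspace_scale[OF S(1)] a by blast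
qed

lemma clin_act: "clin (act x)"
  unfolding tensor_action_def[abs_def] by (rule clin_extend)

lemma act_tensor: "act x (tensor u) = (\<Sum>i\<in>I. tensor (u(i := uea_embed x * u i)))"
proof -
  have "act x (tensor u) = (\<Sum>i\<in>I. pure ((family u)(i := lie_module.action (factors i) x (family u i))))"
    unfolding tensor_action_def tensor_def by (rule extend_pure)
  also have "\<dots> = (\<Sum>i\<in>I. tensor (u(i := uea_embed x * u i)))"
  proof (intro sum.cong refl)
    fix i assume i: "i \<in> I"
    have "family u i = coset (L i) (u i)" using i by (simp add: family_def)
    then show "pure ((family u)(i := lie_module.action (factors i) x (family u i))) = tensor (u(i := uea_embed x * u i))"
      by (simp only: operations(4)[OF i] family_update[OF i] tensor_def)
  qed
  finally show ?thesis .
qed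

lemma tensor_space: "cspan (pure ` tensor_families I factors) = tensors"
  by (simp add: families tensors_def tensor_def[abs_def] image_image)

lemma tensor_in: "tensor u \<in> tensors"
  unfolding tensors_def by (rule complex_vector.span_base) blast

lemma subspace_tensors: "csubspace tensors"
  unfolding tensors_def by (rule complex_vector.subspace_span)

lemma tensors_induct:
  assumes "csubspace {a. P a}" "\<And>u. P (tensor u)" "a \<in> tensors" shows "P a"
  using complex_vector.span_minimal[OF _ assms(1), of "range tensor"] assms(2,3) unfolding tensors_def by blast

lemma relations_tensors: "relations \<subseteq> tensors"
  by (rule relations_least[OF subspace_tensors])
    (intro subspace_diff[OF subspace_tensors] subspace_scale[OF subspace_tensors] tensor_in)+

lemma act_tensors: "a \<in> tensors \<Longrightarrow> act x a \<in> tensors"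
  by (rule tensors_induct[OF subspace_vimage[OF clin_act subspace_tensors]])
    (simp_all add: act_tensor subspace_sum[OF subspace_tensors] tensor_in)

lemma act_relations: "b \<in> relations \<Longrightarrow> act x b \<in> relations"
proof -
  note Rs = subspace_relations
  have "relations \<subseteq> {b. act x b \<in> relations}"
  proof (rule relations_least[OF subspace_vimage[OF clin_act Rs]], unfold mem_Collect_eq)
    fix u :: "nat \<Rightarrow> 'l uea" and i a b assume i: "i \<in> I"
    let ?t = "\<lambda>c j. tensor (u(i := c, j := uea_embed x * (u(i := c)) j))"
    have "?t (a + b) j - ?t a j - ?t b j \<in> relations" if "j \<in> I" for j
    proof (cases "j = i")
      case True
      then show ?thesis using tensor_add[OF i, of u "uea_embed x * a" "uea_embed x * b"] by (simp add: distrib_left)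
    next
      case False
      have "?t c j = tensor ((u(j := uea_embed x * u j))(i := c))" for c
        using False by (simp add: fun_upd_twist)
      then show ?thesis using tensor_add[OF i] by simp
    qed
    then show "act x (tensor (u(i := a + b)) - tensor (u(i := a)) - tensor (u(i := b))) \<in> relations"
      by (simp only: clin_diff[OF clin_act] act_tensor sum_subtractf[symmetric] subspace_sum[OF Rs])
  next
    fix u :: "nat \<Rightarrow> 'l uea" and i c a assume i: "i \<in> I"
    let ?t = "\<lambda>c j. tensor (u(i := c, j := uea_embed x * (u(i := c)) j))"
    have "?t (c *\<^sub>C a) j - c *\<^sub>C ?t a j \<in> relations" if "j \<in> I" for j
    proof (cases "j = i")
      case True
      then show ?thesis using tensor_scale[OF i, of u c "uea_embed x * a"] by (simp add: uea_scale_right)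
    next
      case False
      have "?t c j = tensor ((u(j := uea_embed x * u j))(i := c))" for c
        using False by (simp add: fun_upd_twist)
      then show ?thesis using tensor_scale[OF i] by simp
    qed
    then show "act x (tensor (u(i := c *\<^sub>C a)) - c *\<^sub>C tensor (u(i := a))) \<in> relations"
      by (simp only: clin_diff[OF clin_act] clin_scale[OF clin_act] act_tensor complex_vector.scale_sum_right
          sum_subtractf[symmetric] subspace_sum[OF Rs])
  qed
  then show "b \<in> relations \<Longrightarrow> act x b \<in> relations" by blast
qed

lemma act_bracket_tensor:
  "act x (act y (tensor u)) - act y (act x (tensor u)) - act (bracket x y) (tensor u) \<in> relations"
proof -
  let ?E = "\<lambda>x y i j. tensor (u(i := uea_embed y * u i, j := uea_embed x * (u(i := uea_embed y * u i)) j))"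
  have E: "act x (act y (tensor u)) = (\<Sum>i\<in>I. \<Sum>j\<in>I. ?E x y i j)" for x y
    by (simp only: act_tensor clin_sum[OF clin_act])
  \<comment> \<open>Operators in different slots commute; only the diagonal terms survive.\<close>
  have "act y (act x (tensor u)) = (\<Sum>i\<in>I. \<Sum>j\<in>I. ?E y x j i)" unfolding E by (rule sum.swap)
  then have "act x (act y (tensor u)) - act y (act x (tensor u)) = (\<Sum>i\<in>I. \<Sum>j\<in>I. ?E x y i j - ?E y x j i)"
    unfolding E[of x y] by (simp only: sum_subtractf)
  also have "\<dots> = (\<Sum>i\<in>I. \<Sum>j\<in>I. if j = i then ?E x y i i - ?E y x i i else 0)"
    by (intro sum.cong refl) (auto simp: fun_upd_twist)
  also have "\<dots> = (\<Sum>i\<in>I. ?E x y i i - ?E y x i i)" using fin by simp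
  finally have "act x (act y (tensor u)) - act y (act x (tensor u)) - act (bracket x y) (tensor u)
      = (\<Sum>i\<in>I. ?E x y i i - ?E y x i i - tensor (u(i := uea_embed (bracket x y) * u i)))"
    by (simp only: act_tensor sum_subtractf)
  also have "\<dots> \<in> relations"
  proof (rule subspace_sum[OF subspace_relations])
    fix i assume i: "i \<in> I"
    have eq: "uea_embed (bracket x y) * u i + uea_embed y * (uea_embed x * u i) = uea_embed x * (uea_embed y * u i)"
      by (simp add: embed_bracket left_diff_distrib mult.assoc)
    from tensor_add[OF i, of u "uea_embed (bracket x y) * u i" "uea_embed y * (uea_embed x * u i)"]
    show "?E x y i i - ?E y x i i - tensor (u(i := uea_embed (bracket x y) * u i)) \<in> relations"
      unfolding eq by (simp add: algebra_simps)
  qed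
  finally show ?thesis .
qed

lemma tensor_representation: "representation_mod act tensors relations"
proof
  fix x y :: 'l and a assume a: "a \<in> tensors"
  have lin: "clin (\<lambda>a. act x (act y a) - act y (act x a) - act (bracket x y) a)"
    "clin (\<lambda>a. act (x + y) a - act x a - act y a)" "clin (\<lambda>a. act (c *\<^sub>C x) a - c *\<^sub>C act x a)" for c
    by (intro clinI; simp add: clin_add[OF clin_act] clin_scale[OF clin_act] scaleC_add_right
        complex_vector.scale_right_diff_distrib mult.commute)+
  show "act x (act y a) - act y (act x a) - act (bracket x y) a \<in> relations"
    by (rule tensors_induct[OF subspace_vimage[OF lin(1) subspace_relations] act_bracket_tensor a])
  show "act (x + y) a - act x a - act y a \<in> relations"
  proof (rule tensors_induct[OF subspace_vimage[OF lin(2) subspace_relations] _ a])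
    show "act (x + y) (tensor u) - act x (tensor u) - act y (tensor u) \<in> relations" for u
      unfolding act_tensor sum_subtractf[symmetric]
      by (rule subspace_sum[OF subspace_relations]) (simp add: embed_add distrib_right tensor_add)
  qed
  fix c
  show "act (c *\<^sub>C x) a - c *\<^sub>C act x a \<in> relations"
  proof (rule tensors_induct[OF subspace_vimage[OF lin(3) subspace_relations] _ a])
    show "act (c *\<^sub>C x) (tensor u) - c *\<^sub>C act x (tensor u) \<in> relations" for u
      unfolding act_tensor complex_vector.scale_sum_right sum_subtractf[symmetric]
      by (rule subspace_sum[OF subspace_relations]) (simp add: embed_scaleC uea_scale_left tensor_scale)
  qed
qed (use clin_act subspace_tensors subspace_relations relations_tensors act_tensors act_relations in auto)

text \<open>A product of functionals separates a tensor with nonzero entries from the relations.\<close>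

lemma tensor_nonzero:
  assumes u: "\<And>i. i \<in> I \<Longrightarrow> u i \<notin> L i" shows "tensor u \<notin> relations"
proof
  assume t: "tensor u \<in> relations"
  have "\<forall>i\<in>I. \<exists>\<phi>. clin \<phi> \<and> (\<forall>j\<in>L i. \<phi> j = 0) \<and> \<phi> (u i) = (1::complex)"
  proof
    fix i assume i: "i \<in> I"
    obtain \<phi> where "clin \<phi>" "\<And>j. j \<in> L i \<Longrightarrow> \<phi> j = 0" "\<phi> (u i) = (1::complex)"
      by (rule exists_functional[OF subspace_L[OF i] u[OF i]], rule that)
    then show "\<exists>\<phi>. clin \<phi> \<and> (\<forall>j\<in>L i. \<phi> j = 0) \<and> \<phi> (u i) = (1::complex)" by blast
  qed
  from bchoice[OF this] obtain \<phi> where \<phi>: "\<And>i. i \<in> I \<Longrightarrow> clin (\<phi> i)" "\<And>i j. i \<in> I \<Longrightarrow> j \<in> L i \<Longrightarrow> \<phi> i j = 0"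
    "\<And>i. i \<in> I \<Longrightarrow> \<phi> i (u i) = (1::complex)" by blast
  define G where "G f = (\<Prod>i\<in>I. \<phi> i (SOME a. f i = coset (L i) a))" for f :: "nat \<Rightarrow> 'l uea set"
  define E where "E p = (\<Sum>f\<in>Poly_Mapping.keys p. Poly_Mapping.lookup p f *\<^sub>C G f)" for p
  have E: "clin E" unfolding E_def by (rule clin_extend)
  have Et: "E (tensor w) = (\<Prod>i\<in>I. \<phi> i (w i))" for w
  proof -
    have "E (tensor w) = G (family w)" unfolding E_def tensor_def by (rule extend_pure)
    also have "\<dots> = (\<Prod>i\<in>I. \<phi> i (w i))" unfolding G_def
    proof (intro prod.cong refl)
      fix i assume i: "i \<in> I"
      have "\<exists>a. family w i = coset (L i) a" using i by (auto simp: family_def)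
      from someI_ex[OF this] have "coset (L i) (w i) = coset (L i) (SOME a. family w i = coset (L i) a)"
        using i by (simp add: family_def)
      then have "w i - (SOME a. family w i = coset (L i) a) \<in> L i" using coset_eq[OF subspace_L[OF i]] by blast
      from \<phi>(2)[OF i this] show "\<phi> i (SOME a. family w i = coset (L i) a) = \<phi> i (w i)" by (simp add: clin_diff[OF \<phi>(1)[OF i]])
    qed
    finally show ?thesis .
  qed
  have slot: "E (tensor (w(i := a))) = \<phi> i a * (\<Prod>j\<in>I - {i}. \<phi> j (w j))" if i: "i \<in> I" for w i a
  proof -
    have "(\<Prod>j\<in>I - {i}. \<phi> j ((w(i := a)) j)) = (\<Prod>j\<in>I - {i}. \<phi> j (w j))" by (intro prod.cong) auto
    then show ?thesis unfolding Et using prod.remove[OF fin i, of "\<lambda>j. \<phi> j ((w(i := a)) j)"] by simp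
  qed
  have "relations \<subseteq> {p. E p \<in> {0}}"
    by (rule relations_least[OF subspace_vimage[OF E subspace_zero_set]])
      (simp_all add: clin_diff[OF E] clin_scale[OF E] slot clin_add[OF \<phi>(1)] clin_scale[OF \<phi>(1)] distrib_right scaleC_complex_def)
  then have "E (tensor u) = 0" using t by blast
  then show False using \<phi>(3) by (simp add: Et)
qed

text \<open>An element that kills all generators except one acts in one factor only.\<close>

lemma one_slot_power:
  assumes i: "i \<in> I" and x: "\<And>j. j \<in> I \<Longrightarrow> j \<noteq> i \<Longrightarrow> uea_embed x \<in> L j"
  shows "(act x ^^ k) (tensor (\<lambda>_. 1)) - tensor ((\<lambda>_. 1)(i := uea_embed x ^ k)) \<in> relations"
proof (induction k)
  case 0
  have "(\<lambda>_. 1)(i := 1) = (\<lambda>_. 1)" by auto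
  then show ?case using subspace_zero[OF subspace_relations] by simp
next
  case (Suc k)
  let ?u = "(\<lambda>_. 1)(i := uea_embed x ^ k)"
  have "act x (tensor ?u) = (\<Sum>j\<in>I. tensor (?u(j := uea_embed x * ?u j)))" by (rule act_tensor)
  also have "\<dots> = tensor (?u(i := uea_embed x * ?u i)) + (\<Sum>j\<in>I - {i}. tensor (?u(j := uea_embed x * ?u j)))"
    by (rule sum.remove[OF fin i])
  finally have "act x (tensor ?u) - tensor ((\<lambda>_. 1)(i := uea_embed x ^ Suc k)) = (\<Sum>j\<in>I - {i}. tensor (?u(j := uea_embed x * ?u j)))"
    by simp
  also have "\<dots> \<in> relations" by (rule subspace_sum[OF subspace_relations]) (use x in \<open>auto intro: tensor_zero\<close>)
  finally have "act x (tensor ?u) - tensor ((\<lambda>_. 1)(i := uea_embed x ^ Suc k)) \<in> relations" .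
  from subspace_add[OF subspace_relations act_relations[OF Suc, of x] this]
  show ?case unfolding clin_diff[OF clin_act] by (simp del: fun_upd_apply power_Suc)
qed

end

section \<open>The submodule generated by the top weight space\<close>

context type_B_lie
begin

lemma lower_sum: "finite S \<Longrightarrow> lower (\<lambda>j. \<Sum>i\<in>S. d i j) y = (\<Sum>i\<in>S. lower (d i) y)"
  by (induction S rule: finite_induct) (simp_all add: lower_zero lower_add)

context
  fixes \<Lambda> :: "'g \<Rightarrow> complex"
  assumes \<Lambda>: "\<Lambda> \<in> dominant_weights" and support: "\<And>i. i \<in> {1..n} \<Longrightarrow> i > 2 \<Longrightarrow> \<Lambda> (h i) = 0"
begin

abbreviation funds :: "nat \<Rightarrow> 'g poly uea set" where "funds i \<equiv> M_fund_ideal i (weight_coeff \<Lambda> i)"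

abbreviation fw :: "nat \<Rightarrow> 'g \<Rightarrow> complex" where "fw \<equiv> fund_weight \<Lambda>"

lemma funds_hw: "i \<in> {1..n} \<Longrightarrow> current_hw (funds i) (fw i)"
  by (rule fund_current_hw[OF \<Lambda> support])

interpretation t: cyclic_tensor "{1..n}" funds
  by unfold_locales (simp_all add: fund_ideal(1))

interpretation r: representation_mod t.act t.tensors t.relations
  by (rule t.tensor_representation)

abbreviation top :: "(nat \<Rightarrow> 'g poly uea set) \<Rightarrow>\<^sub>0 complex" where "top \<equiv> t.tensor (\<lambda>_. 1)"

text \<open>A weight vector of weight \<open>\<Lambda> - lower d\<close> in the tensor product.\<close>

definition tensor_weight :: "(nat \<Rightarrow> nat) \<Rightarrow> ((nat \<Rightarrow> 'g poly uea set) \<Rightarrow>\<^sub>0 complex) set" where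
  "tensor_weight d = {a \<in> t.tensors. \<forall>y\<in>H. t.act (monom y 0) a - (\<Lambda> y - lower d y) *\<^sub>C a \<in> t.relations}"

definition homogeneous :: "nat \<Rightarrow> (nat \<Rightarrow> nat) \<Rightarrow> 'g poly uea \<Rightarrow> bool" where
  "homogeneous i d a \<longleftrightarrow> d \<in> depths \<and> (if d = (\<lambda>_. 0) then a = 1 else a \<in> current_weight (funds i) (fw i) d)"

lemma tensor_weight_subspace: "csubspace (tensor_weight d)"
proof -
  have lin: "clin (\<lambda>a. t.act (monom y 0) a - (\<Lambda> y - lower d y) *\<^sub>C a)" for y
    by (intro clinI) (simp_all add: clin_add[OF t.clin_act] clin_scale[OF t.clin_act] scaleC_add_right
        complex_vector.scale_right_diff_distrib mult.commute)
  have "tensor_weight d = t.tensors \<inter> (\<Inter>y\<in>H. {a. t.act (monom y 0) a - (\<Lambda> y - lower d y) *\<^sub>C a \<in> t.relations})"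
    by (auto simp: tensor_weight_def)
  also have "csubspace \<dots>"
    by (intro complex_vector.subspace_inter t.subspace_tensors complex_vector.subspace_Inter)
      (auto intro: subspace_vimage[OF lin t.subspace_relations])
  finally show ?thesis .
qed

lemma relations_tensor_weight: "t.relations \<subseteq> tensor_weight d"
  using t.relations_tensors t.act_relations subspace_diff[OF t.subspace_relations] subspace_scale[OF t.subspace_relations]
  by (auto simp: tensor_weight_def)

lemma homogeneous_tensor:
  assumes d: "\<And>i. i \<in> {1..n} \<Longrightarrow> homogeneous i (d i) (u i)"
  shows "t.tensor u \<in> tensor_weight (\<lambda>j. \<Sum>i=1..n. d i j)"
  unfolding tensor_weight_def
proof (intro CollectI conjI ballI t.tensor_in)
  fix y assume y: "y \<in> H"
  let ?c = "\<lambda>i. fw i y - lower (d i) y"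
  have "(\<Sum>i=1..n. fw i y) = \<Lambda> y" by (rule fund_weight_sum[OF \<Lambda> support])
  then have "(\<Sum>i=1..n. ?c i) = \<Lambda> y - lower (\<lambda>j. \<Sum>i=1..n. d i j) y"
    by (simp add: sum_subtractf lower_sum)
  then have "t.act (monom y 0) (t.tensor u) - (\<Lambda> y - lower (\<lambda>j. \<Sum>i=1..n. d i j) y) *\<^sub>C t.tensor u
      = (\<Sum>i=1..n. t.tensor (u(i := cur y 0 * u i)) - ?c i *\<^sub>C t.tensor u)"
    by (simp add: t.act_tensor sum_subtractf complex_vector.scale_sum_left[symmetric])
  also have "\<dots> \<in> t.relations"
  proof (rule subspace_sum[OF t.subspace_relations])
    fix i assume i: "i \<in> {1..n}"
    have "cur y 0 * u i - ?c i *\<^sub>C u i \<in> funds i"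
      using d[OF i] y hw_weight[OF funds_hw[OF i] y]
      by (auto simp: homogeneous_def current_weight_def[OF funds_hw[OF i]] lower_zero split: if_splits)
    from t.tensor_cong[OF i this, of u]
    have "t.tensor (u(i := cur y 0 * u i)) - ?c i *\<^sub>C t.tensor u = t.tensor (u(i := ?c i *\<^sub>C u i)) - ?c i *\<^sub>C t.tensor (u(i := u i))"
      by simp
    then show "t.tensor (u(i := cur y 0 * u i)) - ?c i *\<^sub>C t.tensor u \<in> t.relations"
      using t.tensor_scale[OF i, of u "?c i" "u i"] by simp
  qed
  finally show "t.act (monom y 0) (t.tensor u) - (\<Lambda> y - lower (\<lambda>j. \<Sum>i=1..n. d i j) y) *\<^sub>C t.tensor u \<in> t.relations" .
qed

lemma homogeneous_one: "homogeneous i (\<lambda>_. 0) 1"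
  by (simp add: homogeneous_def depths_def)

text \<open>Everything except the multiples of the product of the generators has weights strictly below \<open>\<Lambda>\<close>:
  decompose one entry after the other.\<close>

lemma tensors_top_or_lower:
  "t.tensors \<subseteq> cspan (insert top (\<Union>d\<in>depths - {\<lambda>_. 0}. tensor_weight d))" (is "_ \<subseteq> ?S")
proof -
  have S: "csubspace ?S" by (rule complex_vector.subspace_span)
  have "\<theta>coef \<in> depths" "\<theta>coef 1 \<noteq> 0" using n1 by (auto simp: depths_def \<theta>coef_def)
  then have "\<theta>coef \<in> depths - {\<lambda>_. 0}" by auto
  then have "tensor_weight \<theta>coef \<subseteq> ?S" by (intro subsetI complex_vector.span_base) blast
  then have R: "t.relations \<subseteq> ?S" using relations_tensor_weight by blast
  have "\<forall>u. (\<forall>i\<in>{1..n} - J. \<exists>d. homogeneous i d (u i)) \<longrightarrow> t.tensor u \<in> ?S" if "finite J" "J \<subseteq> {1..n}" for J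
    using that
  proof (induction J rule: finite_induct)
    case empty
    show ?case
    proof (intro allI impI)
      fix u assume "\<forall>i\<in>{1..n} - {}. \<exists>d. homogeneous i d (u i)"
      then have "\<forall>i\<in>{1..n}. \<exists>d. homogeneous i d (u i)" by simp
      from bchoice[OF this] obtain d where d: "\<And>i. i \<in> {1..n} \<Longrightarrow> homogeneous i (d i) (u i)" by blast
      let ?D = "\<lambda>j. \<Sum>i=1..n. d i j"
      have w: "t.tensor u \<in> tensor_weight ?D" by (rule homogeneous_tensor[OF d])
      show "t.tensor u \<in> ?S"
      proof (cases "?D = (\<lambda>_. 0)")
        case True
        have "d i = (\<lambda>_. 0)" if i: "i \<in> {1..n}" for i
        proof
          fix j
          have "d i j \<le> ?D j" by (rule member_le_sum[OF i]) simp_all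
          then show "d i j = 0" using fun_cong[OF True, of j] by simp
        qed
        then have "u i = 1" if "i \<in> {1..n}" for i using d[OF that] that by (simp add: homogeneous_def)
        then have "t.tensor u = top" unfolding t.tensor_def t.family_def by (intro arg_cong[of _ _ pure] restrict_ext) simp
        then show ?thesis by (simp add: complex_vector.span_base)
      next
        case False
        have "?D \<in> depths" using d by (auto simp: depths_def homogeneous_def)
        then show ?thesis using False w by (intro complex_vector.span_base) blast
      qed
    qed
  next
    case (insert j J)
    have j: "j \<in> {1..n}" and IH: "\<And>u. (\<forall>i\<in>{1..n} - J. \<exists>d. homogeneous i d (u i)) \<Longrightarrow> t.tensor u \<in> ?S"
      using insert by auto
    show ?case
    proof (intro allI impI)
      fix u assume u: "\<forall>i\<in>{1..n} - insert j J. \<exists>d. homogeneous i d (u i)"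
      let ?Q = "{a. t.tensor (u(j := a)) \<in> ?S}"
      have Q: "csubspace ?Q" by (rule t.slot_subspace[OF S R j])
      have hom: "a \<in> ?Q" if "homogeneous j d a" for a d
      proof -
        have "\<exists>d. homogeneous i d ((u(j := a)) i)" if "i \<in> {1..n} - J" for i
          using u that \<open>homogeneous j d a\<close> by (cases "i = j") auto
        then show ?thesis using IH[of "u(j := a)"] by blast
      qed
      obtain z D g l where D: "finite D" "D \<subseteq> depths - {\<lambda>_. 0}" "\<And>d. d \<in> D \<Longrightarrow> g d \<in> current_weight (funds j) (fw j) d"
        "l \<in> funds j" "u j = z *\<^sub>C 1 + (\<Sum>d\<in>D. g d) + l"
        by (rule current_weight_span[OF funds_hw[OF j], where u = "u j"], rule that)
      have "g d \<in> ?Q" if "d \<in> D" for d by (rule hom[of d]) (use D(2,3) that in \<open>auto simp: homogeneous_def\<close>)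
      then have "(\<Sum>d\<in>D. g d) \<in> ?Q" by (rule subspace_sum[OF Q])
      moreover have "l \<in> ?Q" using t.tensor_zero[OF j D(4)] R by blast
      ultimately have "u j \<in> ?Q"
        unfolding D(5) by (intro subspace_add[OF Q] subspace_scale[OF Q] hom[OF homogeneous_one])
      then show "t.tensor u \<in> ?S" by simp
    qed
  qed
  from this[of "{1..n}"] have "t.tensor u \<in> ?S" for u by simp
  then show ?thesis unfolding t.tensors_def by (intro complex_vector.span_minimal[OF _ S]) blast
qed

text \<open>Separate the weight \<open>\<Lambda>\<close> from the strictly lower ones.\<close>

lemma top_weight_multiple:
  assumes a: "a \<in> t.tensors" and weight: "\<And>y. y \<in> H \<Longrightarrow> t.act (monom y 0) a - \<Lambda> y *\<^sub>C a \<in> t.relations"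
  obtains c where "a - c *\<^sub>C top \<in> t.relations"
proof -
  note Rs = t.subspace_relations
  let ?z = "\<lambda>_. 0 :: nat"
  have "a \<in> cspan (insert top (\<Union>d\<in>depths - {?z}. tensor_weight d))" using a tensors_top_or_lower by blast
  then obtain c where c: "a - c *\<^sub>C top \<in> cspan (\<Union>d\<in>depths - {?z}. tensor_weight d)"
    by (auto simp: complex_vector.span_insert)
  obtain D x where D: "finite D" "D \<subseteq> depths - {?z}" "\<And>d. d \<in> D \<Longrightarrow> x d \<in> tensor_weight d"
    "a - c *\<^sub>C top = (\<Sum>d\<in>D. x d)" by (rule span_Union_subspaces[OF c tensor_weight_subspace]) blast
  have zero: "?z \<notin> D" using D(2) by blast
  \<comment> \<open>Index \<open>0\<close> carries the part of weight \<open>\<Lambda>\<close>, so that the whole sum vanishes.\<close>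
  define x' where "x' = x(?z := - (a - c *\<^sub>C top))"
  have "top \<in> tensor_weight (\<lambda>j. \<Sum>i=1..n. 0)" by (rule homogeneous_tensor[OF homogeneous_one])
  then have "top \<in> tensor_weight ?z" by simp
  moreover have "a \<in> tensor_weight ?z" using a weight by (simp add: tensor_weight_def lower_zero)
  ultimately have "- (a - c *\<^sub>C top) \<in> tensor_weight ?z"
    using tensor_weight_subspace[of ?z] by (intro subspace_minus subspace_diff subspace_scale)
  then have x': "x' d \<in> tensor_weight d" if "d \<in> insert ?z D" for d using that D(3) by (auto simp: x'_def)
  have "(\<Sum>d\<in>D. x' d) = (\<Sum>d\<in>D. x d)" by (intro sum.cong) (use zero in \<open>auto simp: x'_def\<close>)
  then have sum: "(\<Sum>d\<in>insert ?z D. x' d) = 0" using D(1,4) zero by (simp add: x'_def)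
  have "x' ?z \<in> t.relations"
  proof (rule eigen_separation[where D = "insert ?z D" and I = H and Y = "\<lambda>y. t.act (monom y 0)" and \<chi> = "\<lambda>d y. \<Lambda> y - lower d y" and x = x'])
    show "t.act (monom y 0) (x' d) - (\<Lambda> y - lower d y) *\<^sub>C x' d \<in> t.relations" if "d \<in> insert ?z D" "y \<in> H" for d y
      using x'[OF that(1)] that(2) by (auto simp: tensor_weight_def)
    have "insert ?z D \<subseteq> depths" using D(2) by (auto simp: depths_def)
    then show "\<exists>y\<in>H. \<Lambda> y - lower d y \<noteq> \<Lambda> y - lower d' y" if "d \<in> insert ?z D" "d' \<in> insert ?z D" "d \<noteq> d'" for d d'
      using weights_distinct[OF \<Lambda>_dual[OF \<Lambda> support], of d d'] that by blast
    show "(\<Sum>d\<in>insert ?z D. x' d) \<in> t.relations" unfolding sum by (rule subspace_zero[OF Rs])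
  qed (use Rs D(1) t.clin_act t.act_relations in auto)
  then have "a - c *\<^sub>C top \<in> t.relations" using subspace_minus[OF Rs, of "x' ?z"] by (simp add: x'_def)
  then show thesis by (rule that)
qed

lemma top_submodule: "T \<Lambda> = quotient_module t.act (r.cyclic top) t.relations"
proof -
  note Rs = t.subspace_relations
  let ?N = "quotient_module t.act t.tensors t.relations"
  have ops: "lie_module.smult ?N c (coset t.relations a) = coset t.relations (c *\<^sub>C a)"
    "lie_module.action ?N x (coset t.relations a) = coset t.relations (t.act x a)" for a c x
    by (rule quotient_operations[where \<rho> = t.act, OF Rs t.clin_act t.act_relations], assumption)+
  have mem: "coset t.relations a \<in> weight_space ?N \<Lambda>
      \<longleftrightarrow> coset t.relations a \<in> coset t.relations ` t.tensors \<and> (\<forall>y\<in>H. t.act (monom y 0) a - \<Lambda> y *\<^sub>C a \<in> t.relations)" for a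
    unfolding weight_space_def by (simp add: ops coset_eq[OF Rs]) (simp add: quotient_module_def)
  have top: "coset t.relations top \<in> weight_space ?N \<Lambda>"
  proof -
    have "top \<in> tensor_weight (\<lambda>j. \<Sum>i=1..n. 0)" by (rule homogeneous_tensor[OF homogeneous_one])
    then show ?thesis unfolding mem by (simp add: tensor_weight_def lower_zero)
  qed
  have "\<exists>c. X = coset t.relations (c *\<^sub>C top)" if X: "X \<in> weight_space ?N \<Lambda>" for X
  proof -
    have "X \<in> coset t.relations ` t.tensors" using X by (simp add: weight_space_def quotient_module_def)
    then obtain a where a: "X = coset t.relations a" "a \<in> t.tensors" by blast
    then have "\<And>y. y \<in> H \<Longrightarrow> t.act (monom y 0) a - \<Lambda> y *\<^sub>C a \<in> t.relations" using X mem[of a] by blast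
    then obtain c where "a - c *\<^sub>C top \<in> t.relations" by (rule top_weight_multiple[OF a(2)])
    then show ?thesis using a(1) coset_eq[OF Rs] by blast
  qed
  then have "generated_submodule ?N (weight_space ?N \<Lambda>) = quotient_module t.act (r.cyclic top) t.relations"
    by (rule r.generated_cyclic[OF t.tensor_in top])
  then show ?thesis
    unfolding T_def M_fund_def Let_def tensor_product_def t.tensor_space by simp
qed

text \<open>In the tensor product \<open>x\<^sub>\<theta>\<^sup>- \<otimes> t\<close> acts on the second factor only, so its powers vanish on the product of
  the generators exactly when they do in \<open>M(\<Lambda>)\<close>; by \<open>larger_ideal_eq\<close> that determines the annihilator.\<close>

lemma top_annihilator: "r.annihilator top = M_ideal \<Lambda>"
proof (rule larger_ideal_eq[OF M_ideal_hw[OF \<Lambda> support]])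
  let ?K = "r.annihilator top"
  note Rs = t.subspace_relations
  have top: "top \<in> t.tensors" by (rule t.tensor_in)
  show K: "left_ideal ?K" by (rule r.annihilator_left_ideal[OF top])
  have letter: "cur x s \<in> ?K" if "\<And>i. i \<in> {1..n} \<Longrightarrow> cur x s \<in> funds i" for x s
    unfolding r.annihilator_letter[OF top] t.act_tensor
    by (rule subspace_sum[OF Rs]) (use that t.tensor_zero in simp)
  have power: "uea_embed p ^ k \<in> ?K \<longleftrightarrow> t.tensor ((\<lambda>_. 1)(i := uea_embed p ^ k)) \<in> t.relations"
    if "i \<in> {1..n}" "\<And>j. j \<in> {1..n} \<Longrightarrow> j \<noteq> i \<Longrightarrow> uea_embed p \<in> funds j" for i p k
    unfolding r.annihilator_power[OF top] by (rule subspace_diff_cancel[OF Rs t.one_slot_power[OF that]])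
  show "M_ideal \<Lambda> \<subseteq> ?K"
  proof (rule M_ideal_least[OF \<Lambda> support K])
    show "current_relations \<subseteq> ?K"
    proof (rule current_relations_subset[OF K])
      show "cur x s \<in> ?K" if "\<beta> \<in> pos" "x \<in> root_space H \<beta>" for \<beta> x s
        by (rule letter[OF hw_raising[OF funds_hw that]])
      show "cur y s \<in> ?K" if "y \<in> H" "1 \<le> s" for y s
        by (rule letter[OF hw_H[OF funds_hw that]])
    qed
    show "cur (h i) 0 - \<Lambda> (h i) *\<^sub>C 1 \<in> ?K" if "i \<in> {1..n}" for i
    proof -
      have "top \<in> tensor_weight (\<lambda>j. \<Sum>i=1..n. 0)" by (rule homogeneous_tensor[OF homogeneous_one])
      then show ?thesis using h_H[OF that] by (simp add: r.annihilator_letter_minus[OF top] tensor_weight_def lower_zero)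
    qed
    show "cur (fv i) 0 ^ Suc (weight_coeff \<Lambda> i) \<in> ?K" if i: "i \<in> {1..n}" for i
    proof -
      have "cur (fv i) 0 \<in> funds j" if "j \<in> {1..n}" "j \<noteq> i" for j by (rule fund_ideal(7)) (use i that in auto)
      from power[OF i this] t.tensor_zero[OF i fund_ideal(4)] show ?thesis by blast
    qed
    show "cur (xm \<beta>) s \<in> ?K" if "\<And>i. i \<in> {1..n} \<Longrightarrow> cur (xm \<beta>) s \<in> funds i" for \<beta> s
      by (rule letter[OF that])
  qed
  fix k assume k: "ft ^ k \<in> ?K"
  have two: "2 \<in> {1..n}" using rank by simp
  have t2: "t.tensor ((\<lambda>_. 1)(2 := ft ^ k)) \<in> t.relations"
    using power[OF two ft_fund[OF \<Lambda> support]] k by blast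
  have "top_degree \<Lambda> < k \<or> 1 \<in> verma_ideal (fw 1)"
  proof (rule ccontr)
    assume "\<not> (top_degree \<Lambda> < k \<or> 1 \<in> verma_ideal (fw 1))"
    then have c: "k \<le> top_degree \<Lambda>" "1 \<notin> verma_ideal (fw 1)" by auto
    have "((\<lambda>_. 1)(2 := ft ^ k)) i \<notin> funds i" if i: "i \<in> {1..n}" for i
      using fund_1[OF \<Lambda> support c(2)] fund_2[OF \<Lambda> support c(1)] fund_trivial[OF \<Lambda> support i] i
      by (cases "i = 1"; cases "i = 2") auto
    from t.tensor_nonzero[OF this] t2 show False by blast
  qed
  then show "ft ^ k \<in> M_ideal \<Lambda>" using power_in_M_ideal[OF \<Lambda> support] by blast
qed

lemma M_iso_T: "M \<Lambda> \<cong>\<^sub>L T \<Lambda>"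
  using r.cyclic_iso[OF t.tensor_in, of "\<lambda>_. 1"] unfolding top_submodule top_annihilator M_def .

end

end

theorem proposition5p3:
  fixes H :: "'g::complex_lie_algebra set"
    and n :: nat
    and \<alpha> :: "nat \<Rightarrow> 'g \<Rightarrow> complex"
    and h :: "nat \<Rightarrow> 'g"
    and xm :: "('g \<Rightarrow> complex) \<Rightarrow> 'g"
    and \<Lambda> :: "'g \<Rightarrow> complex"
  assumes "simple_lie H n \<alpha> h xm"
    and "n \<ge> 2"
    and "simple_lie.type_B n \<alpha> h"
    and "\<Lambda> \<in> simple_lie.dominant_weights H n h"
    and "\<And>i. i \<in> {1..n} \<Longrightarrow> i > 2 \<Longrightarrow> \<Lambda> (h i) = 0"
  shows "(\<forall>k::nat.
            if int k \<le> \<lfloor>d_prime n 2 * real (simple_lie.weight_coeff h \<Lambda> 2)\<rfloor>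
            then simple_lie.M_graded H n \<alpha> h xm \<Lambda> k \<cong>\<^sub>L
                   simple_lie.V H n \<alpha> (\<lambda>y. \<Lambda> y - of_nat k * simple_lie.theta11 n \<alpha> y)
            else lie_module.carrier (simple_lie.M_graded H n \<alpha> h xm \<Lambda> k) =
                   {lie_module.zero (simple_lie.M_graded H n \<alpha> h xm \<Lambda> k)})
         \<and> simple_lie.M H n \<alpha> h xm \<Lambda> \<cong>\<^sub>L simple_lie.T H n \<alpha> h xm \<Lambda>"
proof -
  interpret simple_lie H n \<alpha> h xm by (rule assms(1))
  interpret type_B_lie H n \<alpha> h xm by unfold_locales (rule assms(2,3))+
  note \<Lambda> = assms(4,5)
  show ?thesis
  proof (intro conjI allI)
    fix k
    show "if int k \<le> \<lfloor>d_prime n 2 * real (weight_coeff \<Lambda> 2)\<rfloor>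
        then M_graded \<Lambda> k \<cong>\<^sub>L V (\<lambda>y. \<Lambda> y - of_nat k * theta11 y)
        else lie_module.carrier (M_graded \<Lambda> k) = {lie_module.zero (M_graded \<Lambda> k)}"
      using top_degree_floor[OF \<Lambda>, of k] graded_iso[OF \<Lambda>, of k] graded_zero[OF \<Lambda>, of k] by auto
  qed (rule M_iso_T[OF \<Lambda>])
qed

end
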